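(* Assume $m\geq 2$ and $d\geq 2$. For generic $P\in \mathbf{S}(m,d)$, the following holds: for any $1\leq i,j\leq m$, and for generic $(x,r_1,\dots,r_{j-1},r_{j+1},\dots,r_m)\in \Lambda_j(P)$, the function $$f_{ij}(z)=y_i(r_1,\dots,r_{j-1},z,r_{j+1},\dots,r_m;x)$$ is not differentially algebraic (DA).
   Context: An analytic function $f(z)$ defined on an open subset of $\mathbb{K}=\mathbb{R}$ or $\mathbb{C}$ is called differentially algebraic (DA) if there exist $n\ge 0$ and a nonzero polynomial $Q$ in $n+2$ variables (with coefficients in $\mathbb{K}$) such that $Q(z,f(z),f'(z),\dots,f^{(n)}(z))=0$ for all $z$ in the domain of $f$. $\mathbf{S}(m,d)$ denotes the set of all systems $P$ of differential equations $y_k'=p_k(y_1,\dots,y_m)$, $k=1,\dots,m$, where $p_1,\dots,p_m$ are real polynomials in $m$ variables of degree at most $d$. Identifying a system with the coefficients of the monomials occurring in the $p_k$'s, $\mathbf{S}(m,d)$ is a finite-dimensional real vector space with its standard topology and (Lebesgue) measure. For $P\in\mathbf{S}(m,d)$ and $r=(r_1,\dots,r_m)\in\mathbb{R}^m$, $y_k(r_1,\dots,r_m;x)$ ($k=1,\dots,m$) denotes the solution of the system $P$ with initial conditions $y_k(0)=r_k$, $k=1,\dots,m$ (the prime being $d/dx$), and $I(P,r)$ denotes the largest interval containing $0$ on which this solution is defined. Put $$\Lambda(P)=\{(x,r)\;|\; r\in\mathbb{R}^m,\ x\in I(P,r)\},$$ $$\Lambda_j(P)=\{(x,r_1,\dots,r_{j-1},r_{j+1},\dots,r_m)\;|\;\exists\,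 r_j \text{ such that } (x,r_1,\dots,r_m)\in\Lambda(P)\}\subset\mathbb{R}^m.$$ The function $f_{ij}$ is defined on the open set of $z\in\mathbb{R}$ with $(x,r_1,\dots,r_{j-1},z,r_{j+1},\dots,r_m)\in\Lambda(P)$. Generic: for $U\subset\mathbb{R}^N$ open and $V\subset U$, $V$ is generic in $U$ if $U\setminus V$ is both of Lebesgue measure $0$ and of first Baire category. A property holds for generic $u\in U$ if the set of $u\in U$ having it is generic in $U$. *)

theory Defs
  imports "HOL-Analysis.Analysis" "HOL-Library.Poly_Mapping"
begin

text \<open>
  Polynomials over \<open>'a\<close> in variables from \<open>'v\<close> are finitely supported functions
  from exponent vectors to coefficients.
\<close>

type_synonym 'v monomial = "'v \<Rightarrow>\<^sub>0 nat"
type_synonym ('v, 'a) mpoly = "('v \<Rightarrow>\<^sub>0 nat) \<Rightarrow>\<^sub>0 'a"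

definition monomial_degree :: "'v monomial \<Rightarrow> nat" where
  "monomial_degree \<alpha> = (\<Sum>v\<in>Poly_Mapping.keys \<alpha>. Poly_Mapping.lookup \<alpha> v)"

definition mpoly_eval :: "('v, 'a::comm_semiring_1) mpoly \<Rightarrow> ('v \<Rightarrow> 'a) \<Rightarrow> 'a" where
  "mpoly_eval p x =
     (\<Sum>\<alpha>\<in>Poly_Mapping.keys p.
        Poly_Mapping.lookup p \<alpha> * (\<Prod>v\<in>Poly_Mapping.keys \<alpha>. x v ^ Poly_Mapping.lookup \<alpha> v))"

definition mpoly_vars :: "('v, 'a::zero) mpoly \<Rightarrow> 'v set" where
  "mpoly_vars p = (\<Union>\<alpha>\<in>Poly_Mapping.keys p. Poly_Mapping.keys \<alpha>)"

definition degree_at_most :: "nat \<Rightarrow> ('v, 'a::zero) mpoly \<Rightarrow> bool" where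
  "degree_at_most d p \<longleftrightarrow> (\<forall>\<alpha>\<in>Poly_Mapping.keys p. monomial_degree \<alpha> \<le> d)"

text \<open>
  \<open>D\<close> is meant to be open and \<open>f\<close> analytic on \<open>D\<close>; then the iterated \<^const>\<open>deriv\<close>
  at points of \<open>D\<close> are the classical derivatives and do not depend on the values of \<open>f\<close>
  outside \<open>D\<close>. Variable \<open>0\<close> of \<open>Q\<close> stands for \<open>z\<close>, variable \<open>k + 1\<close> for
  the \<open>k\<close>-th derivative.
\<close>

definition differentially_algebraic_on ::
    "'a::real_normed_field set \<Rightarrow> ('a \<Rightarrow> 'a) \<Rightarrow> bool" where
  "differentially_algebraic_on D f \<longleftrightarrow>
     (\<exists>(n::nat) (Q :: (nat, 'a) mpoly). Q \<noteq> 0 \<and> mpoly_vars Q \<subseteq> {..n + 1} \<and>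
        (\<forall>z\<in>D. mpoly_eval Q (case_nat z (\<lambda>k. (deriv ^^ k) f z)) = 0))"

definition nowhere_dense_in :: "'a topology \<Rightarrow> 'a set \<Rightarrow> bool" where
  "nowhere_dense_in X A \<longleftrightarrow> A \<subseteq> topspace X \<and> X interior_of (X closure_of A) = {}"

definition first_category_in :: "'a topology \<Rightarrow> 'a set \<Rightarrow> bool" where
  "first_category_in X A \<longleftrightarrow>
     (\<exists>\<F>. countable \<F> \<and> (\<forall>B\<in>\<F>. nowhere_dense_in X B) \<and> A = \<Union>\<F>)"

text \<open>
  For a finite index set \<open>I\<close>, the space \<open>\<real>\<^sup>N\<close> with \<open>N = card I\<close> is represented by the
  extensional functions \<open>I \<rightarrow>\<^sub>E UNIV\<close>. Since \<open>U\<close> is open, being of first category in \<open>U\<close>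
  and in the whole space is the same.
\<close>

definition generic_in :: "'i set \<Rightarrow> ('i \<Rightarrow> real) set \<Rightarrow> ('i \<Rightarrow> real) set \<Rightarrow> bool" where
  "generic_in I U V \<longleftrightarrow>
     openin (powertop_real I) U \<and> V \<subseteq> U \<and>
     U - V \<in> null_sets (completion (PiM I (\<lambda>_. lborel))) \<and>
     first_category_in (powertop_real I) (U - V)"

text \<open>The indices \<open>1, \<dots>, m\<close> are the elements of a finite type \<open>'m\<close>.\<close>

type_synonym 'm system = "'m \<Rightarrow> ('m, real) mpoly"

definition systems :: "nat \<Rightarrow> 'm::finite system set" where
  "systems d = {P. \<forall>k. degree_at_most d (P k)}"

definition coeff_index :: "nat \<Rightarrow> ('m::finite \<times> 'm monomial) set" where
  "coeff_index d = UNIV \<times> {\<alpha>. monomial_degree \<alpha> \<le> d}"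

definition system_coeffs :: "nat \<Rightarrow> 'm::finite system \<Rightarrow> ('m \<times> 'm monomial \<Rightarrow> real)" where
  "system_coeffs d P = restrict (\<lambda>(k, \<alpha>). Poly_Mapping.lookup (P k) \<alpha>) (coeff_index d)"

lemma finite_coeff_index: "finite (coeff_index d :: ('m::finite \<times> 'm monomial) set)"
proof -
  let ?A = "{\<alpha>::'m monomial. monomial_degree \<alpha> \<le> d}"
  have "Poly_Mapping.lookup \<alpha> x \<le> d" if "monomial_degree \<alpha> \<le> d" for \<alpha> :: "'m monomial" and x
  proof -
    have "Poly_Mapping.lookup \<alpha> x \<le> monomial_degree \<alpha>"
    proof (cases "x \<in> Poly_Mapping.keys \<alpha>")
      case True
      then show ?thesis
        unfolding monomial_degree_def by (intro member_le_sum) auto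
    next
      case False
      then have "Poly_Mapping.lookup \<alpha> x = 0"
        by (simp only: Poly_Mapping.in_keys_iff not_not)
      then show ?thesis by simp
    qed
    with that show ?thesis by simp
  qed
  then have "Poly_Mapping.lookup ` ?A \<subseteq> UNIV \<rightarrow>\<^sub>E {..d}"
    by auto
  then have "finite (Poly_Mapping.lookup ` ?A)"
    by (rule finite_subset) (auto intro: finite_PiE)
  then have "finite ?A"
    by (rule finite_imageD) (auto intro: poly_mapping_eqI simp: inj_on_def)
  then show ?thesis
    by (simp add: coeff_index_def)
qed

lemma bij_betw_system_coeffs:
  "bij_betw (system_coeffs d) (systems d :: 'm::finite system set) (coeff_index d \<rightarrow>\<^sub>E UNIV)"
proof (rule bij_betwI')
  fix P Q :: "'m system" assume P: "P \<in> systems d" and Q: "Q \<in> systems d"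
  show "system_coeffs d P = system_coeffs d Q \<longleftrightarrow> P = Q"
  proof
    assume eq: "system_coeffs d P = system_coeffs d Q"
    have "Poly_Mapping.lookup (P k) \<alpha> = Poly_Mapping.lookup (Q k) \<alpha>" for k \<alpha>
    proof (cases "monomial_degree \<alpha> \<le> d")
      case True
      then show ?thesis
        using fun_cong[OF eq, of "(k, \<alpha>)"] by (simp add: system_coeffs_def coeff_index_def)
    next
      case False
      then have "\<alpha> \<notin> Poly_Mapping.keys (P k)" "\<alpha> \<notin> Poly_Mapping.keys (Q k)"
        using P Q by (auto simp: systems_def degree_at_most_def)
      then show ?thesis
        by (simp only: Poly_Mapping.in_keys_iff not_not)
    qed
    then show "P = Q"
      by (intro ext poly_mapping_eqI)
  qed simp
next
  fix c :: "'m \<times> 'm monomial \<Rightarrow> real" assume c: "c \<in> coeff_index d \<rightarrow>\<^sub>E UNIV"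
  define g where "g k \<alpha> = (if (k, \<alpha>) \<in> coeff_index d then c (k, \<alpha>) else 0)" for k \<alpha>
  have fin: "finite {\<alpha>. g k \<alpha> \<noteq> 0}" for k
  proof (rule finite_subset)
    show "{\<alpha>. g k \<alpha> \<noteq> 0} \<subseteq> snd ` (coeff_index d :: ('m \<times> 'm monomial) set)"
      by (auto simp: g_def image_iff Bex_def split: if_splits)
  qed (rule finite_imageI[OF finite_coeff_index])
  define P where "P k = Abs_poly_mapping (g k)" for k
  have lookup_P: "Poly_Mapping.lookup (P k) = g k" for k
    by (simp add: P_def Abs_poly_mapping_inverse fin)
  have "monomial_degree \<alpha> \<le> d" if "\<alpha> \<in> Poly_Mapping.keys (P k)" for k \<alpha>
  proof -
    have "Poly_Mapping.lookup (P k) \<alpha> \<noteq> 0"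
      using that by (rule Poly_Mapping.in_keys_iff[THEN iffD1])
    then show ?thesis
      unfolding lookup_P by (auto simp: g_def coeff_index_def split: if_splits)
  qed
  then have P: "P \<in> systems d"
    by (simp only: systems_def degree_at_most_def mem_Collect_eq) blast
  have cP: "c = system_coeffs d P"
  proof
    fix x show "c x = system_coeffs d P x"
      by (cases x) (simp add: system_coeffs_def lookup_P g_def restrict_def PiE_arb[OF c])
  qed
  show "\<exists>P\<in>systems d. c = system_coeffs d P"
  proof (rule bexI)
    show "c = system_coeffs d P" by (fact cP)
    show "P \<in> systems d" by (fact P)
  qed
next
  fix P :: "'m system"
  show "system_coeffs d P \<in> coeff_index d \<rightarrow>\<^sub>E UNIV"
    unfolding system_coeffs_def by simp
qed

definition vector_field :: "'m::finite system \<Rightarrow> real ^ 'm \<Rightarrow> real ^ 'm" where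
  "vector_field P y = (\<chi> k. mpoly_eval (P k) (($) y))"

definition solves_ivp ::
    "'m::finite system \<Rightarrow> real ^ 'm \<Rightarrow> real set \<Rightarrow> (real \<Rightarrow> real ^ 'm) \<Rightarrow> bool" where
  "solves_ivp P r J y \<longleftrightarrow>
     is_interval J \<and> 0 \<in> J \<and> y 0 = r \<and>
     (\<forall>t\<in>J. (y has_vector_derivative vector_field P (y t)) (at t within J))"

text \<open>
  The vector field is locally Lipschitz, so local solutions fit together and the union below
  is itself an interval on which the solution exists, hence the largest one.
\<close>

definition max_interval :: "'m::finite system \<Rightarrow> real ^ 'm \<Rightarrow> real set" where
  "max_interval P r = \<Union>{J. \<exists>y. solves_ivp P r J y}"

text \<open>The values of \<open>solution P r\<close> are determined on \<open>max_interval P r\<close> only.\<close>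

definition solution :: "'m::finite system \<Rightarrow> real ^ 'm \<Rightarrow> real \<Rightarrow> real ^ 'm" where
  "solution P r = (SOME y. solves_ivp P r (max_interval P r) y)"

definition Lambda :: "'m::finite system \<Rightarrow> (real \<times> (real ^ 'm)) set" where
  "Lambda P = {(x, r). x \<in> max_interval P r}"

text \<open>
  A point \<open>(x, r\<^sub>1, \<dots>, r\<^sub>j\<^sub>-\<^sub>1, r\<^sub>j\<^sub>+\<^sub>1, \<dots>, r\<^sub>m)\<close> is encoded as a function \<open>v\<close> on the
  \<open>m\<close>-element index set \<open>- {Some j}\<close>, with \<open>v None = x\<close> and \<open>v (Some k) = r\<^sub>k\<close>.
\<close>

definition param_index :: "'m::finite \<Rightarrow> 'm option set" where
  "param_index j = - {Some j}"

definition initial_value :: "'m::finite \<Rightarrow> ('m option \<Rightarrow> real) \<Rightarrow> real \<Rightarrow> real ^ 'm" where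
  "initial_value j v z = (\<chi> k. if k = j then z else v (Some k))"

definition Lambda_proj :: "'m::finite \<Rightarrow> 'm system \<Rightarrow> ('m option \<Rightarrow> real) set" where
  "Lambda_proj j P =
     {v \<in> param_index j \<rightarrow>\<^sub>E UNIV. \<exists>z. (v None, initial_value j v z) \<in> Lambda P}"

definition f_domain :: "'m::finite system \<Rightarrow> 'm \<Rightarrow> ('m option \<Rightarrow> real) \<Rightarrow> real set" where
  "f_domain P j v = {z. (v None, initial_value j v z) \<in> Lambda P}"

definition f_fun ::
    "'m::finite system \<Rightarrow> 'm \<Rightarrow> 'm \<Rightarrow> ('m option \<Rightarrow> real) \<Rightarrow> real \<Rightarrow> real" where
  "f_fun P i j v z = solution P (initial_value j v z) (v None) $ i"

end

theory Submission
  imports Defs "HOL-Complex_Analysis.Complex_Analysis"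
begin

text \<open>
  A function that solves a differential algebraic equation satisfies one linear relation, the same
  at all points, between the monomials of bounded size in \<open>z, f(z), f'(z), \<dots>\<close>. By elimination
  this is visible in a single polynomial: for each size \<open>s\<close> there is a nonzero polynomial
  \<open>dae_cert s\<close> in the jets of a function at finitely many points that vanishes on the jets of
  every function with a relation of size \<open>s\<close> (\<open>dae_cert_vanishes\<close>, \<open>dae_cert_nonzero\<close>). So a
  function is not differentially algebraic as soon as every certificate is nonzero somewhere.

  Along the flow of a polynomial system, take the certificate of \<open>f\<^sub>i\<^sub>j\<close> at points
  \<open>z\<^sub>0, z\<^sub>1, \<dots>\<close> as a function of the time \<open>x\<close>. It is analytic in \<open>x\<close>, and its derivatives at
  \<open>x = 0\<close> are polynomials \<open>cert_coeff\<close> in the coefficients of the system, the points and the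
  remaining initial values. If one of these polynomials is not zero, it is nonzero for all systems
  outside a closed null set; for such a system it is nonzero for almost all initial values, and then
  the certificate vanishes at countably many times only. Rational points and all sizes give
  countably many conditions, so the theorem follows from the claim that for all \<open>i, j, s\<close> some
  \<open>cert_coeff\<close> is not the zero polynomial (\<open>generic_if_certificates_nonzero\<close>).

  Suppose the claim fails for some \<open>i, j, s\<close>. Then the certificate vanishes for all systems, all
  times and all points. With at least two variables and degree at least two, there are systems that
  imitate the logistic system \<open>O' = v O (1 + \<gamma> J - O)\<close>, \<open>J' = O\<close>, \<open>v' = v\<close> with small
  \<open>\<gamma> \<noteq> 0\<close>: the variables \<open>v O\<close> and
  \<open>v (1 + \<gamma> J)\<close> satisfy a quadratic system, and by affine changes of variables \<open>f\<^sub>i\<^sub>j\<close> at time \<open>X\<close>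
  becomes \<open>J\<close> for \<open>i \<noteq> j\<close> and \<open>J + exp X O\<close> plus a constant of size \<open>1 / \<gamma>\<close> for \<open>i = j\<close>
  (\<open>embed_distinct\<close>, \<open>embed_same\<close>). For \<open>\<gamma> \<rightarrow> 0\<close> the certificate, or its leading coefficient
  under a common shift of the values, vanishes on the jets in \<open>z\<close> of the unperturbed \<open>J\<close> or
  \<open>J + exp X O\<close>. Here \<open>O = z E / (1 + z (E - 1))\<close> with \<open>E = exp (v - 1)\<close> and \<open>v = exp X\<close>, and the
  jets of \<open>J\<close> are integrals \<open>\<integral> R(exp (v - 1)) / v dv\<close> of rational functions \<open>R\<close> with poles depending
  on the point.

  Such integrals are algebraically independent over the field of meromorphic functions
  (\<open>logistic_integrals_independent\<close>). By Ostrowski's theorem on algebraic relations between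
  primitives (\<open>ostrowski\<close>) it is enough that no nontrivial linear combination has a meromorphic
  primitive, that is, to find a nonzero residue. The function \<open>R(exp (v - 1))\<close> is periodic, so it
  repeats one principal part at infinitely many points \<open>p\<^sub>k\<close>; the residue of its quotient by \<open>v\<close> is
  a nonzero polynomial in \<open>1 / p\<^sub>k\<close> and cannot vanish for all \<open>k\<close>. Hence the certificate would be
  the zero polynomial, which it is not.
\<close>

no_notation fps_nth (infixl "$" 75)

section \<open>Polynomial expressions\<close>

text \<open>
  Polynomials are kept as expressions, because they are evaluated in several rings (real and complex
  numbers, power series, Laurent series), substituted into one another and differentiated along a
  flow, while their coefficients are hardly ever needed.
\<close>

datatype 'x pexp = Const real | Var 'x | Add "'x pexp" "'x pexp" | Mul "'x pexp" "'x pexp"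

primrec peval_in :: "(real \<Rightarrow> 'a::comm_ring_1) \<Rightarrow> ('x \<Rightarrow> 'a) \<Rightarrow> 'x pexp \<Rightarrow> 'a" where
  "peval_in h e (Const a) = h a"
| "peval_in h e (Var x) = e x"
| "peval_in h e (Add p q) = peval_in h e p + peval_in h e q"
| "peval_in h e (Mul p q) = peval_in h e p * peval_in h e q"

definition peval :: "('x \<Rightarrow> 'a::real_normed_field) \<Rightarrow> 'x pexp \<Rightarrow> 'a" where
  "peval = peval_in of_real"

lemma peval_simps [simp]:
  "peval e (Const a) = of_real a" "peval e (Var x) = e x" "peval e (Add p q) = peval e p + peval e q"
  "peval e (Mul p q) = peval e p * peval e q"
  by (simp_all add: peval_def del: of_real_eq_id)

primrec pvars :: "'x pexp \<Rightarrow> 'x set" where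
  "pvars (Const a) = {}"
| "pvars (Var x) = {x}"
| "pvars (Add p q) = pvars p \<union> pvars q"
| "pvars (Mul p q) = pvars p \<union> pvars q"

primrec psubst :: "('x \<Rightarrow> 'y pexp) \<Rightarrow> 'x pexp \<Rightarrow> 'y pexp" where
  "psubst s (Const a) = Const a"
| "psubst s (Var x) = s x"
| "psubst s (Add p q) = Add (psubst s p) (psubst s q)"
| "psubst s (Mul p q) = Mul (psubst s p) (psubst s q)"

text \<open>
  The derivation of the polynomial ring that extends a given map on the variables: the chain rule for
  an expression whose variables move.
\<close>

primrec pderive :: "('x \<Rightarrow> 'x pexp) \<Rightarrow> 'x pexp \<Rightarrow> 'x pexp" where
  "pderive s (Const a) = Const 0"
| "pderive s (Var x) = s x"
| "pderive s (Add p q) = Add (pderive s p) (pderive s q)"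
| "pderive s (Mul p q) = Add (Mul (pderive s p) q) (Mul p (pderive s q))"

definition psum :: "'x pexp list \<Rightarrow> 'x pexp" where
  "psum ps = foldr Add ps (Const 0)"

definition pprod :: "'x pexp list \<Rightarrow> 'x pexp" where
  "pprod ps = foldr Mul ps (Const 1)"

definition ppow :: "'x pexp \<Rightarrow> nat \<Rightarrow> 'x pexp" where
  "ppow p n = pprod (replicate n p)"

lemma finite_pvars [simp]: "finite (pvars p)"
  by (induction p) auto

lemma peval_cong: "(\<And>x. x \<in> pvars p \<Longrightarrow> e x = e' x) \<Longrightarrow> peval e p = peval e' p"
  by (induction p) auto

lemma peval_psubst: "peval e (psubst s p) = peval (\<lambda>x. peval e (s x)) p"
  by (induction p) auto

lemma pvars_psubst: "pvars (psubst s p) = (\<Union>x\<in>pvars p. pvars (s x))"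
  by (induction p) auto

lemma peval_psum: "peval e (psum ps) = (\<Sum>p\<leftarrow>ps. peval e p)"
  by (induction ps) (auto simp: psum_def)

lemma peval_pprod: "peval e (pprod ps) = (\<Prod>p\<leftarrow>ps. peval e p)"
  by (induction ps) (auto simp: pprod_def)

lemma peval_ppow: "peval e (ppow p n) = peval e p ^ n"
  by (induction n) (auto simp: ppow_def pprod_def)

lemma pvars_psum: "pvars (psum ps) = (\<Union>p\<in>set ps. pvars p)"
  by (induction ps) (auto simp: psum_def)

lemma pvars_pprod: "pvars (pprod ps) = (\<Union>p\<in>set ps. pvars p)"
  by (induction ps) (auto simp: pprod_def)

lemma pvars_ppow: "pvars (ppow p n) \<subseteq> pvars p"
  by (auto simp: ppow_def pvars_pprod)

lemma peval_of_real:
  "peval (\<lambda>x. of_real (e x) :: 'a::real_normed_field) p = of_real (peval e p)"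
  by (induction p) auto

lemma has_field_derivative_peval:
  assumes "\<And>x. x \<in> pvars p \<Longrightarrow> ((\<lambda>t. e t x) has_field_derivative peval (e t) (s x)) (at t within S)"
  shows "((\<lambda>t. peval (e t) p) has_field_derivative peval (e t) (pderive s p)) (at t within S)"
  using assms by (induction p) (auto intro!: derivative_eq_intros)

lemma continuous_on_peval:
  assumes "\<And>x. x \<in> pvars p \<Longrightarrow> continuous_on S (\<lambda>t. e t x)"
  shows "continuous_on S (\<lambda>t. peval (e t) p)"
  using assms by (induction p) (auto intro!: continuous_intros)

lemma tendsto_peval:
  assumes "\<And>x. x \<in> pvars p \<Longrightarrow> ((\<lambda>t. e t x) \<longlongrightarrow> e' x) F"
  shows "((\<lambda>t. peval (e t) p) \<longlongrightarrow> peval e' p) F"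
  using assms by (induction p) (auto intro!: tendsto_intros)

lemma holomorphic_on_peval:
  assumes "\<And>x. x \<in> pvars p \<Longrightarrow> (\<lambda>t. e t x) holomorphic_on S"
  shows "(\<lambda>t. peval (e t) p) holomorphic_on S"
  using assms by (induction p) (auto intro!: holomorphic_intros)

lemma peval_line_poly:
  obtains q :: "real poly" where "\<And>t. poly q t = peval (e(b := t)) p"
proof -
  have "poly (peval_in (\<lambda>a. [:a:]) (\<lambda>x. if x = b then [:0, 1:] else [:e x:]) p) t = peval (e(b := t)) p" for t
    by (induction p) auto
  then show ?thesis using that by blast
qed

text \<open>
  Along each coordinate line the expression is a polynomial in one variable with finitely many roots,
  so the coordinates can be moved one after the other into arbitrary infinite sets.
\<close>

lemma peval_nonzero_move:
  fixes e :: "'x \<Rightarrow> real"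
  assumes "finite B" "\<forall>b\<in>B. infinite (S b)" "peval e p \<noteq> 0"
  shows "\<exists>e'. (\<forall>b\<in>B. e' b \<in> S b) \<and> (\<forall>b. b \<notin> B \<longrightarrow> e' b = e b) \<and> peval e' p \<noteq> 0"
  using assms
proof (induction B rule: finite_induct)
  case (insert b B)
  then obtain e' where e': "\<forall>b\<in>B. e' b \<in> S b" "\<forall>b. b \<notin> B \<longrightarrow> e' b = e b" "peval e' p \<noteq> 0"
    by auto
  obtain q where q: "\<And>t. poly q t = peval (e'(b := t)) p" by (rule peval_line_poly[of e' b p]) blast
  have "poly q (e' b) \<noteq> 0" using q[of "e' b"] e'(3) by simp
  then have "q \<noteq> 0" by auto
  then have "finite {t. poly q t = 0}" by (rule poly_roots_finite)
  moreover have "infinite (S b)" using insert.prems by auto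
  ultimately have "\<not> S b \<subseteq> {t. poly q t = 0}" by (metis finite_subset)
  then obtain t where t: "t \<in> S b" "poly q t \<noteq> 0" by auto
  show ?case
    by (rule exI[of _ "e'(b := t)"]) (use e' t q insert.hyps in \<open>auto simp: fun_upd_def\<close>)
qed auto

section \<open>Certificates of linear independence\<close>

text \<open>
  Elimination without division: the pivot is the value of the first function at the first point, and
  it is used to remove that point from the other functions. The product of all pivots is nonzero only
  if the functions are linearly independent.
\<close>

function cert :: "(nat \<Rightarrow> 'a::comm_ring_1) list \<Rightarrow> nat \<Rightarrow> 'a" where
  "cert [] b = 1"
| "cert (g # gs) b = g b * cert (map (\<lambda>h b'. g b * h b' - h b * g b') gs) (Suc b)"
  by pat_completeness auto
termination by (relation "Wellfounded.measure (\<lambda>(gs, b). length gs)") auto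

text \<open>
  Elimination with a nonzero pivot keeps a nontrivial relation nontrivial, and a relation of length one
  forces its pivot to vanish.
\<close>

lemma cert_eq_0:
  fixes gs :: "(nat \<Rightarrow> 'a::idom) list"
  assumes "\<And>b'. b \<le> b' \<Longrightarrow> b' < b + length gs \<Longrightarrow> (\<Sum>i<length gs. c i * (gs ! i) b') = 0"
    and "\<exists>i<length gs. c i \<noteq> 0"
  shows "cert gs b = 0"
  using assms
proof (induction "length gs" arbitrary: gs b c)
  case (Suc n)
  then obtain g gs' where gs: "gs = g # gs'" by (cases gs) auto
  have len: "length gs' = n" using Suc gs by simp
  have rel: "c 0 * g b' + (\<Sum>i<n. c (Suc i) * (gs' ! i) b') = 0" if "b \<le> b'" "b' \<le> b + n" for b'
    using Suc.prems(1)[of b'] that gs len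
    by (simp add: sum.lessThan_Suc_shift del: sum.lessThan_Suc)
  show ?case
  proof (cases "g b = 0")
    case False
    have "cert (map (\<lambda>h b'. g b * h b' - h b * g b') gs') (Suc b) = 0"
    proof (rule Suc.hyps(1)[where c = "\<lambda>i. c (Suc i)"])
      fix b' assume b': "Suc b \<le> b'" "b' < Suc b + length (map (\<lambda>h b'. g b * h b' - h b * g b') gs')"
      have 1: "(\<Sum>i<n. c (Suc i) * (gs' ! i) b') = - (c 0 * g b')"
        using rel[of b'] b' len by (simp add: eq_neg_iff_add_eq_0 add.commute)
      have 2: "(\<Sum>i<n. c (Suc i) * (gs' ! i) b) = - (c 0 * g b)"
        using rel[of b] by (simp add: eq_neg_iff_add_eq_0 add.commute)
      have "(\<Sum>i<n. c (Suc i) * (g b * (gs' ! i) b' - (gs' ! i) b * g b')) =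
         g b * (\<Sum>i<n. c (Suc i) * (gs' ! i) b') - g b' * (\<Sum>i<n. c (Suc i) * (gs' ! i) b)"
        by (simp add: sum_distrib_left algebra_simps sum_subtractf)
      also have "\<dots> = 0" unfolding 1 2 by (simp add: algebra_simps)
      finally show "(\<Sum>i<length (map (\<lambda>h b'. g b * h b' - h b * g b') gs'). c (Suc i) *
         (map (\<lambda>h b'. g b * h b' - h b * g b') gs' ! i) b') = 0"
        by (simp add: len)
    next
      show "\<exists>i<length (map (\<lambda>h b'. g b * h b' - h b * g b') gs'). c (Suc i) \<noteq> 0"
      proof (rule ccontr)
        assume "\<not> ?thesis"
        then have *: "\<forall>i<n. c (Suc i) = 0" by (simp add: len)
        then have "c 0 * g b = 0" using rel[of b] by simp
        then have "c 0 = 0" using False by simp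
        obtain i where i: "i < Suc n" "c i \<noteq> 0" using Suc.prems(2) gs len by auto
        show False using i * \<open>c 0 = 0\<close> by (cases i) auto
      qed
    qed (use len in simp)
    then show ?thesis using gs by simp
  qed (simp add: gs)
qed simp

lemma cert_cong:
  assumes "length gs = length hs"
    and "\<And>i b'. i < length gs \<Longrightarrow> b \<le> b' \<Longrightarrow> b' < b + length gs \<Longrightarrow> (gs ! i) b' = (hs ! i) b'"
  shows "cert gs b = cert hs b"
  using assms
proof (induction "length gs" arbitrary: gs hs b)
  case (Suc n)
  then obtain g gs' where gs: "gs = g # gs'" by (cases gs) auto
  obtain k hs' where hs: "hs = k # hs'" using Suc by (cases hs) auto
  have len: "length gs' = n" "length hs' = n" using Suc gs hs by auto
  have g: "g b' = k b'" if "b \<le> b'" "b' \<le> b + n" for b'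
    using Suc.prems(2)[of 0 b'] that gs hs len by simp
  have h: "(gs' ! i) b' = (hs' ! i) b'" if "i < n" "b \<le> b'" "b' \<le> b + n" for i b'
    using Suc.prems(2)[of "Suc i" b'] that gs hs len by simp
  have "cert (map (\<lambda>h b'. g b * h b' - h b * g b') gs') (Suc b) =
        cert (map (\<lambda>h b'. k b * h b' - h b * k b') hs') (Suc b)"
    by (rule Suc.hyps(1)) (use g h len in auto)
  then show ?case using gs hs g[of b] by simp
qed simp

text \<open>
  Points are picked one after the other, each where the first remaining function does not vanish;
  elimination keeps the others independent.
\<close>

lemma cert_nonzero_exists:
  fixes fs :: "('x \<Rightarrow> 'a::field) list"
  assumes "\<And>c. (\<forall>x. (\<Sum>i<length fs. c i * (fs ! i) x) = 0) \<Longrightarrow> \<forall>i<length fs. c i = 0"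
  shows "\<exists>w. cert (map (\<lambda>f b'. f (w b')) fs) b \<noteq> 0"
  using assms
proof (induction "length fs" arbitrary: fs b)
  case (Suc n)
  then obtain f fs' where fs: "fs = f # fs'" by (cases fs) auto
  have len: "length fs' = n" using Suc fs by simp
  have indep: "(\<forall>i<Suc n. c i = 0)"
    if "\<And>x. c 0 * f x + (\<Sum>i<n. c (Suc i) * (fs' ! i) x) = 0" for c
  proof -
    have eq: "(\<Sum>i<length fs. c i * (fs ! i) x) = c 0 * f x + (\<Sum>i<n. c (Suc i) * (fs' ! i) x)" for x
      unfolding fs by (simp add: len sum.lessThan_Suc_shift del: sum.lessThan_Suc)
    have "\<forall>i<length fs. c i = 0"
      by (rule Suc.prems) (simp only: eq that, simp)
    then show ?thesis using fs len by simp
  qed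
  have "\<exists>x0. f x0 \<noteq> 0"
  proof (rule ccontr)
    assume "\<not> ?thesis"
    then have "\<forall>i<Suc n. (if i = 0 then 1 else 0::'a) = 0"
      by (intro indep[of "\<lambda>i. if i = 0 then 1 else 0"]) simp
    then show False by (auto dest: spec[of _ 0])
  qed
  then obtain x0 where x0: "f x0 \<noteq> 0" by blast
  define hs where "hs = map (\<lambda>h x. f x0 * h x - h x0 * f x) fs'"
  have "\<exists>w. cert (map (\<lambda>f b'. f (w b')) hs) (Suc b) \<noteq> 0"
  proof (rule Suc.hyps(1))
    fix c assume c: "\<forall>x. (\<Sum>i<length hs. c i * (hs ! i) x) = 0"
    define d where "d i = (case i of 0 \<Rightarrow> - (\<Sum>i<n. c i * (fs' ! i) x0) | Suc i \<Rightarrow> f x0 * c i)" for i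
    have "\<forall>i<Suc n. d i = 0"
    proof (rule indep)
      fix x
      have "0 = (\<Sum>i<n. c i * (f x0 * (fs' ! i) x - (fs' ! i) x0 * f x))"
        using c len by (simp add: hs_def)
      also have "\<dots> = d 0 * f x + (\<Sum>i<n. d (Suc i) * (fs' ! i) x)"
        by (simp add: d_def sum_distrib_left sum_distrib_right algebra_simps sum_subtractf)
      finally show "d 0 * f x + (\<Sum>i<n. d (Suc i) * (fs' ! i) x) = 0" by simp
    qed
    then have "\<forall>i<n. d (Suc i) = 0" by simp
    then show "\<forall>i<length hs. c i = 0" using x0 by (simp add: d_def hs_def len)
  qed (simp add: hs_def len)
  then obtain w where w: "cert (map (\<lambda>f b'. f (w b')) hs) (Suc b) \<noteq> 0" by blast
  define w' where "w' = w(b := x0)"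
  have "cert (map (\<lambda>f b'. f (w b')) hs) (Suc b) =
     cert (map (\<lambda>h b'. f (w' b) * h b' - h b * f (w' b')) (map (\<lambda>f b'. f (w' b')) fs')) (Suc b)"
    by (rule cert_cong) (auto simp: hs_def w'_def)
  then have "cert (map (\<lambda>f b'. f (w' b')) fs) b \<noteq> 0"
    using w x0 by (simp add: fs w'_def)
  then show ?case by blast
qed simp

text \<open>
  The same recursion on expressions: the certificate is a polynomial in the values of the functions.
\<close>

function certp :: "(nat \<Rightarrow> 'x pexp) list \<Rightarrow> nat \<Rightarrow> 'x pexp" where
  "certp [] b = Const 1"
| "certp (g # gs) b = Mul (g b)
     (certp (map (\<lambda>h b'. Add (Mul (g b) (h b')) (Mul (Const (-1)) (Mul (h b) (g b')))) gs) (Suc b))"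
  by pat_completeness auto
termination by (relation "Wellfounded.measure (\<lambda>(gs, b). length gs)") auto

lemma peval_certp: "peval e (certp gs b) = cert (map (\<lambda>g b. peval e (g b)) gs) b"
  by (induction gs b rule: certp.induct) (auto simp: o_def)

lemma pvars_certp:
  "pvars (certp gs b) \<subseteq> (\<Union>g\<in>set gs. \<Union>b'\<in>{b..<b + length gs}. pvars (g b'))"
proof (induction gs b rule: certp.induct)
  case (2 g gs b)
  have "pvars (certp (map (\<lambda>h b'. Add (Mul (g b) (h b')) (Mul (Const (-1)) (Mul (h b) (g b')))) gs) (Suc b))
    \<subseteq> (\<Union>h\<in>set gs. \<Union>b'\<in>{Suc b..<Suc b + length gs}.
         pvars (g b) \<union> pvars (h b') \<union> (pvars (h b) \<union> pvars (g b')))"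
    using 2 by simp
  also have "\<dots> \<subseteq> (\<Union>h\<in>set (g # gs). \<Union>b'\<in>{b..<b + length (g # gs)}. pvars (h b'))"
  proof (intro UN_least Un_least)
    fix h b' assume h: "h \<in> set gs" and b': "b' \<in> {Suc b..<Suc b + length gs}"
    have *: "pvars (k c) \<subseteq> (\<Union>h\<in>set (g # gs). \<Union>b'\<in>{b..<b + length (g # gs)}. pvars (h b'))"
      if "k \<in> set (g # gs)" "c \<in> {b..<b + length (g # gs)}" for k c
      using that by blast
    have "b \<in> {b..<b + length (g # gs)}" "b' \<in> {b..<b + length (g # gs)}"
      "g \<in> set (g # gs)" "h \<in> set (g # gs)" using h b' by auto
    then show "pvars (g b) \<subseteq> (\<Union>h\<in>set (g # gs). \<Union>b'\<in>{b..<b + length (g # gs)}. pvars (h b'))"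
      "pvars (h b') \<subseteq> (\<Union>h\<in>set (g # gs). \<Union>b'\<in>{b..<b + length (g # gs)}. pvars (h b'))"
      "pvars (h b) \<subseteq> (\<Union>h\<in>set (g # gs). \<Union>b'\<in>{b..<b + length (g # gs)}. pvars (h b'))"
      "pvars (g b') \<subseteq> (\<Union>h\<in>set (g # gs). \<Union>b'\<in>{b..<b + length (g # gs)}. pvars (h b'))"
      by (blast intro!: *)+
  qed
  finally show ?case by (auto intro!: bexI[of _ b])
qed auto

section \<open>Differential algebraic equations of bounded type\<close>

text \<open>
  Every polynomial has its monomials in the box of some size, so that countably many certificates
  exhaust all differential equations.
\<close>

definition mon_box :: "nat \<Rightarrow> nat monomial set" where
  "mon_box s = {\<alpha>. Poly_Mapping.keys \<alpha> \<subseteq> {..s} \<and> (\<forall>v. Poly_Mapping.lookup \<alpha> v \<le> s)}"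

definition mon_val :: "'v monomial \<Rightarrow> ('v \<Rightarrow> 'a::comm_semiring_1) \<Rightarrow> 'a" where
  "mon_val \<alpha> w = (\<Prod>v\<in>Poly_Mapping.keys \<alpha>. w v ^ Poly_Mapping.lookup \<alpha> v)"

lemma finite_mon_box: "finite (mon_box s)"
proof -
  have "Poly_Mapping.lookup ` mon_box s \<subseteq> {f. \<forall>x. (x \<in> {..s} \<longrightarrow> f x \<in> {..s}) \<and> (x \<notin> {..s} \<longrightarrow> f x = 0)}"
    by (auto simp: mon_box_def Poly_Mapping.in_keys_iff)
  moreover have "finite \<dots>" by (rule finite_set_of_finite_funs) auto
  ultimately have "finite (Poly_Mapping.lookup ` mon_box s)" by (rule finite_subset)
  then show ?thesis by (rule finite_imageD) (auto intro: poly_mapping_eqI simp: inj_on_def)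
qed

definition mons :: "nat \<Rightarrow> nat monomial list" where
  "mons s = (SOME xs. set xs = mon_box s \<and> distinct xs)"

lemma mons: "set (mons s) = mon_box s" "distinct (mons s)"
  using someI_ex[OF finite_distinct_list[OF finite_mon_box[of s]]] by (auto simp: mons_def)

text \<open>
  Uniqueness of expansions in base \<open>s + 1\<close>. It separates the monomials of a box along the curve
  \<open>(t, t ^ B, t ^ B\<^sup>2, \<dots>)\<close> with \<open>B = s + 1\<close>.
\<close>

lemma base_digits_inj:
  fixes a b :: "nat \<Rightarrow> nat"
  assumes "\<And>v. a v \<le> s" "\<And>v. b v \<le> s" "(\<Sum>v<n. a v * Suc s ^ v) = (\<Sum>v<n. b v * Suc s ^ v)"
  shows "\<forall>v<n. a v = b v"
  using assms
proof (induction n arbitrary: a b)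
  case (Suc n)
  have sh: "(\<Sum>v<Suc n. f v * Suc s ^ v) = f 0 + Suc s * (\<Sum>v<n. f (Suc v) * Suc s ^ v)" for f :: "nat \<Rightarrow> nat"
    by (subst sum.lessThan_Suc_shift) (simp add: sum_distrib_left algebra_simps del: sum.lessThan_Suc)
  have eq: "a 0 + Suc s * (\<Sum>v<n. a (Suc v) * Suc s ^ v) = b 0 + Suc s * (\<Sum>v<n. b (Suc v) * Suc s ^ v)"
    using Suc.prems(3) unfolding sh .
  have lt: "a 0 < Suc s" "b 0 < Suc s" using Suc.prems(1)[of 0] Suc.prems(2)[of 0] by auto
  have "a 0 = b 0"
    using arg_cong[OF eq, of "\<lambda>x. x mod Suc s"] lt
    by (simp only: mod_mult_self2 mod_less)
  moreover have "Suc s * (\<Sum>v<n. a (Suc v) * Suc s ^ v) = Suc s * (\<Sum>v<n. b (Suc v) * Suc s ^ v)"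
    using eq \<open>a 0 = b 0\<close> by (simp only: add_left_cancel)
  then have "(\<Sum>v<n. a (Suc v) * Suc s ^ v) = (\<Sum>v<n. b (Suc v) * Suc s ^ v)"
    by (simp only: nat_mult_eq_cancel1 zero_less_Suc)
  then have "\<forall>v<n. a (Suc v) = b (Suc v)"
    by (intro Suc.IH[of "\<lambda>v. a (Suc v)" "\<lambda>v. b (Suc v)"]) (use Suc.prems in auto)
  ultimately have "a v = b v" if "v < Suc n" for v
    using that by (cases v) auto
  then show ?case by blast
qed simp

lemma mon_val_superset:
  assumes "finite V" "Poly_Mapping.keys \<alpha> \<subseteq> V"
  shows "mon_val \<alpha> w = (\<Prod>v\<in>V. w v ^ Poly_Mapping.lookup \<alpha> v)"
  unfolding mon_val_def
  by (rule prod.mono_neutral_left) (use assms in \<open>auto simp: Poly_Mapping.in_keys_iff\<close>)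

text \<open>
  On that curve the monomials of the box become distinct powers of \<open>t\<close>.
\<close>

lemma mons_independent:
  fixes c :: "nat \<Rightarrow> real"
  assumes "\<And>w. (\<Sum>i<length (mons s). c i * mon_val (mons s ! i) w) = 0"
  shows "\<forall>i<length (mons s). c i = 0"
proof -
  define ex where "ex i = (\<Sum>v<Suc s. Poly_Mapping.lookup (mons s ! i) v * Suc s ^ v)" for i
  have box: "mons s ! i \<in> mon_box s" if "i < length (mons s)" for i
    using that mons(1) nth_mem by blast
  have inj: "i = j" if "i < length (mons s)" "j < length (mons s)" "ex i = ex j" for i j
  proof -
    have eq: "\<forall>v<Suc s. Poly_Mapping.lookup (mons s ! i) v = Poly_Mapping.lookup (mons s ! j) v"
      by (rule base_digits_inj[where s = s]) (use that box in \<open>auto simp: mon_box_def ex_def\<close>)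
    have "Poly_Mapping.lookup (mons s ! i) v = Poly_Mapping.lookup (mons s ! j) v" for v
    proof (cases "v < Suc s")
      case False
      then have "v \<notin> Poly_Mapping.keys (mons s ! i)" "v \<notin> Poly_Mapping.keys (mons s ! j)"
        using box[OF that(1)] box[OF that(2)] by (auto simp: mon_box_def)
      then show ?thesis by (simp add: Poly_Mapping.in_keys_iff)
    qed (use eq in auto)
    then have "mons s ! i = mons s ! j" by (rule poly_mapping_eqI)
    then show ?thesis using mons(2) that nth_eq_iff_index_eq by blast
  qed
  define q where "q = (\<Sum>i<length (mons s). monom (c i) (ex i))"
  have "poly q t = 0" for t
  proof -
    have "mon_val (mons s ! i) (\<lambda>v. t ^ (Suc s ^ v)) = t ^ ex i" if "i < length (mons s)" for i
    proof -
      have "mon_val (mons s ! i) (\<lambda>v. t ^ (Suc s ^ v)) =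
        (\<Prod>v<Suc s. (t ^ (Suc s ^ v)) ^ Poly_Mapping.lookup (mons s ! i) v)"
        by (rule mon_val_superset) (use box[OF that] in \<open>auto simp: mon_box_def\<close>)
      also have "\<dots> = t ^ ex i"
        unfolding ex_def power_sum by (intro prod.cong) (auto simp: power_mult[symmetric] mult.commute)
      finally show ?thesis .
    qed
    then have "poly q t = (\<Sum>i<length (mons s). c i * mon_val (mons s ! i) (\<lambda>v. t ^ (Suc s ^ v)))"
      by (simp add: q_def poly_sum poly_monom)
    then show ?thesis using assms by simp
  qed
  then have "q = 0" using poly_all_0_iff_0 by blast
  have "c j = 0" if "j < length (mons s)" for j
  proof -
    have "0 = coeff q (ex j)" using \<open>q = 0\<close> by simp
    also have "\<dots> = (\<Sum>i<length (mons s). if i = j then c i else 0)"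
      unfolding q_def coeff_sum by (rule sum.cong) (use inj that in \<open>auto simp: coeff_monom\<close>)
    also have "\<dots> = c j" using that by simp
    finally show ?thesis by simp
  qed
  then show ?thesis by blast
qed

definition pmon :: "nat \<Rightarrow> nat monomial \<Rightarrow> (nat \<times> nat) pexp" where
  "pmon b \<alpha> = pprod (map (\<lambda>v. ppow (Var (b, v)) (Poly_Mapping.lookup \<alpha> v))
     (sorted_list_of_set (Poly_Mapping.keys \<alpha>)))"

lemma peval_pmon: "peval e (pmon b \<alpha>) = mon_val \<alpha> (\<lambda>v. e (b, v))"
  by (simp add: pmon_def peval_pprod peval_ppow o_def mon_val_def prod.distinct_set_conv_list[symmetric])

lemma pvars_pmon: "pvars (pmon b \<alpha>) \<subseteq> {b} \<times> UNIV"
proof -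
  have "fst x = b" if "x \<in> pvars (ppow (Var (b, v)) n)" for x v n
    using subsetD[OF pvars_ppow that] by auto
  then show ?thesis unfolding pmon_def pvars_pprod by fastforce
qed

text \<open>
  Variable \<open>(b, 0)\<close> is the \<open>b\<close>-th point and \<open>(b, Suc l)\<close> the value of the \<open>l\<close>-th derivative there.
\<close>

definition dae_cert :: "nat \<Rightarrow> (nat \<times> nat) pexp" where
  "dae_cert s = certp (map (\<lambda>\<alpha> b. pmon b \<alpha>) (mons s)) 0"

definition npts :: "nat \<Rightarrow> nat" where "npts s = length (mons s)"

lemma pvars_dae_cert:
  assumes "x \<in> pvars (dae_cert s)"
  shows "fst x < npts s"
proof -
  have "x \<in> (\<Union>g\<in>set (map (\<lambda>\<alpha> b. pmon b \<alpha>) (mons s)). \<Union>b'\<in>{0..<npts s}. pvars (g b'))"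
    using assms pvars_certp[of "map (\<lambda>\<alpha> b. pmon b \<alpha>) (mons s)" 0]
    unfolding dae_cert_def npts_def length_map add_0 by blast
  then obtain \<alpha> b' where "b' < npts s" "x \<in> pvars (pmon b' \<alpha>)" by auto
  then show ?thesis using pvars_pmon[of b' \<alpha>] by auto
qed

lemma dae_cert_nonzero: "\<exists>e :: nat \<times> nat \<Rightarrow> real. peval e (dae_cert s) \<noteq> 0"
proof -
  have "\<exists>w. cert (map (\<lambda>f b'. f (w b')) (map mon_val (mons s))) 0 \<noteq> (0::real)"
    by (rule cert_nonzero_exists) (use mons_independent in auto)
  then obtain w :: "nat \<Rightarrow> nat \<Rightarrow> real" where w: "cert (map (\<lambda>f b'. f (w b')) (map mon_val (mons s))) 0 \<noteq> 0"
    by blast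
  have "peval (\<lambda>(b, v). w b v) (dae_cert s) \<noteq> 0"
    using w by (simp add: dae_cert_def peval_certp peval_pmon o_def)
  then show ?thesis by blast
qed

text \<open>
  The differential equation is a linear relation between the monomials of a box whose coefficients do
  not depend on the point.
\<close>

theorem dae_cert_vanishes:
  fixes f :: "real \<Rightarrow> real"
  assumes "differentially_algebraic_on D f"
  shows "\<exists>s. \<forall>e. (\<forall>b<npts s. e (b, 0) \<in> D \<and> (\<forall>l. e (b, Suc l) = (deriv ^^ l) f (e (b, 0))))
    \<longrightarrow> peval e (dae_cert s) = 0"
proof -
  from assms obtain n and Q :: "(nat, real) mpoly" where Q: "Q \<noteq> 0" "mpoly_vars Q \<subseteq> {..n + 1}"
    "\<And>z. z \<in> D \<Longrightarrow> mpoly_eval Q (case_nat z (\<lambda>k. (deriv ^^ k) f z)) = 0"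
    unfolding differentially_algebraic_on_def by blast
  define s where "s = Max (insert (n + 1) (\<Union>\<alpha>\<in>Poly_Mapping.keys Q. Poly_Mapping.lookup \<alpha> ` Poly_Mapping.keys \<alpha>))"
  have fin: "finite (insert (n + 1) (\<Union>\<alpha>\<in>Poly_Mapping.keys Q. Poly_Mapping.lookup \<alpha> ` Poly_Mapping.keys \<alpha>))"
    by auto
  have s1: "n + 1 \<le> s" unfolding s_def by (rule Max_ge[OF fin]) auto
  have s2: "Poly_Mapping.lookup \<alpha> v \<le> s" if "\<alpha> \<in> Poly_Mapping.keys Q" for \<alpha> v
  proof (cases "v \<in> Poly_Mapping.keys \<alpha>")
    case True
    show ?thesis unfolding s_def by (rule Max_ge[OF fin]) (use True that in auto)
  qed (simp add: Poly_Mapping.in_keys_iff)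
  have sub: "Poly_Mapping.keys Q \<subseteq> mon_box s"
    using Q(2) s1 s2 by (fastforce simp: mon_box_def mpoly_vars_def)
  define c where "c i = Poly_Mapping.lookup Q (mons s ! i)" for i
  have ind: "mpoly_eval Q w = (\<Sum>i<length (mons s). c i * mon_val (mons s ! i) w)" for w
  proof -
    have "mpoly_eval Q w = (\<Sum>\<alpha>\<in>Poly_Mapping.keys Q. Poly_Mapping.lookup Q \<alpha> * mon_val \<alpha> w)"
      by (simp add: mpoly_eval_def mon_val_def)
    also have "\<dots> = (\<Sum>\<alpha>\<in>set (mons s). Poly_Mapping.lookup Q \<alpha> * mon_val \<alpha> w)"
      by (rule sum.mono_neutral_left) (use sub finite_mon_box mons(1) in \<open>auto simp: Poly_Mapping.in_keys_iff\<close>)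
    also have "\<dots> = (\<Sum>i<length (mons s). c i * mon_val (mons s ! i) w)"
      unfolding c_def
      by (rule sum.reindex_bij_betw[OF bij_betw_nth[OF mons(2) refl refl], symmetric])
    finally show ?thesis .
  qed
  have c: "\<exists>i<length (mons s). c i \<noteq> 0"
  proof -
    obtain \<alpha> where "\<alpha> \<in> Poly_Mapping.keys Q" using Q(1) by fastforce
    moreover from this obtain i where "i < length (mons s)" "mons s ! i = \<alpha>"
      using sub mons(1) by (metis in_set_conv_nth subsetD)
    ultimately show ?thesis by (auto simp: c_def Poly_Mapping.in_keys_iff)
  qed
  show ?thesis
  proof (intro exI[of _ s] allI impI)
    fix e assume e: "\<forall>b<npts s. e (b, 0) \<in> D \<and> (\<forall>l. e (b, Suc l) = (deriv ^^ l) f (e (b, 0)))"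
    show "peval e (dae_cert s) = 0"
      unfolding dae_cert_def peval_certp
    proof (rule cert_eq_0[where c = c])
      fix b assume b: "0 \<le> b" "b < 0 + length (map (\<lambda>g b. peval e (g b)) (map (\<lambda>\<alpha> b. pmon b \<alpha>) (mons s)))"
      then have b': "b < npts s" by (simp add: npts_def)
      have "(\<lambda>v. e (b, v)) = case_nat (e (b, 0)) (\<lambda>k. (deriv ^^ k) f (e (b, 0)))"
        using e b' by (auto simp: fun_eq_iff split: nat.split)
      then have "mpoly_eval Q (\<lambda>v. e (b, v)) = 0" using Q(3) e b' by simp
      then show "(\<Sum>i<length (map (\<lambda>g b. peval e (g b)) (map (\<lambda>\<alpha> b. pmon b \<alpha>) (mons s))). c i *
         (map (\<lambda>g b. peval e (g b)) (map (\<lambda>\<alpha> b. pmon b \<alpha>) (mons s)) ! i) b) = 0"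
        by (simp add: ind peval_pmon)
    qed (use c in simp)
  qed
qed

section \<open>Local flow of a polynomial vector field\<close>

definition fps_prim :: "complex fps \<Rightarrow> complex fps" where
  "fps_prim F = Abs_fps (\<lambda>n. if n = 0 then 0 else fps_nth F (n - 1) / of_nat n)"

abbreviation cconst :: "real \<Rightarrow> complex fps" where
  "cconst \<equiv> (\<lambda>a. fps_const (complex_of_real a))"

text \<open>
  Picard iteration on formal power series. Each step makes one more coefficient final, and
  \<open>formal_sol\<close> collects the final ones.
\<close>

primrec picard :: "('m \<Rightarrow> 'm pexp) \<Rightarrow> ('m \<Rightarrow> complex) \<Rightarrow> nat \<Rightarrow> 'm \<Rightarrow> complex fps" where
  "picard V U 0 = (\<lambda>k. fps_const (U k))"
| "picard V U (Suc n) = (\<lambda>k. fps_const (U k) + fps_prim (peval_in cconst (picard V U n) (V k)))"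

definition fps_agree :: "nat \<Rightarrow> complex fps \<Rightarrow> complex fps \<Rightarrow> bool" where
  "fps_agree n F G \<longleftrightarrow> (\<forall>i\<le>n. fps_nth F i = fps_nth G i)"

lemma fps_agree_peval_in:
  assumes "\<And>x. fps_agree n (e x) (e' x)"
  shows "fps_agree n (peval_in cconst e p) (peval_in cconst e' p)"
  using assms by (induction p) (auto simp: fps_agree_def fps_mult_nth intro!: sum.cong)

lemma fps_agree_prim:
  "fps_agree n F G \<Longrightarrow> fps_agree (Suc n) (fps_const c + fps_prim F) (fps_const c + fps_prim G)"
  by (auto simp: fps_agree_def fps_prim_def)

lemma picard_agree_Suc: "fps_agree n (picard V U n k) (picard V U (Suc n) k)"
proof (induction n arbitrary: k)
  case 0
  then show ?case by (auto simp: fps_agree_def fps_prim_def)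
next
  case (Suc n)
  have "fps_agree n (peval_in cconst (picard V U n) (V k)) (peval_in cconst (picard V U (Suc n)) (V k))"
    by (rule fps_agree_peval_in) (rule Suc)
  from fps_agree_prim[OF this] show ?case by simp
qed

lemma picard_agree: "n \<le> m \<Longrightarrow> fps_agree n (picard V U n k) (picard V U m k)"
proof (induction m rule: dec_induct)
  case base
  then show ?case by (simp add: fps_agree_def)
next
  case (step m)
  then show ?case using picard_agree_Suc[of m V U k] by (simp add: fps_agree_def del: picard.simps)
qed

definition formal_sol :: "('m \<Rightarrow> 'm pexp) \<Rightarrow> ('m \<Rightarrow> complex) \<Rightarrow> 'm \<Rightarrow> complex fps" where
  "formal_sol V U k = Abs_fps (\<lambda>n. fps_nth (picard V U n k) n)"

lemma formal_sol_agree: "fps_agree n (formal_sol V U k) (picard V U n k)"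
  unfolding fps_agree_def formal_sol_def fps_nth_Abs_fps
proof (intro allI impI)
  fix i assume "i \<le> n"
  then show "fps_nth (picard V U i k) i = fps_nth (picard V U n k) i"
    using picard_agree[of i n V U k] by (auto simp: fps_agree_def)
qed

lemma formal_sol_0: "fps_nth (formal_sol V U k) 0 = U k"
  by (simp add: formal_sol_def)

lemma formal_sol_deriv: "fps_deriv (formal_sol V U k) = peval_in cconst (formal_sol V U) (V k)"
proof (rule fps_ext)
  fix i
  have "fps_nth (fps_deriv (formal_sol V U k)) i = of_nat (Suc i) * fps_nth (picard V U (Suc i) k) (Suc i)"
    by (simp add: formal_sol_def del: picard.simps of_nat_Suc)
  also have "\<dots> = fps_nth (peval_in cconst (picard V U i) (V k)) i"
    by (simp add: fps_prim_def del: of_nat_Suc)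
  also have "\<dots> = fps_nth (peval_in cconst (formal_sol V U) (V k)) i"
    using fps_agree_peval_in[OF formal_sol_agree[of i V U], where p = "V k"] by (simp add: fps_agree_def)
  finally show "fps_nth (fps_deriv (formal_sol V U k)) i = fps_nth (peval_in cconst (formal_sol V U) (V k)) i" .
qed

text \<open>
  Weighted \<open>\<ell>\<^sup>1\<close> norms are submultiplicative, and integration gains a factor \<open>\<rho>\<close>; so Picard iteration
  stays bounded for small \<open>\<rho>\<close>, uniformly for bounded initial values.
\<close>

definition l1_bound :: "real \<Rightarrow> complex fps \<Rightarrow> real \<Rightarrow> bool" where
  "l1_bound \<rho> F B \<longleftrightarrow> (\<forall>n. (\<Sum>i<n. norm (fps_nth F i) * \<rho> ^ i) \<le> B)"

lemma l1_bound_nonneg: "l1_bound \<rho> F B \<Longrightarrow> 0 \<le> B"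
  by (auto simp: l1_bound_def dest: spec[of _ 0])

lemma l1_bound_const: "norm c \<le> B \<Longrightarrow> l1_bound \<rho> (fps_const c) B"
  unfolding l1_bound_def
proof
  fix n assume "norm c \<le> B"
  have "(\<Sum>i<n. norm (fps_nth (fps_const c) i) * \<rho> ^ i) = (\<Sum>i<n. if i = 0 then norm c else 0)"
    by (rule sum.cong) auto
  also have "\<dots> \<le> B"
    using \<open>norm c \<le> B\<close> order_trans[OF norm_ge_zero \<open>norm c \<le> B\<close>] by (auto simp: sum.delta)
  finally show "(\<Sum>i<n. norm (fps_nth (fps_const c) i) * \<rho> ^ i) \<le> B" .
qed

lemma l1_bound_add: 
  assumes "0 \<le> \<rho>" "l1_bound \<rho> F A" "l1_bound \<rho> G B" shows "l1_bound \<rho> (F + G) (A + B)"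
  unfolding l1_bound_def
proof
  fix n
  have "(\<Sum>i<n. norm (fps_nth (F + G) i) * \<rho> ^ i) \<le>
        (\<Sum>i<n. norm (fps_nth F i) * \<rho> ^ i + norm (fps_nth G i) * \<rho> ^ i)"
    using assms(1) by (intro sum_mono) (auto simp: distrib_right[symmetric] intro!: mult_right_mono norm_triangle_ineq)
  also have "\<dots> \<le> A + B" using assms by (auto simp: sum.distrib l1_bound_def intro!: add_mono)
  finally show "(\<Sum>i<n. norm (fps_nth (F + G) i) * \<rho> ^ i) \<le> A + B" .
qed

lemma l1_bound_mult:
  assumes "0 \<le> \<rho>" "l1_bound \<rho> F A" "l1_bound \<rho> G B" shows "l1_bound \<rho> (F * G) (A * B)"
  unfolding l1_bound_def
proof
  fix n
  let ?f = "\<lambda>i. norm (fps_nth F i) * \<rho> ^ i" and ?g = "\<lambda>i. norm (fps_nth G i) * \<rho> ^ i"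
  have "(\<Sum>i<n. norm (fps_nth (F * G) i) * \<rho> ^ i) \<le> (\<Sum>k<n. \<Sum>i\<le>k. ?f i * ?g (k - i))"
  proof (rule sum_mono)
    fix k
    have "norm (fps_nth (F * G) k) \<le> (\<Sum>i\<le>k. norm (fps_nth F i) * norm (fps_nth G (k - i)))"
      unfolding fps_mult_nth by (rule order_trans[OF norm_sum]) (simp add: norm_mult atMost_atLeast0)
    then have "norm (fps_nth (F * G) k) * \<rho> ^ k \<le>
      (\<Sum>i\<le>k. norm (fps_nth F i) * norm (fps_nth G (k - i))) * \<rho> ^ k"
      using assms(1) by (intro mult_right_mono) auto
    also have "\<dots> = (\<Sum>i\<le>k. ?f i * ?g (k - i))"
    proof (unfold sum_distrib_right, rule sum.cong)
      fix i assume "i \<in> {..k}"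
      then have "\<rho> ^ k = \<rho> ^ i * \<rho> ^ (k - i)" by (simp add: power_add[symmetric])
      then show "norm (fps_nth F i) * norm (fps_nth G (k - i)) * \<rho> ^ k = ?f i * ?g (k - i)" by simp
    qed simp
    finally show "norm (fps_nth (F * G) k) * \<rho> ^ k \<le> (\<Sum>i\<le>k. ?f i * ?g (k - i))" .
  qed
  also have "\<dots> = (\<Sum>(i, j)\<in>{(i, j). i + j < n}. ?f i * ?g j)"
    by (rule sum.triangle_reindex[symmetric])
  also have "\<dots> \<le> (\<Sum>(i, j)\<in>{..<n} \<times> {..<n}. ?f i * ?g j)"
    by (rule sum_mono2) (use assms(1) in auto)
  also have "\<dots> = (\<Sum>i<n. ?f i) * (\<Sum>j<n. ?g j)"
    by (simp add: sum.cartesian_product[symmetric] sum_product)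
  also have "\<dots> \<le> A * B"
    using assms l1_bound_nonneg[OF assms(2)]
    by (intro mult_mono) (auto simp: l1_bound_def intro!: sum_nonneg)
  finally show "(\<Sum>i<n. norm (fps_nth (F * G) i) * \<rho> ^ i) \<le> A * B" .
qed

lemma l1_bound_prim:
  assumes "0 \<le> \<rho>" "l1_bound \<rho> F A" shows "l1_bound \<rho> (fps_prim F) (\<rho> * A)"
  unfolding l1_bound_def
proof
  fix n
  show "(\<Sum>i<n. norm (fps_nth (fps_prim F) i) * \<rho> ^ i) \<le> \<rho> * A"
  proof (cases n)
    case 0
    then show ?thesis using assms l1_bound_nonneg by simp
  next
    case (Suc m)
    have "(\<Sum>i<n. norm (fps_nth (fps_prim F) i) * \<rho> ^ i) =
          (\<Sum>i<m. norm (fps_nth F i) / real (Suc i) * \<rho> ^ Suc i)"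
      unfolding Suc sum.lessThan_Suc_shift by (simp add: fps_prim_def norm_divide del: of_nat_Suc)
    also have "\<dots> \<le> (\<Sum>i<m. \<rho> * (norm (fps_nth F i) * \<rho> ^ i))"
    proof (rule sum_mono)
      fix i
      have "norm (fps_nth F i) / real (Suc i) \<le> norm (fps_nth F i)"
        by (simp add: divide_le_eq mult_left_le_one_le algebra_simps)
      then have "norm (fps_nth F i) / real (Suc i) * \<rho> ^ Suc i \<le> norm (fps_nth F i) * \<rho> ^ Suc i"
        using assms(1) by (intro mult_right_mono) auto
      then show "norm (fps_nth F i) / real (Suc i) * \<rho> ^ Suc i \<le> \<rho> * (norm (fps_nth F i) * \<rho> ^ i)"
        by (simp add: algebra_simps)
    qed
    also have "\<dots> \<le> \<rho> * A"
      using assms by (auto simp: sum_distrib_left[symmetric] l1_bound_def intro!: mult_left_mono)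
    finally show ?thesis .
  qed
qed

primrec pbound :: "real \<Rightarrow> 'x pexp \<Rightarrow> real" where
  "pbound B (Const a) = \<bar>a\<bar>"
| "pbound B (Var x) = B"
| "pbound B (Add p q) = pbound B p + pbound B q"
| "pbound B (Mul p q) = pbound B p * pbound B q"

lemma pbound_nonneg: "0 \<le> B \<Longrightarrow> 0 \<le> pbound B p"
  by (induction p) auto

lemma l1_bound_peval_in:
  assumes "0 \<le> \<rho>" "\<And>x. l1_bound \<rho> (e x) B"
  shows "l1_bound \<rho> (peval_in cconst e p) (pbound B p)"
  using assms by (induction p) (auto intro: l1_bound_const l1_bound_add l1_bound_mult)

text \<open>
  The smallness of \<open>\<rho>\<close> makes the integral term contribute at most \<open>1\<close>.
\<close>

lemma picard_bound:
  assumes "0 \<le> \<rho>" "\<And>k. norm (U k) \<le> R" "\<And>k. \<rho> * pbound (R + 1) (V k) \<le> 1"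
  shows "l1_bound \<rho> (picard V U n k) (R + 1)"
proof (induction n arbitrary: k)
  case 0
  show ?case using assms(2)[of k] by (auto intro!: l1_bound_const)
next
  case (Suc n)
  have 1: "l1_bound \<rho> (peval_in cconst (picard V U n) (V k)) (pbound (R + 1) (V k))"
    by (rule l1_bound_peval_in) (use assms(1) Suc in auto)
  have "l1_bound \<rho> (fps_const (U k)) R" by (rule l1_bound_const) (rule assms)
  moreover have "l1_bound \<rho> (fps_prim (peval_in cconst (picard V U n) (V k))) 1"
    using l1_bound_prim[OF assms(1) 1] assms(3)[of k]
    by (auto simp: l1_bound_def intro: order_trans)
  ultimately show ?case using l1_bound_add[OF assms(1)] by simp
qed

lemma formal_sol_nth_bound:
  assumes "0 < \<rho>" "\<And>k. norm (U k) \<le> R" "\<And>k. \<rho> * pbound (R + 1) (V k) \<le> 1"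
  shows "norm (fps_nth (formal_sol V U k) i) \<le> (R + 1) / \<rho> ^ i"
proof -
  have "norm (fps_nth (picard V U i k) i) * \<rho> ^ i \<le> (\<Sum>j<Suc i. norm (fps_nth (picard V U i k) j) * \<rho> ^ j)"
    by (rule member_le_sum) (use assms(1) in auto)
  also have "\<dots> \<le> R + 1"
    using picard_bound[where V = V and U = U and n = i and k = k, OF less_imp_le[OF assms(1)] assms(2,3)] unfolding l1_bound_def by blast
  finally show ?thesis using assms(1) by (simp add: formal_sol_def field_simps)
qed

lemma formal_sol_radius:
  assumes "0 < \<rho>" "\<And>k. norm (U k) \<le> R" "\<And>k. \<rho> * pbound (R + 1) (V k) \<le> 1"
  shows "ereal \<rho> \<le> fps_conv_radius (formal_sol V U k)"
  unfolding fps_conv_radius_def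
proof (rule conv_radius_geI_ex')
  fix r :: real assume r: "0 < r" "ereal r < ereal \<rho>"
  show "summable (\<lambda>n. fps_nth (formal_sol V U k) n * of_real r ^ n)"
  proof (rule summable_comparison_test')
    show "summable (\<lambda>n. (R + 1) * (r / \<rho>) ^ n)"
      by (rule summable_mult, rule summable_geometric) (use r assms(1) in auto)
    fix n
    have "norm (fps_nth (formal_sol V U k) n * of_real r ^ n) = norm (fps_nth (formal_sol V U k) n) * r ^ n"
      using r by (simp add: norm_mult norm_power)
    also have "\<dots> \<le> (R + 1) / \<rho> ^ n * r ^ n"
      using r by (intro mult_right_mono formal_sol_nth_bound assms) auto
    finally show "norm (fps_nth (formal_sol V U k) n * of_real r ^ n) \<le> (R + 1) * (r / \<rho>) ^ n"
      by (simp add: power_divide)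
  qed
qed

lemma eval_fps_peval_in:
  assumes "\<And>x. ereal \<rho> \<le> fps_conv_radius (e x)" "norm t < \<rho>"
  shows "ereal \<rho> \<le> fps_conv_radius (peval_in cconst e p) \<and> eval_fps (peval_in cconst e p) t = peval (\<lambda>x. eval_fps (e x) t) p"
proof (induction p)
  case (Add p q)
  have "ereal (norm t) < fps_conv_radius (peval_in cconst e p)" "ereal (norm t) < fps_conv_radius (peval_in cconst e q)"
    using Add assms(2) by (auto intro: less_le_trans[of _ "ereal \<rho>"])
  moreover have "ereal \<rho> \<le> fps_conv_radius (peval_in cconst e p + peval_in cconst e q)"
    using Add fps_conv_radius_add[of "peval_in cconst e p" "peval_in cconst e q"] by (meson min.bounded_iff order_trans)
  ultimately show ?case using Add by (simp add: eval_fps_add)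
next
  case (Mul p q)
  have "ereal (norm t) < fps_conv_radius (peval_in cconst e p)" "ereal (norm t) < fps_conv_radius (peval_in cconst e q)"
    using Mul assms(2) by (auto intro: less_le_trans[of _ "ereal \<rho>"])
  moreover have "ereal \<rho> \<le> fps_conv_radius (peval_in cconst e p * peval_in cconst e q)"
    using Mul fps_conv_radius_mult[of "peval_in cconst e p" "peval_in cconst e q"] by (meson min.bounded_iff order_trans)
  ultimately show ?case using Mul by (simp add: eval_fps_mult)
qed (use assms in auto)

text \<open>
  The coefficients of the formal solution are polynomials in the initial value; they inherit every
  property that is stable under sums and products. It is applied to continuity, to holomorphy along a
  curve and to being real.
\<close>

lemma formal_sol_nth_closure:
  fixes Q :: "('s \<Rightarrow> complex) \<Rightarrow> bool"
  assumes c: "\<And>a. Q (\<lambda>_. of_real a)"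
    and a: "\<And>f g. Q f \<Longrightarrow> Q g \<Longrightarrow> Q (\<lambda>s. f s + g s)"
    and m: "\<And>f g. Q f \<Longrightarrow> Q g \<Longrightarrow> Q (\<lambda>s. f s * g s)"
    and U: "\<And>k. Q (\<lambda>s. U s k)"
  shows "Q (\<lambda>s. fps_nth (formal_sol V (U s) k) i)"
proof -
  have sum: "Q (\<lambda>s. \<Sum>i\<in>I. f i s)" if "finite I" "\<And>i. i \<in> I \<Longrightarrow> Q (f i)" for I :: "nat set" and f
    using that
  proof (induction I)
    case empty
    then show ?case using c[of 0] by simp
  next
    case (insert x I)
    then show ?case using a[of "f x" "\<lambda>s. \<Sum>i\<in>I. f i s"] by simp
  qed
  have p: "Q (\<lambda>s. fps_nth (peval_in cconst (e s) p) i)" if "\<And>x i. Q (\<lambda>s. fps_nth (e s x) i)"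
    for e :: "'s \<Rightarrow> 'b \<Rightarrow> complex fps" and p i
  proof (induction p arbitrary: i)
    case (Const x)
    then show ?case using c[of x] c[of 0] by (cases "i = 0") simp_all
  next
    case (Mul p q)
    then show ?case by (auto simp: fps_mult_nth intro!: sum m)
  qed (use that in \<open>auto intro!: a\<close>)
  have "Q (\<lambda>s. fps_nth (picard V (U s) n k) i)" for n k i
  proof (induction n arbitrary: k i)
    case 0
    show ?case using U[of k] c[of 0] by (cases "i = 0") simp_all
  next
    case (Suc n)
    have 1: "Q (\<lambda>s. fps_nth (peval_in cconst (picard V (U s) n) (V k)) (i - 1))" by (rule p) (rule Suc)
    show ?case
    proof (cases "i = 0")
      case True
      then show ?thesis using U[of k] by (simp add: fps_prim_def)
    next
      case False
      then show ?thesis using m[OF 1 c[of "1 / of_nat i"]] by (simp add: fps_prim_def)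
    qed
  qed
  then show ?thesis by (simp add: formal_sol_def)
qed

definition cflow :: "('m::finite \<Rightarrow> 'm pexp) \<Rightarrow> complex \<Rightarrow> complex ^ 'm \<Rightarrow> complex ^ 'm" where
  "cflow V t U = (\<chi> k. eval_fps (formal_sol V (\<lambda>k. U $ k) k) t)"

abbreviation cvec :: "real ^ 'm \<Rightarrow> complex ^ 'm" where
  "cvec r \<equiv> (\<chi> k. of_real (r $ k))"

text \<open>
  The radius depends on the bound for the initial value only. The partial sums converge uniformly, and
  their coefficients are polynomials in the initial value, which gives continuity and holomorphic
  dependence on it.
\<close>

theorem local_flow:
  fixes V :: "'m::finite \<Rightarrow> 'm pexp"
  assumes "0 < R"
  obtains \<rho> where "0 < \<rho>"
    and "\<And>U k. cflow V 0 U = U"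
    and "\<And>U t k. norm U < R \<Longrightarrow> norm t < \<rho> \<Longrightarrow>
      ((\<lambda>t. cflow V t U $ k) has_field_derivative peval (\<lambda>k. cflow V t U $ k) (V k)) (at t)"
    and "continuous_on (ball 0 \<rho> \<times> ball 0 R) (\<lambda>(t, U). cflow V t U)"
    and "\<And>S u t k. open S \<Longrightarrow> (\<And>k. (\<lambda>s. u s $ k) holomorphic_on S) \<Longrightarrow>
      (\<And>s. s \<in> S \<Longrightarrow> norm (u s) < R) \<Longrightarrow> norm t < \<rho> \<Longrightarrow> (\<lambda>s. cflow V t (u s) $ k) holomorphic_on S"
    and "\<And>r t k. norm (cvec r) < R \<Longrightarrow> \<bar>t\<bar> < \<rho> \<Longrightarrow> cflow V (of_real t) (cvec r) $ k \<in> \<real>"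
proof -
  define \<sigma> where "\<sigma> = 1 / (1 + (\<Sum>k\<in>UNIV. pbound (R + 1) (V k)))"
  have nn: "0 \<le> pbound (R + 1) (V k)" for k using assms by (simp add: pbound_nonneg)
  have pos: "0 < 1 + (\<Sum>k\<in>UNIV. pbound (R + 1) (V k))"
    by (simp add: add_pos_nonneg nn sum_nonneg)
  then have s0: "0 < \<sigma>" by (simp add: \<sigma>_def)
  have sV: "\<sigma> * pbound (R + 1) (V k) \<le> 1" for k
  proof -
    have "pbound (R + 1) (V k) \<le> (\<Sum>k\<in>UNIV. pbound (R + 1) (V k))"
      by (rule member_le_sum) (use nn in auto)
    then show ?thesis using pos by (simp add: \<sigma>_def field_simps)
  qed
  have U: "norm (U $ k) \<le> R" if "norm U < R" for U :: "complex ^ 'm" and k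
    using that Finite_Cartesian_Product.norm_nth_le[of U k] by simp
  \<comment> \<open>Half the radius of the estimates: the series are then dominated by a geometric one.\<close>
  define \<rho> where "\<rho> = \<sigma> / 2"
  have r0: "0 < \<rho>" "\<rho> < \<sigma>" using s0 by (auto simp: \<rho>_def)
  define S where "S N t U k = (\<Sum>i<N. fps_nth (formal_sol V (\<lambda>k. U $ k) k) i * t ^ i)"
    for N t k and U :: "complex ^ 'm"
  have lim: "uniform_limit (ball 0 \<rho> \<times> ball 0 R) (\<lambda>N (t, U). S N t U k) (\<lambda>(t, U). cflow V t U $ k) sequentially" for k
  proof -
    have "uniform_limit (ball 0 \<rho> \<times> ball 0 R)
      (\<lambda>N x. \<Sum>i<N. fps_nth (formal_sol V (\<lambda>k. snd x $ k) k) i * fst x ^ i)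
      (\<lambda>x. suminf (\<lambda>i. fps_nth (formal_sol V (\<lambda>k. snd x $ k) k) i * fst x ^ i)) sequentially"
    proof (rule Weierstrass_m_test)
      fix i and x :: "complex \<times> (complex ^ 'm)" assume x: "x \<in> ball 0 \<rho> \<times> ball 0 R"
      have "norm (fps_nth (formal_sol V (\<lambda>k. snd x $ k) k) i * fst x ^ i) =
        norm (fps_nth (formal_sol V (\<lambda>k. snd x $ k) k) i) * norm (fst x) ^ i"
        by (simp add: norm_mult norm_power)
      also have "\<dots> \<le> (R + 1) / \<sigma> ^ i * \<rho> ^ i"
        using x r0 assms s0 by (intro mult_mono power_mono formal_sol_nth_bound U sV) auto
      also have "\<dots> = (R + 1) * (1 / 2) ^ i"
        using s0 by (simp add: \<rho>_def field_simps)
      finally show "norm (fps_nth (formal_sol V (\<lambda>k. snd x $ k) k) i * fst x ^ i) \<le> (R + 1) * (1 / 2) ^ i" .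
    next
      show "summable (\<lambda>i. (R + 1) * (1 / 2 :: real) ^ i)"
        by (rule summable_mult, rule summable_geometric) simp
    qed
    then show ?thesis by (simp add: S_def cflow_def eval_fps_def split_def)
  qed
  show ?thesis
  proof (rule that[OF r0(1)])
    show "cflow V 0 U = U" for U :: "complex ^ 'm"
      by (simp add: cflow_def vec_eq_iff eval_fps_at_0 formal_sol_0)
  next
    fix U :: "complex ^ 'm" and t :: complex and k assume Ut: "norm U < R" "norm t < \<rho>"
    have rad: "ereal \<sigma> \<le> fps_conv_radius (formal_sol V (\<lambda>k. U $ k) x)" for x
      by (rule formal_sol_radius[where R = R]) (use s0 U[OF Ut(1)] sV in auto)
    have t: "norm t < \<sigma>" using Ut r0 by simp
    have "ereal (norm t) < fps_conv_radius (formal_sol V (\<lambda>k. U $ k) k)"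
      by (rule less_le_trans[OF _ rad]) (use t in simp)
    from has_field_derivative_eval_fps[OF this, of UNIV]
    have *: "(eval_fps (formal_sol V (\<lambda>k. U $ k) k) has_field_derivative
      eval_fps (peval_in cconst (formal_sol V (\<lambda>k. U $ k)) (V k)) t) (at t)"
      by (simp only: formal_sol_deriv)
    have "eval_fps (peval_in cconst (formal_sol V (\<lambda>k. U $ k)) (V k)) t
      = peval (\<lambda>x. eval_fps (formal_sol V (\<lambda>k. U $ k) x) t) (V k)"
      using eval_fps_peval_in[where e = "formal_sol V (\<lambda>k. U $ k)" and p = "V k"] rad t by blast
    with * show "((\<lambda>t. cflow V t U $ k) has_field_derivative peval (\<lambda>k. cflow V t U $ k) (V k)) (at t)"
      by (simp add: cflow_def)
  next
    have "continuous_on (ball 0 \<rho> \<times> ball 0 R) (\<lambda>(t, U). cflow V t U $ k)" for k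
    proof (rule uniform_limit_theorem[OF _ lim])
      have "continuous_on (ball 0 \<rho> \<times> ball 0 R) (\<lambda>x. fps_nth (formal_sol V (\<lambda>k. snd x $ k) k) i)" for i
        by (rule formal_sol_nth_closure) (auto intro!: continuous_intros)
      then show "\<forall>\<^sub>F N in sequentially. continuous_on (ball 0 \<rho> \<times> ball 0 R) (\<lambda>(t, U). S N t U k)"
        by (auto simp: S_def split_def intro!: continuous_intros always_eventually)
    qed simp
    then have "continuous_on (ball 0 \<rho> \<times> ball 0 R) (\<lambda>x. \<chi> k. cflow V (fst x) (snd x) $ k)"
      by (intro continuous_on_vec_lambda) (simp add: split_def)
    then show "continuous_on (ball 0 \<rho> \<times> ball 0 R) (\<lambda>(t, U). cflow V t U)"
      by (simp add: split_def)
  next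
    fix S' :: "complex set" and u :: "complex \<Rightarrow> complex ^ 'm" and t :: complex and k
    assume S': "open S'" and u: "\<And>k. (\<lambda>s. u s $ k) holomorphic_on S'"
      and uR: "\<And>s. s \<in> S' \<Longrightarrow> norm (u s) < R" and t: "norm t < \<rho>"
    show "(\<lambda>s. cflow V t (u s) $ k) holomorphic_on S'"
    proof (rule holomorphic_uniform_sequence[OF S'])
      fix N
      have "(\<lambda>s. fps_nth (formal_sol V (\<lambda>k. u s $ k) k) i) holomorphic_on S'" for i
        by (rule formal_sol_nth_closure) (use u in \<open>auto intro!: holomorphic_intros\<close>)
      then show "(\<lambda>s. S N t (u s) k) holomorphic_on S'"
        by (auto simp: S_def intro!: holomorphic_intros)
    next
      fix x assume "x \<in> S'"
      then obtain d where d: "d > 0" "cball x d \<subseteq> S'" using S' open_contains_cball by blast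
      have "uniform_limit (cball x d) (\<lambda>N s. case (t, u s) of (t, U) \<Rightarrow> S N t U k)
         (\<lambda>s. case (t, u s) of (t, U) \<Rightarrow> cflow V t U $ k) sequentially"
        by (rule uniform_limit_compose'[OF lim]) (use d t uR in auto)
      then show "\<exists>d>0. cball x d \<subseteq> S' \<and> uniform_limit (cball x d) (\<lambda>N s. S N t (u s) k) (\<lambda>s. cflow V t (u s) $ k) sequentially"
        using d by auto
    qed
  next
    fix r :: "real ^ 'm" and t k assume rt: "norm (cvec r) < R" "\<bar>t\<bar> < \<rho>"
    have im: "Im (fps_nth (formal_sol V (\<lambda>k. cvec r $ k) k) i) = 0" for i
      using formal_sol_nth_closure[where Q = "\<lambda>f. Im (f ()) = 0" and U = "\<lambda>_ k. cvec r $ k" and V = V and k = k and i = i]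
      by simp
    have rad: "ereal \<sigma> \<le> fps_conv_radius (formal_sol V (\<lambda>k. cvec r $ k) x)" for x
      by (rule formal_sol_radius[where R = R]) (use s0 U[OF rt(1)] sV in auto)
    have "ereal (norm (complex_of_real t)) < fps_conv_radius (formal_sol V (\<lambda>k. cvec r $ k) k)"
      by (rule less_le_trans[OF _ rad]) (use rt r0 in simp)
    from sums_eval_fps[OF this] have "(\<lambda>n. fps_nth (formal_sol V (\<lambda>k. cvec r $ k) k) n * of_real t ^ n) sums cflow V (of_real t) (cvec r) $ k"
      by (simp add: cflow_def)
    then have "(\<lambda>n. Im (fps_nth (formal_sol V (\<lambda>k. cvec r $ k) k) n * of_real t ^ n)) sums Im (cflow V (of_real t) (cvec r) $ k)"
      by (rule sums_Im)
    moreover have "Im (fps_nth (formal_sol V (\<lambda>k. cvec r $ k) k) n * of_real t ^ n) = 0" for n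
      using im[of n] by (simp add: of_real_power[symmetric] del: of_real_power)
    ultimately have "(\<lambda>n. 0 :: real) sums Im (cflow V (of_real t) (cvec r) $ k)" by (simp only:)
    then have "Im (cflow V (of_real t) (cvec r) $ k) = 0"
      by (rule sums_unique2[OF _ sums_zero])
    then show "cflow V (of_real t) (cvec r) $ k \<in> \<real>" by (simp add: complex_is_Real_iff)
  qed
qed

section \<open>Uniqueness of solutions\<close>

text \<open>
  The derivative is taken within \<open>J\<close>, so that closed intervals are allowed.
\<close>

definition solves_on :: "('m::finite \<Rightarrow> 'm pexp) \<Rightarrow> real set \<Rightarrow> (real \<Rightarrow> real ^ 'm) \<Rightarrow> bool" where
  "solves_on V J y \<longleftrightarrow>
     (\<forall>t\<in>J. \<forall>k. ((\<lambda>s. y s $ k) has_real_derivative peval (\<lambda>k. y t $ k) (V k)) (at t within J))"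

lemma peval_bound:
  fixes y :: "real ^ 'm"
  assumes "norm y \<le> B" shows "\<bar>peval (\<lambda>k. y $ k) p\<bar> \<le> pbound B p"
proof (induction p)
  case (Var x)
  then show ?case using assms component_le_norm_cart[of y x] by simp
next
  case (Mul p q)
  have "0 \<le> B" using assms norm_ge_zero order_trans by blast
  then show ?case using Mul by (auto simp: abs_mult pbound_nonneg intro!: mult_mono)
qed auto

lemma peval_lipschitz:
  fixes p :: "'m::finite pexp"
  assumes "0 \<le> B"
  shows "\<exists>L\<ge>0. \<forall>y z :: real ^ 'm. norm y \<le> B \<longrightarrow> norm z \<le> B \<longrightarrow>
    \<bar>peval (\<lambda>k. y $ k) p - peval (\<lambda>k. z $ k) p\<bar> \<le> L * norm (y - z)"
proof (induction p)
  case (Const a)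
  then show ?case by (intro exI[of _ 0]) simp
next
  case (Var k)
  show ?case
    by (intro exI[of _ 1]) (use component_le_norm_cart[of "_ - _ :: real ^ 'm" k] in auto)
next
  case (Add p q)
  then obtain L M where *: "L \<ge> 0" "M \<ge> 0"
    "\<And>y z :: real ^ 'm. norm y \<le> B \<Longrightarrow> norm z \<le> B \<Longrightarrow> \<bar>peval (\<lambda>k. y $ k) p - peval (\<lambda>k. z $ k) p\<bar> \<le> L * norm (y - z)"
    "\<And>y z :: real ^ 'm. norm y \<le> B \<Longrightarrow> norm z \<le> B \<Longrightarrow> \<bar>peval (\<lambda>k. y $ k) q - peval (\<lambda>k. z $ k) q\<bar> \<le> M * norm (y - z)"
    by blast
  show ?case
  proof (intro exI[of _ "L + M"] conjI allI impI)
    fix y z :: "real ^ 'm" assume "norm y \<le> B" "norm z \<le> B"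
    from *(3)[OF this] *(4)[OF this]
    show "\<bar>peval (\<lambda>k. y $ k) (Add p q) - peval (\<lambda>k. z $ k) (Add p q)\<bar> \<le> (L + M) * norm (y - z)"
      by (simp add: distrib_right)
  qed (use * in auto)
next
  case (Mul p q)
  then obtain L M where *: "L \<ge> 0" "M \<ge> 0"
    "\<And>y z :: real ^ 'm. norm y \<le> B \<Longrightarrow> norm z \<le> B \<Longrightarrow> \<bar>peval (\<lambda>k. y $ k) p - peval (\<lambda>k. z $ k) p\<bar> \<le> L * norm (y - z)"
    "\<And>y z :: real ^ 'm. norm y \<le> B \<Longrightarrow> norm z \<le> B \<Longrightarrow> \<bar>peval (\<lambda>k. y $ k) q - peval (\<lambda>k. z $ k) q\<bar> \<le> M * norm (y - z)"
    by blast
  let ?P = "pbound B p" and ?Q = "pbound B q"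
  have nn: "0 \<le> ?P" "0 \<le> ?Q" using assms by (auto simp: pbound_nonneg)
  show ?case
  proof (intro exI[of _ "?P * M + L * ?Q"] conjI allI impI)
    fix y z :: "real ^ 'm" assume yz: "norm y \<le> B" "norm z \<le> B"
    let ?p = "\<lambda>y :: real ^ 'm. peval (\<lambda>k. y $ k) p" and ?q = "\<lambda>y :: real ^ 'm. peval (\<lambda>k. y $ k) q"
    have "?p y * ?q y - ?p z * ?q z = ?p y * (?q y - ?q z) + (?p y - ?p z) * ?q z"
      by (simp add: algebra_simps)
    also have "\<bar>\<dots>\<bar> \<le> ?P * (M * norm (y - z)) + (L * norm (y - z)) * ?Q"
      using * nn yz
      by (intro order_trans[OF abs_triangle_ineq] add_mono) (auto simp: abs_mult intro!: mult_mono peval_bound)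
    finally show "\<bar>peval (\<lambda>k. y $ k) (Mul p q) - peval (\<lambda>k. z $ k) (Mul p q)\<bar> \<le> (?P * M + L * ?Q) * norm (y - z)"
      by (simp add: algebra_simps)
  qed (use * nn in auto)
qed

lemma solves_on_subset: "solves_on V J y \<Longrightarrow> I \<subseteq> J \<Longrightarrow> solves_on V I y"
  unfolding solves_on_def by (meson DERIV_subset subsetD)

lemma solves_on_continuous:
  assumes "solves_on V J y" shows "continuous_on J y"
proof -
  have "continuous_on J (\<lambda>t. y t $ k)" for k
    by (rule DERIV_continuous_on) (use assms in \<open>auto simp: solves_on_def\<close>)
  then have "continuous_on J (\<lambda>t. \<chi> k. y t $ k)" by (rule continuous_on_vec_lambda)
  then show ?thesis by simp
qed

text \<open>
  The squared distance of the two solutions times \<open>exp (- 2 M t)\<close> decreases, where \<open>M\<close> is a Lipschitz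
  constant on the bounded set that they visit.
\<close>

lemma solves_on_unique_forward:
  assumes "a \<le> b" "solves_on V {a..b} y" "solves_on V {a..b} z" "y a = z a"
  shows "y b = z b"
proof -
  note cont = solves_on_continuous[OF assms(2)] solves_on_continuous[OF assms(3)]
  have "bounded (y ` {a..b} \<union> z ` {a..b})"
    using cont by (auto intro!: compact_imp_bounded compact_continuous_image)
  then obtain B where B: "\<And>t. t \<in> {a..b} \<Longrightarrow> norm (y t) \<le> B" "\<And>t. t \<in> {a..b} \<Longrightarrow> norm (z t) \<le> B"
    unfolding bounded_iff by blast
  have "0 \<le> B" using B(1)[of a] assms(1) order_trans[OF norm_ge_zero] by auto
  then have "\<forall>k. \<exists>L\<ge>0. \<forall>y z :: real ^ 'a. norm y \<le> B \<longrightarrow> norm z \<le> B \<longrightarrow>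
    \<bar>peval (\<lambda>k. y $ k) (V k) - peval (\<lambda>k. z $ k) (V k)\<bar> \<le> L * norm (y - z)"
    using peval_lipschitz by blast
  then obtain L where L: "\<And>k. 0 \<le> L k" "\<And>k y z. norm (y :: real ^ 'a) \<le> B \<Longrightarrow> norm z \<le> B \<Longrightarrow>
    \<bar>peval (\<lambda>k. y $ k) (V k) - peval (\<lambda>k. z $ k) (V k)\<bar> \<le> L k * norm (y - z)"
    by metis
  define M where "M = (\<Sum>k\<in>UNIV. L k)"
  define w where "w t = y t - z t" for t
  define g where "g t = exp (- (2 * M) * t) * (\<Sum>k\<in>UNIV. (w t $ k)\<^sup>2)" for t
  have "g b \<le> g a"
  proof (rule DERIV_nonpos_imp_decreasing_open[OF assms(1)])
    fix t assume t: "a < t" "t < b"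
    let ?d = "\<lambda>k. peval (\<lambda>k. y t $ k) (V k) - peval (\<lambda>k. z t $ k) (V k)"
    have at: "at t within {a..b} = at t" using t by (simp add: at_within_Icc_at)
    have "((\<lambda>t. y t $ k) has_real_derivative peval (\<lambda>k. y t $ k) (V k)) (at t)"
         "((\<lambda>t. z t $ k) has_real_derivative peval (\<lambda>k. z t $ k) (V k)) (at t)" for k
      using assms(2,3) t at by (auto simp: solves_on_def dest!: bspec[of _ _ t])
    then have w': "((\<lambda>t. w t $ k) has_real_derivative ?d k) (at t)" for k
      unfolding w_def by (auto intro!: derivative_eq_intros)
    let ?D = "exp (- (2 * M) * t) * (2 * (\<Sum>k\<in>UNIV. w t $ k * ?d k) - 2 * M * (\<Sum>k\<in>UNIV. (w t $ k)\<^sup>2))"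
    have "(g has_real_derivative ?D) (at t)"
      unfolding g_def
      by (rule derivative_eq_intros w' refl)+
        (simp add: algebra_simps sum_distrib_left sum_distrib_right power2_eq_square sum.distrib)
    moreover have "?D \<le> 0"
    proof -
      have "w t $ k * ?d k \<le> L k * (norm (w t))\<^sup>2" for k
      proof -
        have "w t $ k * ?d k \<le> \<bar>w t $ k\<bar> * \<bar>?d k\<bar>" by (simp add: abs_mult[symmetric])
        also have "\<dots> \<le> norm (w t) * (L k * norm (w t))"
          using L(2)[of "y t" "z t" k] B[of t] t component_le_norm_cart[of "w t" k]
          by (intro mult_mono) (auto simp: w_def)
        finally show ?thesis by (simp add: power2_eq_square algebra_simps)
      qed
      then have "(\<Sum>k\<in>UNIV. w t $ k * ?d k) \<le> M * (norm (w t))\<^sup>2"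
        unfolding M_def sum_distrib_right by (rule sum_mono)
      also have "(norm (w t))\<^sup>2 = (\<Sum>k\<in>UNIV. (w t $ k)\<^sup>2)"
        by (simp add: norm_vec_def L2_set_def sum_nonneg)
      finally show ?thesis by (intro mult_nonneg_nonpos) auto
    qed
    ultimately show "\<exists>y. DERIV g t :> y \<and> y \<le> 0" by blast
  next
    show "continuous_on {a..b} g"
      unfolding g_def w_def using cont by (auto intro!: continuous_intros)
  qed
  also have "g a = 0" by (simp add: g_def w_def assms(4))
  finally have "(\<Sum>k\<in>UNIV. (w b $ k)\<^sup>2) \<le> 0" by (simp add: g_def mult_le_0_iff)
  then have "(\<Sum>k\<in>UNIV. (w b $ k)\<^sup>2) = 0" by (intro antisym sum_nonneg) simp_all
  then have "\<forall>k. (w b $ k)\<^sup>2 = 0" by (simp add: sum_nonneg_eq_0_iff)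
  then show ?thesis by (simp add: w_def vec_eq_iff)
qed

lemma solves_on_shift:
  assumes "solves_on V J y" shows "solves_on V ((\<lambda>t. t + c) ` J) (\<lambda>t. y (t - c))"
  unfolding solves_on_def
proof (intro ballI allI)
  fix t k assume "t \<in> (\<lambda>t. t + c) ` J"
  then obtain s where s: "s \<in> J" "t = s + c" by auto
  have im: "(\<lambda>t. t - c) ` (\<lambda>t. t + c) ` J = J" by (simp add: image_image)
  have "((\<lambda>s. y s $ k) has_real_derivative peval (\<lambda>k. y (t - c) $ k) (V k)) (at (t - c) within (\<lambda>t. t - c) ` (\<lambda>t. t + c) ` J)"
    using assms s unfolding im by (simp add: solves_on_def)
  moreover have "((\<lambda>t. t - c) has_real_derivative 1) (at t within (\<lambda>t. t + c) ` J)"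
    by (auto intro!: derivative_eq_intros)
  ultimately have "((\<lambda>s. y s $ k) \<circ> (\<lambda>t. t - c) has_real_derivative peval (\<lambda>k. y (t - c) $ k) (V k) * 1)
      (at t within (\<lambda>t. t + c) ` J)" by (rule DERIV_image_chain)
  then show "((\<lambda>s. y (s - c) $ k) has_real_derivative peval (\<lambda>k. y (t - c) $ k) (V k)) (at t within (\<lambda>t. t + c) ` J)"
    by (simp add: o_def)
qed

text \<open>
  Reversing time reduces uniqueness to the left to uniqueness to the right.
\<close>

lemma solves_on_reflect:
  assumes "solves_on V J y" shows "solves_on (\<lambda>k. Mul (Const (-1)) (V k)) (uminus ` J) (\<lambda>t. y (- t))"
  unfolding solves_on_def
proof (intro ballI allI)
  fix t k assume "t \<in> uminus ` J"
  then obtain s where s: "s \<in> J" "t = - s" by auto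
  have im: "uminus ` uminus ` J = J" by (simp add: image_image)
  have "((\<lambda>s. y s $ k) has_real_derivative peval (\<lambda>k. y (- t) $ k) (V k)) (at (- t) within uminus ` uminus ` J)"
    using assms s unfolding im by (simp add: solves_on_def)
  moreover have "(uminus has_real_derivative -1) (at t within uminus ` J)"
    by (auto intro!: derivative_eq_intros)
  ultimately have "((\<lambda>s. y s $ k) \<circ> uminus has_real_derivative peval (\<lambda>k. y (- t) $ k) (V k) * (-1))
      (at t within uminus ` J)" by (rule DERIV_image_chain)
  then show "((\<lambda>s. y (- s) $ k) has_real_derivative peval (\<lambda>k. y (- t) $ k) (Mul (Const (-1)) (V k))) (at t within uminus ` J)"
    by (simp add: o_def)
qed

lemma is_interval_Icc_subset:
  fixes J :: "real set"
  assumes "is_interval J" "a \<in> J" "b \<in> J" shows "{a..b} \<subseteq> J"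
proof
  fix x assume "x \<in> {a..b}"
  then show "x \<in> J" using assms mem_is_interval_1_I[of J a b x] by simp
qed

lemma solves_on_unique:
  assumes "is_interval J" "a \<in> J" "b \<in> J" "solves_on V J y" "solves_on V J z" "y a = z a"
  shows "y b = z b"
proof (cases "a \<le> b")
  case True
  then have *: "{a..b} \<subseteq> J" by (intro is_interval_Icc_subset assms)
  show ?thesis
    by (rule solves_on_unique_forward[OF True solves_on_subset[OF assms(4) *] solves_on_subset[OF assms(5) *] assms(6)])
next
  case False
  then have *: "{b..a} \<subseteq> J" by (intro is_interval_Icc_subset assms)
  have "solves_on (\<lambda>k. Mul (Const (-1)) (V k)) {-a..-b} (\<lambda>t. y (- t))"
    using solves_on_reflect[OF solves_on_subset[OF assms(4) *]] by simp
  moreover have "solves_on (\<lambda>k. Mul (Const (-1)) (V k)) {-a..-b} (\<lambda>t. z (- t))"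
    using solves_on_reflect[OF solves_on_subset[OF assms(5) *]] by simp
  ultimately show ?thesis
    using solves_on_unique_forward[of "-a" "-b" "\<lambda>k. Mul (Const (-1)) (V k)" "\<lambda>t. y (- t)" "\<lambda>t. z (- t)"]
      False assms(6) by simp
qed

lemma solves_on_glue:
  assumes "open I" "open J" "solves_on V I y" "solves_on V J z" "\<And>t. t \<in> I \<Longrightarrow> t \<in> J \<Longrightarrow> y t = z t"
  shows "solves_on V (I \<union> J) (\<lambda>t. if t \<in> I then y t else z t)"
  unfolding solves_on_def
proof (intro ballI allI)
  fix t k assume t: "t \<in> I \<union> J"
  have atIJ: "at t within (I \<union> J) = at t" using assms(1,2) t by (intro at_within_open) auto
  show "((\<lambda>t. (if t \<in> I then y t else z t) $ k) has_real_derivative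
    peval (\<lambda>k. (if t \<in> I then y t else z t) $ k) (V k)) (at t within I \<union> J)"
  proof (cases "t \<in> I")
    case True
    then have "((\<lambda>s. y s $ k) has_real_derivative peval (\<lambda>k. y t $ k) (V k)) (at t)"
      using assms(3) at_within_open[OF True assms(1)] unfolding solves_on_def by metis
    then have "((\<lambda>s. (if s \<in> I then y s else z s) $ k) has_real_derivative peval (\<lambda>k. y t $ k) (V k)) (at t)"
      by (rule has_field_derivative_transform_within_open[where S = I]) (use assms(1) True in auto)
    then show ?thesis using True unfolding atIJ by simp
  next
    case False
    then have J: "t \<in> J" using t by simp
    then have "((\<lambda>s. z s $ k) has_real_derivative peval (\<lambda>k. z t $ k) (V k)) (at t)"
      using assms(4) at_within_open[OF J assms(2)] unfolding solves_on_def by metis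
    then have "((\<lambda>s. (if s \<in> I then y s else z s) $ k) has_real_derivative peval (\<lambda>k. z t $ k) (V k)) (at t)"
      by (rule has_field_derivative_transform_within_open[where S = J]) (use assms(2,5) J in auto)
    then show ?thesis using False unfolding atIJ by simp
  qed
qed

lemma norm_cvec [simp]: "norm (cvec r) = norm r"
  by (simp add: norm_vec_def L2_set_def)

lemma cvec_diff: "cvec r - cvec s = cvec (r - s)"
  by (simp add: vec_eq_iff)

lemma dist_cvec [simp]: "dist (cvec r) (cvec s) = dist r s"
  by (simp only: dist_norm cvec_diff norm_cvec)

section \<open>Holomorphic representation of the flow near a given time\<close>

text \<open>
  Near the time \<open>x0\<close> and the initial value \<open>r\<close> the flow extends to a map \<open>G\<close> of complex times and
  complex initial values. Holomorphy in the initial value is required along holomorphic curves \<open>u\<close>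
  only: this suffices for jets in one coordinate and avoids functions of several complex variables.
\<close>

definition flow_rep :: "('m::finite \<Rightarrow> 'm pexp) \<Rightarrow> real \<Rightarrow> real ^ 'm \<Rightarrow> real \<Rightarrow>
    (complex \<Rightarrow> complex ^ 'm \<Rightarrow> complex ^ 'm) \<Rightarrow> bool" where
  "flow_rep V x0 r \<epsilon> G \<longleftrightarrow> 0 < \<epsilon> \<and>
     (\<forall>r'\<in>ball r \<epsilon>. \<exists>I y. open I \<and> is_interval I \<and> 0 \<in> I \<and> {x0-\<epsilon><..<x0+\<epsilon>} \<subseteq> I \<and> solves_on V I y \<and> y 0 = r' \<and>
        (\<forall>x. \<bar>x - x0\<bar> < \<epsilon> \<longrightarrow> cvec (y x) = G (of_real x) (cvec r'))) \<and>
     (\<forall>U\<in>ball (cvec r) \<epsilon>. \<forall>t\<in>ball (of_real x0) \<epsilon>. \<forall>k.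
        ((\<lambda>t. G t U $ k) has_field_derivative peval (\<lambda>k. G t U $ k) (V k)) (at t)) \<and>
     continuous_on (ball (of_real x0) \<epsilon> \<times> ball (cvec r) \<epsilon>) (\<lambda>(t, U). G t U) \<and>
     (\<forall>S u t k. open S \<longrightarrow> (\<forall>k. (\<lambda>s. u s $ k) holomorphic_on S) \<longrightarrow> u ` S \<subseteq> ball (cvec r) \<epsilon> \<longrightarrow>
        t \<in> ball (of_real x0) \<epsilon> \<longrightarrow> (\<lambda>s. G t (u s) $ k) holomorphic_on S)"

lemma cflow_real_solution:
  fixes V :: "'m::finite \<Rightarrow> 'm pexp" and q :: "real ^ 'm"
  assumes d: "\<And>t k. norm t < \<rho> \<Longrightarrow>
      ((\<lambda>t. cflow V t (cvec q) $ k) has_field_derivative peval (\<lambda>k. cflow V t (cvec q) $ k) (V k)) (at t)"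
    and re: "\<And>t k. \<bar>t\<bar> < \<rho> \<Longrightarrow> cflow V (of_real t) (cvec q) $ k \<in> \<real>"
  defines "y \<equiv> (\<lambda>t. \<chi> k. Re (cflow V (of_real t) (cvec q) $ k))"
  shows "solves_on V {-\<rho><..<\<rho>} y" "\<And>t. \<bar>t\<bar> < \<rho> \<Longrightarrow> cvec (y t) = cflow V (of_real t) (cvec q)"
proof -
  show 1: "cvec (y t) = cflow V (of_real t) (cvec q)" if "\<bar>t\<bar> < \<rho>" for t
    using re[OF that] by (auto simp: y_def vec_eq_iff complex_is_Real_iff complex_eq_iff)
  show "solves_on V {-\<rho><..<\<rho>} y"
    unfolding solves_on_def
  proof (intro ballI allI)
    fix t k assume "t \<in> {-\<rho><..<\<rho>}"
    then have t: "\<bar>t\<bar> < \<rho>" by auto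
    have "((\<lambda>t. cflow V (of_real t) (cvec q) $ k) has_vector_derivative
      peval (\<lambda>k. cflow V (of_real t) (cvec q) $ k) (V k)) (at t within {-\<rho><..<\<rho>})"
      by (rule has_vector_derivative_real_field) (use d[of "of_real t" k] t in simp)
    from bounded_linear.has_vector_derivative[OF bounded_linear_Re this]
    have "((\<lambda>t. y t $ k) has_real_derivative Re (peval (\<lambda>k. cflow V (of_real t) (cvec q) $ k) (V k)))
      (at t within {-\<rho><..<\<rho>})"
      by (simp add: y_def has_real_derivative_iff_has_vector_derivative)
    also have "(\<lambda>k. cflow V (of_real t) (cvec q) $ k) = (\<lambda>k. of_real (y t $ k))"
      using 1[OF t] by (auto simp: fun_eq_iff vec_eq_iff)
    finally show "((\<lambda>t. y t $ k) has_real_derivative peval (\<lambda>k. y t $ k) (V k)) (at t within {-\<rho><..<\<rho>})"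
      by (simp add: peval_of_real)
  qed
qed

lemma flow_repD:
  assumes "flow_rep V x0 r \<epsilon> G"
  shows "0 < \<epsilon>"
    and "\<And>r'. norm (r' - r) < \<epsilon> \<Longrightarrow> \<exists>I y. open I \<and> is_interval I \<and> 0 \<in> I \<and> {x0-\<epsilon><..<x0+\<epsilon>} \<subseteq> I \<and> solves_on V I y \<and> y 0 = r' \<and>
        (\<forall>x. \<bar>x - x0\<bar> < \<epsilon> \<longrightarrow> cvec (y x) = G (of_real x) (cvec r'))"
    and "\<And>U t k. norm (U - cvec r) < \<epsilon> \<Longrightarrow> norm (t - of_real x0) < \<epsilon> \<Longrightarrow>
        ((\<lambda>t. G t U $ k) has_field_derivative peval (\<lambda>k. G t U $ k) (V k)) (at t)"
    and "continuous_on (ball (of_real x0) \<epsilon> \<times> ball (cvec r) \<epsilon>) (\<lambda>(t, U). G t U)"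
    and "\<And>S u t k. open S \<Longrightarrow> (\<And>k. (\<lambda>s. u s $ k) holomorphic_on S) \<Longrightarrow>
        (\<And>s. s \<in> S \<Longrightarrow> norm (u s - cvec r) < \<epsilon>) \<Longrightarrow>
        norm (t - of_real x0) < \<epsilon> \<Longrightarrow> (\<lambda>s. G t (u s) $ k) holomorphic_on S"
  using assms unfolding flow_rep_def
  by (simp_all add: dist_norm norm_minus_commute image_subset_iff)

lemma flow_repI:
  assumes "0 < \<epsilon>"
    and "\<And>r'. norm (r' - r) < \<epsilon> \<Longrightarrow> \<exists>I y. open I \<and> is_interval I \<and> 0 \<in> I \<and> {x0-\<epsilon><..<x0+\<epsilon>} \<subseteq> I \<and> solves_on V I y \<and> y 0 = r' \<and>
        (\<forall>x. \<bar>x - x0\<bar> < \<epsilon> \<longrightarrow> cvec (y x) = G (of_real x) (cvec r'))"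
    and "\<And>U t k. norm (U - cvec r) < \<epsilon> \<Longrightarrow> norm (t - of_real x0) < \<epsilon> \<Longrightarrow>
        ((\<lambda>t. G t U $ k) has_field_derivative peval (\<lambda>k. G t U $ k) (V k)) (at t)"
    and "continuous_on (ball (of_real x0) \<epsilon> \<times> ball (cvec r) \<epsilon>) (\<lambda>(t, U). G t U)"
    and "\<And>S u t k. open S \<Longrightarrow> (\<And>k. (\<lambda>s. u s $ k) holomorphic_on S) \<Longrightarrow>
        (\<And>s. s \<in> S \<Longrightarrow> norm (u s - cvec r) < \<epsilon>) \<Longrightarrow>
        norm (t - of_real x0) < \<epsilon> \<Longrightarrow> (\<lambda>s. G t (u s) $ k) holomorphic_on S"
  shows "flow_rep V x0 r \<epsilon> G"
  using assms unfolding flow_rep_def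
  by (simp add: dist_norm norm_minus_commute image_subset_iff)

lemma is_interval_Un:
  fixes I J :: "real set"
  assumes "is_interval I" "is_interval J" "c \<in> I" "c \<in> J"
  shows "is_interval (I \<union> J)"
  using assms unfolding is_interval_connected_1 by (intro connected_Un) auto

text \<open>
  The new representation is the local flow applied to the point that the old one reaches at time \<open>x1\<close>.
\<close>

lemma flow_rep_step:
  assumes rep: "flow_rep V x1 r \<epsilon> G" and R: "norm (G (of_real x1) (cvec r)) < R"
    and \<rho>: "0 < \<rho>"
    and Fl0: "\<And>U k. cflow V 0 U = U"
    and Fl1: "\<And>U t k. norm U < R \<Longrightarrow> norm t < \<rho> \<Longrightarrow>
      ((\<lambda>t. cflow V t U $ k) has_field_derivative peval (\<lambda>k. cflow V t U $ k) (V k)) (at t)"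
    and Fl2: "continuous_on (ball 0 \<rho> \<times> ball 0 R) (\<lambda>(t, U). cflow V t U)"
    and Fl3: "\<And>S u t k. open S \<Longrightarrow> (\<And>k. (\<lambda>s. u s $ k) holomorphic_on S) \<Longrightarrow>
      (\<And>s. s \<in> S \<Longrightarrow> norm (u s) < R) \<Longrightarrow> norm t < \<rho> \<Longrightarrow> (\<lambda>s. cflow V t (u s) $ k) holomorphic_on S"
    and Fl4: "\<And>r t k. norm (cvec r) < R \<Longrightarrow> \<bar>t\<bar> < \<rho> \<Longrightarrow> cflow V (of_real t) (cvec r) $ k \<in> \<real>"
    and c: "\<bar>c - x1\<bar> < \<rho>"
  shows "\<exists>\<epsilon>' G'. flow_rep V c r \<epsilon>' G'"
proof -
  note D = flow_repD[OF rep]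
  define X where "X = complex_of_real x1"
  have contX: "continuous_on (ball (cvec r) \<epsilon>) (\<lambda>U. G X U)"
  proof -
    have "continuous_on (ball (cvec r) \<epsilon>) (\<lambda>U. (\<lambda>(t, U). G t U) (X, U))"
      by (rule continuous_on_compose2[OF D(4)]) (use D(1) in \<open>auto simp: X_def intro!: continuous_intros\<close>)
    then show ?thesis by simp
  qed
  have op: "open (ball (cvec r) \<epsilon> \<inter> (\<lambda>U. G X U) -` ball 0 R)"
    by (rule continuous_open_preimage[OF contX]) auto
  have "cvec r \<in> ball (cvec r) \<epsilon> \<inter> (\<lambda>U. G X U) -` ball 0 R" using R D(1) by (simp add: X_def)
  then obtain \<epsilon>1 where \<epsilon>1: "0 < \<epsilon>1" "ball (cvec r) \<epsilon>1 \<subseteq> ball (cvec r) \<epsilon> \<inter> (\<lambda>U. G X U) -` ball 0 R"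
    using op open_contains_ball by blast
  define \<epsilon>' where "\<epsilon>' = min (min \<epsilon> \<epsilon>1) (\<rho> - \<bar>c - x1\<bar>)"
  have \<epsilon>': "0 < \<epsilon>'" "\<epsilon>' \<le> \<epsilon>" "\<epsilon>' \<le> \<epsilon>1" "\<epsilon>' \<le> \<rho> - \<bar>c - x1\<bar>" using \<epsilon>1 D(1) c by (auto simp: \<epsilon>'_def)
  have GR: "norm (G X U) < R" if "norm (U - cvec r) < \<epsilon>'" for U
    using \<epsilon>1(2) that \<epsilon>' by (auto simp: subset_iff dist_norm norm_minus_commute)
  have tc: "norm (t - X) < \<rho>" if "norm (t - of_real c) < \<epsilon>'" for t
  proof -
    have "t - X = (t - of_real c) + of_real (c - x1)" by (simp add: X_def)
    then have "norm (t - X) \<le> norm (t - of_real c) + norm (complex_of_real (c - x1))"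
      using norm_triangle_ineq by metis
    also have "norm (complex_of_real (c - x1)) = \<bar>c - x1\<bar>" by (simp only: norm_of_real)
    finally show ?thesis using that \<epsilon>' by linarith
  qed
  define G' where "G' t U = cflow V (t - X) (G X U)" for t U
  have "flow_rep V c r \<epsilon>' G'"
  proof (rule flow_repI)
    show "0 < \<epsilon>'" by (rule \<epsilon>')
  next
    fix r' assume r': "norm (r' - r) < \<epsilon>'"
    then obtain I y where y: "open I" "is_interval I" "0 \<in> I" "{x1-\<epsilon><..<x1+\<epsilon>} \<subseteq> I" "solves_on V I y" "y 0 = r'"
      "\<And>x. \<bar>x - x1\<bar> < \<epsilon> \<Longrightarrow> cvec (y x) = G (of_real x) (cvec r')" using D(2)[of r'] \<epsilon>' by fastforce
    define q where "q = y x1"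
    have cq: "cvec q = G X (cvec r')" using y(7)[of x1] D(1) by (simp add: q_def X_def)
    have "norm (cvec r' - cvec r) < \<epsilon>'" using r' by (simp only: cvec_diff norm_cvec)
    then have nq: "norm (cvec q) < R" unfolding cq by (rule GR)
    define z where "z = (\<lambda>t. \<chi> k. Re (cflow V (of_real t) (cvec q) $ k))"
    have z: "solves_on V {-\<rho><..<\<rho>} z" "\<And>t. \<bar>t\<bar> < \<rho> \<Longrightarrow> cvec (z t) = cflow V (of_real t) (cvec q)"
      unfolding z_def by (rule cflow_real_solution[OF Fl1[OF nq] Fl4[OF nq]]; assumption)+
    define J where "J = {x1-\<rho><..<x1+\<rho>}"
    have J: "open J" "is_interval J" "x1 \<in> J" using \<rho> by (auto simp: J_def is_interval_oo)
    have x1: "x1 \<in> I" using y(4) D(1) by auto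
    have "x \<in> (\<lambda>t. t + x1) ` {-\<rho><..<\<rho>}" if "x \<in> J" for x
      by (rule image_eqI[of _ _ "x - x1"]) (use that in \<open>auto simp: J_def\<close>)
    then have "(\<lambda>t. t + x1) ` {-\<rho><..<\<rho>} = J"
      by (auto simp: J_def)
    then have zJ: "solves_on V J (\<lambda>t. z (t - x1))" using solves_on_shift[OF z(1), of x1] by simp
    have "cvec (z 0) = cvec q" using z(2)[of 0] \<rho> Fl0 by simp
    then have z0: "z 0 = q" by (simp add: vec_eq_iff)
    have agree: "y t = z (t - x1)" if "t \<in> I" "t \<in> J" for t
    proof (rule solves_on_unique[of "I \<inter> J" x1 t V y "\<lambda>t. z (t - x1)"])
      show "is_interval (I \<inter> J)" using y(2) J(2) by (rule is_interval_Int)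
      show "solves_on V (I \<inter> J) y" by (rule solves_on_subset[OF y(5)]) auto
      show "solves_on V (I \<inter> J) (\<lambda>t. z (t - x1))" by (rule solves_on_subset[OF zJ]) auto
    qed (use that x1 J z0 in \<open>auto simp: q_def\<close>)
    define w where "w = (\<lambda>t. if t \<in> I then y t else z (t - x1))"
    have w: "solves_on V (I \<union> J) w" unfolding w_def by (rule solves_on_glue[OF y(1) J(1) y(5) zJ agree])
    have wJ: "w t = z (t - x1)" if "t \<in> J" for t using agree that by (simp add: w_def)
    show "\<exists>I y. open I \<and> is_interval I \<and> 0 \<in> I \<and> {c-\<epsilon>'<..<c+\<epsilon>'} \<subseteq> I \<and> solves_on V I y \<and> y 0 = r' \<and>
        (\<forall>x. \<bar>x - c\<bar> < \<epsilon>' \<longrightarrow> cvec (y x) = G' (of_real x) (cvec r'))"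
    proof (intro exI[of _ "I \<union> J"] exI[of _ w] conjI allI impI)
      show "is_interval (I \<union> J)" by (rule is_interval_Un[OF y(2) J(2) x1 J(3)])
      show "{c - \<epsilon>'<..<c + \<epsilon>'} \<subseteq> I \<union> J" using \<epsilon>'(4) by (auto simp: J_def)
      show "w 0 = r'" using y(3,6) by (simp add: w_def)
      fix x assume "\<bar>x - c\<bar> < \<epsilon>'"
      then have "x \<in> J" "\<bar>x - x1\<bar> < \<rho>" using \<epsilon>'(4) by (auto simp: J_def)
      then show "cvec (w x) = G' (of_real x) (cvec r')"
        using z(2)[of "x - x1"] by (simp only: wJ G'_def cq X_def of_real_diff)
    qed (use y J w in auto)
  next
    fix U and t :: complex and k assume U: "norm (U - cvec r) < \<epsilon>'" and t: "norm (t - of_real c) < \<epsilon>'"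
    have "((\<lambda>s. cflow V (s - X) (G X U) $ k) has_field_derivative peval (\<lambda>k. cflow V (t - X) (G X U) $ k) (V k) * 1) (at t)"
      by (rule DERIV_chain2[where f = "\<lambda>t. cflow V t (G X U) $ k" and g = "\<lambda>s. s - X"])
        (rule Fl1[OF GR[OF U] tc[OF t]], auto intro!: derivative_eq_intros)
    then show "((\<lambda>t. G' t U $ k) has_field_derivative peval (\<lambda>k. G' t U $ k) (V k)) (at t)"
      by (simp add: G'_def)
  next
    have 1: "continuous_on (ball (of_real c) \<epsilon>' \<times> ball (cvec r) \<epsilon>') (\<lambda>p. G X (snd p))"
      by (rule continuous_on_compose2[OF contX]) (use \<epsilon>' in \<open>auto intro!: continuous_intros\<close>)
    have "continuous_on (ball (of_real c) \<epsilon>' \<times> ball (cvec r) \<epsilon>') (\<lambda>p. (\<lambda>(t, U). cflow V t U) (fst p - X, G X (snd p)))"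
    proof (rule continuous_on_compose2[OF Fl2])
      show "continuous_on (ball (of_real c) \<epsilon>' \<times> ball (cvec r) \<epsilon>') (\<lambda>p. (fst p - X, G X (snd p)))"
        by (intro continuous_intros 1)
      show "(\<lambda>p. (fst p - X, G X (snd p))) ` (ball (of_real c) \<epsilon>' \<times> ball (cvec r) \<epsilon>') \<subseteq> ball 0 \<rho> \<times> ball 0 R"
        using GR tc by (auto simp: dist_norm norm_minus_commute)
    qed
    then show "continuous_on (ball (of_real c) \<epsilon>' \<times> ball (cvec r) \<epsilon>') (\<lambda>(t, U). G' t U)"
      by (simp add: G'_def split_def)
  next
    fix S :: "complex set" and u and t :: complex and k
    assume S: "open S" "\<And>k. (\<lambda>s. u s $ k) holomorphic_on S" "\<And>s. s \<in> S \<Longrightarrow> norm (u s - cvec r) < \<epsilon>'"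
      and t: "norm (t - of_real c) < \<epsilon>'"
    show "(\<lambda>s. G' t (u s) $ k) holomorphic_on S"
      unfolding G'_def
    proof (rule Fl3[OF S(1)])
      show "(\<lambda>s. G X (u s) $ k) holomorphic_on S" for k
        by (rule D(5)[OF S(1,2)]) (use S(3) \<epsilon>' D(1) in \<open>auto simp: X_def intro: less_le_trans\<close>)
    qed (use S(3) GR tc[OF t] in auto)
  qed
  then show ?thesis by blast
qed

text \<open>
  The solution is bounded on the segment from \<open>0\<close> to \<open>x0\<close>, so one radius serves for all local flows
  along it and finitely many steps of equal length reach \<open>x0\<close>.
\<close>

theorem flow_rep_exists:
  assumes y: "solves_on V J y" and J: "is_interval J" "0 \<in> J" "x0 \<in> J"
  shows "\<exists>\<epsilon> G. flow_rep V x0 (y 0) \<epsilon> G"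
proof -
  define r where "r = y 0"
  have seg: "closed_segment 0 x0 \<subseteq> J"
    using J by (simp add: is_interval_convex_1 closed_segment_subset)
  have "bounded (y ` closed_segment 0 x0)"
    using solves_on_continuous[OF solves_on_subset[OF y seg]]
    by (auto intro!: compact_imp_bounded compact_continuous_image)
  then obtain B where B: "\<And>t. t \<in> closed_segment 0 x0 \<Longrightarrow> norm (y t) \<le> B"
    unfolding bounded_iff by auto
  define R where "R = max B 0 + 1"
  have R: "0 < R" "\<And>t. t \<in> closed_segment 0 x0 \<Longrightarrow> norm (y t) < R"
    using B by (fastforce simp: R_def)+
  obtain \<rho> where \<rho>: "0 < \<rho>" "\<And>U k. cflow V 0 U = U"
    "\<And>U t k. norm U < R \<Longrightarrow> norm t < \<rho> \<Longrightarrow>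
      ((\<lambda>t. cflow V t U $ k) has_field_derivative peval (\<lambda>k. cflow V t U $ k) (V k)) (at t)"
    "continuous_on (ball 0 \<rho> \<times> ball 0 R) (\<lambda>(t, U). cflow V t U)"
    "\<And>S u t k. open S \<Longrightarrow> (\<And>k. (\<lambda>s. u s $ k) holomorphic_on S) \<Longrightarrow>
      (\<And>s. s \<in> S \<Longrightarrow> norm (u s) < R) \<Longrightarrow> norm t < \<rho> \<Longrightarrow> (\<lambda>s. cflow V t (u s) $ k) holomorphic_on S"
    "\<And>r t k. norm (cvec r) < R \<Longrightarrow> \<bar>t\<bar> < \<rho> \<Longrightarrow> cflow V (of_real t) (cvec r) $ k \<in> \<real>"
    using local_flow[OF R(1), of V] by blast
  obtain N :: nat where N: "\<bar>x0\<bar> / \<rho> < real N" using reals_Archimedean2 by blast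
  have "0 \<le> \<bar>x0\<bar> / \<rho>" using \<rho>(1) by simp
  then have N0: "0 < real N" using N by linarith
  \<comment> \<open>The step length is smaller than the radius of the local flow.\<close>
  define h where "h = x0 / real N"
  have h: "\<bar>h\<bar> < \<rho>" using N N0 \<rho>(1) by (simp add: h_def field_simps)
  have in_seg: "real i * h \<in> closed_segment 0 x0" if "i \<le> N" for i
  proof -
    have "real i * h = (real i / real N) *\<^sub>R x0" by (simp add: h_def)
    then show ?thesis using that N0
      by (auto simp: in_segment intro!: exI[of _ "real i / real N"])
  qed
  have r: "norm r < R" using R(2)[of 0] by (simp add: r_def)
  have base: "\<exists>\<epsilon> G. flow_rep V 0 r \<epsilon> G"
  proof -
    define \<epsilon> where "\<epsilon> = min \<rho> (R - norm r)"
    have \<epsilon>: "0 < \<epsilon>" "\<epsilon> \<le> \<rho>" "\<epsilon> \<le> R - norm r" using \<rho> r by (auto simp: \<epsilon>_def)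
    have UR: "norm U < R" if "norm (U - cvec r) < \<epsilon>" for U
    proof -
      have "norm U \<le> norm (U - cvec r) + norm (cvec r)" using norm_triangle_ineq[of "U - cvec r" "cvec r"] by simp
      then show ?thesis using that \<epsilon>(3) by simp
    qed
    have "flow_rep V 0 r \<epsilon> (cflow V)"
    proof (rule flow_repI)
      fix r' assume "norm (r' - r) < \<epsilon>"
      then have "norm (cvec r' - cvec r) < \<epsilon>" by (simp only: cvec_diff norm_cvec)
      then have nq: "norm (cvec r') < R" by (rule UR)
      define z where "z = (\<lambda>t. \<chi> k. Re (cflow V (of_real t) (cvec r') $ k))"
      have z: "solves_on V {-\<rho><..<\<rho>} z" "\<And>t. \<bar>t\<bar> < \<rho> \<Longrightarrow> cvec (z t) = cflow V (of_real t) (cvec r')"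
        unfolding z_def by (rule cflow_real_solution[OF \<rho>(3)[OF nq] \<rho>(6)[OF nq]]; assumption)+
      have "cvec (z 0) = cvec r'" using z(2)[of 0] \<rho>(1,2) by simp
      then have z0: "z 0 = r'" by (simp add: vec_eq_iff)
      show "\<exists>I y. open I \<and> is_interval I \<and> 0 \<in> I \<and> {0-\<epsilon><..<0+\<epsilon>} \<subseteq> I \<and> solves_on V I y \<and> y 0 = r' \<and>
        (\<forall>x. \<bar>x - 0\<bar> < \<epsilon> \<longrightarrow> cvec (y x) = cflow V (of_real x) (cvec r'))"
        by (intro exI[of _ "{-\<rho><..<\<rho>}"] exI[of _ z])
          (use z(1) z(2) z0 \<rho>(1) \<epsilon> in \<open>auto simp: is_interval_oo\<close>)
    next
      show "continuous_on (ball (of_real 0) \<epsilon> \<times> ball (cvec r) \<epsilon>) (\<lambda>(t, U). cflow V t U)"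
        by (rule continuous_on_subset[OF \<rho>(4)])
          (use \<epsilon>(2) UR in \<open>auto simp: dist_norm norm_minus_commute\<close>)
    qed (use \<epsilon> UR \<rho>(3,5) in auto)
    then show ?thesis by blast
  qed
  have "\<exists>\<epsilon> G. flow_rep V (real i * h) r \<epsilon> G" if "i \<le> N" for i
    using that
  proof (induction i)
    case 0
    then show ?case using base by simp
  next
    case (Suc i)
    then obtain \<epsilon> G where rep: "flow_rep V (real i * h) r \<epsilon> G" by auto
    obtain I z where z: "is_interval I" "0 \<in> I" "{real i * h-\<epsilon><..<real i * h+\<epsilon>} \<subseteq> I" "solves_on V I z" "z 0 = r"
      "\<And>x. \<bar>x - real i * h\<bar> < \<epsilon> \<Longrightarrow> cvec (z x) = G (of_real x) (cvec r)"
      using flow_repD(2)[OF rep, of r] flow_repD(1)[OF rep] by auto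
    have iI: "real i * h \<in> I" using z(3) flow_repD(1)[OF rep] by auto
    have iJ: "real i * h \<in> J" using in_seg[of i] seg Suc.prems by auto
    have "z (real i * h) = y (real i * h)"
    proof (rule solves_on_unique[of "I \<inter> J" 0])
      show "is_interval (I \<inter> J)" using z(1) J(1) by (rule is_interval_Int)
      show "solves_on V (I \<inter> J) z" by (rule solves_on_subset[OF z(4)]) auto
      show "solves_on V (I \<inter> J) y" by (rule solves_on_subset[OF y]) auto
    qed (use z J iI iJ in \<open>auto simp: r_def\<close>)
    then have "G (of_real (real i * h)) (cvec r) = cvec (y (real i * h))"
      using z(6)[of "real i * h"] flow_repD(1)[OF rep] by simp
    then have "norm (G (of_real (real i * h)) (cvec r)) = norm (y (real i * h))" by (simp only: norm_cvec)
    then have nR: "norm (G (of_real (real i * h)) (cvec r)) < R"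
      using R(2)[OF in_seg[of i]] Suc.prems by simp
    have "\<bar>real (Suc i) * h - real i * h\<bar> < \<rho>" using h by (simp add: algebra_simps)
    show ?case
    proof (rule flow_rep_step[OF rep nR \<rho>(1)])
      show "\<bar>real (Suc i) * h - real i * h\<bar> < \<rho>" by fact
    qed (rule \<rho>; assumption)+
  qed
  from this[of N] show ?thesis using N0 by (simp add: h_def r_def)
qed

section \<open>The flow and its jets in one initial coordinate\<close>

text \<open>
  The times at which the maximal solution starting in \<open>r\<close> exists.
\<close>

definition flow_dom :: "('m::finite \<Rightarrow> 'm pexp) \<Rightarrow> real ^ 'm \<Rightarrow> real set" where
  "flow_dom V r = {x. \<exists>J y. is_interval J \<and> 0 \<in> J \<and> x \<in> J \<and> solves_on V J y \<and> y 0 = r}"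

definition flow :: "('m::finite \<Rightarrow> 'm pexp) \<Rightarrow> real ^ 'm \<Rightarrow> real \<Rightarrow> real ^ 'm" where
  "flow V r x = (SOME w. \<exists>J y. is_interval J \<and> 0 \<in> J \<and> x \<in> J \<and> solves_on V J y \<and> y 0 = r \<and> w = y x)"

lemma flow_eq:
  assumes "is_interval J" "0 \<in> J" "x \<in> J" "solves_on V J y" "y 0 = r"
  shows "flow V r x = y x"
proof -
  have "\<exists>J y. is_interval J \<and> 0 \<in> J \<and> x \<in> J \<and> solves_on V J y \<and> y 0 = r \<and> flow V r x = y x"
    unfolding flow_def by (rule someI_ex) (use assms in blast)
  then obtain I z where z: "is_interval I" "0 \<in> I" "x \<in> I" "solves_on V I z" "z 0 = r" "flow V r x = z x"
    by blast
  have "z x = y x"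
  proof (rule solves_on_unique[of "I \<inter> J" 0])
    show "is_interval (I \<inter> J)" using z(1) assms(1) by (rule is_interval_Int)
    show "solves_on V (I \<inter> J) z" by (rule solves_on_subset[OF z(4)]) auto
    show "solves_on V (I \<inter> J) y" by (rule solves_on_subset[OF assms(4)]) auto
  qed (use z assms in auto)
  then show ?thesis using z by simp
qed

lemma fdomI:
  assumes "is_interval J" "0 \<in> J" "x \<in> J" "solves_on V J y" "y 0 = r"
  shows "x \<in> flow_dom V r"
  using assms unfolding flow_dom_def by blast

lemma zero_in_flow_dom: "0 \<in> flow_dom V r"
proof (rule fdomI[where J = "{0}" and y = "\<lambda>_. r"])
  show "solves_on V {0} (\<lambda>_. r)"
    by (simp add: solves_on_def has_field_derivative_iff at_within_def)
qed (auto simp: is_interval_1)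

lemma flow_0 [simp]: "flow V r 0 = r"
proof (rule flow_eq[where J = "{0}"])
  show "solves_on V {0} (\<lambda>_. r)"
    by (simp add: solves_on_def has_field_derivative_iff at_within_def)
qed (auto simp: is_interval_1)

lemma flow_rep_flow_dom:
  assumes "x0 \<in> flow_dom V r"
  obtains \<epsilon> G where "flow_rep V x0 r \<epsilon> G"
proof -
  from assms obtain J y where y: "is_interval J" "0 \<in> J" "x0 \<in> J" "solves_on V J y" "y 0 = r"
    unfolding flow_dom_def by blast
  then show ?thesis using flow_rep_exists[of V J y x0] that by blast
qed

lemma flow_rep_flow:
  assumes rep: "flow_rep V x0 r \<epsilon> G" and r': "norm (r' - r) < \<epsilon>" and x: "\<bar>x - x0\<bar> < \<epsilon>"
  shows "x \<in> flow_dom V r' \<and> cvec (flow V r' x) = G (of_real x) (cvec r')"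
proof -
  obtain I z where z: "is_interval I" "0 \<in> I" "{x0-\<epsilon><..<x0+\<epsilon>} \<subseteq> I" "solves_on V I z" "z 0 = r'"
    "\<And>x. \<bar>x - x0\<bar> < \<epsilon> \<Longrightarrow> cvec (z x) = G (of_real x) (cvec r')"
    using flow_repD(2)[OF rep r'] by auto
  have xI: "x \<in> I" using z(3) x by (auto simp: subset_iff abs_less_iff)
  show ?thesis
    using fdomI[OF z(1,2) xI z(4,5)] flow_eq[OF z(1,2) xI z(4,5)] z(6)[OF x] by simp
qed

lemma open_flow_dom: "open {(x, r). x \<in> flow_dom V r}"
proof (subst open_subopen, intro ballI)
  fix p assume "p \<in> {(x, r). x \<in> flow_dom V r}"
  then obtain x0 r where p: "p = (x0, r)" "x0 \<in> flow_dom V r" by auto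
  obtain \<epsilon> G where rep: "flow_rep V x0 r \<epsilon> G" using flow_rep_flow_dom[OF p(2)] by blast
  note e = flow_repD(1)[OF rep] flow_rep_flow[OF rep]
  have "ball x0 \<epsilon> \<times> ball r \<epsilon> \<subseteq> {(x, r). x \<in> flow_dom V r}"
    using e(2) by (auto simp: dist_norm norm_minus_commute abs_minus_commute)
  moreover have "open (ball x0 \<epsilon> \<times> ball r \<epsilon>)" "p \<in> ball x0 \<epsilon> \<times> ball r \<epsilon>"
    using e(1) p by (auto intro: open_Times)
  ultimately show "\<exists>T. open T \<and> p \<in> T \<and> T \<subseteq> {(x, r). x \<in> flow_dom V r}" by blast
qed

lemma is_interval_flow_dom: "is_interval (flow_dom V r)"
proof -
  have "flow_dom V r = \<Union>{J. is_interval J \<and> 0 \<in> J \<and> (\<exists>y. solves_on V J y \<and> y 0 = r)}"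
    unfolding flow_dom_def by blast
  moreover have "connected \<dots>"
    by (rule connected_Union) (auto simp: is_interval_connected_1)
  ultimately show ?thesis by (simp add: is_interval_connected_1)
qed

subsection \<open>Higher derivatives depending on a parameter\<close>

lemma higher_deriv_cong_open:
  fixes f g :: "real \<Rightarrow> real"
  assumes "open S" "x \<in> S" "\<And>x. x \<in> S \<Longrightarrow> f x = g x"
  shows "(deriv ^^ l) f x = (deriv ^^ l) g x"
  using assms(2)
proof (induction l arbitrary: x)
  case (Suc l)
  have "\<forall>\<^sub>F y in nhds x. (deriv ^^ l) f y = (deriv ^^ l) g y"
    using eventually_nhds_in_open[OF assms(1) Suc.prems] by (rule eventually_mono) (rule Suc.IH)
  then show ?case by (auto intro: deriv_cong_ev)
qed (use assms in auto)

lemma real_complex_deriv: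
  fixes F :: "real \<Rightarrow> real" and g :: "complex \<Rightarrow> complex" and S :: "complex set"
  assumes g: "(g has_field_derivative D) (at (of_real x))"
    and S: "open S" "of_real x \<in> S" "\<And>x. of_real x \<in> S \<Longrightarrow> g (of_real x) = of_real (F x)"
  shows "D \<in> \<real>" "(F has_real_derivative Re D) (at x)"
proof -
  define T where "T = complex_of_real -` S"
  have T: "open T" "x \<in> T"
    unfolding T_def using S by (auto intro!: open_vimage continuous_intros)
  have v: "((\<lambda>x. g (of_real x)) has_vector_derivative D) (at x)"
    by (rule has_vector_derivative_real_field[OF g])
  have re: "((\<lambda>x. Re (g (of_real x))) has_vector_derivative Re D) (at x)"
    by (rule bounded_linear.has_vector_derivative[OF bounded_linear_Re v])
  have im: "((\<lambda>x. Im (g (of_real x))) has_vector_derivative Im D) (at x)"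
    by (rule bounded_linear.has_vector_derivative[OF bounded_linear_Im v])
  have "(F has_vector_derivative Re D) (at x)"
    by (rule has_vector_derivative_transform_within_open[OF re T]) (use S(3) in \<open>simp add: T_def\<close>)
  then show "(F has_real_derivative Re D) (at x)" by (simp add: has_real_derivative_iff_has_vector_derivative)
  have "((\<lambda>_. 0 :: real) has_vector_derivative Im D) (at x)"
    by (rule has_vector_derivative_transform_within_open[OF im T]) (use S(3) in \<open>simp add: T_def\<close>)
  then have "Im D = 0" by (metis has_vector_derivative_const vector_derivative_unique_at)
  then show "D \<in> \<real>" by (simp add: complex_is_Real_iff)
qed

text \<open>
  Higher derivatives of a real function are those of any holomorphic extension; this makes Cauchy's
  estimates available for real jets.
\<close>

lemma real_complex_higher_deriv:
  fixes f :: "real \<Rightarrow> real"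
  assumes "g holomorphic_on S" "open S" "\<And>x. of_real x \<in> S \<Longrightarrow> g (of_real x) = of_real (f x)" "of_real x \<in> S"
  shows "(deriv ^^ l) g (of_real x) = of_real ((deriv ^^ l) f x)"
  using assms(4)
proof (induction l arbitrary: x)
  case (Suc l)
  have "((deriv ^^ l) g has_field_derivative (deriv ^^ Suc l) g (of_real x)) (at (of_real x))"
    using holomorphic_derivI[OF holomorphic_higher_deriv[OF assms(1,2)] assms(2) Suc.prems] by simp
  from real_complex_deriv[OF this assms(2) Suc.prems Suc.IH]
  have "(deriv ^^ Suc l) g (of_real x) \<in> \<real>" "deriv ((deriv ^^ l) f) x = Re ((deriv ^^ Suc l) g (of_real x))"
    by (auto intro: DERIV_imp_deriv)
  then show ?case by (simp add: complex_is_Real_iff complex_eq_iff)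
qed (use assms(3) in auto)

text \<open>
  Cauchy's estimate for the difference of two functions.
\<close>

lemma higher_deriv_diff_bound:
  assumes "f holomorphic_on ball c \<rho>" "g holomorphic_on ball c \<rho>" "0 < \<rho>"
    and "\<And>w. w \<in> cball c (\<rho> / 2) \<Longrightarrow> norm (f w - g w) \<le> e"
  shows "norm ((deriv ^^ l) f c - (deriv ^^ l) g c) \<le> fact l * e / (\<rho> / 2) ^ l"
proof -
  have h: "(\<lambda>w. f w - g w) holomorphic_on ball c \<rho>" using assms by (intro holomorphic_intros)
  have "norm ((deriv ^^ l) (\<lambda>w. f w - g w) c) \<le> fact l * e / (\<rho> / 2) ^ l"
  proof (rule Cauchy_inequality)
    show "(\<lambda>w. f w - g w) holomorphic_on ball c (\<rho> / 2)"
      by (rule holomorphic_on_subset[OF h]) (use assms(3) in auto)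
    show "continuous_on (cball c (\<rho> / 2)) (\<lambda>w. f w - g w)"
      by (rule holomorphic_on_imp_continuous_on[OF holomorphic_on_subset[OF h]]) (use assms(3) in auto)
    show "0 < \<rho> / 2" using assms(3) by simp
    show "norm (f x - g x) \<le> e" if "norm (c - x) = \<rho> / 2" for x
      by (rule assms(4)) (use that in \<open>simp add: dist_norm\<close>)
  qed
  also have "(deriv ^^ l) (\<lambda>w. f w - g w) c = (deriv ^^ l) f c - (deriv ^^ l) g c"
    by (rule higher_deriv_diff[OF assms(1,2)]) (use assms(3) in auto)
  finally show ?thesis .
qed

text \<open>
  By compactness continuity in the parameter is uniform on a smaller disc, where Cauchy's estimate
  applies.
\<close>

lemma tendsto_higher_deriv_param:
  fixes H :: "'p::topological_space \<Rightarrow> complex \<Rightarrow> complex"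
  assumes \<rho>: "0 < \<rho>" and p0: "p0 \<in> A" and hol: "\<And>p. p \<in> A \<Longrightarrow> H p holomorphic_on ball c \<rho>"
    and cont: "continuous_on (A \<times> ball c \<rho>) (\<lambda>(p, w). H p w)"
  shows "((\<lambda>p. (deriv ^^ l) (H p) c) \<longlongrightarrow> (deriv ^^ l) (H p0) c) (at p0 within A)"
proof (rule tendstoI)
  fix e :: real assume e: "0 < e"
  define e' where "e' = e / 2 / fact l * (\<rho> / 2) ^ l"
  have e': "0 < e'" using e \<rho> by (simp add: e'_def)
  have "continuous_on (A \<times> cball c (\<rho> / 2)) (\<lambda>(p, w). H p w)"
    by (rule continuous_on_subset[OF cont]) (use \<rho> in auto)
  from continuous_on_prod_compactE[OF this compact_cball p0 e'] obtain X0 where X0: "p0 \<in> X0" "open X0"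
    "\<forall>p\<in>X0 \<inter> A. \<forall>w\<in>cball c (\<rho> / 2). dist (H p w) (H p0 w) \<le> e'"
    unfolding prod.case by blast
  have "\<forall>\<^sub>F p in at p0 within A. p \<in> X0 \<inter> A"
    using X0(1,2) eventually_at_topological by blast
  then show "\<forall>\<^sub>F p in at p0 within A. dist ((deriv ^^ l) (H p) c) ((deriv ^^ l) (H p0) c) < e"
  proof (rule eventually_mono)
    fix p assume p: "p \<in> X0 \<inter> A"
    have "norm ((deriv ^^ l) (H p) c - (deriv ^^ l) (H p0) c) \<le> fact l * e' / (\<rho> / 2) ^ l"
      by (rule higher_deriv_diff_bound[OF hol hol \<rho>]) (use p p0 X0(3) in \<open>auto simp: dist_norm[symmetric]\<close>)
    also have "\<dots> = e / 2" using \<rho> by (simp add: e'_def)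
    finally show "dist ((deriv ^^ l) (H p) c) ((deriv ^^ l) (H p0) c) < e" using e by (simp add: dist_norm)
  qed
qed

text \<open>
  Interchange of derivatives: the difference quotient in the parameter converges uniformly on a disc,
  hence so do its derivatives at the centre.
\<close>

lemma has_field_derivative_higher_deriv_param:
  assumes \<rho>: "0 < \<rho>" and T: "open T" "t0 \<in> T"
    and hol: "\<And>t. t \<in> T \<Longrightarrow> H t holomorphic_on ball c \<rho>" "H' t0 holomorphic_on ball c \<rho>"
    and der: "\<And>t w. t \<in> T \<Longrightarrow> w \<in> ball c \<rho> \<Longrightarrow> ((\<lambda>t. H t w) has_field_derivative H' t w) (at t)"
    and cont: "continuous_on (T \<times> ball c \<rho>) (\<lambda>(t, w). H' t w)"
  shows "((\<lambda>t. (deriv ^^ l) (H t) c) has_field_derivative (deriv ^^ l) (H' t0) c) (at (t0::complex))"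
  unfolding has_field_derivative_iff
proof (rule tendstoI)
  fix e :: real assume e: "0 < e"
  define e' where "e' = e / 2 / fact l * (\<rho> / 2) ^ l"
  have e': "0 < e'" using e \<rho> by (simp add: e'_def)
  have "continuous_on (T \<times> cball c (\<rho> / 2)) (\<lambda>(t, w). H' t w)"
    by (rule continuous_on_subset[OF cont]) (use \<rho> in auto)
  from continuous_on_prod_compactE[OF this compact_cball T(2) e'] obtain X0 where X0: "t0 \<in> X0" "open X0"
    "\<forall>p\<in>X0 \<inter> T. \<forall>w\<in>cball c (\<rho> / 2). dist (H' p w) (H' t0 w) \<le> e'"
    unfolding prod.case by blast
  have "open (X0 \<inter> T)" "t0 \<in> X0 \<inter> T" using X0 T by auto
  then obtain \<delta> where \<delta>: "0 < \<delta>" "ball t0 \<delta> \<subseteq> X0 \<inter> T" using open_contains_ball by blast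
  have "\<forall>\<^sub>F t in at t0. t \<in> ball t0 \<delta> - {t0}"
    using \<delta>(1) eventually_at_ball'[of \<delta> t0 UNIV] by (auto elim: eventually_mono)
  then show "\<forall>\<^sub>F t in at t0. dist (((deriv ^^ l) (H t) c - (deriv ^^ l) (H t0) c) / (t - t0)) ((deriv ^^ l) (H' t0) c) < e"
  proof (rule eventually_mono)
    fix t assume t: "t \<in> ball t0 \<delta> - {t0}"
    have tT: "t \<in> T" using t \<delta>(2) by auto
    let ?q = "\<lambda>w. inverse (t - t0) * (H t w - H t0 w)"
    have hd: "(\<lambda>w. H t w - H t0 w) holomorphic_on ball c \<rho>"
      using hol(1)[OF tT] hol(1)[OF T(2)] by (rule holomorphic_on_diff)
    have hq: "?q holomorphic_on ball c \<rho>" by (intro holomorphic_on_mult holomorphic_on_const hd)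
    have bound: "norm (?q w - H' t0 w) \<le> e'" if w: "w \<in> cball c (\<rho> / 2)" for w
    proof -
      have w': "w \<in> ball c \<rho>" using w \<rho> by auto
      have "norm ((H t w - H' t0 w * t) - (H t0 w - H' t0 w * t0)) \<le> e' * norm (t - t0)"
      proof (rule field_differentiable_bound[where S = "ball t0 \<delta>" and f = "\<lambda>s. H s w - H' t0 w * s" and f' = "\<lambda>s. H' s w - H' t0 w"])
        fix s assume s: "s \<in> ball t0 \<delta>"
        show "((\<lambda>s. H s w - H' t0 w * s) has_field_derivative H' s w - H' t0 w) (at s within ball t0 \<delta>)"
          using s \<delta>(2) w' by (auto intro!: derivative_eq_intros has_field_derivative_at_within[OF der])
        show "norm (H' s w - H' t0 w) \<le> e'"
          using X0(3) s \<delta>(2) w unfolding dist_norm[symmetric] by blast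
      qed (use t \<delta> in auto)
      moreover have "?q w - H' t0 w = inverse (t - t0) * ((H t w - H' t0 w * t) - (H t0 w - H' t0 w * t0))"
        using t by (simp add: field_simps)
      ultimately have "norm (?q w - H' t0 w) \<le> inverse (norm (t - t0)) * (e' * norm (t - t0))"
        by (simp only: norm_mult norm_inverse mult_left_mono inverse_nonnegative_iff_nonnegative norm_ge_zero)
      also have "\<dots> = e'" using t by (simp add: field_simps)
      finally show ?thesis .
    qed
    have "norm ((deriv ^^ l) ?q c - (deriv ^^ l) (H' t0) c) \<le> fact l * e' / (\<rho> / 2) ^ l"
      by (rule higher_deriv_diff_bound[OF hq hol(2) \<rho> bound])
    also have "\<dots> = e / 2" using \<rho> by (simp add: e'_def)
    also have "(deriv ^^ l) ?q c = inverse (t - t0) * (deriv ^^ l) (\<lambda>w. H t w - H t0 w) c"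
      by (rule higher_deriv_cmult[OF hd]) (use \<rho> in auto)
    also have "(deriv ^^ l) (\<lambda>w. H t w - H t0 w) c = (deriv ^^ l) (H t) c - (deriv ^^ l) (H t0) c"
      by (rule higher_deriv_diff[OF hol(1)[OF tT] hol(1)[OF T(2)]]) (use \<rho> in auto)
    finally show "dist (((deriv ^^ l) (H t) c - (deriv ^^ l) (H t0) c) / (t - t0)) ((deriv ^^ l) (H' t0) c) < e"
      using e by (simp add: dist_norm field_simps)
  qed
qed

subsection \<open>The jets solve the variational system\<close>

definition jet_shift :: "'m \<times> nat \<Rightarrow> ('m \<times> nat) pexp" where
  "jet_shift = (\<lambda>(k, l). Var (k, Suc l))"

text \<open>
  The time derivative of the \<open>l\<close>-th derivative of coordinate \<open>k\<close> with respect to an initial value, as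
  a polynomial in all such derivatives (the higher variational equations). Variable \<open>(k, l)\<close> stands
  for the \<open>l\<close>-th derivative of coordinate \<open>k\<close>.
\<close>

definition jet_field :: "('m \<Rightarrow> 'm pexp) \<Rightarrow> 'm \<Rightarrow> nat \<Rightarrow> ('m \<times> nat) pexp" where
  "jet_field V k l = (pderive jet_shift ^^ l) (psubst (\<lambda>k. Var (k, 0)) (V k))"

lemma higher_deriv_peval:
  assumes g: "\<And>k. g k holomorphic_on S" and S: "open S" and w: "w \<in> S"
  shows "(deriv ^^ l) (\<lambda>w. peval (\<lambda>k. g k w) p) w =
     peval (\<lambda>(k, i). (deriv ^^ i) (g k) w) ((pderive jet_shift ^^ l) (psubst (\<lambda>k. Var (k, 0)) p))"
  using w
proof (induction l arbitrary: w)
  case 0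
  then show ?case by (simp add: peval_psubst)
next
  case (Suc l)
  have peval: "\<forall>\<^sub>F z in nhds w. (deriv ^^ l) (\<lambda>w. peval (\<lambda>k. g k w) p) z =
     peval (\<lambda>(k, i). (deriv ^^ i) (g k) z) ((pderive jet_shift ^^ l) (psubst (\<lambda>k. Var (k, 0)) p))"
    using eventually_nhds_in_open[OF S Suc.prems] by (rule eventually_mono) (rule Suc.IH)
  have "((\<lambda>z. peval (\<lambda>(k, i). (deriv ^^ i) (g k) z) ((pderive jet_shift ^^ l) (psubst (\<lambda>k. Var (k, 0)) p)))
    has_field_derivative peval (\<lambda>(k, i). (deriv ^^ i) (g k) w) (pderive jet_shift ((pderive jet_shift ^^ l) (psubst (\<lambda>k. Var (k, 0)) p)))) (at w)"
  proof (rule has_field_derivative_peval)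
    fix x :: "'a \<times> nat"
    obtain k i where x: "x = (k, i)" by (cases x)
    have "((deriv ^^ i) (g k) has_field_derivative (deriv ^^ Suc i) (g k) w) (at w)"
      using holomorphic_derivI[OF holomorphic_higher_deriv[OF g S] S Suc.prems] by simp
    then show "((\<lambda>t. case x of (k, i) \<Rightarrow> (deriv ^^ i) (g k) t) has_field_derivative
      peval (\<lambda>(k, i). (deriv ^^ i) (g k) w) (jet_shift x)) (at w)"
      by (simp add: x jet_shift_def)
  qed
  then show ?case using deriv_cong_ev[OF peval refl] by (simp add: DERIV_imp_deriv)
qed

definition set_coord :: "real ^ 'm \<Rightarrow> 'm \<Rightarrow> real \<Rightarrow> real ^ 'm" where
  "set_coord r j z = (\<chi> i. if i = j then z else r $ i)"

definition set_ccoord :: "complex ^ 'm \<Rightarrow> 'm \<Rightarrow> complex \<Rightarrow> complex ^ 'm" where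
  "set_ccoord U j w = (\<chi> i. if i = j then w else U $ i)"

text \<open>
  Derivatives of the flow with respect to the \<open>j\<close>-th initial value, taken at \<open>r\<close>.
\<close>

definition jet :: "('m::finite \<Rightarrow> 'm pexp) \<Rightarrow> 'm \<Rightarrow> real \<Rightarrow> real ^ 'm \<Rightarrow> 'm \<times> nat \<Rightarrow> real" where
  "jet V j x r = (\<lambda>(k, l). (deriv ^^ l) (\<lambda>z. flow V (set_coord r j z) x $ k) (r $ j))"

lemma set_ccoord_of_real: "set_ccoord (cvec r) j (of_real z) = cvec (set_coord r j z)"
  by (simp add: set_ccoord_def set_coord_def vec_eq_iff)

lemma norm_set_ccoord: "norm (set_ccoord U j w - U) = norm (w - U $ j)"
proof -
  have "set_ccoord U j w - U = axis j (w - U $ j)" by (simp add: set_ccoord_def axis_def vec_eq_iff)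
  moreover have "(\<Sum>i\<in>UNIV. (norm (axis j (w - U $ j) $ i))\<^sup>2) = (\<Sum>i\<in>UNIV. if i = j then (norm (w - U $ j))\<^sup>2 else 0)"
    by (rule sum.cong) (auto simp: axis_def)
  ultimately show ?thesis by (simp add: norm_vec_def L2_set_def)
qed

text \<open>
  All three follow from a representation of the flow by complex times and initial values, since
  Cauchy's estimates turn properties of the flow on a disc in the \<open>j\<close>-th initial value into properties
  of the jets. Only perturbations of \<open>r\<close> that keep the \<open>j\<close>-th coordinate are considered, because the
  derivatives are taken at that coordinate.
\<close>

theorem jet_properties:
  fixes V :: "'m::finite \<Rightarrow> 'm pexp"
  assumes "x0 \<in> flow_dom V r"
  shows jet_tendsto: "((\<lambda>(x, r'). jet V j x r' k) \<longlongrightarrow> jet V j x0 r k) (at (x0, r) within {(x, r'). r' $ j = r $ j})"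
    and jet_deriv: "((\<lambda>x. jet V j x r (i, l)) has_real_derivative peval (jet V j x0 r) (jet_field V i l)) (at x0)"
    and jet_analytic: "\<exists>\<epsilon> h. 0 < \<epsilon> \<and> h holomorphic_on ball (complex_of_real x0) \<epsilon> \<and>
           (\<forall>x. \<bar>x - x0\<bar> < \<epsilon> \<longrightarrow> h (of_real x) = of_real (jet V j x r k))"
proof -
  obtain \<epsilon> G where rep: "flow_rep V x0 r \<epsilon> G" using flow_rep_flow_dom[OF assms] by blast
  note D = flow_repD(1)[OF rep] flow_rep_flow[OF rep] flow_repD(3-5)[OF rep]
  define \<rho> where "\<rho> = \<epsilon> / 2"
  have \<rho>: "0 < \<rho>" using D(1) by (simp add: \<rho>_def)
  define c where "c = complex_of_real (r $ j)"
  define H where "H k t U w = G t (set_ccoord U j w) $ k" for k t U w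
  define h where "h k l t U = (deriv ^^ l) (H k t U) c" for k l t U
  have near: "norm (set_ccoord U j w - cvec r) < \<epsilon>"
    if "norm (U - cvec r) < \<rho>" "U $ j = c" "w \<in> ball c \<rho>" for U w
  proof -
    have "norm (set_ccoord U j w - cvec r) \<le> norm (set_ccoord U j w - U) + norm (U - cvec r)"
      using norm_triangle_ineq[of "set_ccoord U j w - U" "U - cvec r"] by simp
    moreover have "norm (set_ccoord U j w - U) < \<rho>"
      using that(2,3) unfolding norm_set_ccoord by (simp add: dist_norm norm_minus_commute)
    ultimately show ?thesis using that(1) by (simp add: \<rho>_def)
  qed
  have cont: "continuous_on (ball (complex_of_real x0) \<rho> \<times> {U. norm (U - cvec r) < \<rho> \<and> U $ j = c} \<times> ball c \<rho>)
      (\<lambda>(t, U, w). H k t U w)" for k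
  proof -
    have 1: "continuous_on (ball (complex_of_real x0) \<rho> \<times> {U. norm (U - cvec r) < \<rho> \<and> U $ j = c} \<times> ball c \<rho>)
      (\<lambda>p. set_ccoord (fst (snd p)) j (snd (snd p)))"
    proof -
      have "continuous_on (ball (complex_of_real x0) \<rho> \<times> {U. norm (U - cvec r) < \<rho> \<and> U $ j = c} \<times> ball c \<rho>)
        (\<lambda>p. if i = j then snd (snd p) else fst (snd p) $ i)" for i
        by (cases "i = j") (auto intro!: continuous_intros)
      then show ?thesis unfolding set_ccoord_def by (rule continuous_on_vec_lambda)
    qed
      have img: "(\<lambda>p. (fst p, set_ccoord (fst (snd p)) j (snd (snd p)))) `
        (ball (complex_of_real x0) \<rho> \<times> {U. norm (U - cvec r) < \<rho> \<and> U $ j = c} \<times> ball c \<rho>) \<subseteq>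
         ball (complex_of_real x0) \<epsilon> \<times> ball (cvec r) \<epsilon>"
      proof (rule image_subsetI)
        fix p assume "p \<in> ball (complex_of_real x0) \<rho> \<times> {U. norm (U - cvec r) < \<rho> \<and> U $ j = c} \<times> ball c \<rho>"
        then obtain t U w where p: "p = (t, U, w)" and
          *: "t \<in> ball (complex_of_real x0) \<rho>" "norm (U - cvec r) < \<rho>" "U $ j = c" "w \<in> ball c \<rho>" by auto
        have "t \<in> ball (complex_of_real x0) \<epsilon>" using *(1) D(1) by (simp add: \<rho>_def)
        moreover have "set_ccoord U j w \<in> ball (cvec r) \<epsilon>"
          using near[OF *(2-4)] by (simp add: dist_norm norm_minus_commute)
        ultimately show "(fst p, set_ccoord (fst (snd p)) j (snd (snd p))) \<in> ball (complex_of_real x0) \<epsilon> \<times> ball (cvec r) \<epsilon>"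
          by (simp add: p)
      qed
    have "continuous_on (ball (complex_of_real x0) \<rho> \<times> {U. norm (U - cvec r) < \<rho> \<and> U $ j = c} \<times> ball c \<rho>)
      (\<lambda>p. (\<lambda>(t, U). G t U) (fst p, set_ccoord (fst (snd p)) j (snd (snd p))))"
      by (rule continuous_on_compose2[OF D(4) _ img]) (intro continuous_intros 1)
    then have "continuous_on (ball (complex_of_real x0) \<rho> \<times> {U. norm (U - cvec r) < \<rho> \<and> U $ j = c} \<times> ball c \<rho>)
      (\<lambda>p. G (fst p) (set_ccoord (fst (snd p)) j (snd (snd p))) $ k)"
      by (intro continuous_intros) simp
    then show ?thesis by (simp add: H_def split_def)
  qed
  have hol: "H k t U holomorphic_on ball c \<rho>"
    if "norm (t - of_real x0) < \<rho>" "norm (U - cvec r) < \<rho>" "U $ j = c" for k t U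
    unfolding H_def
  proof (rule D(5))
    show "(\<lambda>s. set_ccoord U j s $ k) holomorphic_on ball c \<rho>" for k
      by (cases "k = j") (auto simp: set_ccoord_def intro!: holomorphic_intros)
  qed (use that near \<rho> in \<open>auto simp: \<rho>_def\<close>)
  have real: "h k l (of_real x) (cvec r') = of_real (jet V j x r' (k, l))"
    if "\<bar>x - x0\<bar> < \<rho>" "norm (r' - r) < \<rho>" "r' $ j = r $ j" for k l x r'
  proof -
    have nr: "norm (cvec r' - cvec r) < \<rho>" using that(2) by (simp only: cvec_diff norm_cvec)
    have nx: "norm (complex_of_real x - of_real x0) < \<rho>"
      using that(1) by (simp only: of_real_diff[symmetric] norm_of_real)
    have "(deriv ^^ l) (H k (of_real x) (cvec r')) (of_real (r $ j)) =
       of_real ((deriv ^^ l) (\<lambda>z. flow V (set_coord r' j z) x $ k) (r $ j))"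
    proof (rule real_complex_higher_deriv[where S = "ball c \<rho>"])
      show "H k (of_real x) (cvec r') holomorphic_on ball c \<rho>"
        by (rule hol[OF nx nr]) (simp add: c_def that)
      fix z assume z: "complex_of_real z \<in> ball c \<rho>"
      have "norm (cvec (set_coord r' j z) - cvec r) < \<epsilon>"
        using near[OF nr _ z] that(3) by (simp add: set_ccoord_of_real c_def)
      then have "norm (set_coord r' j z - r) < \<epsilon>" by (simp only: cvec_diff norm_cvec)
      then have "cvec (flow V (set_coord r' j z) x) = G (of_real x) (cvec (set_coord r' j z))"
        using D(2) that(1) \<rho>_def \<rho> by auto
      then show "H k (of_real x) (cvec r') (of_real z) = of_real (flow V (set_coord r' j z) x $ k)"
        unfolding H_def set_ccoord_of_real by (metis vec_lambda_beta)
    qed (use \<rho> in \<open>auto simp: c_def\<close>)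
    then show ?thesis by (simp add: h_def c_def jet_def that(3))
  qed
  have hder: "((\<lambda>t. h k l t (cvec r)) has_field_derivative
     peval (\<lambda>(k, l). h k l t (cvec r)) (jet_field V k l)) (at t)" if "t \<in> ball (complex_of_real x0) \<rho>" for k l t
  proof -
    have t: "norm (t - of_real x0) < \<rho>" using that by (simp add: dist_norm norm_minus_commute)
    have cr: "norm (cvec r - cvec r) < \<rho>" "cvec r $ j = c" using \<rho> by (auto simp: c_def)
    have cH: "continuous_on (ball (complex_of_real x0) \<rho> \<times> ball c \<rho>) (\<lambda>p. H k (fst p) (cvec r) (snd p))" for k
    proof -
      have "continuous_on (ball (complex_of_real x0) \<rho> \<times> ball c \<rho>) (\<lambda>p. (\<lambda>(t, U, w). H k t U w) (fst p, cvec r, snd p))"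
        by (rule continuous_on_compose2[OF cont]) (use cr in \<open>auto intro!: continuous_intros\<close>)
      then show ?thesis by simp
    qed
    have "((\<lambda>t. (deriv ^^ l) (H k t (cvec r)) c) has_field_derivative
       (deriv ^^ l) (\<lambda>w. peval (\<lambda>i. H i t (cvec r) w) (V k)) c) (at t)"
    proof (rule has_field_derivative_higher_deriv_param[where T = "ball (complex_of_real x0) \<rho>" and \<rho> = \<rho> and H' = "\<lambda>t w. peval (\<lambda>i. H i t (cvec r) w) (V k)"])
      show "H k s (cvec r) holomorphic_on ball c \<rho>" if "s \<in> ball (complex_of_real x0) \<rho>" for s
        by (rule hol[OF _ cr]) (use that in \<open>simp add: dist_norm norm_minus_commute\<close>)
      show "(\<lambda>w. peval (\<lambda>i. H i t (cvec r) w) (V k)) holomorphic_on ball c \<rho>"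
        by (rule holomorphic_on_peval) (rule hol[OF t cr])
      show "((\<lambda>t. H k t (cvec r) w) has_field_derivative peval (\<lambda>i. H i s (cvec r) w) (V k)) (at s)"
        if "s \<in> ball (complex_of_real x0) \<rho>" "w \<in> ball c \<rho>" for s w
        unfolding H_def
        by (rule D(3)[OF near[OF cr that(2)]]) (use that(1) \<rho> in \<open>simp add: \<rho>_def dist_norm norm_minus_commute\<close>)
      show "continuous_on (ball (complex_of_real x0) \<rho> \<times> ball c \<rho>) (\<lambda>(t, w). peval (\<lambda>i. H i t (cvec r) w) (V k))"
        unfolding split_def by (rule continuous_on_peval) (rule cH)
    qed (use \<rho> that in auto)
    also have "(deriv ^^ l) (\<lambda>w. peval (\<lambda>i. H i t (cvec r) w) (V k)) c =
       peval (\<lambda>(k, i). (deriv ^^ i) (H k t (cvec r)) c) (jet_field V k l)"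
      unfolding jet_field_def
      by (rule higher_deriv_peval[where S = "ball c \<rho>"]) (use hol[OF t cr] \<rho> in auto)
    finally show ?thesis by (simp add: h_def)
  qed
  have h_real: "(\<lambda>(k, l). h k l (of_real x) (cvec r)) = (\<lambda>p. of_real (jet V j x r p))" if "\<bar>x - x0\<bar> < \<rho>" for x
    using real[OF that, of r] \<rho> by (auto simp: fun_eq_iff)
  show "((\<lambda>x. jet V j x r (i, l)) has_real_derivative peval (jet V j x0 r) (jet_field V i l)) (at x0)"
  proof -
    have "((\<lambda>t. h i l t (cvec r)) has_field_derivative of_real (peval (jet V j x0 r) (jet_field V i l))) (at (of_real x0))"
      using hder[of "of_real x0" i l] h_real[of x0] \<rho> by (simp add: peval_of_real)
    from real_complex_deriv(2)[OF this, of "ball (complex_of_real x0) \<rho>" "\<lambda>x. jet V j x r (i, l)"]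
    show ?thesis using real[of _ r] \<rho> by (auto simp: dist_norm norm_minus_commute of_real_diff[symmetric] simp del: of_real_diff)
  qed
  obtain k1 l1 where k: "k = (k1, l1)" by (cases k)
  show "\<exists>\<epsilon> h. 0 < \<epsilon> \<and> h holomorphic_on ball (complex_of_real x0) \<epsilon> \<and>
           (\<forall>x. \<bar>x - x0\<bar> < \<epsilon> \<longrightarrow> h (of_real x) = of_real (jet V j x r k))"
  proof (intro exI[of _ \<rho>] exI[of _ "\<lambda>t. h k1 l1 t (cvec r)"] conjI allI impI)
    show "(\<lambda>t. h k1 l1 t (cvec r)) holomorphic_on ball (complex_of_real x0) \<rho>"
      unfolding holomorphic_on_open[OF open_ball] using hder by blast
  qed (use \<rho> real[of _ r] k in auto)
  show "((\<lambda>(x, r'). jet V j x r' k) \<longlongrightarrow> jet V j x0 r k) (at (x0, r) within {(x, r'). r' $ j = r $ j})"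
  proof -
    define A where "A = {(x, r'). \<bar>x - x0\<bar> < \<rho> \<and> norm (r' - r) < \<rho> \<and> r' $ j = r $ j}"
    have mem: "(complex_of_real (fst p), cvec (snd p)) \<in> ball (complex_of_real x0) \<rho> \<times> {U. norm (U - cvec r) < \<rho> \<and> U $ j = c}"
      if "p \<in> A" for p
    proof -
      have "norm (cvec (snd p) - cvec r) < \<rho>"
        using that unfolding cvec_diff norm_cvec by (auto simp: A_def)
      then show ?thesis using that
        by (auto simp: A_def c_def dist_norm abs_minus_commute simp flip: of_real_diff)
    qed
    have lim: "((\<lambda>p. (deriv ^^ l1) (H k1 (of_real (fst p)) (cvec (snd p))) c) \<longlongrightarrow>
       (deriv ^^ l1) (H k1 (of_real (fst (x0, r))) (cvec (snd (x0, r)))) c) (at (x0, r) within A)"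
    proof (rule tendsto_higher_deriv_param[OF \<rho>])
      show "(x0, r) \<in> A" using \<rho> by (auto simp: A_def)
      show "H k1 (of_real (fst p)) (cvec (snd p)) holomorphic_on ball c \<rho>" if "p \<in> A" for p
        by (rule hol) (use mem[OF that] in \<open>auto simp: dist_norm norm_minus_commute\<close>)
      have "continuous_on (A \<times> ball c \<rho>) (\<lambda>q. (\<lambda>(t, U, w). H k1 t U w) (of_real (fst (fst q)), cvec (snd (fst q)), snd q))"
      proof (rule continuous_on_compose2[OF cont])
        show "continuous_on (A \<times> ball c \<rho>) (\<lambda>q. (complex_of_real (fst (fst q)), cvec (snd (fst q)), snd q))"
          by (intro continuous_intros continuous_on_vec_lambda)
        show "(\<lambda>q. (complex_of_real (fst (fst q)), cvec (snd (fst q)), snd q)) ` (A \<times> ball c \<rho>) \<subseteq>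
          ball (complex_of_real x0) \<rho> \<times> {U. norm (U - cvec r) < \<rho> \<and> U $ j = c} \<times> ball c \<rho>"
          using mem by auto
      qed
      then show "continuous_on (A \<times> ball c \<rho>) (\<lambda>(p, w). H k1 (of_real (fst p)) (cvec (snd p)) w)"
        by (simp add: split_def)
    qed
    have "((\<lambda>p. Re (h k1 l1 (of_real (fst p)) (cvec (snd p)))) \<longlongrightarrow> Re (h k1 l1 (of_real x0) (cvec r))) (at (x0, r) within A)"
      using tendsto_Re[OF lim] by (simp add: h_def)
    moreover have "\<forall>\<^sub>F p in at (x0, r) within A.
        Re (h k1 l1 (of_real (fst p)) (cvec (snd p))) = jet V j (fst p) (snd p) k"
      unfolding eventually_at_filter
      by (rule always_eventually) (auto simp: A_def k real)
    ultimately have "((\<lambda>p. jet V j (fst p) (snd p) k) \<longlongrightarrow> Re (h k1 l1 (of_real x0) (cvec r))) (at (x0, r) within A)"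
      by (rule Lim_transform_eventually)
    moreover have "at (x0, r) within A = at (x0, r) within {(x, r'). r' $ j = r $ j}"
      by (rule at_within_nhd[where S = "ball x0 \<rho> \<times> ball r \<rho>"])
        (use \<rho> in \<open>auto simp: A_def dist_norm norm_minus_commute abs_minus_commute intro: open_Times\<close>)
    moreover have "Re (h k1 l1 (of_real x0) (cvec r)) = jet V j x0 r k" using real[of x0 r] \<rho> k by simp
    ultimately show ?thesis by (simp add: split_def)
  qed
qed

section \<open>Null sets and meagre sets in coordinate spaces\<close>

abbreviation lebI :: "'i set \<Rightarrow> ('i \<Rightarrow> real) measure" where
  "lebI I \<equiv> PiM I (\<lambda>_. lborel)"

lemma space_lebI: "space (lebI I) = I \<rightarrow>\<^sub>E UNIV"
  by (simp add: space_PiM)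

lemma product_sigma_finite_lborel: "product_sigma_finite (\<lambda>_ :: 'i. lborel :: real measure)"
  by (simp add: product_sigma_finite_def lborel.sigma_finite_measure_axioms)

lemma powertop_real_box:
  assumes "openin (powertop_real I) W" "x \<in> W"
  obtains U where "\<And>i. i \<in> I \<Longrightarrow> open (U i)" "x \<in> Pi\<^sub>E I U" "Pi\<^sub>E I U \<subseteq> W"
proof -
  have "\<exists>U. finite {i \<in> I. U i \<noteq> topspace euclideanreal} \<and> (\<forall>i\<in>I. openin euclideanreal (U i)) \<and>
      x \<in> Pi\<^sub>E I U \<and> Pi\<^sub>E I U \<subseteq> W"
    by (rule bspec[OF iffD1[OF openin_product_topology_alt assms(1)] assms(2)])
  then obtain U where U: "\<forall>i\<in>I. openin euclideanreal (U i)" "x \<in> Pi\<^sub>E I U" "Pi\<^sub>E I U \<subseteq> W"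
    by (elim exE conjE)
  have "open (U i)" if "i \<in> I" for i using bspec[OF U(1) that] by (simp only: open_openin)
  then show ?thesis using U(2,3) by (rule that[of U])
qed

text \<open>
  An open set of a finite product is the countable union of the rational boxes that it contains.
\<close>

lemma openin_lebI_measurable:
  fixes W :: "('i \<Rightarrow> real) set"
  assumes I: "finite I" and W: "openin (powertop_real I) W"
  shows "W \<in> sets (lebI I)"
proof -
  define box where "box q = Pi\<^sub>E I (\<lambda>i. {fst (q i :: real \<times> real)<..<snd (q i)})" for q
  define Q where "Q = {q \<in> I \<rightarrow>\<^sub>E (\<rat> \<times> \<rat>). box q \<subseteq> W}"
  have "countable (I \<rightarrow>\<^sub>E ((\<rat> :: real set) \<times> (\<rat> :: real set)))"
    by (intro countable_PiE I countable_SIGMA countable_rat)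
  then have cQ: "countable Q" unfolding Q_def by (rule countable_subset[rotated]) auto
  have "W = (\<Union>q\<in>Q. box q)"
  proof (intro subset_antisym subsetI)
    fix x assume x: "x \<in> W"
    obtain U where U: "\<And>i. i \<in> I \<Longrightarrow> open (U i)" "x \<in> Pi\<^sub>E I U" "Pi\<^sub>E I U \<subseteq> W"
      using powertop_real_box[OF W x] by metis
    have "\<exists>p. fst p \<in> \<rat> \<and> snd p \<in> \<rat> \<and> fst p < x i \<and> x i < snd p \<and> {fst p<..<snd p} \<subseteq> U i" if "i \<in> I" for i
    proof -
      have "open (U i)" "x i \<in> U i" using U that by auto
      then obtain e where e: "e > 0" "ball (x i) e \<subseteq> U i" using open_contains_ball by blast
      obtain a where a: "a \<in> \<rat>" "x i - e < a" "a < x i" using Rats_dense_in_real[of "x i - e" "x i"] e by auto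
      obtain b where b: "b \<in> \<rat>" "x i < b" "b < x i + e" using Rats_dense_in_real[of "x i" "x i + e"] e by auto
      have "{a<..<b} \<subseteq> ball (x i) e" using a b by (auto simp: dist_real_def)
      then show ?thesis using a b e by (intro exI[of _ "(a, b)"]) auto
    qed
    then have "\<forall>i\<in>I. \<exists>p. fst p \<in> \<rat> \<and> snd p \<in> \<rat> \<and> fst p < x i \<and> x i < snd p \<and> {fst p<..<snd p} \<subseteq> U i" by blast
    from bchoice[OF this] obtain q0 where q0: "\<And>i. i \<in> I \<Longrightarrow> fst (q0 i) \<in> \<rat> \<and> snd (q0 i) \<in> \<rat> \<and> fst (q0 i) < x i \<and> x i < snd (q0 i) \<and>
      {fst (q0 i)<..<snd (q0 i)} \<subseteq> U i" by blast
    define q where "q = restrict q0 I"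
    have "box q \<subseteq> Pi\<^sub>E I U" unfolding box_def by (rule PiE_mono) (use q0 in \<open>auto simp: q_def\<close>)
    then have 1: "box q \<subseteq> W" using U(3) by (rule order_trans)
    have 2: "q \<in> I \<rightarrow>\<^sub>E (\<rat> \<times> \<rat>)" using q0 by (auto simp: q_def mem_Times_iff)
    have "q \<in> Q" unfolding Q_def using 1 2 by simp
    moreover have "x \<in> box q" using q0 U(2) by (auto simp: q_def box_def PiE_iff)
    ultimately show "x \<in> (\<Union>q\<in>Q. box q)" by auto
  qed (auto simp: Q_def)
  moreover have "box q \<in> sets (lebI I)" for q
    unfolding box_def by (rule sets_PiM_I_finite[OF I]) auto
  ultimately show ?thesis using cQ by (auto intro!: sets.countable_UN')
qed

lemma openin_lebI_not_null:
  fixes W :: "('i \<Rightarrow> real) set"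
  assumes I: "finite I" and W: "openin (powertop_real I) W" "W \<noteq> {}"
  shows "W \<notin> null_sets (lebI I)"
proof
  assume null: "W \<in> null_sets (lebI I)"
  interpret product_sigma_finite "\<lambda>_ :: 'i. lborel :: real measure" by (rule product_sigma_finite_lborel)
  obtain x where x: "x \<in> W" using W(2) by blast
  obtain U where U: "\<And>i. i \<in> I \<Longrightarrow> open (U i)" "x \<in> Pi\<^sub>E I U" "Pi\<^sub>E I U \<subseteq> W"
    using powertop_real_box[OF W(1) x] by metis
  have op: "open (U i)" "U i \<noteq> {}" if "i \<in> I" for i using U that by auto
  have pos: "emeasure lborel (U i) \<noteq> 0" if "i \<in> I" for i
  proof
    assume "emeasure lborel (U i) = 0"
    then have "U i \<in> null_sets lborel" using op[OF that] by (intro null_setsI) auto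
    then have "negligible (U i)" by (simp add: negligible_iff_null_sets null_sets_completionI)
    then show False using open_not_negligible op[OF that] by blast
  qed
  have "emeasure (lebI I) (Pi\<^sub>E I U) = (\<Prod>i\<in>I. emeasure lborel (U i))"
    by (rule emeasure_PiM[OF I]) (use op in auto)
  also have "\<dots> \<noteq> 0" using pos I by (simp add: prod_zero_iff)
  finally have "emeasure (lebI I) (Pi\<^sub>E I U) \<noteq> 0" .
  moreover have "emeasure (lebI I) (Pi\<^sub>E I U) \<le> emeasure (lebI I) W"
    by (rule emeasure_mono[OF U(3)]) (use null in auto)
  ultimately show False using null by (auto simp: null_sets_def)
qed

text \<open>
  Each exceptional set \<open>Z a\<close> is closed in the open set \<open>W a\<close> and null. An open set inside its closure
  would meet \<open>W a\<close> in an open null set, which is empty; so \<open>Z a\<close> is nowhere dense.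
\<close>

theorem generic_inI:
  assumes I: "finite I" and U: "openin (powertop_real I) U" "V \<subseteq> U"
    and A: "countable A" "U - V \<subseteq> (\<Union>a\<in>A. Z a)"
    and Z: "\<And>a. a \<in> A \<Longrightarrow> Z a \<subseteq> W a" "\<And>a. a \<in> A \<Longrightarrow> openin (powertop_real I) (W a)"
      "\<And>a. a \<in> A \<Longrightarrow> openin (powertop_real I) (W a - Z a)" "\<And>a. a \<in> A \<Longrightarrow> Z a \<in> null_sets (lebI I)"
  shows "generic_in I U V"
  unfolding generic_in_def
proof (intro conjI U)
  have "(\<Union>a\<in>A. Z a) \<in> null_sets (lebI I)" by (rule null_sets_UN'[OF A(1) Z(4)])
  then show "U - V \<in> null_sets (completion (lebI I))"
    using A(2) null_sets_completion_subset null_sets_completionI by blast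
  have "nowhere_dense_in (powertop_real I) (Z a \<inter> (U - V))" if a: "a \<in> A" for a
    unfolding nowhere_dense_in_def
  proof
    let ?X = "powertop_real I" and ?S = "Z a \<inter> (U - V)"
    show "?S \<subseteq> topspace ?X" using openin_subset[OF U(1)] by auto
    show "?X interior_of (?X closure_of ?S) = {}"
    proof (rule ccontr)
      let ?B = "?X interior_of (?X closure_of ?S)"
      assume ne: "?B \<noteq> {}"
      have "?B \<inter> ?X closure_of ?S \<noteq> {}" using interior_of_subset[of ?X "?X closure_of ?S"] ne by auto
      then have "?B \<inter> ?S \<noteq> {}" using openin_Int_closure_of_eq_empty[of ?X ?B ?S] by simp
      then have ne2: "?B \<inter> W a \<noteq> {}" using Z(1)[OF a] by auto
      have "(W a - Z a) \<inter> ?X closure_of ?S = {}"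
        using openin_Int_closure_of_eq_empty[OF Z(3)[OF a], of ?S] by auto
      then have "?B \<inter> W a \<subseteq> Z a" using interior_of_subset[of ?X "?X closure_of ?S"] by blast
      moreover have op: "openin ?X (?B \<inter> W a)" using Z(2)[OF a] by (intro openin_Int) auto
      ultimately have "?B \<inter> W a \<in> null_sets (lebI I)"
        using Z(4)[OF a] openin_lebI_measurable[OF I op] null_sets_subset by blast
      then show False using openin_lebI_not_null[OF I op ne2] by simp
    qed
  qed
  moreover have "U - V = \<Union>((\<lambda>a. Z a \<inter> (U - V)) ` A)" using A(2) by blast
  ultimately show "first_category_in (powertop_real I) (U - V)"
    unfolding first_category_in_def using A(1)
    by (intro exI[of _ "(\<lambda>a. Z a \<inter> (U - V)) ` A"]) auto
qed

text \<open>
  Fubini's theorem.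
\<close>

lemma null_by_lines:
  fixes A :: "('i \<Rightarrow> real) set"
  assumes "finite J" "i \<notin> J" "A \<in> sets (lebI (insert i J))"
    and ae: "AE v in lebI J. AE t in lborel. v(i := t) \<notin> A"
  shows "A \<in> null_sets (lebI (insert i J))"
proof -
  interpret product_sigma_finite "\<lambda>_ :: 'i. lborel :: real measure" by (rule product_sigma_finite_lborel)
  have "emeasure (lebI (insert i J)) A = (\<integral>\<^sup>+ v. indicator A v \<partial>lebI (insert i J))"
    using assms(3) by simp
  also have "\<dots> = (\<integral>\<^sup>+ v. (\<integral>\<^sup>+ t. indicator A (v(i := t)) \<partial>lborel) \<partial>lebI J)"
    by (rule product_nn_integral_insert[OF assms(1,2)]) (use assms(3) in auto)
  also have "\<dots> = (\<integral>\<^sup>+ v. 0 \<partial>lebI J)"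
  proof (rule nn_integral_cong_AE)
    show "AE v in lebI J. (\<integral>\<^sup>+ t. indicator A (v(i := t)) \<partial>lborel) = 0"
      using ae
    proof eventually_elim
      case (elim v)
      have "(\<integral>\<^sup>+ t. indicator A (v(i := t)) \<partial>lborel) = (\<integral>\<^sup>+ t. 0 \<partial>(lborel :: real measure))"
        by (rule nn_integral_cong_AE) (use elim in \<open>auto elim: eventually_mono\<close>)
      then show ?case by simp
    qed
  qed
  finally show ?thesis using assms(3) by (simp add: null_sets_def)
qed

definition over :: "'i set \<Rightarrow> ('i \<Rightarrow> real) \<Rightarrow> ('i \<Rightarrow> real) \<Rightarrow> 'i \<Rightarrow> real" where
  "over I v e = (\<lambda>x. if x \<in> I then v x else e x)"

lemma continuous_map_peval_over:
  "continuous_map (powertop_real I) euclideanreal (\<lambda>v. peval (over I v e) p)"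
proof (induction p)
  case (Var x)
  then show ?case by (cases "x \<in> I") (auto simp: over_def intro!: continuous_map_product_projection)
qed (auto intro!: continuous_intros continuous_map_real_mult)

lemma openin_peval_over:
  "openin (powertop_real I) {v \<in> I \<rightarrow>\<^sub>E UNIV. peval (over I v e) p \<noteq> 0}"
  using openin_continuous_map_preimage[OF continuous_map_peval_over[of I e p], of "- {0}"]
  by (simp add: open_Compl)

lemma measurable_peval_over: "(\<lambda>v. peval (over I v e) p) \<in> borel_measurable (lebI I)"
proof (induction p)
  case (Var x)
  then show ?case by (cases "x \<in> I") (auto simp: over_def)
qed auto

text \<open>
  By induction on the number of coordinates: where the polynomial is nonzero for one value of the last
  coordinate, it has finitely many zeros in that coordinate.
\<close>

theorem peval_zeros_null:
  assumes "finite I" "peval (over I v0 e) p \<noteq> 0"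
  shows "{v \<in> I \<rightarrow>\<^sub>E UNIV. peval (over I v e) p = 0} \<in> null_sets (lebI I)"
  using assms
proof (induction I arbitrary: e rule: finite_induct)
  case empty
  then show ?case by (simp add: over_def)
next
  case (insert i J)
  let ?Z = "{v \<in> insert i J \<rightarrow>\<^sub>E UNIV. peval (over (insert i J) v e) p = 0}"
  have Z: "?Z \<in> sets (lebI (insert i J))"
    using measurable_peval_over[of "insert i J" e p] unfolding space_lebI[symmetric] by measurable
  have "over (insert i J) v0 e = over J v0 (e(i := v0 i))"
    using insert.hyps by (auto simp: over_def)
  then have "{v \<in> J \<rightarrow>\<^sub>E UNIV. peval (over J v (e(i := v0 i))) p = 0} \<in> null_sets (lebI J)"
    using insert.IH insert.prems by simp
  then have "AE v in lebI J. v \<notin> {v \<in> J \<rightarrow>\<^sub>E UNIV. peval (over J v (e(i := v0 i))) p = 0}"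
    by (rule AE_not_in)
  moreover have "AE v in lebI J. v \<in> J \<rightarrow>\<^sub>E UNIV" by (rule AE_I2) (simp add: space_lebI)
  ultimately have "AE v in lebI J. AE t in lborel. v(i := t) \<notin> ?Z"
  proof eventually_elim
    case (elim v)
    obtain q where q: "\<And>t. poly q t = peval ((over J v e)(i := t)) p" by (rule peval_line_poly[of "over J v e" i p]) blast
    have eq: "(over J v e)(i := t) = over J v (e(i := t))" "over (insert i J) (v(i := t)) e = over J v (e(i := t))" for t
      using insert.hyps by (auto simp: over_def)
    have "poly q (v0 i) \<noteq> 0" using elim q[of "v0 i"] by (simp add: eq)
    then have "finite {t. poly q t = 0}" by (intro poly_roots_finite) auto
    then have "AE t in lborel. t \<notin> {t. poly q t = 0}"
      by (intro AE_not_in finite_imp_null_set_lborel)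
    then show ?case by (rule eventually_mono) (auto simp: q eq)
  qed
  with null_by_lines[OF insert.hyps Z] show ?case .
qed

section \<open>Systems as polynomial expressions in their coefficients\<close>

text \<open>
  The quantities on which the certificate along the flow depends: coefficients of the system, points
  \<open>z\<^sub>b\<close>, the other initial values, and the jets of the flow at the \<open>b\<close>-th point.
\<close>

datatype 'm cert_var = CoeffVar "'m \<times> 'm monomial" | PointVar nat | InitVar "'m option" | JetVar nat "'m \<times> nat"

definition mlist :: "nat \<Rightarrow> 'm::finite monomial list" where
  "mlist d = (SOME xs. set xs = {\<alpha>. monomial_degree \<alpha> \<le> d} \<and> distinct xs)"

definition vlist :: "'m::finite list" where
  "vlist = (SOME xs. set xs = UNIV \<and> distinct xs)"

lemma finite_monomials: "finite {\<alpha> :: 'm::finite monomial. monomial_degree \<alpha> \<le> d}"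
proof -
  have "{\<alpha> :: 'm monomial. monomial_degree \<alpha> \<le> d} \<subseteq> snd ` (coeff_index d :: ('m \<times> 'm monomial) set)"
    by (force simp: coeff_index_def)
  then show ?thesis using finite_coeff_index finite_surj by blast
qed

lemma mlist: "set (mlist d) = {\<alpha> :: 'm::finite monomial. monomial_degree \<alpha> \<le> d}" "distinct (mlist d :: 'm monomial list)"
  using someI_ex[OF finite_distinct_list[OF finite_monomials[where 'm = 'm and d = d]]] by (auto simp: mlist_def)

lemma vlist: "set (vlist :: 'm::finite list) = UNIV" "distinct (vlist :: 'm list)"
  using someI_ex[OF finite_distinct_list[OF finite_class.finite_UNIV[where 'a = 'm]]] by (auto simp: vlist_def)

definition monomial_pexp :: "('m::finite \<Rightarrow> 'x pexp) \<Rightarrow> 'm monomial \<Rightarrow> 'x pexp" where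
  "monomial_pexp y \<alpha> = pprod (map (\<lambda>v. ppow (y v) (Poly_Mapping.lookup \<alpha> v)) vlist)"

text \<open>
  The general polynomial vector field of degree \<open>d\<close> with coefficients \<open>C\<close> at the point \<open>y\<close>. Both are
  expressions: coefficients are numbers for a given system and variables when all systems are
  considered at once.
\<close>

definition general_field :: "nat \<Rightarrow> ('m \<times> 'm monomial \<Rightarrow> 'x pexp) \<Rightarrow> ('m::finite \<Rightarrow> 'x pexp) \<Rightarrow> 'm \<Rightarrow> 'x pexp" where
  "general_field d C y k = psum (map (\<lambda>\<alpha>. Mul (C (k, \<alpha>)) (monomial_pexp y \<alpha>)) (mlist d))"

lemma peval_general_field:
  "peval e (general_field d C y k) = (\<Sum>\<alpha> | monomial_degree \<alpha> \<le> d. peval e (C (k, \<alpha>)) * mon_val \<alpha> (\<lambda>v. peval e (y v)))"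
proof -
  have "peval e (monomial_pexp y \<alpha>) = mon_val \<alpha> (\<lambda>v. peval e (y v))" for \<alpha>
    by (subst mon_val_superset[of UNIV])
      (auto simp: monomial_pexp_def peval_pprod peval_ppow o_def prod.distinct_set_conv_list[OF vlist(2), unfolded vlist(1)])
  then show ?thesis
    by (simp add: general_field_def peval_psum o_def sum.distinct_set_conv_list[OF mlist(2), unfolded mlist(1)])
qed

lemma psubst_psum: "psubst s (psum ps) = psum (map (psubst s) ps)"
  by (induction ps) (auto simp: psum_def)

lemma psubst_pprod: "psubst s (pprod ps) = pprod (map (psubst s) ps)"
  by (induction ps) (auto simp: pprod_def)

lemma psubst_general_field: "psubst s (general_field d C y k) = general_field d (\<lambda>a. psubst s (C a)) (\<lambda>v. psubst s (y v)) k"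
  by (simp add: general_field_def monomial_pexp_def psubst_psum psubst_pprod ppow_def o_def)

lemma pvars_general_field: "pvars (general_field d C y k) \<subseteq> (\<Union>a. pvars (C a)) \<union> (\<Union>v. pvars (y v))"
proof -
  have "pvars (ppow (y v) n) \<subseteq> (\<Union>v. pvars (y v))" for v n using pvars_ppow[of "y v" n] by blast
  then have "pvars (monomial_pexp y \<alpha>) \<subseteq> (\<Union>v. pvars (y v))" for \<alpha>
    unfolding monomial_pexp_def pvars_pprod by auto
  then show ?thesis unfolding general_field_def pvars_psum by fastforce
qed

definition field_of :: "nat \<Rightarrow> ('m \<times> 'm monomial \<Rightarrow> real) \<Rightarrow> 'm::finite \<Rightarrow> 'm pexp" where
  "field_of d c = general_field d (\<lambda>a. Const (if a \<in> coeff_index d then c a else 0)) Var"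

lemma peval_field_of:
  assumes "P \<in> systems d"
  shows "peval (\<lambda>k. y $ k) (field_of d (system_coeffs d P) k) = vector_field P y $ k"
proof -
  have "peval (\<lambda>k. y $ k) (field_of d (system_coeffs d P) k) =
     (\<Sum>\<alpha> | monomial_degree \<alpha> \<le> d. Poly_Mapping.lookup (P k) \<alpha> * mon_val \<alpha> (\<lambda>v. y $ v))"
    unfolding field_of_def peval_general_field by (rule sum.cong) (auto simp: system_coeffs_def coeff_index_def)
  also have "\<dots> = (\<Sum>\<alpha>\<in>Poly_Mapping.keys (P k). Poly_Mapping.lookup (P k) \<alpha> * mon_val \<alpha> (\<lambda>v. y $ v))"
    by (rule sum.mono_neutral_right[OF finite_monomials])
      (use assms in \<open>auto simp: systems_def degree_at_most_def Poly_Mapping.in_keys_iff\<close>)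
  finally show ?thesis by (simp add: vector_field_def mpoly_eval_def mon_val_def)
qed

lemma has_vector_derivative_components:
  fixes y :: "real \<Rightarrow> real ^ 'm"
  shows "(y has_vector_derivative D) (at t within J) \<longleftrightarrow>
    (\<forall>k. ((\<lambda>s. y s $ k) has_real_derivative D $ k) (at t within J))"
proof
  assume "(y has_vector_derivative D) (at t within J)"
  then show "\<forall>k. ((\<lambda>s. y s $ k) has_real_derivative D $ k) (at t within J)"
    using bounded_linear.has_vector_derivative[OF bounded_linear_vec_nth]
    by (auto simp: has_real_derivative_iff_has_vector_derivative)
next
  assume *: "\<forall>k. ((\<lambda>s. y s $ k) has_real_derivative D $ k) (at t within J)"
  have "((\<lambda>x. y x \<bullet> i) has_derivative (\<lambda>x. (x *\<^sub>R D) \<bullet> i)) (at t within J)" if "i \<in> Basis" for i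
  proof -
    obtain k where k: "i = axis k 1" using \<open>i \<in> Basis\<close> by (auto simp: Basis_vec_def)
    have "((\<lambda>s. y s $ k) has_derivative (\<lambda>x. x * D $ k)) (at t within J)"
      using * by (simp add: has_field_derivative_def mult.commute[of _ "D $ k"])
    then show ?thesis by (simp add: k inner_axis)
  qed
  then show "(y has_vector_derivative D) (at t within J)"
    unfolding has_vector_derivative_def by (subst has_derivative_componentwise_within) blast
qed

lemma solves_ivp_iff_solves_on:
  assumes "P \<in> systems d"
  shows "solves_ivp P r J y \<longleftrightarrow> is_interval J \<and> 0 \<in> J \<and> y 0 = r \<and> solves_on (field_of d (system_coeffs d P)) J y"
  unfolding solves_ivp_def solves_on_def has_vector_derivative_components peval_field_of[OF assms] ..

lemma solves_on_flow_dom: "solves_on V (flow_dom V r) (flow V r)"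
  unfolding solves_on_def
proof (intro ballI allI)
  fix t k assume t: "t \<in> flow_dom V r"
  obtain \<epsilon> G where rep: "flow_rep V t r \<epsilon> G" using flow_rep_flow_dom[OF t] by blast
  obtain I y where y: "open I" "is_interval I" "0 \<in> I" "{t-\<epsilon><..<t+\<epsilon>} \<subseteq> I" "solves_on V I y" "y 0 = r"
    using flow_repD(2)[OF rep, of r] flow_repD(1)[OF rep] by auto
  have tI: "t \<in> I" using y(4) flow_repD(1)[OF rep] by auto
  have eq: "flow V r s = y s" if "s \<in> I" for s by (rule flow_eq[OF y(2,3) that y(5,6)])
  have "((\<lambda>s. y s $ k) has_real_derivative peval (\<lambda>k. y t $ k) (V k)) (at t)"
    using y(5) tI at_within_open[OF tI y(1)] unfolding solves_on_def by metis
  then have "((\<lambda>s. flow V r s $ k) has_real_derivative peval (\<lambda>k. y t $ k) (V k)) (at t)"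
    by (rule has_field_derivative_transform_within_open[where S = I]) (use y(1) tI eq in auto)
  then show "((\<lambda>s. flow V r s $ k) has_real_derivative peval (\<lambda>k. flow V r t $ k) (V k)) (at t within flow_dom V r)"
    using eq[OF tI] by (simp add: has_field_derivative_at_within)
qed

text \<open>
  Here and in the next lemma the interval and the solution of the theorem are identified with the
  domain and the flow of the expressions.
\<close>

lemma max_interval_eq:
  assumes "P \<in> systems d" shows "max_interval P r = flow_dom (field_of d (system_coeffs d P)) r"
  unfolding max_interval_def flow_dom_def solves_ivp_iff_solves_on[OF assms] by blast

lemma solution_eq:
  assumes "P \<in> systems d" "x \<in> max_interval P r"
  shows "solution P r x = flow (field_of d (system_coeffs d P)) r x"
proof -
  let ?V = "field_of d (system_coeffs d P)"
  have "solves_ivp P r (max_interval P r) (flow ?V r)"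
    unfolding solves_ivp_iff_solves_on[OF assms(1)] max_interval_eq[OF assms(1)]
    using is_interval_flow_dom zero_in_flow_dom solves_on_flow_dom flow_0 by blast
  then have "solves_ivp P r (max_interval P r) (solution P r)"
    unfolding solution_def by (rule someI[where P = "solves_ivp P r (max_interval P r)"])
  then have "is_interval (max_interval P r)" "0 \<in> max_interval P r" "solves_on ?V (max_interval P r) (solution P r)"
    "solution P r 0 = r"
    unfolding solves_ivp_iff_solves_on[OF assms(1)] by auto
  then show ?thesis using flow_eq[OF _ _ assms(2)] by metis
qed

section \<open>Certificates along the flow\<close>

definition field_univ :: "nat \<Rightarrow> nat \<Rightarrow> 'm::finite \<Rightarrow> 'm cert_var pexp" where
  "field_univ d b = general_field d (\<lambda>a. if a \<in> coeff_index d then Var (CoeffVar a) else Const 0) (\<lambda>k. Var (JetVar b (k, 0)))"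

definition shift_univ :: "'m cert_var \<Rightarrow> 'm cert_var pexp" where
  "shift_univ x = (case x of JetVar b (k, l) \<Rightarrow> Var (JetVar b (k, Suc l)) | _ \<Rightarrow> Const 0)"

text \<open>
  The variational equations with the coefficients of the system as variables;
  \<open>specialize\<close> inserts the numbers.
\<close>

definition jet_field_univ :: "nat \<Rightarrow> nat \<Rightarrow> 'm::finite \<Rightarrow> nat \<Rightarrow> 'm cert_var pexp" where
  "jet_field_univ d b k l = (pderive shift_univ ^^ l) (field_univ d b k)"

definition specialize :: "('m \<times> 'm monomial \<Rightarrow> real) \<Rightarrow> 'm cert_var \<Rightarrow> ('m \<times> nat) pexp" where
  "specialize c x = (case x of CoeffVar a \<Rightarrow> Const (c a) | JetVar b p \<Rightarrow> Var p | _ \<Rightarrow> Const 0)"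

lemma psubst_pderive: "(\<And>x. psubst s (\<sigma> x) = pderive \<sigma>' (s x)) \<Longrightarrow> psubst s (pderive \<sigma> p) = pderive \<sigma>' (psubst s p)"
  by (induction p) auto

lemma jet_field_field_of: "jet_field (field_of d c) k l = psubst (specialize c) (jet_field_univ d b k l)"
proof (induction l)
  case 0
  have "psubst (specialize c) (if a \<in> coeff_index d then Var (CoeffVar a) else Const 0) = Const (if a \<in> coeff_index d then c a else 0)" for a
    by (simp add: specialize_def)
  then show ?case by (simp add: jet_field_def jet_field_univ_def field_of_def field_univ_def psubst_general_field) (simp add: specialize_def)
next
  case (Suc l)
  have "psubst (specialize c) (shift_univ x) = pderive jet_shift (specialize c x)" for x :: "'a cert_var"
    by (auto simp: shift_univ_def specialize_def jet_shift_def split: cert_var.splits prod.splits)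
  from psubst_pderive[of "specialize c" shift_univ jet_shift, OF this] Suc show ?case by (simp add: jet_field_def jet_field_univ_def)
qed

lemma pvars_pderive_closed:
  assumes "pvars p \<subseteq> S" "\<And>x. x \<in> S \<Longrightarrow> pvars (\<sigma> x) \<subseteq> S"
  shows "pvars (pderive \<sigma> p) \<subseteq> S"
  using assms by (induction p) auto

lemma pvars_jet_field_univ: "pvars (jet_field_univ d b k l) \<subseteq> CoeffVar ` coeff_index d \<union> range (JetVar b)"
proof (induction l)
  case 0
  show ?case unfolding jet_field_univ_def field_univ_def
    by (simp, rule order_trans[OF pvars_general_field]) (auto split: if_splits)
next
  case (Suc l)
  have "pvars (shift_univ x :: 'a cert_var pexp) \<subseteq> CoeffVar ` coeff_index d \<union> range (JetVar b)" if "x \<in> CoeffVar ` coeff_index d \<union> range (JetVar b)" for x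
    using that by (auto simp: shift_univ_def)
  from pvars_pderive_closed[OF Suc this] show ?case by (simp add: jet_field_univ_def)
qed

definition time_deriv :: "nat \<Rightarrow> 'm::finite cert_var \<Rightarrow> 'm cert_var pexp" where
  "time_deriv d x = (case x of JetVar b (k, l) \<Rightarrow> jet_field_univ d b k l | _ \<Rightarrow> Const 0)"

text \<open>
  The certificate for coordinate \<open>i\<close> of the flow.
\<close>

definition cert_flow :: "'m \<Rightarrow> nat \<Rightarrow> 'm cert_var pexp" where
  "cert_flow i s = psubst (\<lambda>(b, v). case v of 0 \<Rightarrow> Var (PointVar b) | Suc l \<Rightarrow> Var (JetVar b (i, l))) (dae_cert s)"

text \<open>
  Its \<open>q\<close>-th derivative with respect to time.
\<close>

definition cert_flow_deriv :: "nat \<Rightarrow> 'm::finite \<Rightarrow> nat \<Rightarrow> nat \<Rightarrow> 'm cert_var pexp" where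
  "cert_flow_deriv d i s q = (pderive (time_deriv d) ^^ q) (cert_flow i s)"

definition flow_vars :: "nat \<Rightarrow> nat \<Rightarrow> 'm::finite cert_var set" where
  "flow_vars d N = {x. case x of CoeffVar a \<Rightarrow> a \<in> coeff_index d | PointVar b \<Rightarrow> b < N | InitVar a \<Rightarrow> False | JetVar b p \<Rightarrow> b < N}"

lemma pvars_cert_flow_deriv: "pvars (cert_flow_deriv d i s q) \<subseteq> flow_vars d (npts s)"
proof (induction q)
  case 0
  show ?case using pvars_dae_cert[of _ s]
    by (fastforce simp: cert_flow_deriv_def cert_flow_def pvars_psubst flow_vars_def split: nat.splits)
next
  case (Suc q)
  have "pvars (time_deriv d x) \<subseteq> flow_vars d (npts s)" if "x \<in> flow_vars d (npts s)" for x :: "'a cert_var"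
  proof (cases x)
    case (JetVar b p)
    then show ?thesis using that pvars_jet_field_univ[of d b "fst p" "snd p"]
      by (auto simp: time_deriv_def flow_vars_def split: prod.splits)
  qed (auto simp: time_deriv_def)
  from pvars_pderive_closed[OF Suc this] show ?case by (simp add: cert_flow_deriv_def)
qed

definition flow_env :: "nat \<Rightarrow> ('m \<times> 'm monomial \<Rightarrow> real) \<Rightarrow> 'm::finite \<Rightarrow> ('m option \<Rightarrow> real) \<Rightarrow> (nat \<Rightarrow> real) \<Rightarrow> real \<Rightarrow> 'm cert_var \<Rightarrow> real" where
  "flow_env d c j v z x y = (case y of CoeffVar a \<Rightarrow> c a | PointVar b \<Rightarrow> z b | InitVar a \<Rightarrow> v a |
     JetVar b p \<Rightarrow> jet (field_of d c) j x (initial_value j v (z b)) p)"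

text \<open>
  At time \<open>0\<close> the flow is the identity, so the jets of coordinate \<open>j\<close> are those of \<open>z\<close> and all other
  coordinates are constant in \<open>z\<close>.
\<close>

definition at_time_0 :: "'m \<Rightarrow> 'm cert_var \<Rightarrow> 'm cert_var pexp" where
  "at_time_0 j x = (case x of JetVar b (k, l) \<Rightarrow>
       (if l = 0 then (if k = j then Var (PointVar b) else Var (InitVar (Some k)))
        else if l = 1 \<and> k = j then Const 1 else Const 0)
     | CoeffVar a \<Rightarrow> Var (CoeffVar a) | PointVar b \<Rightarrow> Var (PointVar b) | InitVar a \<Rightarrow> Const 0)"

text \<open>
  The Taylor coefficients at time \<open>0\<close> of the certificate along the flow, up to factorials. Unlike the
  certificate at other times they are polynomials in the data.
\<close>

definition cert_coeff :: "nat \<Rightarrow> 'm::finite \<Rightarrow> 'm \<Rightarrow> nat \<Rightarrow> nat \<Rightarrow> 'm cert_var pexp" where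
  "cert_coeff d i j s q = psubst (at_time_0 j) (cert_flow_deriv d i s q)"

definition param_env :: "('m \<times> 'm monomial \<Rightarrow> real) \<Rightarrow> ('m option \<Rightarrow> real) \<Rightarrow> (nat \<Rightarrow> real) \<Rightarrow> 'm cert_var \<Rightarrow> real" where
  "param_env c v z y = (case y of CoeffVar a \<Rightarrow> c a | PointVar b \<Rightarrow> z b | InitVar a \<Rightarrow> v a | JetVar b p \<Rightarrow> 0)"

definition param_vars :: "nat \<Rightarrow> nat \<Rightarrow> 'm::finite \<Rightarrow> 'm cert_var set" where
  "param_vars d N j = {x. case x of CoeffVar a \<Rightarrow> a \<in> coeff_index d | PointVar b \<Rightarrow> b < N | InitVar a \<Rightarrow> a \<in> Some ` (- {j}) | JetVar b p \<Rightarrow> False}"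

lemma pvars_cert_coeff: "pvars (cert_coeff d i j s q) \<subseteq> param_vars d (npts s) j"
proof -
  have "pvars (at_time_0 j x) \<subseteq> param_vars d (npts s) j" if "x \<in> flow_vars d (npts s)" for x
  proof (cases x)
    case (JetVar b p)
    then show ?thesis using that by (cases p) (simp add: at_time_0_def param_vars_def flow_vars_def)
  qed (use that in \<open>auto simp: at_time_0_def param_vars_def flow_vars_def\<close>)
  then show ?thesis unfolding cert_coeff_def pvars_psubst using pvars_cert_flow_deriv[of d i s q] by blast
qed

lemma set_coord_initial_value: "set_coord (initial_value j v a) j z = initial_value j v z"
  by (simp add: set_coord_def initial_value_def vec_eq_iff)

lemma higher_deriv_id_real: "(deriv ^^ l) (\<lambda>z :: real. z) a = (if l = 0 then a else if l = 1 then 1 else 0)"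
proof -
  have 1: "deriv (\<lambda>z :: real. z) = (\<lambda>_. 1)" by (simp add: fun_eq_iff)
  have 2: "(deriv ^^ l) (\<lambda>_ :: real. c :: real) = (\<lambda>_. if l = 0 then c else 0)" for l c
    by (induction l) (auto simp: fun_eq_iff)
  show ?thesis
  proof (cases l)
    case (Suc n)
    then show ?thesis using 1 2[of n 1] by (simp add: funpow_swap1 fun_eq_iff)
  qed simp
qed

lemma higher_deriv_const_real: "(deriv ^^ l) (\<lambda>_ :: real. c :: real) a = (if l = 0 then c else 0)"
proof -
  have "(deriv ^^ l) (\<lambda>_ :: real. c :: real) = (\<lambda>_. if l = 0 then c else 0)"
    by (induction l) (auto simp: fun_eq_iff)
  then show ?thesis by simp
qed

lemma peval_cert_coeff: "peval (param_env c v z) (cert_coeff d i j s q) = peval (flow_env d c j v z 0) (cert_flow_deriv d i s q)"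
  unfolding cert_coeff_def peval_psubst
proof (rule peval_cong)
  fix x assume "x \<in> pvars (cert_flow_deriv d i s q)"
  then have x: "x \<in> flow_vars d (npts s)" using pvars_cert_flow_deriv by blast
  show "peval (param_env c v z) (at_time_0 j x) = flow_env d c j v z 0 x"
  proof (cases x)
    case (JetVar b p)
    obtain k l where p: "p = (k, l)" by (cases p)
    have "jet (field_of d c) j 0 (initial_value j v (z b)) (k, l) =
      (deriv ^^ l) (\<lambda>t. if k = j then t else v (Some k)) (z b)"
      by (simp add: jet_def set_coord_initial_value) (simp add: initial_value_def)
    also have "\<dots> = (if k = j then if l = 0 then z b else if l = 1 then 1 else 0 else if l = 0 then v (Some k) else 0)"
      by (cases "k = j") (simp_all add: higher_deriv_id_real higher_deriv_const_real)
    finally show ?thesis by (simp add: JetVar p at_time_0_def flow_env_def param_env_def)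
  qed (use x in \<open>auto simp: at_time_0_def flow_env_def param_env_def flow_vars_def\<close>)
qed

definition flow_dom_all :: "nat \<Rightarrow> ('m \<times> 'm monomial \<Rightarrow> real) \<Rightarrow> 'm::finite \<Rightarrow> ('m option \<Rightarrow> real) \<Rightarrow> (nat \<Rightarrow> real) \<Rightarrow> nat \<Rightarrow> real set" where
  "flow_dom_all d c j v z N = (\<Inter>b\<in>{..<N}. flow_dom (field_of d c) (initial_value j v (z b)))"

lemma open_flow_dom_slice: "open (flow_dom V r)"
proof -
  have "open ((\<lambda>x. (x, r)) -` {(x, r). x \<in> flow_dom V r})"
    by (rule open_vimage[OF open_flow_dom]) (intro continuous_intros)
  moreover have "(\<lambda>x. (x, r)) -` {(x, r). x \<in> flow_dom V r} = flow_dom V r" by auto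
  ultimately show ?thesis by (simp only:)
qed

lemma flow_dom_all: "open (flow_dom_all d c j v z N)" "is_interval (flow_dom_all d c j v z N)" "0 \<in> flow_dom_all d c j v z N"
proof -
  show "open (flow_dom_all d c j v z N)" unfolding flow_dom_all_def
    by (rule open_INT) (auto intro: open_flow_dom_slice)
  show "is_interval (flow_dom_all d c j v z N)" unfolding flow_dom_all_def
    unfolding is_interval_1
  proof (intro ballI allI impI INT_I)
    fix x y t b
    assume *: "x \<in> (\<Inter>b\<in>{..<N}. flow_dom (field_of d c) (initial_value j v (z b)))"
      "y \<in> (\<Inter>b\<in>{..<N}. flow_dom (field_of d c) (initial_value j v (z b)))" "x \<le> t \<and> t \<le> y" "b \<in> {..<N}"
    show "t \<in> flow_dom (field_of d c) (initial_value j v (z b))"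
      by (rule mem_is_interval_1_I[OF is_interval_flow_dom, of x _ _ y]) (use * in auto)
  qed
  show "0 \<in> flow_dom_all d c j v z N" unfolding flow_dom_all_def using zero_in_flow_dom by blast
qed

lemma cert_flow_deriv_deriv:
  assumes "x \<in> flow_dom_all d c j v z (npts s)"
  shows "((\<lambda>x. peval (flow_env d c j v z x) (cert_flow_deriv d i s q)) has_real_derivative peval (flow_env d c j v z x) (cert_flow_deriv d i s (Suc q))) (at x)"
proof -
  have "((\<lambda>x. peval (flow_env d c j v z x) (cert_flow_deriv d i s q)) has_real_derivative
     peval (flow_env d c j v z x) (pderive (time_deriv d) (cert_flow_deriv d i s q))) (at x)"
  proof (rule has_field_derivative_peval)
    fix y assume "y \<in> pvars (cert_flow_deriv d i s q)"
    then have y: "y \<in> flow_vars d (npts s)" using pvars_cert_flow_deriv by blast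
    show "((\<lambda>t. flow_env d c j v z t y) has_real_derivative peval (flow_env d c j v z x) (time_deriv d y)) (at x)"
    proof (cases y)
      case (JetVar b p)
      obtain k l where p: "p = (k, l)" by (cases p)
      have b: "b < npts s" using y by (simp add: JetVar flow_vars_def)
      let ?r = "initial_value j v (z b)"
      have "peval (flow_env d c j v z x) (jet_field_univ d b k l) = peval (jet (field_of d c) j x ?r) (jet_field (field_of d c) k l)"
        unfolding jet_field_field_of[where b = b] peval_psubst
      proof (rule peval_cong)
        fix w assume "w \<in> pvars (jet_field_univ d b k l)"
        then have "w \<in> CoeffVar ` coeff_index d \<union> range (JetVar b)" using pvars_jet_field_univ by blast
        then show "flow_env d c j v z x w = peval (jet (field_of d c) j x ?r) (specialize c w)"
          by (auto simp: flow_env_def specialize_def)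
      qed
      then show ?thesis
        using jet_deriv[of x "field_of d c" ?r j k l] assms b by (simp add: JetVar p time_deriv_def flow_env_def flow_dom_all_def)
    qed (use y in \<open>auto simp: time_deriv_def flow_env_def flow_vars_def\<close>)
  qed
  then show ?thesis by (simp add: cert_flow_deriv_def)
qed

lemma cert_flow_deriv_analytic:
  assumes "x0 \<in> flow_dom_all d c j v z (npts s)"
  shows "\<exists>\<epsilon> h. 0 < \<epsilon> \<and> h holomorphic_on ball (of_real x0) \<epsilon> \<and>
    (\<forall>x. \<bar>x - x0\<bar> < \<epsilon> \<longrightarrow> h (of_real x) = complex_of_real (peval (flow_env d c j v z x) (cert_flow i s)))"
proof -
  let ?X = "pvars (cert_flow i s)"
  have "\<forall>y\<in>?X. \<exists>\<epsilon> h. 0 < \<epsilon> \<and> h holomorphic_on ball (of_real x0) \<epsilon> \<and>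
    (\<forall>x. \<bar>x - x0\<bar> < \<epsilon> \<longrightarrow> h (of_real x) = complex_of_real (flow_env d c j v z x y))"
  proof
    fix y assume "y \<in> ?X"
    then have y: "y \<in> flow_vars d (npts s)" using pvars_cert_flow_deriv[of d i s 0] by (auto simp: cert_flow_deriv_def)
    show "\<exists>\<epsilon> h. 0 < \<epsilon> \<and> h holomorphic_on ball (of_real x0) \<epsilon> \<and>
      (\<forall>x. \<bar>x - x0\<bar> < \<epsilon> \<longrightarrow> h (of_real x) = complex_of_real (flow_env d c j v z x y))"
    proof (cases y)
      case (JetVar b p)
      then show ?thesis
        using jet_analytic[of x0 "field_of d c" "initial_value j v (z b)" j p] assms y
        by (simp add: flow_env_def flow_dom_all_def flow_vars_def)
    qed (use y in \<open>auto simp: flow_env_def flow_vars_def intro!: exI[of _ 1] exI[of _ "\<lambda>_. of_real _"]\<close>)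
  qed
  from bchoice[OF this] obtain \<epsilon> where "\<forall>y\<in>?X. \<exists>h. 0 < \<epsilon> y \<and> h holomorphic_on ball (of_real x0) (\<epsilon> y) \<and>
    (\<forall>x. \<bar>x - x0\<bar> < \<epsilon> y \<longrightarrow> h (of_real x) = complex_of_real (flow_env d c j v z x y))" by blast
  from bchoice[OF this] obtain h where h: "\<And>y. y \<in> ?X \<Longrightarrow> 0 < \<epsilon> y \<and> h y holomorphic_on ball (of_real x0) (\<epsilon> y) \<and>
    (\<forall>x. \<bar>x - x0\<bar> < \<epsilon> y \<longrightarrow> h y (of_real x) = complex_of_real (flow_env d c j v z x y))" by blast
  define e where "e = Min (insert 1 (\<epsilon> ` ?X))"
  have e: "0 < e" "\<And>y. y \<in> ?X \<Longrightarrow> e \<le> \<epsilon> y" unfolding e_def using h by auto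
  show ?thesis
  proof (intro exI[of _ e] exI[of _ "\<lambda>t. peval (\<lambda>y. h y t) (cert_flow i s)"] conjI allI impI)
    show "(\<lambda>t. peval (\<lambda>y. h y t) (cert_flow i s)) holomorphic_on ball (of_real x0) e"
    proof (rule holomorphic_on_peval)
      fix y assume y: "y \<in> ?X"
      have "ball (complex_of_real x0) e \<subseteq> ball (of_real x0) (\<epsilon> y)" using e(2)[OF y] by auto
      then show "h y holomorphic_on ball (of_real x0) e" using h[OF y] holomorphic_on_subset by blast
    qed
    fix x assume x: "\<bar>x - x0\<bar> < e"
    have "peval (\<lambda>y. h y (of_real x)) (cert_flow i s) = peval (\<lambda>y. complex_of_real (flow_env d c j v z x y)) (cert_flow i s)"
      by (rule peval_cong) (use h e(2) x in force)
    then show "peval (\<lambda>y. h y (of_real x)) (cert_flow i s) = complex_of_real (peval (flow_env d c j v z x) (cert_flow i s))"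
      by (simp add: peval_of_real)
  qed (rule e)
qed

text \<open>
  Each point is the only one of the set in some interval with rational end points.
\<close>

lemma countable_isolated:
  fixes S :: "real set"
  assumes "\<And>x. x \<in> S \<Longrightarrow> \<exists>\<epsilon>>0. \<forall>y\<in>S. \<bar>y - x\<bar> < \<epsilon> \<longrightarrow> y = x"
  shows "countable S"
proof -
  have "\<forall>x\<in>S. \<exists>p. fst p \<in> \<rat> \<and> snd p \<in> \<rat> \<and> S \<inter> {fst p<..<snd p} = {x}"
  proof
    fix x assume x: "x \<in> S"
    obtain e where e: "e > 0" "\<And>y. y \<in> S \<Longrightarrow> \<bar>y - x\<bar> < e \<Longrightarrow> y = x" using assms[OF x] by blast
    obtain a where a: "a \<in> \<rat>" "x - e < a" "a < x" using Rats_dense_in_real[of "x - e" x] e by auto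
    obtain b where b: "b \<in> \<rat>" "x < b" "b < x + e" using Rats_dense_in_real[of x "x + e"] e by auto
    have "S \<inter> {a<..<b} = {x}"
    proof (intro subset_antisym subsetI)
      fix y assume y: "y \<in> S \<inter> {a<..<b}"
      then have "\<bar>y - x\<bar> < e" using a b by auto
      then show "y \<in> {x}" using e(2)[of y] y by simp
    qed (use x a b in auto)
    then show "\<exists>p. fst p \<in> \<rat> \<and> snd p \<in> \<rat> \<and> S \<inter> {fst p<..<snd p} = {x}"
      using a b by (intro exI[of _ "(a, b)"]) auto
  qed
  from bchoice[OF this] obtain p where p: "\<forall>x\<in>S. fst (p x) \<in> \<rat> \<and> snd (p x) \<in> \<rat> \<and> S \<inter> {fst (p x)<..<snd (p x)} = {x}" by blast
  have "inj_on p S" by (rule inj_onI) (metis p singleton_inject)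
  moreover have "p ` S \<subseteq> \<rat> \<times> \<rat>"
    by (rule image_subsetI) (use p in \<open>simp add: mem_Times_iff\<close>)
  then have "countable (p ` S)" by (rule countable_subset) (intro countable_SIGMA countable_rat)
  ultimately show ?thesis by (rule countable_image_inj_on[rotated])
qed

text \<open>
  The certificate is analytic on a connected set of times. So it vanishes identically, and then all its
  derivatives at time \<open>0\<close> do, or its zeros are isolated and therefore countable.
\<close>

theorem certificate_zeros:
  fixes d c j v z i s
  defines "D \<equiv> (\<lambda>x. peval (flow_env d c j v z x) (cert_flow i s))" and "I \<equiv> flow_dom_all d c j v z (npts s)"
  shows certificate_zeros_countable: "peval (param_env c v z) (cert_coeff d i j s q) \<noteq> 0 \<Longrightarrow> countable {x \<in> I. D x = 0}"
    and certificate_zero: "(\<And>q. peval (param_env c v z) (cert_coeff d i j s q) = 0) \<Longrightarrow> x \<in> I \<Longrightarrow> D x = 0"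
proof -
  define T where "T = {x \<in> I. \<exists>\<epsilon>>0. \<forall>y. \<bar>y - x\<bar> < \<epsilon> \<longrightarrow> D y = 0}"
  have dich: "(\<exists>\<epsilon>>0. \<forall>y. \<bar>y - x\<bar> < \<epsilon> \<longrightarrow> D y = 0) \<or> (\<exists>\<epsilon>>0. \<forall>y. \<bar>y - x\<bar> < \<epsilon> \<longrightarrow> y \<noteq> x \<longrightarrow> D y \<noteq> 0)"
    if x: "x \<in> I" for x
  proof -
    obtain \<epsilon> h where h: "0 < \<epsilon>" "h holomorphic_on ball (of_real x) \<epsilon>"
      "\<And>y. \<bar>y - x\<bar> < \<epsilon> \<Longrightarrow> h (of_real y) = complex_of_real (D y)"
      using cert_flow_deriv_analytic[of x d c j v z s i] x unfolding I_def D_def by blast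
    have dist: "of_real y \<in> ball (complex_of_real x) \<delta> \<longleftrightarrow> \<bar>y - x\<bar> < \<delta>" for y \<delta>
      by (simp add: dist_of_real dist_real_def abs_minus_commute)
    show ?thesis
    proof (cases "\<forall>t\<in>ball (of_real x) \<epsilon>. h t = 0")
      case True
      have "D y = 0" if "\<bar>y - x\<bar> < \<epsilon>" for y
        using True h(3)[OF that] that dist[of y \<epsilon>] by (metis of_real_eq_0_iff)
      then show ?thesis using h(1) by blast
    next
      case False
      then obtain \<beta> where \<beta>: "\<beta> \<in> ball (of_real x) \<epsilon>" "h \<beta> \<noteq> 0" by blast
      have "\<exists>r>0. r \<le> \<epsilon> \<and> (\<forall>t\<in>ball (of_real x) r - {of_real x}. h t \<noteq> 0)"
      proof (cases "h (of_real x) = 0")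
        case True
        obtain r where r: "0 < r" "ball (complex_of_real x) r \<subseteq> ball (of_real x) \<epsilon>" "\<And>t. t \<in> ball (of_real x) r - {of_real x} \<Longrightarrow> h t \<noteq> 0"
          by (rule isolated_zeros[OF h(2) open_ball connected_ball _ True \<beta>]) (use h(1) in auto)
        then show ?thesis using h(1) by (intro exI[of _ "min r \<epsilon>"]) auto
      next
        case False
        have "continuous_on (ball (of_real x) \<epsilon>) h" using h(2) by (rule holomorphic_on_imp_continuous_on)
        then have "open (ball (of_real x) \<epsilon> \<inter> h -` (- {0}))"
          by (rule continuous_open_preimage) auto
        moreover have "of_real x \<in> ball (of_real x) \<epsilon> \<inter> h -` (- {0})" using False h(1) by simp
        ultimately obtain r where "r > 0" "ball (of_real x) r \<subseteq> ball (of_real x) \<epsilon> \<inter> h -` (- {0})"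
          using open_contains_ball by blast
        then show ?thesis using h(1) by (intro exI[of _ "min r \<epsilon>"]) auto
      qed
      then obtain r where r: "r > 0" "r \<le> \<epsilon>" "\<And>t. t \<in> ball (of_real x) r - {of_real x} \<Longrightarrow> h t \<noteq> 0" by blast
      have "D y \<noteq> 0" if "\<bar>y - x\<bar> < r" "y \<noteq> x" for y
        using r(3)[of "of_real y"] h(3)[of y] that dist[of y r] r(2) by auto
      then show ?thesis using r(1) by blast
    qed
  qed
  have conn: "connected I" unfolding I_def using flow_dom_all(2) is_interval_connected_1 by blast
  have T: "T = {} \<or> T = I"
  proof -
    have "open T"
    proof (subst open_subopen, intro ballI)
      fix x assume "x \<in> T"
      then obtain e where e: "x \<in> I" "e > 0" "\<And>y. \<bar>y - x\<bar> < e \<Longrightarrow> D y = 0" unfolding T_def by blast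
      have "I \<inter> ball x (e / 2) \<subseteq> T"
      proof
        fix y assume y: "y \<in> I \<inter> ball x (e / 2)"
        have "D w = 0" if "\<bar>w - y\<bar> < e / 2" for w
        proof (rule e(3))
          have "\<bar>x - y\<bar> < e / 2" using y by (simp add: dist_real_def)
          with that show "\<bar>w - x\<bar> < e" by linarith
        qed
        then show "y \<in> T" using y e(2) unfolding T_def by (auto intro!: exI[of _ "e / 2"])
      qed
      moreover have "open (I \<inter> ball x (e / 2))" unfolding I_def by (intro open_Int flow_dom_all(1) open_ball)
      moreover have "x \<in> I \<inter> ball x (e / 2)" using e by simp
      ultimately show "\<exists>S. open S \<and> x \<in> S \<and> S \<subseteq> T" by blast
    qed
    moreover have "open (I - T)"
    proof (subst open_subopen, intro ballI)
      fix x assume x: "x \<in> I - T"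
      then obtain e where e: "e > 0" "\<And>y. \<bar>y - x\<bar> < e \<Longrightarrow> y \<noteq> x \<Longrightarrow> D y \<noteq> 0"
        using dich[of x] unfolding T_def by blast
      have "I \<inter> ball x e \<subseteq> I - T"
      proof
        fix y assume y: "y \<in> I \<inter> ball x e"
        have "y \<notin> T"
        proof
          assume "y \<in> T"
          then have "y \<noteq> x" using x by auto
          then have "D y \<noteq> 0" using e(2)[of y] y by (auto simp: dist_real_def abs_minus_commute)
          moreover have "D y = 0" using \<open>y \<in> T\<close> unfolding T_def by force
          ultimately show False by simp
        qed
        then show "y \<in> I - T" using y by simp
      qed
      moreover have "open (I \<inter> ball x e)" unfolding I_def by (intro open_Int flow_dom_all(1) open_ball)
      moreover have "x \<in> I \<inter> ball x e" using x e by simp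
      ultimately show "\<exists>S. open S \<and> x \<in> S \<and> S \<subseteq> I - T" by blast
    qed
    moreover have "T \<subseteq> I" unfolding T_def by blast
    ultimately show ?thesis using connectedD[OF conn, of T "I - T"] by blast
  qed
  have I0: "0 \<in> I" unfolding I_def by (rule flow_dom_all(3))
  have Wq: "peval (flow_env d c j v z 0) (cert_flow_deriv d i s q) = peval (param_env c v z) (cert_coeff d i j s q)" for q by (rule peval_cert_coeff[symmetric])
  {
    assume "T = I"
    then have "0 \<in> T" using I0 by simp
    then obtain e where e: "e > 0" "\<And>y. \<bar>y - 0\<bar> < e \<Longrightarrow> D y = 0" unfolding T_def by blast
    have "peval (flow_env d c j v z x) (cert_flow_deriv d i s q) = 0" if "x \<in> I \<inter> ball 0 e" for x q
      using that
    proof (induction q arbitrary: x)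
      case 0
      then show ?case using e(2)[of x] by (simp add: D_def cert_flow_deriv_def)
    next
      case (Suc q)
      have op: "open (I \<inter> ball 0 e)" unfolding I_def by (intro open_Int flow_dom_all(1) open_ball)
      have "((\<lambda>x. peval (flow_env d c j v z x) (cert_flow_deriv d i s q)) has_real_derivative peval (flow_env d c j v z x) (cert_flow_deriv d i s (Suc q))) (at x)"
        by (rule cert_flow_deriv_deriv) (use Suc.prems in \<open>simp add: I_def\<close>)
      then have "((\<lambda>x. 0) has_real_derivative peval (flow_env d c j v z x) (cert_flow_deriv d i s (Suc q))) (at x)"
        by (rule has_field_derivative_transform_within_open[OF _ op Suc.prems]) (rule Suc.IH)
      then show ?case using DERIV_unique[OF _ DERIV_const] by blast
    qed
    then have "peval (param_env c v z) (cert_coeff d i j s q) = 0" for q using Wq[of q] I0 e(1) by simp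
  }
  then show "countable {x \<in> I. D x = 0}" if "peval (param_env c v z) (cert_coeff d i j s q) \<noteq> 0"
  proof -
    have "T = {}" using T that \<open>T = I \<Longrightarrow> _\<close> by blast
    show ?thesis
    proof (rule countable_isolated)
      fix x assume "x \<in> {x \<in> I. D x = 0}"
      then obtain e where "e > 0" "\<And>y. \<bar>y - x\<bar> < e \<Longrightarrow> y \<noteq> x \<Longrightarrow> D y \<noteq> 0"
        using dich[of x] \<open>T = {}\<close> unfolding T_def by blast
      then show "\<exists>\<epsilon>>0. \<forall>y\<in>{x \<in> I. D x = 0}. \<bar>y - x\<bar> < \<epsilon> \<longrightarrow> y = x" by blast
    qed
  qed
  show "D x = 0" if z: "\<And>q. peval (param_env c v z) (cert_coeff d i j s q) = 0" and x: "x \<in> I"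
  proof -
    obtain \<epsilon> h where h: "0 < \<epsilon>" "h holomorphic_on ball (of_real 0) \<epsilon>"
      "\<And>y. \<bar>y - 0\<bar> < \<epsilon> \<Longrightarrow> h (of_real y) = complex_of_real (D y)"
      using cert_flow_deriv_analytic[of 0 d c j v z s i] I0 unfolding I_def D_def by blast
    obtain \<delta> where \<delta>: "0 < \<delta>" "\<delta> \<le> \<epsilon>" "ball 0 \<delta> \<subseteq> I"
    proof -
      obtain \<delta>1 where d1: "0 < \<delta>1" "ball 0 \<delta>1 \<subseteq> I"
        using flow_dom_all(1)[of d c j v z "npts s"] I0 open_contains_ball unfolding I_def by blast
      have "ball 0 (min \<delta>1 \<epsilon>) \<subseteq> ball (0 :: real) \<delta>1" by auto
      with d1 show ?thesis using that[of "min \<delta>1 \<epsilon>"] h(1) by auto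
    qed
    have Dq: "(deriv ^^ q) D y = peval (flow_env d c j v z y) (cert_flow_deriv d i s q)" if "y \<in> I" for q y
      using that
    proof (induction q arbitrary: y)
      case (Suc q)
      have op: "open I" unfolding I_def by (rule flow_dom_all(1))
      have "((\<lambda>x. peval (flow_env d c j v z x) (cert_flow_deriv d i s q)) has_real_derivative peval (flow_env d c j v z y) (cert_flow_deriv d i s (Suc q))) (at y)"
        by (rule cert_flow_deriv_deriv) (use Suc.prems in \<open>simp add: I_def\<close>)
      then have "((deriv ^^ q) D has_real_derivative peval (flow_env d c j v z y) (cert_flow_deriv d i s (Suc q))) (at y)"
        by (rule has_field_derivative_transform_within_open[OF _ op Suc.prems]) (simp add: Suc.IH)
      then show ?case by (simp add: DERIV_imp_deriv)
    qed (simp add: D_def cert_flow_deriv_def)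
    have hb: "h holomorphic_on ball 0 \<delta>" using h(2) \<delta>(2) by (auto intro: holomorphic_on_subset)
    have hq: "(deriv ^^ q) h 0 = 0" for q
    proof -
      have "(deriv ^^ q) h (of_real 0) = of_real ((deriv ^^ q) D 0)"
        by (rule real_complex_higher_deriv[OF hb]) (use \<delta> h(3) in auto)
      then show ?thesis using Dq[OF I0, of q] Wq[of q] z[of q] by simp
    qed
    have "h t = 0" if "t \<in> ball 0 \<delta>" for t
      using holomorphic_power_series[OF hb that] hq by (simp add: sums_iff)
    then have "D y = 0" if "\<bar>y\<bar> < \<delta>" for y
      using h(3)[of y] that \<delta>(2) by (metis diff_zero dist_0_norm mem_ball norm_of_real of_real_eq_0_iff order_less_le_trans)
    then have "0 \<in> T" unfolding T_def using I0 \<delta>(1) by auto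
    then have "x \<in> T" using T x by auto
    then show ?thesis unfolding T_def by force
  qed
qed

section \<open>Genericity from one nonzero certificate\<close>

lemma openinI_eventually:
  assumes "S \<subseteq> topspace X" "\<And>v. v \<in> S \<Longrightarrow> eventually (\<lambda>w. w \<in> S) (nhdsin X v)"
  shows "openin X S"
proof (subst openin_subopen, intro ballI)
  fix v assume v: "v \<in> S"
  with assms obtain T where "openin X T" "v \<in> T" "\<forall>w\<in>T. w \<in> S"
    unfolding eventually_nhdsin by blast
  then show "\<exists>T. openin X T \<and> v \<in> T \<and> T \<subseteq> S" by blast
qed

lemma eventually_nhdsin_openin:
  "openin X S \<Longrightarrow> v \<in> S \<Longrightarrow> eventually (\<lambda>w. w \<in> S) (nhdsin X v)"
  unfolding eventually_nhdsin by blast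

lemma tendsto_compose_at_within:
  assumes "(f \<longlongrightarrow> f p0) (at p0 within A)" "(g \<longlongrightarrow> p0) F" "\<And>v. g v \<in> A"
  shows "((\<lambda>v. f (g v)) \<longlongrightarrow> f p0) F"
proof (rule topological_tendstoI)
  fix S assume S: "open S" "f p0 \<in> S"
  then have "eventually (\<lambda>p. p \<noteq> p0 \<longrightarrow> p \<in> A \<longrightarrow> f p \<in> S) (nhds p0)"
    using assms(1) by (auto simp: tendsto_def eventually_at_filter)
  from eventually_compose_filterlim[OF this assms(2)]
  show "eventually (\<lambda>v. f (g v) \<in> S) F" using S(2) assms(3) by (auto elim!: eventually_mono)
qed

lemma finite_param_index: "finite (param_index (j :: 'm::finite))"
  by (rule finite_subset[of _ UNIV]) auto

lemma tendsto_param: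
  fixes j :: "'m::finite"
  assumes "v0 \<in> param_index j \<rightarrow>\<^sub>E UNIV"
  shows "((\<lambda>v. (v None, initial_value j v z)) \<longlongrightarrow> (v0 None, initial_value j v0 z)) (nhdsin (powertop_real (param_index j)) v0)"
proof -
  let ?X = "powertop_real (param_index j)"
  have c: "((\<lambda>v. v a) \<longlongrightarrow> v0 a) (nhdsin ?X v0)" if a: "a \<in> param_index j" for a
  proof (rule topological_tendstoI)
    fix S :: "real set" assume S: "open S" "v0 a \<in> S"
    have "openin ?X {v \<in> topspace ?X. v a \<in> S}"
      by (rule openin_continuous_map_preimage[OF continuous_map_product_projection[OF a]]) (use S in simp)
    then have "eventually (\<lambda>w. w \<in> {v \<in> topspace ?X. v a \<in> S}) (nhdsin ?X v0)"
      by (rule eventually_nhdsin_openin) (use S assms in auto)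
    then show "eventually (\<lambda>v. v a \<in> S) (nhdsin ?X v0)" by (rule eventually_mono) auto
  qed
  have "((\<lambda>v. initial_value j v z) \<longlongrightarrow> initial_value j v0 z) (nhdsin ?X v0)"
  proof (rule vec_tendstoI)
    fix k
    show "((\<lambda>v. initial_value j v z $ k) \<longlongrightarrow> initial_value j v0 z $ k) (nhdsin ?X v0)"
      using c[of "Some k"] by (cases "k = j") (auto simp: initial_value_def param_index_def)
  qed
  moreover have "((\<lambda>v. v None) \<longlongrightarrow> v0 None) (nhdsin ?X v0)" by (rule c) (simp add: param_index_def)
  ultimately show ?thesis by (intro tendsto_Pair)
qed

lemma openin_param_preimage:
  fixes j :: "'m::finite"
  assumes "open G"
  shows "openin (powertop_real (param_index j)) {v \<in> param_index j \<rightarrow>\<^sub>E UNIV. (v None, initial_value j v z) \<in> G}"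
proof (rule openinI_eventually)
  let ?X = "powertop_real (param_index j)"
  fix v0 assume v0: "v0 \<in> {v \<in> param_index j \<rightarrow>\<^sub>E UNIV. (v None, initial_value j v z) \<in> G}"
  then have "eventually (\<lambda>v. (v None, initial_value j v z) \<in> G) (nhdsin ?X v0)"
    using topological_tendstoD[OF tendsto_param[of v0 j z] assms] by simp
  moreover have "eventually (\<lambda>v. v \<in> topspace ?X) (nhdsin ?X v0)"
    by (rule eventually_nhdsin_openin[OF openin_topspace]) (use v0 in simp)
  ultimately show "eventually (\<lambda>v. v \<in> {v \<in> param_index j \<rightarrow>\<^sub>E UNIV. (v None, initial_value j v z) \<in> G}) (nhdsin ?X v0)"
    by eventually_elim simp
qed auto

definition rat_point :: "rat list \<Rightarrow> nat \<Rightarrow> real" where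
  "rat_point zs b = of_rat (zs ! b)"

lemma infinite_Rats_interval:
  assumes "a < b" shows "infinite (\<rat> \<inter> {a<..<b :: real})"
proof
  assume fin: "finite (\<rat> \<inter> {a<..<b})"
  obtain x where x: "x \<in> \<rat>" "a < x" "x < b" using Rats_dense_in_real[OF assms] by blast
  define m where "m = Min (\<rat> \<inter> {a<..<b})"
  have "m \<in> \<rat> \<inter> {a<..<b}" unfolding m_def by (rule Min_in[OF fin]) (use x in auto)
  then obtain y where y: "y \<in> \<rat>" "a < y" "y < m" "m < b" using Rats_dense_in_real[of a m] by auto
  have "m \<le> y" unfolding m_def by (rule Min_le[OF fin]) (use y in auto)
  then show False using y by simp
qed

lemma peval_param_env_cong:
  assumes "\<And>b. b < npts s \<Longrightarrow> z b = z' b" "\<And>a. a \<in> Some ` (- {j}) \<Longrightarrow> v a = v' a"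
  shows "peval (param_env c v z) (cert_coeff d i j s q) = peval (param_env c v' z') (cert_coeff d i j s q)"
proof (rule peval_cong)
  fix x assume "x \<in> pvars (cert_coeff d i j s q)"
  then have "x \<in> param_vars d (npts s) j" using pvars_cert_coeff by blast
  then show "param_env c v z x = param_env c v' z' x"
    using assms by (cases x) (auto simp: param_vars_def param_env_def)
qed

text \<open>
  The points may be taken rational and in any given interval. This leaves countably many certificates
  to be considered, and they can be placed inside the domain of \<open>f\<^sub>i\<^sub>j\<close>.
\<close>

lemma rational_points:
  assumes "peval (param_env c v z) (cert_coeff d i j s q) \<noteq> 0" "a < b"
  obtains zs where "peval (param_env c v (rat_point zs)) (cert_coeff d i j s q) \<noteq> 0" "\<And>n. n < npts s \<Longrightarrow> rat_point zs n \<in> {a<..<b}"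
proof -
  let ?B = "PointVar ` {..<npts s} :: 'a cert_var set"
  have "finite ?B" "\<forall>y\<in>?B. infinite (\<rat> \<inter> {a<..<b})" using infinite_Rats_interval[OF assms(2)] by auto
  from peval_nonzero_move[OF this assms(1)] obtain e' where e':
    "\<forall>y\<in>?B. e' y \<in> \<rat> \<inter> {a<..<b}" "\<forall>y. y \<notin> ?B \<longrightarrow> e' y = param_env c v z y" "peval e' (cert_coeff d i j s q) \<noteq> 0" by blast
  have "\<forall>n\<in>{..<npts s}. \<exists>r :: rat. e' (PointVar n) = of_rat r"
    using e'(1) by (auto simp: Rats_def)
  from bchoice[OF this] obtain f :: "nat \<Rightarrow> rat" where f: "\<forall>n\<in>{..<npts s}. e' (PointVar n) = of_rat (f n)" by blast
  define zs where "zs = map f [0..<npts s]"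
  have zs: "rat_point zs n = e' (PointVar n)" if "n < npts s" for n using f that by (simp add: rat_point_def zs_def)
  have "peval (param_env c v (rat_point zs)) (cert_coeff d i j s q) = peval e' (cert_coeff d i j s q)"
  proof (rule peval_cong)
    fix x assume "x \<in> pvars (cert_coeff d i j s q)"
    then have "x \<in> param_vars d (npts s) j" using pvars_cert_coeff by blast
    then show "param_env c v (rat_point zs) x = e' x"
      using zs e'(2)[rule_format, of x] by (cases x) (auto simp: param_vars_def param_env_def image_iff)
  qed
  then show ?thesis using that[of zs] e' zs by auto
qed

lemma flow_env_Zero_indep:
  "peval (flow_env d c j (v(None := t)) z x) (cert_flow i s) = peval (flow_env d c j v z x) (cert_flow i s)"
proof (rule peval_cong)
  fix y assume "y \<in> pvars (cert_flow i s)"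
  then have "y \<in> flow_vars d (npts s)" using pvars_cert_flow_deriv[of d i s 0] by (auto simp: cert_flow_deriv_def)
  moreover have "initial_value j (v(None := t)) a = initial_value j v a" for a
    by (auto simp: initial_value_def vec_eq_iff)
  ultimately show "flow_env d c j (v(None := t)) z x y = flow_env d c j v z x y"
    by (cases y) (auto simp: flow_env_def flow_vars_def)
qed

text \<open>
  The assumption \<open>good\<close> is the condition on the system: a certificate coefficient that is nonzero for
  some system is nonzero for this one. Then for almost all initial values the certificate has countably
  many zeros in time, and Fubini's theorem in the time coordinate makes its zero set null. It is closed
  where it is defined because jets are continuous.
\<close>

theorem generic_params:
  fixes P :: "'m::finite system"
  assumes P: "P \<in> systems d" and c: "c = system_coeffs d P"
    and good: "\<And>s zs. (\<exists>c v q. peval (param_env c v (rat_point zs)) (cert_coeff d i j s q) \<noteq> 0) \<Longrightarrow>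
       \<exists>v q. peval (param_env c v (rat_point zs)) (cert_coeff d i j s q) \<noteq> 0"
    and certificate_coefficient_nonzero: "\<And>s. \<exists>c v z q. peval (param_env c v z) (cert_coeff d i j s q) \<noteq> 0"
  shows "generic_in (param_index j) (Lambda_proj j P)
     {v \<in> Lambda_proj j P. \<not> differentially_algebraic_on (f_domain P j v) (f_fun P i j v)}"
proof -
  define V where "V = field_of d c"
  let ?I = "param_index j" and ?X = "powertop_real (param_index j)"
  define G where "G = {(x, r). x \<in> flow_dom V r}"
  have G: "open G" unfolding G_def by (rule open_flow_dom)
  have LG: "Lambda P = G" unfolding Lambda_def G_def max_interval_eq[OF P] V_def c ..
  define A where "A = {(s, zs). \<exists>c v q. peval (param_env c v (rat_point zs)) (cert_coeff d i j s q) \<noteq> 0}"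
  define Ow where "Ow = (\<lambda>(s, zs). {v \<in> ?I \<rightarrow>\<^sub>E UNIV. \<forall>b<npts s. (v None, initial_value j v (rat_point zs b)) \<in> G})"
  define D where "D = (\<lambda>s zs v. peval (flow_env d c j v (rat_point zs) (v None)) (cert_flow i s))"
  define Z where "Z = (\<lambda>(s, zs). {v \<in> Ow (s, zs). D s zs v = 0})"
  have Oopen: "openin ?X (Ow a)" for a
  proof -
    obtain s zs where a: "a = (s, zs)" by (cases a)
    have "openin ?X (topspace ?X \<inter> (\<Inter>b\<in>{..<npts s}. {v \<in> ?I \<rightarrow>\<^sub>E UNIV. (v None, initial_value j v (rat_point zs b)) \<in> G}))"
      using openin_topspace[of ?X]
      by (intro openin_Int_Inter) (auto intro: openin_param_preimage[OF G])
    also have "topspace ?X \<inter> (\<Inter>b\<in>{..<npts s}. {v \<in> ?I \<rightarrow>\<^sub>E UNIV. (v None, initial_value j v (rat_point zs b)) \<in> G}) = Ow a"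
      by (auto simp: Ow_def a)
    finally show ?thesis .
  qed
  have Dopen: "openin ?X (Ow a - Z a)" for a
  proof (rule openinI_eventually)
    obtain s zs where a: "a = (s, zs)" by (cases a)
    fix v0 assume v0: "v0 \<in> Ow a - Z a"
    then have v0': "v0 \<in> ?I \<rightarrow>\<^sub>E UNIV" by (auto simp: Ow_def a)
    have "((\<lambda>v. D s zs v) \<longlongrightarrow> D s zs v0) (nhdsin ?X v0)"
      unfolding D_def
    proof (rule tendsto_peval)
      fix y assume "y \<in> pvars (cert_flow i s)"
      then have y: "y \<in> flow_vars d (npts s)" using pvars_cert_flow_deriv[of d i s 0] by (auto simp: cert_flow_deriv_def)
      show "((\<lambda>v. flow_env d c j v (rat_point zs) (v None) y) \<longlongrightarrow> flow_env d c j v0 (rat_point zs) (v0 None) y) (nhdsin ?X v0)"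
      proof (cases y)
        case (JetVar b p)
        let ?q = "(v0 None, initial_value j v0 (rat_point zs b))"
        have "?q \<in> G" using v0 y by (auto simp: Ow_def a JetVar flow_vars_def)
        then have "v0 None \<in> flow_dom V (initial_value j v0 (rat_point zs b))" by (simp add: G_def)
        from jet_tendsto[OF this, of j p]
        have lim: "((\<lambda>(x, r'). jet V j x r' p) \<longlongrightarrow> (\<lambda>(x, r'). jet V j x r' p) ?q)
          (at ?q within {(x, r'). r' $ j = initial_value j v0 (rat_point zs b) $ j})" by (simp only: prod.case)
        have mem: "(v None, initial_value j v (rat_point zs b)) \<in> {(x, r'). r' $ j = initial_value j v0 (rat_point zs b) $ j}" for v
          by (simp add: initial_value_def)
        have "((\<lambda>v. (\<lambda>(x, r'). jet V j x r' p) (v None, initial_value j v (rat_point zs b))) \<longlongrightarrow> (\<lambda>(x, r'). jet V j x r' p) ?q) (nhdsin ?X v0)"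
          by (rule tendsto_compose_at_within[OF lim tendsto_param[OF v0'] mem])
        then show ?thesis by (simp add: flow_env_def JetVar V_def)
      qed (use y in \<open>auto simp: flow_env_def flow_vars_def\<close>)
    qed
    moreover have "D s zs v0 \<noteq> 0" using v0 by (auto simp: Z_def a)
    ultimately have "eventually (\<lambda>v. D s zs v \<noteq> 0) (nhdsin ?X v0)" by (rule tendsto_imp_eventually_ne)
    moreover have "eventually (\<lambda>v. v \<in> Ow a) (nhdsin ?X v0)"
      by (rule eventually_nhdsin_openin[OF Oopen]) (use v0 in auto)
    ultimately show "eventually (\<lambda>v. v \<in> Ow a - Z a) (nhdsin ?X v0)"
      by eventually_elim (auto simp: Z_def a)
  next
    show "Ow a - Z a \<subseteq> topspace ?X" using openin_subset[OF Oopen[of a]] by blast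
  qed
  have fI: "finite ?I" by (rule finite_param_index)
  have Znull: "Z a \<in> null_sets (lebI ?I)" if aA: "a \<in> A" for a
  proof -
    obtain s zs where a: "a = (s, zs)" by (cases a)
    let ?J = "Some ` (- {j})"
    have I: "?I = insert None ?J" unfolding param_index_def by (auto simp: image_iff)
    have Zs: "Z a \<in> sets (lebI ?I)"
    proof -
      have "Z a = Ow a - (Ow a - Z a)" by (auto simp: Z_def a)
      then show ?thesis using openin_lebI_measurable[OF fI Oopen[of a]] openin_lebI_measurable[OF fI Dopen[of a]]
        by (metis sets.Diff)
    qed
    from aA good[of zs s] obtain v1 q where v1: "peval (param_env c v1 (rat_point zs)) (cert_coeff d i j s q) \<noteq> 0"
      unfolding A_def a by blast
    define p where "p = psubst (\<lambda>x. case x of CoeffVar a \<Rightarrow> Const (c a) | PointVar b \<Rightarrow> Const (rat_point zs b) | InitVar a \<Rightarrow> Var a | JetVar b p \<Rightarrow> Const 0) (cert_coeff d i j s q)"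
    have p: "peval w p = peval (param_env c w (rat_point zs)) (cert_coeff d i j s q)" for w
      unfolding p_def peval_psubst by (rule peval_cong) (simp add: param_env_def split: cert_var.split)
    have "over ?J v1 v1 = v1" by (auto simp: over_def)
    then have "{v \<in> ?J \<rightarrow>\<^sub>E UNIV. peval (over ?J v v1) p = 0} \<in> null_sets (lebI ?J)"
      by (intro peval_zeros_null[where ?v0.0 = v1]) (use v1 p in auto)
    then have "AE v in lebI ?J. v \<notin> {v \<in> ?J \<rightarrow>\<^sub>E UNIV. peval (over ?J v v1) p = 0}" by (rule AE_not_in)
    moreover have "AE v in lebI ?J. v \<in> ?J \<rightarrow>\<^sub>E UNIV" by (rule AE_I2) (simp add: space_lebI)
    ultimately have "AE v in lebI ?J. AE t in lborel. v(None := t) \<notin> Z a"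
    proof eventually_elim
      case (elim v)
      then have "peval (param_env c (over ?J v v1) (rat_point zs)) (cert_coeff d i j s q) \<noteq> 0" using p by auto
      then have "peval (param_env c v (rat_point zs)) (cert_coeff d i j s q) \<noteq> 0"
        by (subst peval_param_env_cong[where v' = "over ?J v v1" and z' = "rat_point zs"]) (auto simp: over_def)
      then have "countable {x \<in> flow_dom_all d c j v (rat_point zs) (npts s). peval (flow_env d c j v (rat_point zs) x) (cert_flow i s) = 0}"
        by (rule certificate_zeros_countable)
      then have "AE t in lborel. t \<notin> {x \<in> flow_dom_all d c j v (rat_point zs) (npts s). peval (flow_env d c j v (rat_point zs) x) (cert_flow i s) = 0}"
        by (intro AE_not_in countable_imp_null_set_lborel)
      then show ?case
      proof (rule eventually_mono)
        fix t assume t: "t \<notin> {x \<in> flow_dom_all d c j v (rat_point zs) (npts s). peval (flow_env d c j v (rat_point zs) x) (cert_flow i s) = 0}"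
        have iv: "initial_value j (v(None := t)) b = initial_value j v b" for b
          by (auto simp: initial_value_def vec_eq_iff)
        show "v(None := t) \<notin> Z a"
        proof
          assume "v(None := t) \<in> Z a"
          then have "t \<in> flow_dom_all d c j v (rat_point zs) (npts s)" "D s zs (v(None := t)) = 0"
            by (auto simp: Z_def Ow_def a flow_dom_all_def G_def V_def iv)
          with t show False by (simp add: D_def flow_env_Zero_indep)
        qed
      qed
    qed
    then show ?thesis using null_by_lines[of ?J None "Z a"] Zs unfolding I by auto
  qed
  show ?thesis
  proof (rule generic_inI[OF fI, where A = A and Z = Z and W = Ow])
    have "Lambda_proj j P = (\<Union>z. {v \<in> ?I \<rightarrow>\<^sub>E UNIV. (v None, initial_value j v z) \<in> G})"
      unfolding Lambda_proj_def LG by blast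
    then show "openin ?X (Lambda_proj j P)"
      using openin_param_preimage[OF G] by (auto intro!: openin_Union)
    show "countable A" by (rule countable_subset[OF subset_UNIV]) simp
    show "Lambda_proj j P - {v \<in> Lambda_proj j P. \<not> differentially_algebraic_on (f_domain P j v) (f_fun P i j v)}
       \<subseteq> (\<Union>a\<in>A. Z a)"
    proof
      fix v assume "v \<in> Lambda_proj j P - {v \<in> Lambda_proj j P. \<not> differentially_algebraic_on (f_domain P j v) (f_fun P i j v)}"
      then have v: "v \<in> Lambda_proj j P" and DA: "differentially_algebraic_on (f_domain P j v) (f_fun P i j v)" by auto
      define F where "F = f_domain P j v"
      have Fdef: "F = {z. (v None, initial_value j v z) \<in> G}" unfolding F_def f_domain_def LG ..
      have "open F"
      proof -
        have "open ((\<lambda>z. (v None, initial_value j v z)) -` G)"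
        proof (rule open_vimage[OF G])
          have "continuous_on UNIV (\<lambda>z. \<chi> k. if k = j then z else v (Some k))"
          proof (rule continuous_on_vec_lambda)
            fix k show "continuous_on UNIV (\<lambda>z. if k = j then z else v (Some k))"
              by (cases "k = j") (auto intro!: continuous_intros)
          qed
          then show "continuous_on UNIV (\<lambda>z. (v None, initial_value j v z))"
            unfolding initial_value_def by (rule continuous_on_Pair[OF continuous_on_const])
        qed
        then show ?thesis by (simp add: Fdef vimage_def)
      qed
      moreover obtain z0 where "z0 \<in> F" using v unfolding Lambda_proj_def LG Fdef by blast
      ultimately obtain \<epsilon> where \<epsilon>: "\<epsilon> > 0" "ball z0 \<epsilon> \<subseteq> F" using open_contains_ball by blast
      from dae_cert_vanishes[OF DA] obtain s where s:
        "\<And>e. (\<forall>b<npts s. e (b, 0) \<in> F \<and> (\<forall>l. e (b, Suc l) = (deriv ^^ l) (f_fun P i j v) (e (b, 0)))) \<Longrightarrow>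
          peval e (dae_cert s) = 0" unfolding F_def by blast
      from certificate_coefficient_nonzero[of s] obtain c' v' z' q where nz: "peval (param_env c' v' z') (cert_coeff d i j s q) \<noteq> 0" by blast
      have "z0 - \<epsilon> < z0 + \<epsilon>" using \<epsilon>(1) by simp
      from rational_points[OF nz this] obtain zs where zs: "peval (param_env c' v' (rat_point zs)) (cert_coeff d i j s q) \<noteq> 0"
        "\<And>n. n < npts s \<Longrightarrow> rat_point zs n \<in> {z0 - \<epsilon><..<z0 + \<epsilon>}" by metis
      have zF: "rat_point zs n \<in> F" if "n < npts s" for n
        using zs(2)[OF that] \<epsilon>(2) by (auto simp: subset_iff dist_real_def abs_less_iff)
      have "(s, zs) \<in> A" using zs(1) unfolding A_def by blast
      moreover have "v \<in> Z (s, zs)"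
      proof -
        have vI: "v \<in> ?I \<rightarrow>\<^sub>E UNIV" using v unfolding Lambda_proj_def by blast
        have "v \<in> Ow (s, zs)" using vI zF by (auto simp: Ow_def Fdef)
        moreover have "D s zs v = 0"
        proof -
          define e where "e = (\<lambda>(b, u). case u of 0 \<Rightarrow> rat_point zs b | Suc l \<Rightarrow> flow_env d c j v (rat_point zs) (v None) (JetVar b (i, l)))"
          have "D s zs v = peval e (dae_cert s)"
            unfolding D_def cert_flow_def peval_psubst
            by (rule peval_cong) (auto simp: e_def flow_env_def split: nat.split)
          also have "\<dots> = 0"
          proof (rule s, intro allI impI conjI)
            fix b assume b: "b < npts s"
            show "e (b, 0) \<in> F" using zF[OF b] by (simp add: e_def)
            fix l
            have "(deriv ^^ l) (\<lambda>z. flow V (initial_value j v z) (v None) $ i) (rat_point zs b) =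
              (deriv ^^ l) (f_fun P i j v) (rat_point zs b)"
            proof (rule higher_deriv_cong_open[OF \<open>open F\<close> zF[OF b]])
              fix z assume "z \<in> F"
              then have "v None \<in> max_interval P (initial_value j v z)"
                unfolding Fdef LG[symmetric] Lambda_def by simp
              from solution_eq[OF P this]
              show "flow V (initial_value j v z) (v None) $ i = f_fun P i j v z"
                by (simp add: f_fun_def V_def c)
            qed
            then show "e (b, Suc l) = (deriv ^^ l) (f_fun P i j v) (e (b, 0))"
              by (simp add: e_def flow_env_def jet_def set_coord_initial_value V_def[symmetric])
                (simp add: initial_value_def)
          qed
          finally show ?thesis .
        qed
        ultimately show ?thesis by (simp add: Z_def)
      qed
      ultimately show "v \<in> (\<Union>a\<in>A. Z a)" by blast
    qed
    show "Z a \<subseteq> Ow a" for a by (auto simp: Z_def split: prod.split)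
  qed (use Oopen Dopen Znull in auto)
qed

text \<open>
  For each certificate with a nonzero coefficient, initial values and an order \<open>q\<close> are fixed at which it
  is nonzero. What remains is a nonzero polynomial in the coefficients of the system, and its zero set is
  null and closed.
\<close>

theorem generic_if_certificates_nonzero:
  assumes certificate_coefficient_nonzero: "\<And>(i :: 'm::finite) j s. \<exists>c v z q. peval (param_env c v z) (cert_coeff d i j s q) \<noteq> 0"
  shows "generic_in (coeff_index d) (system_coeffs d ` (systems d :: 'm system set))
           (system_coeffs d ` {P \<in> systems d. \<forall>i j.
              generic_in (param_index j) (Lambda_proj j P)
                {v \<in> Lambda_proj j P.
                   \<not> differentially_algebraic_on (f_domain P j v) (f_fun P i j v)}})"
    (is "generic_in ?C (_ ` ?S) (_ ` ?good)")
proof -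
  define A where "A = {(i :: 'm, j :: 'm, s, zs). \<exists>c v q. peval (param_env c v (rat_point zs)) (cert_coeff d i j s q) \<noteq> 0}"
  have "\<forall>a\<in>A. \<exists>w. case a of (i, j, s, zs) \<Rightarrow> case w of (v, q) \<Rightarrow> \<exists>c. peval (param_env c v (rat_point zs)) (cert_coeff d i j s q) \<noteq> 0"
    unfolding A_def by fast
  from bchoice[OF this] obtain wit where wit: "\<And>i j s zs. (i, j, s, zs) \<in> A \<Longrightarrow>
      \<exists>c. peval (param_env c (fst (wit (i, j, s, zs))) (rat_point zs)) (cert_coeff d i j s (snd (wit (i, j, s, zs)))) \<noteq> 0"
    by (fastforce simp: split_def)
  define p where "p = (\<lambda>(i, j, s, zs). psubst (\<lambda>x. case x of CoeffVar a \<Rightarrow> Var a | PointVar b \<Rightarrow> Const (rat_point zs b)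
      | InitVar a \<Rightarrow> Const (fst (wit (i, j, s, zs)) a) | JetVar b p \<Rightarrow> Const 0) (cert_coeff d i j s (snd (wit (i, j, s, zs)))))"
  have p: "peval c (p (i, j, s, zs)) = peval (param_env c (fst (wit (i, j, s, zs))) (rat_point zs)) (cert_coeff d i j s (snd (wit (i, j, s, zs))))" for c i j s zs
    unfolding p_def prod.case peval_psubst by (rule peval_cong) (simp add: param_env_def split: cert_var.split)
  have fC: "finite ?C" by (rule finite_coeff_index)
  define Z where "Z a = {c \<in> ?C \<rightarrow>\<^sub>E UNIV. peval (over ?C c (\<lambda>_. 0)) (p a) = 0}" for a
  have img: "system_coeffs d ` ?S = ?C \<rightarrow>\<^sub>E UNIV"
    using bij_betw_system_coeffs by (rule bij_betw_imp_surj_on)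
  show ?thesis
  proof (rule generic_inI[OF fC, where A = A and Z = Z and W = "\<lambda>_. ?C \<rightarrow>\<^sub>E UNIV"])
    have ot: "openin (powertop_real ?C) (?C \<rightarrow>\<^sub>E UNIV)"
      using openin_topspace[of "powertop_real ?C"] by simp
    then show "openin (powertop_real ?C) (system_coeffs d ` ?S)" unfolding img .
    show "system_coeffs d ` ?good \<subseteq> system_coeffs d ` ?S" by blast
    have cm: "countable (UNIV :: 'm set)" by (rule countable_finite) simp
    have "A \<subseteq> UNIV \<times> UNIV \<times> UNIV" by auto
    moreover have "countable (UNIV \<times> UNIV \<times> UNIV :: ('m \<times> 'm \<times> nat \<times> rat list) set)"
      by (intro countable_SIGMA cm) simp
    ultimately show "countable A" by (rule countable_subset)
    show "openin (powertop_real ?C) (?C \<rightarrow>\<^sub>E UNIV)" by (rule ot)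
    show "Z a \<subseteq> ?C \<rightarrow>\<^sub>E UNIV" for a unfolding Z_def by blast
    show "openin (powertop_real ?C) ((?C \<rightarrow>\<^sub>E UNIV) - Z a)" for a
    proof -
      have "(?C \<rightarrow>\<^sub>E UNIV) - Z a = {c \<in> ?C \<rightarrow>\<^sub>E UNIV. peval (over ?C c (\<lambda>_. 0)) (p a) \<noteq> 0}"
        unfolding Z_def by blast
      then show ?thesis using openin_peval_over[of ?C "\<lambda>_. 0" "p a"] by simp
    qed
    show "Z a \<in> null_sets (lebI ?C)" if aA: "a \<in> A" for a
    proof -
      obtain i j s zs where a: "a = (i, j, s, zs)" by (cases a)
      obtain c0 :: "'m \<times> 'm monomial \<Rightarrow> real" where c0: "peval c0 (p a) \<noteq> 0" using wit[of i j s zs] aA unfolding a p by blast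
      have "peval (over ?C c0 (\<lambda>_. 0)) (p a) = peval c0 (p a)"
      proof (rule peval_cong)
        fix y assume "y \<in> pvars (p a)"
        then obtain x where x: "x \<in> pvars (cert_coeff d i j s (snd (wit a)))"
          "y \<in> pvars (case x of CoeffVar a \<Rightarrow> Var a | PointVar b \<Rightarrow> Const (rat_point zs b) | InitVar r \<Rightarrow> Const (fst (wit a) r) | JetVar b p \<Rightarrow> Const 0)"
          unfolding p_def a prod.case pvars_psubst by blast
        have "x \<in> param_vars d (npts s) j" using x(1) pvars_cert_coeff by blast
        then have "y \<in> ?C" using x(2) by (cases x) (auto simp: param_vars_def)
        then show "over ?C c0 (\<lambda>_. 0) y = c0 y" by (simp add: over_def)
      qed
      then show ?thesis unfolding Z_def by (intro peval_zeros_null[OF fC, where ?v0.0 = c0]) (use c0 in simp)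
    qed
    show "system_coeffs d ` ?S - system_coeffs d ` ?good \<subseteq> (\<Union>a\<in>A. Z a)"
    proof
      fix c assume c: "c \<in> system_coeffs d ` ?S - system_coeffs d ` ?good"
      then obtain P where P: "P \<in> systems d" "c = system_coeffs d P" by blast
      show "c \<in> (\<Union>a\<in>A. Z a)"
      proof (rule ccontr)
        assume n: "c \<notin> (\<Union>a\<in>A. Z a)"
        have cC: "c \<in> ?C \<rightarrow>\<^sub>E UNIV" using c img by blast
        have "P \<in> ?good"
        proof (intro CollectI conjI allI P(1))
          fix i j :: 'm
          show "generic_in (param_index j) (Lambda_proj j P)
                {v \<in> Lambda_proj j P. \<not> differentially_algebraic_on (f_domain P j v) (f_fun P i j v)}"
          proof (rule generic_params[OF P])
            fix s zs assume "\<exists>c v q. peval (param_env c v (rat_point zs)) (cert_coeff d i j s q) \<noteq> 0"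
            then have "(i, j, s, zs) \<in> A" unfolding A_def by blast
            then have "c \<notin> Z (i, j, s, zs)" using n by blast
            then have "peval (over ?C c (\<lambda>_. 0)) (p (i, j, s, zs)) \<noteq> 0" using cC unfolding Z_def by blast
            moreover have "peval (over ?C c (\<lambda>_. 0)) (p (i, j, s, zs)) = peval c (p (i, j, s, zs))"
            proof (rule peval_cong)
              fix y assume "y \<in> pvars (p (i, j, s, zs))"
              then obtain x where x: "x \<in> pvars (cert_coeff d i j s (snd (wit (i, j, s, zs))))"
                "y \<in> pvars (case x of CoeffVar a \<Rightarrow> Var a | PointVar b \<Rightarrow> Const (rat_point zs b) | InitVar r \<Rightarrow> Const (fst (wit (i, j, s, zs)) r) | JetVar b p \<Rightarrow> Const 0)"
                unfolding p_def prod.case pvars_psubst by blast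
              have "x \<in> param_vars d (npts s) j" using x(1) pvars_cert_coeff by blast
              then have "y \<in> ?C" using x(2) by (cases x) (auto simp: param_vars_def)
              then show "over ?C c (\<lambda>_. 0) y = c y" by (simp add: over_def)
            qed
            ultimately show "\<exists>v q. peval (param_env c v (rat_point zs)) (cert_coeff d i j s q) \<noteq> 0" unfolding p by metis
          qed (rule certificate_coefficient_nonzero)
        qed
        then show False using c P(2) by blast
      qed
    qed
  qed
qed

section \<open>Algebraic independence of primitives\<close>

text \<open>
  Exponent vectors of monomials in the variables \<open>X\<close> of total degree at most \<open>n\<close>.
\<close>

definition exponents :: "'x set \<Rightarrow> nat \<Rightarrow> ('x \<Rightarrow> nat) set" where
  "exponents X n = {\<mu>. (\<forall>x. x \<notin> X \<longrightarrow> \<mu> x = 0) \<and> sum \<mu> X \<le> n}"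

definition monom_val :: "'x set \<Rightarrow> ('x \<Rightarrow> 'k::field_char_0) \<Rightarrow> ('x \<Rightarrow> nat) \<Rightarrow> 'k" where
  "monom_val X u \<mu> = (\<Prod>x\<in>X. u x ^ \<mu> x)"

lemma finite_exponents:
  assumes "finite X" shows "finite (exponents X n)"
proof (rule finite_subset)
  show "exponents X n \<subseteq> {\<mu>. \<forall>x. (x \<in> X \<longrightarrow> \<mu> x \<in> {..n}) \<and> (x \<notin> X \<longrightarrow> \<mu> x = 0)}"
  proof
    fix \<mu> assume "\<mu> \<in> exponents X n"
    then have m: "\<forall>x. x \<notin> X \<longrightarrow> \<mu> x = 0" "sum \<mu> X \<le> n" by (auto simp: exponents_def)
    have "\<mu> x \<le> n" if "x \<in> X" for x
      by (rule order_trans[OF member_le_sum m(2)]) (use that assms in auto)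
    then show "\<mu> \<in> {\<mu>. \<forall>x. (x \<in> X \<longrightarrow> \<mu> x \<in> {..n}) \<and> (x \<notin> X \<longrightarrow> \<mu> x = 0)}" using m(1) by simp
  qed
  show "finite {\<mu>. \<forall>x. (x \<in> X \<longrightarrow> \<mu> x \<in> {..n}) \<and> (x \<notin> X \<longrightarrow> \<mu> x = 0)}"
    by (rule finite_set_of_finite_funs) (use assms in auto)
qed

lemma exponents_0: "finite X \<Longrightarrow> exponents X 0 = {\<lambda>_. 0}"
  by (auto simp: exponents_def fun_eq_iff)

lemma sum_up:
  assumes "finite X" "x \<in> X" shows "sum (\<mu>(x := Suc (\<mu> x))) X = Suc (sum \<mu> X)"
proof -
  have "sum (\<mu>(x := Suc (\<mu> x))) (X - {x}) = sum \<mu> (X - {x})" by (rule sum.cong) auto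
  then show ?thesis using sum.remove[OF assms, of \<mu>] sum.remove[OF assms, of "\<mu>(x := Suc (\<mu> x))"] by simp
qed

subsection \<open>Polynomial functions over a subfield\<close>

text \<open>
  Functions given by a polynomial over \<open>K\<close>. The coefficients become visible here, as the argument of
  Ostrowski compares them.
\<close>

definition polyfun_over :: "'k set \<Rightarrow> 'x set \<Rightarrow> (('x \<Rightarrow> 'k::field_char_0) \<Rightarrow> 'k) \<Rightarrow> bool" where
  "polyfun_over K X P \<longleftrightarrow> (\<exists>n g. (\<forall>\<mu>. g \<mu> \<in> K) \<and> (\<forall>u. P u = (\<Sum>\<mu>\<in>exponents X n. g \<mu> * monom_val X u \<mu>)))"

definition subfield_set :: "'k::field_char_0 set \<Rightarrow> bool" where
  "subfield_set K \<longleftrightarrow> 0 \<in> K \<and> 1 \<in> K \<and> (\<forall>a\<in>K. \<forall>b\<in>K. a + b \<in> K \<and> a * b \<in> K) \<and> (\<forall>a\<in>K. inverse a \<in> K)"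

lemma subfield_set:
  assumes "subfield_set K"
  shows "0 \<in> K" "1 \<in> K" "a \<in> K \<Longrightarrow> b \<in> K \<Longrightarrow> a + b \<in> K" "a \<in> K \<Longrightarrow> b \<in> K \<Longrightarrow> a * b \<in> K" "a \<in> K \<Longrightarrow> inverse a \<in> K"
  using assms by (auto simp: subfield_set_def)

lemma subfield_set_sum:
  assumes "subfield_set K" "\<And>x. x \<in> A \<Longrightarrow> f x \<in> K" shows "sum f A \<in> K"
  using assms(2) by (induction A rule: infinite_finite_induct) (auto intro: subfield_set[OF assms(1)])

lemma subfield_set_of_nat: "subfield_set K \<Longrightarrow> of_nat n \<in> K"
  by (induction n) (auto intro: subfield_set)

lemma monom_val_add: "monom_val X u (\<lambda>x. \<mu> x + \<nu> x) = monom_val X u \<mu> * monom_val X u \<nu>"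
  by (simp add: monom_val_def power_add prod.distrib)

lemma polyfun_over_const:
  assumes "finite X" "subfield_set K" "c \<in> K" shows "polyfun_over K X (\<lambda>u. c)"
  unfolding polyfun_over_def
  by (rule exI[of _ 0], rule exI[of _ "\<lambda>_. c"]) (use assms in \<open>simp add: exponents_0 monom_val_def\<close>)

lemma polyfun_over_var:
  assumes X: "finite X" and K: "subfield_set K" and x: "x \<in> X" shows "polyfun_over K X (\<lambda>u. u x)"
  unfolding polyfun_over_def
proof (rule exI[of _ 1], rule exI[of _ "\<lambda>\<mu>. if \<mu> = (\<lambda>y. if y = x then 1 else 0) then 1 else 0"], intro conjI allI)
  let ?e = "\<lambda>y. if y = x then 1 else 0 :: nat"
  have e: "?e \<in> exponents X 1" using X x by (auto simp: exponents_def)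
  have m: "monom_val X u ?e = u x" for u :: "'a \<Rightarrow> 'b"
  proof -
    have "monom_val X u ?e = (\<Prod>y\<in>X. if y = x then u y else 1)" unfolding monom_val_def by (rule prod.cong) auto
    then show ?thesis using X x by simp
  qed
  show "(if \<mu> = ?e then 1 else 0) \<in> K" for \<mu> using subfield_set(1,2)[OF K] by simp
  fix u :: "'a \<Rightarrow> 'b"
  have "(\<Sum>\<mu>\<in>exponents X 1. (if \<mu> = ?e then 1 else 0) * monom_val X u \<mu>) = (\<Sum>\<mu>\<in>exponents X 1. if \<mu> = ?e then monom_val X u \<mu> else 0)"
    by (rule sum.cong) auto
  also have "\<dots> = monom_val X u ?e" using finite_exponents[OF X, of 1] e by simp
  finally show "u x = (\<Sum>\<mu>\<in>exponents X 1. (if \<mu> = ?e then 1 else 0) * monom_val X u \<mu>)" using m by simp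
qed

lemma polyfun_over_add:
  assumes X: "finite X" and K: "subfield_set K" and PQ: "polyfun_over K X P" "polyfun_over K X Q"
  shows "polyfun_over K X (\<lambda>u. P u + Q u)"
proof -
  obtain n g where g: "\<And>\<mu>. g \<mu> \<in> K" "\<And>u. P u = (\<Sum>\<mu>\<in>exponents X n. g \<mu> * monom_val X u \<mu>)"
    using PQ(1) unfolding polyfun_over_def by blast
  obtain m h where h: "\<And>\<mu>. h \<mu> \<in> K" "\<And>u. Q u = (\<Sum>\<mu>\<in>exponents X m. h \<mu> * monom_val X u \<mu>)"
    using PQ(2) unfolding polyfun_over_def by blast
  have ext: "(\<Sum>\<mu>\<in>exponents X k. f \<mu> * monom_val X u \<mu>) = (\<Sum>\<mu>\<in>exponents X (n + m). (if \<mu> \<in> exponents X k then f \<mu> else 0) * monom_val X u \<mu>)"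
    if "k \<le> n + m" for k f and u :: "'a \<Rightarrow> 'b"
  proof -
    have "(\<Sum>\<mu>\<in>exponents X k. f \<mu> * monom_val X u \<mu>) = (\<Sum>\<mu>\<in>exponents X k. (if \<mu> \<in> exponents X k then f \<mu> else 0) * monom_val X u \<mu>)"
      by (rule sum.cong) auto
    also have "\<dots> = (\<Sum>\<mu>\<in>exponents X (n + m). (if \<mu> \<in> exponents X k then f \<mu> else 0) * monom_val X u \<mu>)"
      by (rule sum.mono_neutral_left[OF finite_exponents[OF X]]) (use that in \<open>auto simp: exponents_def\<close>)
    finally show ?thesis .
  qed
  show ?thesis unfolding polyfun_over_def
  proof (rule exI[of _ "n + m"], rule exI[of _ "\<lambda>\<mu>. (if \<mu> \<in> exponents X n then g \<mu> else 0) + (if \<mu> \<in> exponents X m then h \<mu> else 0)"], intro conjI allI)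
    show "(if \<mu> \<in> exponents X n then g \<mu> else 0) + (if \<mu> \<in> exponents X m then h \<mu> else 0) \<in> K" for \<mu>
      by (intro subfield_set(3)[OF K]) (use g(1) h(1) subfield_set(1)[OF K] in auto)
    show "P u + Q u = (\<Sum>\<mu>\<in>exponents X (n + m). ((if \<mu> \<in> exponents X n then g \<mu> else 0) + (if \<mu> \<in> exponents X m then h \<mu> else 0)) * monom_val X u \<mu>)" for u
      unfolding g(2) h(2) distrib_right sum.distrib by (subst (1 2) ext) auto
  qed
qed

lemma polyfun_over_mult:
  assumes X: "finite X" and K: "subfield_set K" and PQ: "polyfun_over K X P" "polyfun_over K X Q"
  shows "polyfun_over K X (\<lambda>u. P u * Q u)"
proof -
  obtain n g where g: "\<And>\<mu>. g \<mu> \<in> K" "\<And>u. P u = (\<Sum>\<mu>\<in>exponents X n. g \<mu> * monom_val X u \<mu>)"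
    using PQ(1) unfolding polyfun_over_def by blast
  obtain m h where h: "\<And>\<mu>. h \<mu> \<in> K" "\<And>u. Q u = (\<Sum>\<mu>\<in>exponents X m. h \<mu> * monom_val X u \<mu>)"
    using PQ(2) unfolding polyfun_over_def by blast
  define S where "S = exponents X n \<times> exponents X m"
  define pl where "pl = (\<lambda>(\<mu> :: 'a \<Rightarrow> nat, \<nu> :: 'a \<Rightarrow> nat) x. \<mu> x + \<nu> x)"
  have S: "finite S" unfolding S_def using finite_exponents[OF X] by blast
  have pl: "pl ` S \<subseteq> exponents X (n + m)" unfolding S_def pl_def by (auto simp: exponents_def sum.distrib)
  show ?thesis unfolding polyfun_over_def
  proof (rule exI[of _ "n + m"], rule exI[of _ "\<lambda>\<kappa>. \<Sum>p | p \<in> S \<and> pl p = \<kappa>. g (fst p) * h (snd p)"], intro conjI allI)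
    show "(\<Sum>p | p \<in> S \<and> pl p = \<kappa>. g (fst p) * h (snd p)) \<in> K" for \<kappa>
      by (intro subfield_set_sum[OF K] subfield_set(4)[OF K] g(1) h(1))
    fix u :: "'a \<Rightarrow> 'b"
    have "P u * Q u = (\<Sum>p\<in>S. (g (fst p) * h (snd p)) * monom_val X u (pl p))"
      unfolding g(2) h(2) sum_product S_def sum.cartesian_product
      by (rule sum.cong) (auto simp: pl_def monom_val_add)
    also have "\<dots> = (\<Sum>\<kappa>\<in>exponents X (n + m). \<Sum>p | p \<in> S \<and> pl p = \<kappa>. (g (fst p) * h (snd p)) * monom_val X u (pl p))"
      by (rule sum.group[OF S finite_exponents[OF X] pl, symmetric])
    also have "\<dots> = (\<Sum>\<kappa>\<in>exponents X (n + m). (\<Sum>p | p \<in> S \<and> pl p = \<kappa>. g (fst p) * h (snd p)) * monom_val X u \<kappa>)"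
      unfolding sum_distrib_right by (intro sum.cong refl) auto
    finally show "P u * Q u = (\<Sum>\<kappa>\<in>exponents X (n + m). (\<Sum>p | p \<in> S \<and> pl p = \<kappa>. g (fst p) * h (snd p)) * monom_val X u \<kappa>)" .
  qed
qed

lemma polyfun_over_peval_in:
  assumes X: "finite X" and K: "subfield_set K" and h: "\<And>a. h a \<in> K" and s: "\<And>x. x \<in> X \<Longrightarrow> s x \<in> K" and p: "pvars p \<subseteq> X"
  shows "polyfun_over K X (\<lambda>u. peval_in h (\<lambda>x. u x + s x) p)"
  using p
proof (induction p)
  case (Var x)
  then show ?case by (auto intro!: polyfun_over_add[OF X K] polyfun_over_var[OF X K] polyfun_over_const[OF X K] s)
qed (auto intro!: polyfun_over_add[OF X K] polyfun_over_mult[OF X K] polyfun_over_const[OF X K] h)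

subsection \<open>Derivations\<close>

lemma deriv_power:
  fixes D :: "'k::field_char_0 \<Rightarrow> 'k"
  assumes D_mult: "\<And>a b. D (a * b) = D a * b + a * D b"
  shows "D 1 = 0" "D (a ^ n) = of_nat n * D a * a ^ (n - 1)"
proof -
  show 1: "D 1 = 0" using D_mult[of 1 1] by simp
  show "D (a ^ n) = of_nat n * D a * a ^ (n - 1)"
  proof (induction n)
    case (Suc n)
    then show ?case by (cases n) (simp_all add: D_mult algebra_simps)
  qed (simp add: 1)
qed

lemma deriv_prod:
  fixes D :: "'k::field_char_0 \<Rightarrow> 'k"
  assumes D_mult: "\<And>a b. D (a * b) = D a * b + a * D b" and X: "finite X"
  shows "D (prod f X) = (\<Sum>x\<in>X. D (f x) * prod f (X - {x}))"
  using X
proof (induction X rule: finite_induct)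
  case (insert x X)
  have "(\<Sum>y\<in>X. D (f y) * prod f (insert x X - {y})) = (\<Sum>y\<in>X. f x * (D (f y) * prod f (X - {y})))"
  proof (rule sum.cong)
    fix y assume y: "y \<in> X"
    have "insert x X - {y} = insert x (X - {y})" using insert.hyps y by auto
    then have "prod f (insert x X - {y}) = f x * prod f (X - {y})" using insert.hyps by simp
    then show "D (f y) * prod f (insert x X - {y}) = f x * (D (f y) * prod f (X - {y}))" by (simp add: ac_simps)
  qed simp
  moreover have "insert x X - {x} = X" using insert.hyps by auto
  ultimately show ?case
    unfolding sum.insert[OF insert.hyps(1,2)] prod.insert[OF insert.hyps(1,2)] D_mult insert.IH
    by (simp add: sum_distrib_left)
qed (simp add: deriv_power[OF D_mult])

lemma deriv_sum:
  fixes D :: "'k::field_char_0 \<Rightarrow> 'k"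
  assumes D_add: "\<And>a b. D (a + b) = D a + D b"
  shows "D (sum f X) = (\<Sum>x\<in>X. D (f x))"
proof -
  have "D 0 = 0" using D_add[of 0 0] by simp
  then show ?thesis by (induction X rule: infinite_finite_induct) (auto simp: D_add)
qed

lemma deriv_monom_val:
  fixes D :: "'k::field_char_0 \<Rightarrow> 'k"
  assumes D_mult: "\<And>a b. D (a * b) = D a * b + a * D b" and X: "finite X"
  shows "D (monom_val X \<phi> \<mu>) = (\<Sum>x\<in>X. of_nat (\<mu> x) * D (\<phi> x) * monom_val X \<phi> (\<mu>(x := \<mu> x - 1)))"
  unfolding monom_val_def deriv_prod[OF D_mult X]
proof (rule sum.cong)
  fix x assume x: "x \<in> X"
  have "(\<Prod>y\<in>X - {x}. \<phi> y ^ (\<mu>(x := \<mu> x - 1)) y) = (\<Prod>y\<in>X - {x}. \<phi> y ^ \<mu> y)" by (rule prod.cong) auto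
  then show "D (\<phi> x ^ \<mu> x) * (\<Prod>y\<in>X - {x}. \<phi> y ^ \<mu> y) =
    of_nat (\<mu> x) * D (\<phi> x) * (\<Prod>y\<in>X. \<phi> y ^ (\<mu>(x := \<mu> x - 1)) y)"
    unfolding prod.remove[OF X x, of "\<lambda>y. \<phi> y ^ (\<mu>(x := \<mu> x - 1)) y"] deriv_power(2)[OF D_mult]
    by simp
qed simp

text \<open>
  Applying a derivation to a polynomial relation gives a relation of the same degree whose coefficients
  are read off here. In top degree they are the derivatives of the old coefficients.
\<close>

lemma deriv_relation:
  fixes D :: "'k::field_char_0 \<Rightarrow> 'k"
  assumes D_add: "\<And>a b. D (a + b) = D a + D b" and D_mult: "\<And>a b. D (a * b) = D a * b + a * D b"
    and X: "finite X" and g: "\<And>\<mu>. \<mu> \<notin> exponents X n \<Longrightarrow> g \<mu> = 0"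
  shows "D (\<Sum>\<mu>\<in>exponents X n. g \<mu> * monom_val X \<phi> \<mu>) = (\<Sum>\<mu>\<in>exponents X n.
    (D (g \<mu>) + (\<Sum>x\<in>X. (of_nat (Suc (\<mu> x)) * g (\<mu>(x := Suc (\<mu> x)))) * D (\<phi> x))) * monom_val X \<phi> \<mu>)"
proof -
  let ?M = "exponents X n"
  have one: "(\<Sum>\<mu>\<in>?M. g \<mu> * (of_nat (\<mu> x) * D (\<phi> x) * monom_val X \<phi> (\<mu>(x := \<mu> x - 1)))) =
     (\<Sum>\<mu>\<in>?M. ((of_nat (Suc (\<mu> x)) * g (\<mu>(x := Suc (\<mu> x)))) * D (\<phi> x)) * monom_val X \<phi> \<mu>)" if x: "x \<in> X" for x
  proof -
    let ?B = "{\<nu>. \<nu>(x := Suc (\<nu> x)) \<in> ?M}"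
    have B: "?B \<subseteq> ?M"
    proof
      fix \<nu> assume "\<nu> \<in> ?B"
      then have "\<forall>y. y \<notin> X \<longrightarrow> (\<nu>(x := Suc (\<nu> x))) y = 0" "sum (\<nu>(x := Suc (\<nu> x))) X \<le> n" by (auto simp: exponents_def)
      moreover from this(1) have "\<nu> y = 0" if "y \<notin> X" for y using that x by (metis fun_upd_apply)
      ultimately show "\<nu> \<in> ?M" unfolding sum_up[OF X x] by (simp add: exponents_def)
    qed
    have "(\<Sum>\<mu>\<in>?M. g \<mu> * (of_nat (\<mu> x) * D (\<phi> x) * monom_val X \<phi> (\<mu>(x := \<mu> x - 1)))) =
      (\<Sum>\<mu>\<in>{\<mu> \<in> ?M. \<mu> x > 0}. g \<mu> * (of_nat (\<mu> x) * D (\<phi> x) * monom_val X \<phi> (\<mu>(x := \<mu> x - 1))))"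
      by (rule sum.mono_neutral_right[OF finite_exponents[OF X]]) auto
    also have "\<dots> = (\<Sum>\<mu>\<in>?B. ((of_nat (Suc (\<mu> x)) * g (\<mu>(x := Suc (\<mu> x)))) * D (\<phi> x)) * monom_val X \<phi> \<mu>)"
      by (rule sum.reindex_bij_witness[of _ "\<lambda>\<nu>. \<nu>(x := Suc (\<nu> x))" "\<lambda>\<mu>. \<mu>(x := \<mu> x - 1)"])
        (auto simp: fun_upd_idem ac_simps)
    also have "\<dots> = (\<Sum>\<mu>\<in>?M. ((of_nat (Suc (\<mu> x)) * g (\<mu>(x := Suc (\<mu> x)))) * D (\<phi> x)) * monom_val X \<phi> \<mu>)"
      by (rule sum.mono_neutral_left[OF finite_exponents[OF X] B]) (use g in auto)
    finally show ?thesis .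
  qed
  have "D (\<Sum>\<mu>\<in>?M. g \<mu> * monom_val X \<phi> \<mu>) = (\<Sum>\<mu>\<in>?M. D (g \<mu>) * monom_val X \<phi> \<mu>) +
    (\<Sum>\<mu>\<in>?M. \<Sum>x\<in>X. g \<mu> * (of_nat (\<mu> x) * D (\<phi> x) * monom_val X \<phi> (\<mu>(x := \<mu> x - 1))))"
    unfolding deriv_sum[of D, OF D_add] D_mult deriv_monom_val[of D, OF D_mult X] sum.distrib sum_distrib_left ..
  also have "(\<Sum>\<mu>\<in>?M. \<Sum>x\<in>X. g \<mu> * (of_nat (\<mu> x) * D (\<phi> x) * monom_val X \<phi> (\<mu>(x := \<mu> x - 1)))) =
    (\<Sum>x\<in>X. \<Sum>\<mu>\<in>?M. g \<mu> * (of_nat (\<mu> x) * D (\<phi> x) * monom_val X \<phi> (\<mu>(x := \<mu> x - 1))))" by (rule sum.swap)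
  also have "\<dots> = (\<Sum>x\<in>X. \<Sum>\<mu>\<in>?M. ((of_nat (Suc (\<mu> x)) * g (\<mu>(x := Suc (\<mu> x)))) * D (\<phi> x)) * monom_val X \<phi> \<mu>)"
    by (rule sum.cong[OF refl]) (rule one)
  also have "\<dots> = (\<Sum>\<mu>\<in>?M. \<Sum>x\<in>X. ((of_nat (Suc (\<mu> x)) * g (\<mu>(x := Suc (\<mu> x)))) * D (\<phi> x)) * monom_val X \<phi> \<mu>)"
    by (rule sum.swap)
  finally show ?thesis unfolding distrib_right sum.distrib sum_distrib_right .
qed

text \<open>
  Take a nontrivial relation of least degree with the fewest terms of top degree, and normalize one top
  coefficient to \<open>1\<close>. Its derivative has fewer top terms, so it is trivial. In top degree this says that
  the coefficients are constants; one degree lower it says that a combination of the \<open>D (\<phi> x)\<close> with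
  these constants is the derivative of an element of \<open>K\<close>, which the assumption excludes.
\<close>

theorem ostrowski:
  fixes D :: "'k::field_char_0 \<Rightarrow> 'k"
  assumes D_add: "\<And>a b. D (a + b) = D a + D b" and D_mult: "\<And>a b. D (a * b) = D a * b + a * D b"
    and K: "subfield_set K" "\<And>a. a \<in> K \<Longrightarrow> D a \<in> K"
    and X: "finite X" "\<And>x. x \<in> X \<Longrightarrow> D (\<phi> x) \<in> K"
    and indep: "\<And>a k. (\<And>x. x \<in> X \<Longrightarrow> D (a x) = 0) \<Longrightarrow> k \<in> K \<Longrightarrow>
       (\<Sum>x\<in>X. a x * D (\<phi> x)) + D k = 0 \<Longrightarrow> \<forall>x\<in>X. a x = 0"
  shows "(\<forall>\<mu>. g \<mu> \<in> K) \<Longrightarrow> (\<Sum>\<mu>\<in>exponents X n. g \<mu> * monom_val X \<phi> \<mu>) = 0 \<Longrightarrow> \<forall>\<mu>\<in>exponents X n. g \<mu> = 0"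
proof (induction n arbitrary: g rule: less_induct)
  case (less n)
  let ?M = "exponents X n" and ?V = "\<lambda>g. \<Sum>\<mu>\<in>exponents X n. g \<mu> * monom_val X \<phi> \<mu>"
  define S where "S g \<longleftrightarrow> (\<forall>\<mu>. g \<mu> \<in> K) \<and> ?V g = 0 \<and> (\<exists>\<mu>\<in>?M. g \<mu> \<noteq> 0)" for g
  define top where "top g = {\<mu> \<in> ?M. sum \<mu> X = n \<and> g \<mu> \<noteq> 0}" for g :: "('a \<Rightarrow> nat) \<Rightarrow> 'k"
  have fin: "finite ?M" by (rule finite_exponents[OF X(1)])
  have ft: "finite (top g)" for g unfolding top_def using fin by simp
  have D0: "D 0 = 0" using D_add[of 0 0] by simp
  have Dn: "D (of_nat k) = 0" for k by (induction k) (simp_all add: D0 D_add deriv_power(1)[of D, OF D_mult])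
  show ?case
  proof (rule ccontr)
    assume "\<not> (\<forall>\<mu>\<in>?M. g \<mu> = 0)"
    then have "S g" using less.prems unfolding S_def by blast
    from ex_has_least_nat[of S g "\<lambda>g. card (top g)", OF this] obtain f where
      f: "S f" "\<And>f'. S f' \<Longrightarrow> card (top f) \<le> card (top f')" by blast
    \<comment> \<open>Without terms of top degree the relation would have smaller degree.\<close>
    have "top f \<noteq> {}"
    proof
      assume t: "top f = {}"
      show False
      proof (cases n)
        case 0
        obtain \<mu> where \<mu>: "\<mu> \<in> ?M" "f \<mu> \<noteq> 0" using f(1) unfolding S_def by blast
        then have "sum \<mu> X = n" using 0 by (simp add: exponents_def)
        then show False using \<mu> t unfolding top_def by blast
      next
        case (Suc m)
        have sub: "exponents X m \<subseteq> ?M" unfolding Suc by (auto simp: exponents_def)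
        have z: "f \<mu> = 0" if "\<mu> \<in> ?M - exponents X m" for \<mu>
        proof -
          have "sum \<mu> X = n" using that Suc by (auto simp: exponents_def)
          then show ?thesis using t that unfolding top_def by blast
        qed
        have "(\<Sum>\<mu>\<in>exponents X m. f \<mu> * monom_val X \<phi> \<mu>) = ?V f"
          by (rule sum.mono_neutral_left[OF fin sub]) (simp add: z)
        then have "\<forall>\<mu>\<in>exponents X m. f \<mu> = 0"
          by (intro less.IH) (use Suc f(1) in \<open>auto simp: S_def\<close>)
        then show False using f(1) z unfolding S_def by blast
      qed
    qed
    then obtain \<mu>0 where \<mu>0: "\<mu>0 \<in> top f" by blast
    then have \<mu>0': "\<mu>0 \<in> ?M" "sum \<mu>0 X = n" "f \<mu>0 \<noteq> 0" by (auto simp: top_def)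
    define f1 where "f1 \<mu> = (if \<mu> \<in> ?M then inverse (f \<mu>0) * f \<mu> else 0)" for \<mu>
    have f1K: "f1 \<mu> \<in> K" for \<mu> using f(1) subfield_set[OF K(1)] unfolding f1_def S_def by simp
    have f1out: "\<mu> \<notin> ?M \<Longrightarrow> f1 \<mu> = 0" for \<mu> by (simp add: f1_def)
    have f10: "f1 \<mu>0 = 1" using \<mu>0' by (simp add: f1_def)
    have "?V f1 = inverse (f \<mu>0) * ?V f" unfolding sum_distrib_left
      by (rule sum.cong) (auto simp: f1_def)
    then have Vf1: "?V f1 = 0" using f(1) by (simp add: S_def)
    have top1: "top f1 = top f" using \<mu>0' by (auto simp: top_def f1_def)
    define f2 where "f2 \<mu> = D (f1 \<mu>) + (\<Sum>x\<in>X. (of_nat (Suc (\<mu> x)) * f1 (\<mu>(x := Suc (\<mu> x)))) * D (\<phi> x))" for \<mu>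
    have "?V f2 = D (?V f1)" unfolding f2_def
      by (rule deriv_relation[of D, OF D_add D_mult X(1) f1out, symmetric])
    then have Vf2: "?V f2 = 0" using Vf1 D0 by simp
    have f2K: "f2 \<mu> \<in> K" for \<mu> unfolding f2_def
      by (intro subfield_set(3,4)[OF K(1)] subfield_set_sum[OF K(1)] subfield_set_of_nat[OF K(1)] K(2) f1K X(2))
    have f2top: "f2 \<mu> = D (f1 \<mu>)" if "sum \<mu> X = n" for \<mu>
    proof -
      have "f1 (\<mu>(x := Suc (\<mu> x))) = 0" if "x \<in> X" for x
      proof (rule f1out)
        have "sum (\<mu>(x := Suc (\<mu> x))) X = Suc n" using sum_up[OF X(1) that] \<open>sum \<mu> X = n\<close> by simp
        then show "\<mu>(x := Suc (\<mu> x)) \<notin> ?M" by (simp add: exponents_def del: fun_upd_apply)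
      qed
      then show ?thesis unfolding f2_def by simp
    qed
    have "top f2 \<subseteq> top f1"
      using f2top D0 unfolding top_def by auto
    moreover have "\<mu>0 \<notin> top f2" using f2top[OF \<mu>0'(2)] f10 deriv_power(1)[of D, OF D_mult] unfolding top_def by simp
    ultimately have "top f2 \<subset> top f" using \<mu>0 top1 by blast
    then have "card (top f2) < card (top f)" by (rule psubset_card_mono[OF ft])
    then have "\<not> S f2" using f(2)[of f2] by linarith
    then have f2z: "\<And>\<mu>. \<mu> \<in> ?M \<Longrightarrow> f2 \<mu> = 0" using f2K Vf2 unfolding S_def by blast
    show False
    proof (cases "n = 0")
      case True
      then have "?M = {\<lambda>_. 0}" using exponents_0[OF X(1)] by simp
      then show False using Vf1 \<mu>0'(1) f10 by (simp add: monom_val_def)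
    next
      case False
      then obtain x0 where x0: "x0 \<in> X" "\<mu>0 x0 > 0" using \<mu>0'(2) by (metis gr0I sum.neutral)
      \<comment> \<open>The coefficient one degree below a top monomial.\<close>
      define \<nu> where "\<nu> = \<mu>0(x0 := \<mu>0 x0 - 1)"
      have up: "\<nu>(x0 := Suc (\<nu> x0)) = \<mu>0" using x0 unfolding \<nu>_def by auto
      have s\<nu>: "Suc (sum \<nu> X) = n" using sum_up[OF X(1) x0(1), of \<nu>] up \<mu>0'(2) by simp
      have \<nu>M: "\<nu> \<in> ?M" using s\<nu> \<mu>0'(1) x0 by (auto simp: exponents_def \<nu>_def)
      define a where "a x = of_nat (Suc (\<nu> x)) * f1 (\<nu>(x := Suc (\<nu> x)))" for x
      have "\<forall>x\<in>X. a x = 0"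
      proof (rule indep)
        show "f1 \<nu> \<in> K" by (rule f1K)
        show "(\<Sum>x\<in>X. a x * D (\<phi> x)) + D (f1 \<nu>) = 0"
          using f2z[OF \<nu>M] unfolding f2_def a_def by (simp only: add.commute)
        fix x assume x: "x \<in> X"
        have s: "sum (\<nu>(x := Suc (\<nu> x))) X = n" using sum_up[OF X(1) x, of \<nu>] s\<nu> by simp
        have "\<nu>(x := Suc (\<nu> x)) \<in> ?M"
          using \<nu>M s x unfolding exponents_def by auto
        then have "D (f1 (\<nu>(x := Suc (\<nu> x)))) = 0" using f2z f2top[OF s] by metis
        then show "D (a x) = 0" unfolding a_def D_mult Dn by simp
      qed
      then have "a x0 = 0" using x0(1) by blast
      then have "of_nat (Suc (\<nu> x0)) = (0 :: 'k)" unfolding a_def up f10 by simp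
      then show False using of_nat_neq_0 by blast
    qed
  qed
qed

text \<open>
  A relation between primitives shifted by elements of \<open>K\<close> makes every coefficient zero, and a
  polynomial with zero coefficients vanishes at all arguments.
\<close>

theorem pexp_relation_trivial:
  fixes D :: "'k::field_char_0 \<Rightarrow> 'k"
  assumes D_add: "\<And>a b. D (a + b) = D a + D b" and D_mult: "\<And>a b. D (a * b) = D a * b + a * D b"
    and K: "subfield_set K" "\<And>a. a \<in> K \<Longrightarrow> D a \<in> K"
    and X: "finite X" "\<And>x. x \<in> X \<Longrightarrow> D (\<phi> x) \<in> K"
    and indep: "\<And>a k. (\<And>x. x \<in> X \<Longrightarrow> D (a x) = 0) \<Longrightarrow> k \<in> K \<Longrightarrow>
       (\<Sum>x\<in>X. a x * D (\<phi> x)) + D k = 0 \<Longrightarrow> \<forall>x\<in>X. a x = 0"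
    and h: "\<And>a. h a \<in> K" and s: "\<And>x. x \<in> X \<Longrightarrow> s x \<in> K" and p: "pvars p \<subseteq> X"
    and rel: "peval_in h (\<lambda>x. \<phi> x + s x) p = 0"
  shows "peval_in h c p = 0"
proof -
  obtain n g where g: "\<And>\<mu>. g \<mu> \<in> K" "\<And>u. peval_in h (\<lambda>x. u x + s x) p = (\<Sum>\<mu>\<in>exponents X n. g \<mu> * monom_val X u \<mu>)"
    using polyfun_over_peval_in[of X K h s p, OF X(1) K(1) h s p] unfolding polyfun_over_def by blast
  have "\<forall>\<mu>\<in>exponents X n. g \<mu> = 0"
    by (rule ostrowski[of D K X \<phi>, OF D_add D_mult K X indep]) (use g rel in auto)
  then have "peval_in h (\<lambda>x. (c x - s x) + s x) p = 0" using g(2)[of "\<lambda>x. c x - s x"] by simp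
  then show ?thesis by simp
qed

section \<open>Integrals of logistic functions\<close>

definition logistic_num :: "nat \<Rightarrow> 'a \<Rightarrow> 'a \<Rightarrow> 'a::field_char_0" where
  "logistic_num l E z = (if l = 0 then z * E else (-1) ^ (l - 1) * fact l * E * (E - 1) ^ (l - 1))"

text \<open>
  The \<open>l\<close>-th derivative with respect to \<open>z\<close> of \<open>z E / (1 + z (E - 1))\<close>, written with its numerator so
  that the pole of order \<open>l + 1\<close> is visible.
\<close>

definition logistic_deriv :: "nat \<Rightarrow> 'a \<Rightarrow> 'a \<Rightarrow> 'a::field_char_0" where
  "logistic_deriv l E z = logistic_num l E z / (1 + z * (E - 1)) ^ Suc l"

lemma of_real_logistic_deriv: "of_real (logistic_deriv l E z) = (logistic_deriv l (of_real E) (of_real z) :: complex)"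
  by (simp add: logistic_deriv_def logistic_num_def)

lemma logistic_denominator_pos:
  fixes z :: real
  assumes "0 < z" "z < 1" "0 < E" shows "0 < 1 + z * (E - 1)"
proof -
  have "0 < z * E" using assms by simp
  moreover have "1 + z * (E - 1) = (1 - z) + z * E" by (simp add: algebra_simps)
  ultimately show ?thesis using assms(2) by linarith
qed

lemma logistic_deriv_has_derivative:
  fixes z :: real
  assumes "0 < z" "z < 1" "0 < E"
  shows "((\<lambda>z. logistic_deriv l E z) has_real_derivative logistic_deriv (Suc l) E z) (at z)"
proof -
  define c where "c = 1 + z * (E - 1)"
  have c: "c \<noteq> 0" using logistic_denominator_pos[OF assms] by (simp add: c_def)
  show ?thesis
  proof (cases l)
    case 0
    have "((\<lambda>z. z * E / (1 + z * (E - 1))) has_real_derivative (E * c - z * E * (E - 1)) / (c * c)) (at z)"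
      unfolding c_def by (rule derivative_eq_intros refl | use c in \<open>simp add: c_def\<close>)+
    moreover have "(E * c - z * E * (E - 1)) / (c * c) = E / (c * c)" by (simp add: c_def algebra_simps)
    ultimately have "((\<lambda>z. z * E / (1 + z * (E - 1))) has_real_derivative E / (c * c)) (at z)" by (simp only:)
    then show ?thesis by (simp add: 0 logistic_deriv_def logistic_num_def c_def power2_eq_square)
  next
    case (Suc m)
    define a where "a = (-1) ^ m * fact (Suc m) * E * (E - 1) ^ m"
    have "((\<lambda>z. a / (1 + z * (E - 1)) ^ Suc (Suc m)) has_real_derivative
      - (a * (real (Suc (Suc m)) * (E - 1) * c ^ Suc m)) / (c ^ Suc (Suc m) * c ^ Suc (Suc m))) (at z)"
      unfolding c_def by (rule derivative_eq_intros refl | use c in \<open>simp add: c_def\<close>)+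
    then have "((\<lambda>z. a / (1 + z * (E - 1)) ^ Suc (Suc m)) has_real_derivative
      (- a * real (Suc (Suc m)) * (E - 1)) / c ^ Suc (Suc (Suc m))) (at z)"
      by (rule back_subst[of "\<lambda>D. (_ has_real_derivative D) (at z)"]) (use c in \<open>simp add: field_simps\<close>)
    moreover have "- a * real (Suc (Suc m)) * (E - 1) = (-1) ^ Suc m * fact (Suc (Suc m)) * E * (E - 1) ^ Suc m"
      unfolding a_def fact_Suc[of "Suc m"] by (simp only: power_Suc of_nat_mult of_nat_id mult_ac mult_minus_left mult_1_left mult_minus_right of_nat_fact)
    moreover have "logistic_deriv (Suc (Suc m)) E z = ((-1) ^ Suc m * fact (Suc (Suc m)) * E * (E - 1) ^ Suc m) / c ^ Suc (Suc (Suc m))"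
      by (simp add: logistic_deriv_def logistic_num_def c_def del: fact_Suc power_Suc of_nat_Suc)
    moreover have "(\<lambda>z. logistic_deriv (Suc m) E z) = (\<lambda>z. a / (1 + z * (E - 1)) ^ Suc (Suc m))"
      by (simp add: logistic_deriv_def logistic_num_def a_def del: fact_Suc power_Suc of_nat_Suc)
    ultimately show ?thesis unfolding Suc by (simp only:)
  qed
qed

lemma higher_deriv_logistic:
  fixes z :: real
  assumes "0 < z" "z < 1" "0 < E"
  shows "(deriv ^^ l) (\<lambda>z. z * E / (1 + z * (E - 1))) z = logistic_deriv l E z"
  using assms
proof (induction l arbitrary: z)
  case 0
  then show ?case by (simp add: logistic_deriv_def logistic_num_def)
next
  case (Suc l)
  have "((deriv ^^ l) (\<lambda>z. z * E / (1 + z * (E - 1))) has_real_derivative logistic_deriv (Suc l) E z) (at z)"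
    by (rule has_field_derivative_transform_within_open[OF logistic_deriv_has_derivative, where S = "{0<..<1}"])
      (use Suc in auto)
  then show ?case by (simp add: DERIV_imp_deriv)
qed

lemma deriv_shift_fun: "deriv (\<lambda>h. f (c + h)) = (\<lambda>h. deriv f (c + h :: complex))"
proof
  fix h
  have "(\<lambda>h. f (c + h)) = (\<lambda>h. f (h + c))" by (simp add: add.commute)
  then show "deriv (\<lambda>h. f (c + h)) h = deriv f (c + h)"
    unfolding deriv_def by (simp add: DERIV_shift[symmetric] add.commute)
qed

text \<open>
  If \<open>F\<close> has the same principal part with coefficients \<open>a\<close> and order \<open>N\<close> at all \<open>p k\<close>, then the residue
  of \<open>F v / v\<close> at \<open>p k\<close> is a polynomial in \<open>1 / p k\<close> whose coefficients are, up to sign, those of the principal part. It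
  vanishes at infinitely many arguments because derivatives have no residues.
\<close>

lemma no_pole_if_residues_vanish:
  fixes F :: "complex \<Rightarrow> complex" and p :: "nat \<Rightarrow> complex"
  assumes A: "\<And>k. (\<lambda>h. F (p k + h)) has_laurent_expansion A"
    and res: "\<And>k. \<exists>H. (\<lambda>h. F (p k + h) / (p k + h)) has_laurent_expansion fls_deriv H"
    and inf: "infinite (range p)" and p0: "\<And>k. p k \<noteq> 0"
  shows "fls_subdegree A \<ge> 0"
proof (rule ccontr)
  assume neg: "\<not> fls_subdegree A \<ge> 0"
  then have A0: "A \<noteq> 0" by auto
  define N where "N = nat (- fls_subdegree A)"
  have N: "N > 0" "int N = - fls_subdegree A" using neg by (auto simp: N_def)
  define a where "a = fls_base_factor_to_fps A"
  have Aa: "A = fls_shift (int N) (fps_to_fls a)"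
    unfolding a_def N(2) by (rule fls_conv_base_factor_to_fps_shift_subdegree)
  have a0: "fps_nth a 0 \<noteq> 0" unfolding a_def using A0 by simp
  define Q where "Q = (\<Sum>i<N. monom (fps_nth a i * (-1) ^ (N - 1 - i)) i)"
  have root: "poly Q (p k) = 0" for k
  proof -
    define B where "B = Abs_fps (\<lambda>n. (-1) ^ n / p k ^ Suc n)"
    have "(fps_const (p k) + fps_X) * B = 1"
    proof (rule fps_ext)
      fix n show "fps_nth ((fps_const (p k) + fps_X) * B) n = fps_nth 1 n"
        using p0[of k] by (cases n) (simp_all add: B_def distrib_right)
    qed
    then have inv: "inverse (fps_const (p k) + fps_X) = B" by (rule fps_inverse_unique)
    have "(\<lambda>h. inverse (p k + h)) has_fps_expansion inverse (fps_const (p k) + fps_X)"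
      by (intro fps_expansion_intros) (use p0[of k] in simp)
    then have "(\<lambda>h. inverse (p k + h)) has_laurent_expansion fps_to_fls B"
      unfolding inv by (rule has_laurent_expansion_fps)
    from has_laurent_expansion_mult[OF A[of k] this]
    have "(\<lambda>h. F (p k + h) / (p k + h)) has_laurent_expansion A * fps_to_fls B" by (simp add: divide_inverse)
    moreover obtain H where "(\<lambda>h. F (p k + h) / (p k + h)) has_laurent_expansion fls_deriv H" using res by blast
    ultimately have "A * fps_to_fls B = fls_deriv H" by (rule has_laurent_expansion_unique)
    then have z: "fls_nth (A * fps_to_fls B) (-1) = 0" by (simp only: fls_deriv_residue)
    have "A * fps_to_fls B = fls_shift (int N) (fps_to_fls (a * B))"
      unfolding Aa by (simp add: fls_times_fps_to_fls fls_shifted_times_simps)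
    then have "fls_nth (A * fps_to_fls B) (-1) = fps_nth (a * B) (N - 1)" using N(1) by (simp add: nat_diff_distrib)
    then have "fps_nth (a * B) (N - 1) = 0" using z by simp
    then have "p k ^ N * (\<Sum>i=0..N - 1. fps_nth a i * ((-1) ^ (N - 1 - i) / p k ^ Suc (N - 1 - i))) = 0"
      by (simp add: fps_mult_nth B_def)
    also have "p k ^ N * (\<Sum>i=0..N - 1. fps_nth a i * ((-1) ^ (N - 1 - i) / p k ^ Suc (N - 1 - i))) = poly Q (p k)"
      unfolding Q_def poly_sum poly_monom sum_distrib_left
    proof (rule sum.cong)
      fix i assume "i \<in> {..<N}"
      then have "p k ^ N = p k ^ Suc (N - 1 - i) * p k ^ i" unfolding power_add[symmetric] by simp
      then show "p k ^ N * (fps_nth a i * ((-1) ^ (N - 1 - i) / p k ^ Suc (N - 1 - i))) =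
        fps_nth a i * (-1) ^ (N - 1 - i) * p k ^ i" using p0[of k] by (simp del: power_Suc)
    qed (use N(1) in auto)
    finally show ?thesis .
  qed
  have "range p \<subseteq> {x. poly Q x = 0}" using root by auto
  then have "Q = 0" using inf poly_roots_finite[of Q] finite_subset by blast
  then have "0 = coeff Q 0" by simp
  also have "\<dots> = (\<Sum>i<N. if i = 0 then fps_nth a i * (-1) ^ (N - 1 - i) else 0)"
    unfolding Q_def coeff_sum by (rule sum.cong) (auto simp: coeff_monom)
  also have "\<dots> = fps_nth a 0 * (-1) ^ (N - 1)" using N(1) by simp
  finally show False using a0 by simp
qed

lemma meromorphic_logistic_deriv: "(\<lambda>v. logistic_deriv l (exp (v - 1)) c) meromorphic_on UNIV"
proof -
  have "(\<lambda>v :: complex. exp (v - 1)) meromorphic_on UNIV"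
    by (intro analytic_on_imp_meromorphic_on analytic_intros)
  then show ?thesis unfolding logistic_deriv_def logistic_num_def by (cases "l = 0") (auto intro!: meromorphic_intros)
qed

text \<open>
  Identity theorem for meromorphic functions on the plane.
\<close>

lemma meromorphic_eventually_zero:
  assumes f: "f meromorphic_on UNIV" and z: "eventually (\<lambda>v. f v = 0) (at (a :: complex))"
  shows "eventually (\<lambda>v. f v = 0) (at b)"
proof -
  have "eventually (\<lambda>z. f z = 0) (cosparse UNIV) \<or> eventually (\<lambda>z. f z \<noteq> 0) (cosparse UNIV)"
    by (rule meromorphic_imp_constant_or_avoid[OF f]) auto
  moreover have "\<not> eventually (\<lambda>z. f z \<noteq> 0) (cosparse UNIV)"
  proof
    assume "eventually (\<lambda>z. f z \<noteq> 0) (cosparse UNIV)"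
    then have "eventually (\<lambda>z. f z \<noteq> 0) (at a)" by (rule eventually_cosparse_imp_eventually_at) simp
    with z have "eventually (\<lambda>_. False) (at a)" by eventually_elim simp
    then show False by simp
  qed
  ultimately have "eventually (\<lambda>z. f z = 0) (cosparse UNIV)" by blast
  then show ?thesis by (rule eventually_cosparse_imp_eventually_at) simp
qed

text \<open>
  The combination has period \<open>2 \<pi> \<i>\<close>, so by the preceding lemma it has no pole at the points over
  \<open>exp (v - 1) = 1 - 1 / z b0\<close>. But among the terms with nonzero coefficient and first index \<open>b0\<close> the one
  of highest order \<open>L\<close> has a pole of order \<open>L + 1\<close> there that nothing else cancels: the other points
  have their poles elsewhere, as they are distinct.
\<close>

lemma no_meromorphic_primitive:
  fixes X :: "(nat \<times> nat) set" and z :: "nat \<Rightarrow> real" and \<alpha> :: "nat \<times> nat \<Rightarrow> complex"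
  assumes X: "finite X" and inj: "inj_on z (fst ` X)" and z01: "\<And>b. b \<in> fst ` X \<Longrightarrow> 0 < z b \<and> z b < 1"
    and g: "g meromorphic_on UNIV"
    and eq: "eventually (\<lambda>v. (\<Sum>x\<in>X. \<alpha> x * (logistic_deriv (snd x) (exp (v - 1)) (of_real (z (fst x))) / v)) + deriv g v = 0) (at 1)"
  shows "\<forall>x\<in>X. \<alpha> x = 0"
proof (rule ccontr)
  assume "\<not> ?thesis"
  then obtain b0 l0 where bl: "(b0, l0) \<in> X" "\<alpha> (b0, l0) \<noteq> 0" by auto
  define L where "L = Max {l. (b0, l) \<in> X \<and> \<alpha> (b0, l) \<noteq> 0}"
  have "{l. (b0, l) \<in> X \<and> \<alpha> (b0, l) \<noteq> 0} \<subseteq> snd ` X" by force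
  then have finL: "finite {l. (b0, l) \<in> X \<and> \<alpha> (b0, l) \<noteq> 0}" using X by (simp add: finite_subset)
  have L: "(b0, L) \<in> X" "\<alpha> (b0, L) \<noteq> 0"
    using Max_in[OF finL] bl unfolding L_def by auto
  have Lmax: "l \<le> L" if "(b0, l) \<in> X" "\<alpha> (b0, l) \<noteq> 0" for l
    unfolding L_def by (rule Max_ge[OF finL]) (use that in simp)
  define z0 where "z0 = z b0"
  have z0: "0 < z0" "z0 < 1" using z01[of b0] bl(1) unfolding z0_def by force+
  \<comment> \<open>The value of \<open>exp (v - 1)\<close> at which the denominator belonging to \<open>z0\<close> vanishes; it is negative.\<close>
  define E0 where "E0 = complex_of_real (1 - 1 / z0)"
  have E0: "E0 \<noteq> 0" "E0 - 1 \<noteq> 0" "1 + of_real z0 * (E0 - 1) = 0"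
  proof -
    have "1 - 1 / z0 \<noteq> 0" using z0 by simp
    then show "E0 \<noteq> 0" unfolding E0_def by (simp only: of_real_eq_0_iff not_False_eq_True)
    have "E0 - 1 = - (1 / of_real z0)" by (simp add: E0_def)
    then show "E0 - 1 \<noteq> 0" "1 + of_real z0 * (E0 - 1) = 0" using z0 by simp_all
  qed
  \<comment> \<open>The solutions of \<open>exp (v - 1) = E0\<close> in the upper half plane.\<close>
  define p where "p k = 1 + Complex (ln (1 / z0 - 1)) (pi * real (2 * k + 1))" for k :: nat
  have pk: "exp (p k - 1) = E0" for k
  proof -
    have c: "cis (pi * real (2 * k + 1)) = - 1"
      by (rule complex_eqI) (simp_all only: cis.sel cos_npi2 sin_npi2, simp_all)
    have "1 / z0 > 1" using z0 by simp
    then have "exp (p k - 1) = complex_of_real (1 / z0 - 1) * cis (pi * real (2 * k + 1))"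
      unfolding p_def exp_eq_polar by simp
    then show ?thesis unfolding c E0_def by simp
  qed
  have Imp: "Im (p k) = pi * real (2 * k + 1)" for k by (simp add: p_def)
  have p0: "p k \<noteq> 0" for k
  proof
    assume "p k = 0"
    then have "pi * real (2 * k + 1) = 0" using Imp[of k] by simp
    then show False using pi_neq_zero by (simp del: of_nat_Suc of_nat_add)
  qed
  have "inj p"
  proof (rule injI)
    fix k k' assume "p k = p k'"
    then have "pi * real (2 * k + 1) = pi * real (2 * k' + 1)" using Imp by metis
    then show "k = k'" by simp
  qed
  then have infp: "infinite (range p)" by (rule range_inj_infinite)
  define F where "F v = (\<Sum>x\<in>X. \<alpha> x * logistic_deriv (snd x) (exp (v - 1)) (of_real (z (fst x))))" for v :: complex
  define F1 where "F1 h = (\<Sum>x\<in>X. \<alpha> x * logistic_deriv (snd x) (E0 * exp h) (of_real (z (fst x))))" for h :: complex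
  have FF1: "F (p k + h) = F1 h" for k h
  proof -
    have "exp (p k + h - 1) = exp ((p k - 1) + h)" by (simp add: algebra_simps)
    also have "\<dots> = E0 * exp h" unfolding exp_add pk ..
    finally show ?thesis by (simp add: F_def F1_def)
  qed
  have Fm: "F meromorphic_on UNIV" unfolding F_def by (intro meromorphic_intros meromorphic_logistic_deriv)
  define A where "A = laurent_expansion F (p 0)"
  have "(\<lambda>h. F (p 0 + h)) has_laurent_expansion A"
    unfolding A_def by (rule meromorphic_on_imp_has_laurent_expansion[OF Fm]) simp
  then have A1: "F1 has_laurent_expansion A" unfolding FF1 .
  have sub: "fls_subdegree A \<ge> 0"
  proof (rule no_pole_if_residues_vanish[OF _ _ infp p0])
    fix k
    show "(\<lambda>h. F (p k + h)) has_laurent_expansion A" using A1 unfolding FF1 .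
    have "eventually (\<lambda>v. F v / v + deriv g v = 0) (at 1)"
      using eq unfolding F_def sum_divide_distrib by (simp add: divide_inverse mult.assoc)
    moreover have "(\<lambda>v. F v / v + deriv g v) meromorphic_on UNIV" by (intro meromorphic_intros Fm g)
    ultimately have "eventually (\<lambda>v. F v / v + deriv g v = 0) (at (p k))" by (rule meromorphic_eventually_zero[rotated])
    then have peval: "eventually (\<lambda>v. - deriv g v = F v / v) (at (p k))"
      by eventually_elim (simp add: eq_neg_iff_add_eq_0 neg_eq_iff_add_eq_0 add.commute)
    have "(\<lambda>h. g (p k + h)) has_laurent_expansion laurent_expansion g (p k)"
      by (rule meromorphic_on_imp_has_laurent_expansion[OF g]) simp
    from has_laurent_expansion_minus[OF has_laurent_expansion_deriv[OF this]]
    have "(\<lambda>h. - deriv g (p k + h)) has_laurent_expansion fls_deriv (- laurent_expansion g (p k))"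
      unfolding deriv_shift_fun by simp
    then have "(\<lambda>h. F (p k + h) / (p k + h)) has_laurent_expansion fls_deriv (- laurent_expansion g (p k))"
      using has_laurent_expansion_cong'[OF peval refl refl] by blast
    then show "\<exists>H. (\<lambda>h. F (p k + h) / (p k + h)) has_laurent_expansion fls_deriv H" by blast
  qed
  \<comment> \<open>Multiplying by this denominator to the power \<open>L + 1\<close> isolates the leading term.\<close>
  define dn where "dn b h = 1 + complex_of_real (z b) * (E0 * exp h - 1)" for b h
  have tdn: "((\<lambda>h. dn b h) \<longlongrightarrow> 1 + of_real (z b) * (E0 - 1)) (at 0)" for b
    unfolding dn_def by (auto intro!: tendsto_eq_intros)
  have tdn0: "((\<lambda>h. dn b0 h) \<longlongrightarrow> 0) (at 0)" using tdn[of b0] E0(3) unfolding z0_def by simp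
  have tN: "((\<lambda>h. logistic_num l (E0 * exp h) c) \<longlongrightarrow> logistic_num l E0 c) (at 0)" for l c
    unfolding logistic_num_def by (auto intro!: tendsto_eq_intros)
  have "(F1 \<longlongrightarrow> fls_nth A 0) (at 0)" by (rule has_laurent_expansion_imp_tendsto_0[OF A1 sub])
  then have lim0: "((\<lambda>h. F1 h * dn b0 h ^ Suc L) \<longlongrightarrow> 0) (at 0)"
    using tendsto_mult[OF _ tendsto_power[OF tdn0, of "Suc L"], of F1 "fls_nth A 0"] by simp
  have nz: "eventually (\<lambda>h. dn b0 h \<noteq> 0) (at 0)"
  proof -
    have "((\<lambda>h. (exp (0 + h) - exp 0) / h) \<longlongrightarrow> exp (0 :: complex)) (at 0)"
      using DERIV_exp[of "0 :: complex"] unfolding DERIV_def .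
    then have "eventually (\<lambda>h :: complex. (exp (0 + h) - exp 0) / h \<noteq> 0) (at 0)"
      by (rule tendsto_imp_eventually_ne) simp
    then show ?thesis
    proof eventually_elim
      case (elim h)
      then have "exp h \<noteq> 1" by auto
      have "dn b0 h = (1 + of_real z0 * (E0 - 1)) + of_real z0 * E0 * (exp h - 1)"
        by (simp add: dn_def z0_def algebra_simps)
      then have "dn b0 h = of_real z0 * E0 * (exp h - 1)" using E0(3) by simp
      then show ?case using \<open>exp h \<noteq> 1\<close> E0(1) z0 by simp
    qed
  qed
  define lm where "lm x = (if x = (b0, L) then \<alpha> x * logistic_num L E0 (of_real z0) else 0)" for x
  have tm: "((\<lambda>h. \<alpha> x * logistic_deriv (snd x) (E0 * exp h) (of_real (z (fst x))) * dn b0 h ^ Suc L) \<longlongrightarrow> lm x) (at 0)"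
    if x: "x \<in> X" for x
  proof -
    obtain b l where bl: "x = (b, l)" by (cases x)
    show ?thesis
    proof (cases "b = b0")
      case True
      show ?thesis
      proof (cases "\<alpha> x = 0")
        case False
        then have "l \<le> L" using Lmax[of l] x bl True by simp
        have lim: "((\<lambda>h. \<alpha> x * (logistic_num l (E0 * exp h) (of_real z0) * dn b0 h ^ (L - l))) \<longlongrightarrow> \<alpha> x * (logistic_num l E0 (of_real z0) * 0 ^ (L - l))) (at 0)"
          by (intro tendsto_intros tN tdn0)
        have lme: "\<alpha> x * (logistic_num l E0 (of_real z0) * 0 ^ (L - l)) = lm x"
          using \<open>l \<le> L\<close> by (cases "l = L") (auto simp: lm_def bl True)
        have evq: "eventually (\<lambda>h. \<alpha> x * (logistic_num l (E0 * exp h) (of_real z0) * dn b0 h ^ (L - l)) =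
          \<alpha> x * logistic_deriv (snd x) (E0 * exp h) (of_real (z (fst x))) * dn b0 h ^ Suc L) (at 0)"
          using nz
        proof eventually_elim
          case (elim h)
          have "Suc L = Suc l + (L - l)" using \<open>l \<le> L\<close> by simp
          then have pw: "dn b0 h ^ Suc L = dn b0 h ^ Suc l * dn b0 h ^ (L - l)" by (simp only: power_add)
          have rl: "logistic_deriv l (E0 * exp h) (of_real z0) = logistic_num l (E0 * exp h) (of_real z0) / dn b0 h ^ Suc l"
            unfolding logistic_deriv_def dn_def z0_def ..
          have cancel: "a * (n * q) = a * (n / D) * (D * q)" if "D \<noteq> 0" for a n q D :: complex using that by simp
          have "dn b0 h ^ Suc l \<noteq> 0" using elim by (simp del: power_Suc)
          then show ?case unfolding bl True fst_conv snd_conv z0_def[symmetric] rl pw by (rule cancel)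
        qed
        show ?thesis using Lim_transform_eventually[OF lim evq] unfolding lme .
      next
        case True
        then have "x \<noteq> (b0, L)" using L(2) by blast
        then have "lm x = 0" unfolding lm_def by (simp only: if_False)
        then show ?thesis unfolding True by simp
      qed
    next
      case False
      have mem: "b \<in> fst ` X" "b0 \<in> fst ` X"
        using imageI[OF x, of fst] imageI[OF L(1), of fst] unfolding bl fst_conv .
      have zb: "z b \<noteq> z0" unfolding z0_def
      proof
        assume "z b = z b0"
        then have "b = b0" by (rule inj_onD[OF inj]) (rule mem)+
        then show False using False by contradiction
      qed
      have "(1 + of_real (z b) * (E0 - 1)) = complex_of_real (1 - z b / z0)"
        using z0 by (simp add: E0_def)
      moreover have "1 - z b / z0 \<noteq> 0" using zb z0 by (simp add: field_simps)
      ultimately have n: "1 + of_real (z b) * (E0 - 1) \<noteq> 0" by (metis of_real_eq_0_iff)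
      have "((\<lambda>h. \<alpha> x * (logistic_num l (E0 * exp h) (of_real (z b)) / dn b h ^ Suc l) * dn b0 h ^ Suc L) \<longlongrightarrow>
        \<alpha> x * (logistic_num l E0 (of_real (z b)) / (1 + of_real (z b) * (E0 - 1)) ^ Suc l) * 0 ^ Suc L) (at 0)"
        by (rule tendsto_mult[OF tendsto_mult[OF tendsto_const tendsto_divide[OF tN tendsto_power[OF tdn]]] tendsto_power[OF tdn0]])
          (use n in simp)
      moreover have "lm x = \<alpha> x * (logistic_num l E0 (of_real (z b)) / (1 + of_real (z b) * (E0 - 1)) ^ Suc l) * 0 ^ Suc L"
        using False by (simp add: lm_def bl)
      moreover have "logistic_deriv (snd x) (E0 * exp h) (of_real (z (fst x))) = logistic_num l (E0 * exp h) (of_real (z b)) / dn b h ^ Suc l" for h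
        unfolding bl logistic_deriv_def dn_def fst_conv snd_conv ..
      ultimately show ?thesis by (simp only:)
    qed
  qed
  have "((\<lambda>h. \<Sum>x\<in>X. \<alpha> x * logistic_deriv (snd x) (E0 * exp h) (of_real (z (fst x))) * dn b0 h ^ Suc L) \<longlongrightarrow> (\<Sum>x\<in>X. lm x)) (at 0)"
    by (rule tendsto_sum) (rule tm)
  then have "((\<lambda>h. F1 h * dn b0 h ^ Suc L) \<longlongrightarrow> (\<Sum>x\<in>X. lm x)) (at 0)"
    unfolding F1_def sum_distrib_right .
  then have "(\<Sum>x\<in>X. lm x) = 0" using lim0 by (rule tendsto_unique[rotated]) simp
  moreover have "(\<Sum>x\<in>X. lm x) = \<alpha> (b0, L) * logistic_num L E0 (of_real z0)"
    unfolding lm_def using X L(1) by simp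
  moreover have "logistic_num L E0 (of_real z0) \<noteq> 0" using E0 z0 by (simp add: logistic_num_def)
  ultimately show False using L(2) by simp
qed

subsection \<open>The field of germs of meromorphic functions\<close>

text \<open>
  Laurent expansions at \<open>1\<close> of functions meromorphic on the whole plane. As series they form a field in
  which the values of the functions at poles do not matter.
\<close>

definition mero_germs :: "complex fls set" where
  "mero_germs = {F. \<exists>f. f meromorphic_on UNIV \<and> (\<lambda>h. f (1 + h)) has_laurent_expansion F}"

lemma merkI: "f meromorphic_on UNIV \<Longrightarrow> (\<lambda>h. f (1 + h)) has_laurent_expansion F \<Longrightarrow> F \<in> mero_germs"
  unfolding mero_germs_def by blast

lemma mero_germs_const: "fls_const c \<in> mero_germs"
  by (rule merkI[of "\<lambda>_. c"]) auto

lemma subfield_set_mero_germs: "subfield_set mero_germs"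
  unfolding subfield_set_def
proof (intro conjI ballI)
  show "0 \<in> mero_germs" "1 \<in> mero_germs" using mero_germs_const[of 0] mero_germs_const[of 1] by auto
  fix F assume "F \<in> mero_germs"
  then obtain f where f: "f meromorphic_on UNIV" "(\<lambda>h. f (1 + h)) has_laurent_expansion F" unfolding mero_germs_def by blast
  show "inverse F \<in> mero_germs"
    by (rule merkI[of "\<lambda>v. inverse (f v)"]) (intro meromorphic_intros laurent_expansion_intros f)+
  fix G assume "G \<in> mero_germs"
  then obtain g where g: "g meromorphic_on UNIV" "(\<lambda>h. g (1 + h)) has_laurent_expansion G" unfolding mero_germs_def by blast
  show "F + G \<in> mero_germs"
    by (rule merkI[of "\<lambda>v. f v + g v"]) (intro meromorphic_intros laurent_expansion_intros f g)+
  show "F * G \<in> mero_germs"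
    by (rule merkI[of "\<lambda>v. f v * g v"]) (intro meromorphic_intros laurent_expansion_intros f g)+
qed

lemma mero_germs_deriv:
  assumes "F \<in> mero_germs" shows "fls_deriv F \<in> mero_germs"
proof -
  obtain f where f: "f meromorphic_on UNIV" "(\<lambda>h. f (1 + h)) has_laurent_expansion F"
    using assms unfolding mero_germs_def by blast
  have "(\<lambda>h. deriv f (1 + h)) has_laurent_expansion fls_deriv F"
    using has_laurent_expansion_deriv[OF f(2)] unfolding deriv_shift_fun .
  then show ?thesis by (rule merkI[OF meromorphic_on_deriv[OF f(1)]])
qed

lemma has_laurent_expansion_peval:
  assumes "\<And>x. x \<in> pvars p \<Longrightarrow> (\<lambda>h. u x h) has_laurent_expansion U x"
  shows "(\<lambda>h. peval (\<lambda>x. u x h) p) has_laurent_expansion peval_in (\<lambda>a. fls_const (of_real a)) U p"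
  using assms by (induction p) (auto intro!: laurent_expansion_intros)

lemma peval_in_fls_const: "peval_in (\<lambda>a. fls_const (of_real a)) (\<lambda>x. fls_const (of_real (e x))) p = fls_const (complex_of_real (peval e p))"
  by (induction p) (simp_all add: fls_plus_const fls_const_mult_const)

text \<open>
  Ostrowski's theorem for the field of meromorphic functions. The terms with \<open>\<sigma>\<close> belong to this field
  and do not affect independence; they are needed for the case of equal indices.
\<close>

theorem logistic_integrals_independent:
  fixes p :: "(nat \<times> nat) pexp" and z :: "nat \<Rightarrow> real" and \<phi> :: "nat \<times> nat \<Rightarrow> complex \<Rightarrow> complex"
  assumes inj: "inj_on z (fst ` pvars p)" and z01: "\<And>b. b \<in> fst ` pvars p \<Longrightarrow> 0 < z b \<and> z b < 1"
    and \<epsilon>: "0 < \<epsilon>"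
    and \<phi>: "\<And>x v. x \<in> pvars p \<Longrightarrow> v \<in> ball 1 \<epsilon> \<Longrightarrow>
      (\<phi> x has_field_derivative logistic_deriv (snd x) (exp (v - 1)) (of_real (z (fst x))) / v) (at v)"
    and rel: "eventually (\<lambda>v. peval (\<lambda>x. \<phi> x v + of_real \<sigma> * v * logistic_deriv (snd x) (exp (v - 1)) (of_real (z (fst x)))) p = 0) (at 1)"
  shows "peval e p = (0 :: real)"
proof -
  let ?h = "\<lambda>a. fls_const (complex_of_real a)"
  define r where "r x v = logistic_deriv (snd x) (exp (v - 1)) (complex_of_real (z (fst x)))" for x v
  define s where "s x = laurent_expansion (\<lambda>v. of_real \<sigma> * v * r x v) 1" for x
  define \<Phi> where "\<Phi> x = fps_to_fls (fps_expansion (\<phi> x) 1)" for x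
  have mr: "(\<lambda>v. r x v) meromorphic_on UNIV" for x unfolding r_def by (rule meromorphic_logistic_deriv)
  have ms: "(\<lambda>v. of_real \<sigma> * v * r x v) meromorphic_on UNIV" for x by (intro meromorphic_intros mr)
  have s: "(\<lambda>h. of_real \<sigma> * (1 + h) * r x (1 + h)) has_laurent_expansion s x" for x
    unfolding s_def by (rule meromorphic_on_imp_has_laurent_expansion[OF ms]) simp
  have \<Phi>: "(\<lambda>h. \<phi> x (1 + h)) has_laurent_expansion \<Phi> x" if "x \<in> pvars p" for x
  proof -
    have "\<phi> x holomorphic_on ball 1 \<epsilon>"
      unfolding holomorphic_on_open[OF open_ball] using \<phi>[OF that] by blast
    then have "\<phi> x analytic_on {1}" using \<epsilon> by (auto simp: analytic_on_def)
    then show ?thesis unfolding \<Phi>_def by (intro has_laurent_expansion_fps analytic_at_imp_has_fps_expansion)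
  qed
  have D\<Phi>: "(\<lambda>h. r x (1 + h) / (1 + h)) has_laurent_expansion fls_deriv (\<Phi> x)" if "x \<in> pvars p" for x
  proof (rule has_laurent_expansion_deriv'[OF \<Phi>[OF that], of "ball 0 \<epsilon>"])
    fix h :: complex assume "h \<in> ball 0 \<epsilon> - {0}"
    then have "1 + h \<in> ball 1 \<epsilon>" by (simp add: dist_norm)
    from \<phi>[OF that this] have "(\<phi> x has_field_derivative r x (1 + h) / (1 + h)) (at (h + 1))"
      unfolding r_def by (simp only: add.commute)
    then show "((\<lambda>h. \<phi> x (1 + h)) has_field_derivative r x (1 + h) / (1 + h)) (at h)"
      unfolding DERIV_shift by (simp only: add.commute)
  qed (use \<epsilon> in auto)
  have "peval_in ?h (\<lambda>x. fls_const (of_real (e x))) p = 0"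
  proof (rule pexp_relation_trivial[where D = fls_deriv and K = mero_germs and X = "pvars p" and \<phi> = \<Phi> and s = s])
    show "fls_deriv (a + b) = fls_deriv a + fls_deriv b" "fls_deriv (a * b) = fls_deriv a * b + a * fls_deriv b"
      for a b :: "complex fls" by simp_all
    show "subfield_set mero_germs" by (rule subfield_set_mero_germs)
    show "a \<in> mero_germs \<Longrightarrow> fls_deriv a \<in> mero_germs" for a by (rule mero_germs_deriv)
    show "fls_deriv (\<Phi> x) \<in> mero_germs" if "x \<in> pvars p" for x
      by (rule merkI[OF _ D\<Phi>[OF that]]) (intro meromorphic_intros mr)
    show "?h a \<in> mero_germs" for a by (rule mero_germs_const)
    show "s x \<in> mero_germs" for x by (rule merkI[OF ms s])
    have "(\<lambda>h. peval (\<lambda>x. \<phi> x (1 + h) + of_real \<sigma> * (1 + h) * r x (1 + h)) p) has_laurent_expansion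
      peval_in ?h (\<lambda>x. \<Phi> x + s x) p"
      by (intro has_laurent_expansion_peval has_laurent_expansion_add \<Phi> s)
    then show "peval_in ?h (\<lambda>x. \<Phi> x + s x) p = 0"
      using rel has_laurent_expansion_eventually_zero_iff[of "\<lambda>v. peval (\<lambda>x. \<phi> x v + of_real \<sigma> * v * r x v) p" 1]
      unfolding r_def by blast
    fix a k assume a: "\<And>x. x \<in> pvars p \<Longrightarrow> fls_deriv (a x) = 0" and k: "k \<in> mero_germs"
      and eq: "(\<Sum>x\<in>pvars p. a x * fls_deriv (\<Phi> x)) + fls_deriv k = 0"
    obtain g where g: "g meromorphic_on UNIV" "(\<lambda>h. g (1 + h)) has_laurent_expansion k" using k unfolding mero_germs_def by blast
    have ac: "a x = fls_const (fls_nth (a x) 0)" if "x \<in> pvars p" for x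
    proof (rule fls_eqI)
      fix n
      have "fls_nth (fls_deriv (a x)) (n - 1) = 0" using a[OF that] by simp
      then have "of_int n * fls_nth (a x) n = 0" by simp
      then show "fls_nth (a x) n = fls_nth (fls_const (fls_nth (a x) 0)) n" by auto
    qed
    have "(\<lambda>h. (\<Sum>x\<in>pvars p. fls_nth (a x) 0 * (r x (1 + h) / (1 + h))) + deriv g (1 + h)) has_laurent_expansion
      (\<Sum>x\<in>pvars p. fls_const (fls_nth (a x) 0) * fls_deriv (\<Phi> x)) + fls_deriv k"
      using has_laurent_expansion_deriv[OF g(2)] unfolding deriv_shift_fun
      by (intro has_laurent_expansion_add has_laurent_expansion_sum has_laurent_expansion_mult has_laurent_expansion_const D\<Phi>)
    moreover have "(\<Sum>x\<in>pvars p. fls_const (fls_nth (a x) 0) * fls_deriv (\<Phi> x)) = (\<Sum>x\<in>pvars p. a x * fls_deriv (\<Phi> x))"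
      by (rule sum.cong[OF refl]) (simp only: ac[symmetric])
    ultimately have "(\<lambda>h. (\<Sum>x\<in>pvars p. fls_nth (a x) 0 * (r x (1 + h) / (1 + h))) + deriv g (1 + h)) has_laurent_expansion 0"
      using eq by simp
    then have "eventually (\<lambda>v. (\<Sum>x\<in>pvars p. fls_nth (a x) 0 * (r x v / v)) + deriv g v = 0) (at 1)"
      using has_laurent_expansion_eventually_zero_iff[of "\<lambda>v. (\<Sum>x\<in>pvars p. fls_nth (a x) 0 * (r x v / v)) + deriv g v" 1] by blast
    from no_meromorphic_primitive[OF finite_pvars inj z01 g(1) this[unfolded r_def]]
    have "\<forall>x\<in>pvars p. fls_nth (a x) 0 = 0" by blast
    then show "\<forall>x\<in>pvars p. a x = 0" using ac by (metis fls_const_0)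
  qed auto
  then show ?thesis unfolding peval_in_fls_const by simp
qed

section \<open>A logistic system\<close>

text \<open>
  The flow as a holomorphic function of the \<open>j\<close>-th initial value alone.
\<close>

lemma flow_analytic_line:
  fixes r :: "real ^ 'm::finite"
  assumes "x \<in> flow_dom V r"
  shows "\<exists>\<rho>>0. \<exists>g. \<forall>k. g k holomorphic_on ball (complex_of_real (r $ j)) \<rho> \<and>
    (\<forall>z. \<bar>z - r $ j\<bar> < \<rho> \<longrightarrow> g k (of_real z) = of_real (flow V (set_coord r j z) x $ k))"
proof -
  obtain \<epsilon> G where rep: "flow_rep V x r \<epsilon> G" using flow_rep_flow_dom[OF assms] by blast
  have \<epsilon>: "0 < \<epsilon>" by (rule flow_repD(1)[OF rep])
  let ?c = "complex_of_real (r $ j)"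
  have nm: "norm (set_ccoord (cvec r) j w - cvec r) = norm (w - ?c)" for w
    unfolding norm_set_ccoord by simp
  show ?thesis
  proof (intro exI[of _ \<epsilon>] exI[of _ "\<lambda>k w. G (of_real x) (set_ccoord (cvec r) j w) $ k"] conjI allI impI \<epsilon>)
    fix k
    show "(\<lambda>w. G (of_real x) (set_ccoord (cvec r) j w) $ k) holomorphic_on ball ?c \<epsilon>"
    proof (rule flow_repD(5)[OF rep])
      show "(\<lambda>s. set_ccoord (cvec r) j s $ k) holomorphic_on ball ?c \<epsilon>" for k
        unfolding set_ccoord_def by (cases "k = j") auto
      show "norm (set_ccoord (cvec r) j s - cvec r) < \<epsilon>" if "s \<in> ball ?c \<epsilon>" for s
        using that unfolding nm by (simp add: dist_norm norm_minus_commute)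
    qed (use \<epsilon> in auto)
    fix z assume z: "\<bar>z - r $ j\<bar> < \<epsilon>"
    have "norm (set_coord r j z - r) = norm (cvec (set_coord r j z) - cvec r)" unfolding cvec_diff norm_cvec ..
    also have "\<dots> = norm (complex_of_real z - ?c)" unfolding set_ccoord_of_real[symmetric] nm ..
    also have "\<dots> < \<epsilon>" using z unfolding of_real_diff[symmetric] norm_of_real .
    finally have "cvec (flow V (set_coord r j z) x) = G (of_real x) (cvec (set_coord r j z))"
      using flow_rep_flow[OF rep, of "set_coord r j z" x] \<epsilon> by simp
    then show "G (of_real x) (set_ccoord (cvec r) j (of_real z)) $ k = of_real (flow V (set_coord r j z) x $ k)"
      unfolding set_ccoord_of_real by (metis vec_lambda_beta)
  qed
qed

lemma jet_linear:
  fixes r :: "real ^ 'm::finite"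
  assumes "x \<in> flow_dom V r"
  shows "(deriv ^^ l) (\<lambda>z. a * flow V (set_coord r j z) x $ k1 + b * flow V (set_coord r j z) x $ k2 + T) (r $ j) =
    a * jet V j x r (k1, l) + b * jet V j x r (k2, l) + (if l = 0 then T else 0)"
proof -
  obtain \<rho> g where \<rho>: "0 < \<rho>" and g: "\<And>k. g k holomorphic_on ball (complex_of_real (r $ j)) \<rho>"
    "\<And>k z. \<bar>z - r $ j\<bar> < \<rho> \<Longrightarrow> g k (of_real z) = complex_of_real (flow V (set_coord r j z) x $ k)"
    using flow_analytic_line[OF assms, of j] by blast
  let ?c = "complex_of_real (r $ j)" let ?S = "ball ?c \<rho>"
  have mem: "of_real z \<in> ?S \<longleftrightarrow> \<bar>z - r $ j\<bar> < \<rho>" for z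
    by (simp add: dist_of_real dist_real_def abs_minus_commute)
  have c: "?c \<in> ?S" using \<rho> by simp
  have J: "(deriv ^^ l) (g k) ?c = of_real (jet V j x r (k, l))" for k
    unfolding jet_def prod.case by (rule real_complex_higher_deriv[OF g(1) open_ball _ c]) (use g(2) mem in blast)
  have "complex_of_real ((deriv ^^ l) (\<lambda>z. a * flow V (set_coord r j z) x $ k1 + b * flow V (set_coord r j z) x $ k2 + T) (r $ j)) =
    (deriv ^^ l) (\<lambda>w. (of_real a * g k1 w + of_real b * g k2 w) + of_real T) ?c"
    by (rule real_complex_higher_deriv[symmetric, OF _ open_ball _ c])
      (use mem g(2) in \<open>auto intro!: holomorphic_intros g(1)\<close>)
  also have "\<dots> = (deriv ^^ l) (\<lambda>w. of_real a * g k1 w + of_real b * g k2 w) ?c + (deriv ^^ l) (\<lambda>w. of_real T) ?c"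
    by (rule higher_deriv_add[OF _ _ open_ball c]) (intro holomorphic_intros g(1))+
  also have "(deriv ^^ l) (\<lambda>w. of_real a * g k1 w + of_real b * g k2 w) ?c =
    (deriv ^^ l) (\<lambda>w. of_real a * g k1 w) ?c + (deriv ^^ l) (\<lambda>w. of_real b * g k2 w) ?c"
    by (rule higher_deriv_add[OF _ _ open_ball c]) (intro holomorphic_intros g(1))+
  also have "\<dots> = of_real a * of_real (jet V j x r (k1, l)) + of_real b * of_real (jet V j x r (k2, l))"
    unfolding higher_deriv_cmult[OF g(1) c open_ball] J ..
  also have "(deriv ^^ l) (\<lambda>w. of_real T) ?c = of_real (if l = 0 then T else 0)" by simp
  finally have "complex_of_real ((deriv ^^ l) (\<lambda>z. a * flow V (set_coord r j z) x $ k1 + b * flow V (set_coord r j z) x $ k2 + T) (r $ j)) =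
    of_real (a * jet V j x r (k1, l) + b * jet V j x r (k2, l) + (if l = 0 then T else 0))"
    by (simp only: of_real_add of_real_mult)
  then show ?thesis by (simp only: of_real_eq_iff)
qed

abbreviation "cO \<equiv> (False, False)"
abbreviation "cJ \<equiv> (False, True)"
abbreviation "cG \<equiv> (True, False)"
abbreviation "cV \<equiv> (True, True)"

text \<open>
  The coordinates are \<open>O, J, \<gamma>, v\<close> with \<open>O' = v O (1 + \<gamma> J - O)\<close>, \<open>J' = O\<close>, \<open>\<gamma>' = 0\<close> and
  \<open>v' = v\<close>. The parameter \<open>\<gamma>\<close> is a coordinate so that continuity in \<open>\<gamma>\<close> is continuity in the initial
  value.
\<close>

definition logistic_field :: "bool \<times> bool \<Rightarrow> (bool \<times> bool) pexp" where
  "logistic_field k = (if k = cO then Mul (Var cV) (Mul (Var cO) (Add (Const 1) (Add (Mul (Var cG) (Var cJ)) (Mul (Const (-1)) (Var cO)))))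
     else if k = cJ then Var cO else if k = cG then Const 0 else Var cV)"

text \<open>
  The initial value \<open>v = 1\<close> makes \<open>v = exp x\<close>.
\<close>

definition logistic_init :: "real \<Rightarrow> real \<Rightarrow> real ^ (bool \<times> bool)" where
  "logistic_init z \<gamma> = (\<chi> k. if k = cO then z else if k = cJ then 0 else if k = cG then \<gamma> else 1)"

lemma set_coord_logistic_init: "set_coord (logistic_init z \<gamma>) cO z' = logistic_init z' \<gamma>"
  by (simp add: set_coord_def logistic_init_def vec_eq_iff)

lemma logistic_init_cO: "logistic_init z \<gamma> $ cO = z" by (simp add: logistic_init_def)

text \<open>
  For \<open>\<gamma> = 0\<close> the logistic equation has an elementary solution, which exists for all times when
  \<open>0 < z < 1\<close>, and \<open>J\<close> is its integral.
\<close>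

lemma aux_explicit:
  assumes z: "0 < z" "z < 1"
  shows "x \<in> flow_dom logistic_field (logistic_init z 0)"
    and "flow logistic_field (logistic_init z 0) x $ cO = z * exp (exp x - 1) / (1 + z * (exp (exp x - 1) - 1))"
proof -
  define R where "R = \<bar>x\<bar> + 1"
  define c where "c t = 1 + z * (exp (exp t - 1) - 1)" for t :: real
  define \<Omega> where "\<Omega> t = z * exp (exp t - 1) / c t" for t :: real
  have c: "c t \<noteq> 0" for t unfolding c_def using logistic_denominator_pos[OF z, of "exp (exp t - 1)"] by simp
  have d\<Omega>: "(\<Omega> has_real_derivative exp t * (\<Omega> t * (1 - \<Omega> t))) (at t within J)" for t J
  proof -
    have dc: "(c has_real_derivative z * (exp (exp t - 1) * exp t)) (at t within J)"
      unfolding c_def by (auto intro!: derivative_eq_intros)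
    have "(\<Omega> has_real_derivative
      (z * (exp (exp t - 1) * exp t) * c t - z * exp (exp t - 1) * (z * (exp (exp t - 1) * exp t))) / (c t * c t)) (at t within J)"
      unfolding \<Omega>_def by (rule derivative_eq_intros dc refl c | simp)+
    also have "(z * (exp (exp t - 1) * exp t) * c t - z * exp (exp t - 1) * (z * (exp (exp t - 1) * exp t))) / (c t * c t)
      = exp t * (\<Omega> t * (1 - \<Omega> t))"
      unfolding \<Omega>_def using c[of t] by (simp add: field_simps)
    finally show ?thesis .
  qed
  have "continuous_on {-R..R} \<Omega>" using d\<Omega> by (intro DERIV_continuous_on)
  then obtain g where g: "\<And>t. t \<in> {-R..R} \<Longrightarrow> (g has_vector_derivative \<Omega> t) (at t within {-R..R})"
    using antiderivative_continuous by blast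
  define y where "y t = (\<chi> k. if k = cO then \<Omega> t else if k = cJ then g t - g 0 else if k = cG then 0 else exp t)" for t
  have y: "y t $ cO = \<Omega> t" "y t $ cJ = g t - g 0" "y t $ cG = 0" "y t $ cV = exp t" for t by (simp_all add: y_def)
  have J: "is_interval {-R..R}" "0 \<in> {-R..R}" "x \<in> {-R..R}" by (auto simp: R_def is_interval_cc)
  have sol: "solves_on logistic_field {-R..R} y"
    unfolding solves_on_def
  proof (intro ballI allI)
    fix t k assume t: "t \<in> {-R..R}"
    have dg: "((\<lambda>s. g s - g 0) has_real_derivative \<Omega> t) (at t within {-R..R})"
      using g[OF t] unfolding has_real_derivative_iff_has_vector_derivative[symmetric]
      by (auto intro!: derivative_eq_intros)
    consider "k = cO" | "k = cJ" | "k = cG" | "k = cV" by (cases k) auto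
    then show "((\<lambda>s. y s $ k) has_real_derivative peval (\<lambda>k. y t $ k) (logistic_field k)) (at t within {-R..R})"
    proof cases
      case 1
      have "peval (\<lambda>k. y t $ k) (logistic_field cO) = exp t * (\<Omega> t * (1 - \<Omega> t))"
        by (simp add: logistic_field_def y del: of_real_eq_id)
      then show ?thesis using d\<Omega>[of t] unfolding 1 y by simp
    next
      case 2
      then show ?thesis using dg by (simp add: y logistic_field_def)
    next
      case 3
      then show ?thesis by (simp add: y logistic_field_def)
    next
      case 4
      have "(exp has_real_derivative exp t) (at t within {-R..R})" by (auto intro!: derivative_eq_intros)
      then show ?thesis unfolding 4 y by (simp add: y logistic_field_def)
    qed
  qed
  have y0: "y 0 = logistic_init z 0" by (simp add: y_def logistic_init_def vec_eq_iff \<Omega>_def c_def)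
  show "x \<in> flow_dom logistic_field (logistic_init z 0)" by (rule fdomI[OF J sol y0])
  show "flow logistic_field (logistic_init z 0) x $ cO = z * exp (exp x - 1) / (1 + z * (exp (exp x - 1) - 1))"
    unfolding flow_eq[OF J sol y0] y \<Omega>_def c_def ..
qed

lemma aux_jet_O:
  assumes z: "0 < z" "z < 1"
  shows "jet logistic_field cO x (logistic_init z 0) (cO, l) = logistic_deriv l (exp (exp x - 1)) z"
proof -
  have "(deriv ^^ l) (\<lambda>z. flow logistic_field (logistic_init z 0) x $ cO) z =
    (deriv ^^ l) (\<lambda>z. z * exp (exp x - 1) / (1 + z * (exp (exp x - 1) - 1))) z"
    by (rule higher_deriv_cong_open[of "{0<..<1}"]) (use z aux_explicit(2) in auto)
  then show ?thesis unfolding jet_def prod.case set_coord_logistic_init logistic_init_cO higher_deriv_logistic[OF z exp_gt_zero] .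
qed

text \<open>
  Differentiation in \<open>x\<close> and in \<open>z\<close> commute, by the variational equations.
\<close>

lemma aux_jet_J:
  assumes z: "0 < z" "z < 1"
  shows "((\<lambda>x. jet logistic_field cO x (logistic_init z 0) (cJ, l)) has_real_derivative logistic_deriv l (exp (exp x - 1)) z) (at x)"
proof -
  have "(pderive jet_shift ^^ l) (Var (cO, 0)) = Var (cO, l)" by (induction l) (simp_all add: jet_shift_def)
  then have "jet_field logistic_field cJ l = Var (cO, l)" by (simp add: jet_field_def logistic_field_def)
  then show ?thesis using jet_deriv[OF aux_explicit(1)[OF z], of cO cJ l x] aux_jet_O[OF z] by simp
qed

text \<open>
  The positive reals near \<open>0\<close> accumulate at \<open>0\<close>.
\<close>

lemma real_zeros_identity:
  assumes f: "f holomorphic_on ball 0 \<epsilon>" and z: "\<And>x :: real. 0 < \<bar>x\<bar> \<Longrightarrow> \<bar>x\<bar> < \<delta> \<Longrightarrow> f (complex_of_real x) = 0"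
    and \<delta>: "0 < \<delta>" "\<delta> \<le> \<epsilon>" and t: "t \<in> ball 0 \<epsilon>"
  shows "f t = 0"
proof (rule analytic_continuation[OF f open_ball connected_ball, of "of_real ` {0<..<\<delta>}" 0])
  show "complex_of_real ` {0<..<\<delta>} \<subseteq> ball 0 \<epsilon>" using \<delta> by auto
  show "(0 :: complex) \<in> ball 0 \<epsilon>" using \<delta> by simp
  show "(0 :: complex) islimpt (of_real ` {0<..<\<delta>})"
    unfolding islimpt_approachable
  proof (intro allI impI)
    fix e :: real assume e: "e > 0"
    show "\<exists>x'\<in>of_real ` {0<..<\<delta>}. x' \<noteq> (0 :: complex) \<and> dist x' 0 < e"
    proof -
      obtain m where m: "0 < m" "m < e" "m < \<delta>" using field_lbound_gt_zero[OF e \<delta>(1)] by blast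
      then have "complex_of_real m \<in> of_real ` {0<..<\<delta>}" by (intro imageI) simp
      moreover have "complex_of_real m \<noteq> 0" "dist (complex_of_real m) 0 < e" using m by simp_all
      ultimately show ?thesis by blast
    qed
  qed
  show "f w = 0" if "w \<in> of_real ` {0<..<\<delta>}" for w using that z by auto
qed (rule t)

lemma of_real_exp_exp: "complex_of_real (exp (exp x - 1)) = exp (exp (of_real x) - 1)"
  by (metis exp_of_real of_real_1 of_real_diff)

lemma aux_jet_complex:
  assumes z: "0 < z" "z < 1"
  shows "\<exists>\<epsilon>>0. \<exists>h. (\<forall>t\<in>ball 0 \<epsilon>. (h has_field_derivative logistic_deriv l (exp (exp t - 1)) (complex_of_real z)) (at t)) \<and>
    (\<lambda>t. logistic_deriv l (exp (exp t - 1)) (complex_of_real z)) holomorphic_on ball 0 \<epsilon> \<and>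
    (\<forall>x. \<bar>x\<bar> < \<epsilon> \<longrightarrow> h (of_real x) = complex_of_real (jet logistic_field cO x (logistic_init z 0) (cJ, l)))"
proof -
  obtain \<epsilon>1 h where h: "0 < \<epsilon>1" "h holomorphic_on ball (complex_of_real 0) \<epsilon>1"
    "\<And>x. \<bar>x - 0\<bar> < \<epsilon>1 \<Longrightarrow> h (of_real x) = complex_of_real (jet logistic_field cO x (logistic_init z 0) (cJ, l))"
    using jet_analytic[OF aux_explicit(1)[OF z], of 0 cO "(cJ, l)"] by blast
  define dn where "dn t = 1 + complex_of_real z * (exp (exp t - 1) - 1)" for t
  have "isCont dn 0" unfolding dn_def by (intro continuous_intros)
  then have "(dn \<longlongrightarrow> dn 0) (nhds 0)" using isCont_def tendsto_at_iff_tendsto_nhds by blast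
  moreover have "dn 0 \<noteq> 0" by (simp add: dn_def)
  ultimately have "eventually (\<lambda>t. dn t \<noteq> 0) (nhds 0)" by (rule tendsto_imp_eventually_ne)
  then obtain \<epsilon>2 where \<epsilon>2: "0 < \<epsilon>2" "\<And>t. dist t 0 < \<epsilon>2 \<Longrightarrow> dn t \<noteq> 0" unfolding eventually_nhds_metric by blast
  define \<epsilon> where "\<epsilon> = min \<epsilon>1 \<epsilon>2"
  have \<epsilon>: "0 < \<epsilon>" "\<epsilon> \<le> \<epsilon>1" "\<epsilon> \<le> \<epsilon>2" using h(1) \<epsilon>2(1) by (auto simp: \<epsilon>_def)
  have hh: "h holomorphic_on ball 0 \<epsilon>" by (rule holomorphic_on_subset[OF h(2)]) (use \<epsilon> in auto)
  have dn: "dn t \<noteq> 0" if "t \<in> ball 0 \<epsilon>" for t using \<epsilon>2(2)[of t] \<epsilon>(3) that by (simp add: dist_commute)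
  have hR: "(\<lambda>t. logistic_deriv l (exp (exp t - 1)) (complex_of_real z)) holomorphic_on ball 0 \<epsilon>"
  proof -
    have N: "(\<lambda>t. logistic_num l (exp (exp t - 1)) (complex_of_real z)) holomorphic_on ball 0 \<epsilon>"
      unfolding logistic_num_def by (cases "l = 0") (auto intro!: holomorphic_intros)
    have d: "dn holomorphic_on ball 0 \<epsilon>" unfolding dn_def by (intro holomorphic_intros)
    show ?thesis unfolding logistic_deriv_def dn_def[symmetric]
      by (rule holomorphic_on_divide[OF N holomorphic_on_power[OF d]]) (simp add: dn del: mem_ball power_Suc)
  qed
  have hd: "(h has_field_derivative deriv h t) (at t)" if "t \<in> ball 0 \<epsilon>" for t
    by (rule holomorphic_derivI[OF hh open_ball that])
  have "deriv h t - logistic_deriv l (exp (exp t - 1)) (complex_of_real z) = 0" if t: "t \<in> ball 0 \<epsilon>" for t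
  proof (rule real_zeros_identity[OF _ _ \<epsilon>(1) order_refl t])
    show "(\<lambda>t. deriv h t - logistic_deriv l (exp (exp t - 1)) (complex_of_real z)) holomorphic_on ball 0 \<epsilon>"
      by (intro holomorphic_on_diff hR holomorphic_deriv[OF hh open_ball])
    fix x :: real assume x: "\<bar>x\<bar> < \<epsilon>"
    then have xb: "complex_of_real x \<in> ball 0 \<epsilon>" by simp
    have *: "h (of_real x) = complex_of_real (jet logistic_field cO x (logistic_init z 0) (cJ, l))" if "complex_of_real x \<in> ball 0 \<epsilon>" for x
      using h(3)[of x] that \<epsilon>(2) by simp
    note rc = real_complex_deriv[OF hd[OF xb] open_ball xb *]
    have "Re (deriv h (of_real x)) = logistic_deriv l (exp (exp x - 1)) z"
      by (rule DERIV_unique[OF rc(2) aux_jet_J[OF z]])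
    then have "deriv h (of_real x) = of_real (logistic_deriv l (exp (exp x - 1)) z)"
      using rc(1) by (metis of_real_Re)
    then show "deriv h (of_real x) - logistic_deriv l (exp (exp (of_real x) - 1)) (complex_of_real z) = 0"
      unfolding of_real_logistic_deriv of_real_exp_exp by simp
  qed
  then have "(h has_field_derivative logistic_deriv l (exp (exp t - 1)) (complex_of_real z)) (at t)" if "t \<in> ball 0 \<epsilon>" for t
    using hd[OF that] that by (metis right_minus_eq)
  then show ?thesis using \<epsilon> hR h(3) by (intro exI[of _ \<epsilon>] conjI exI[of _ h]) auto
qed

text \<open>
  In the variable \<open>v = exp x\<close> the jets of \<open>J\<close> become primitives of the functions
  \<open>logistic_deriv l (exp (v - 1)) z / v\<close>. The relation is assumed for real \<open>x \<noteq> 0\<close> only, as the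
  embedding of the logistic system degenerates at \<open>x = 0\<close>.
\<close>

theorem aux_jets_independent:
  fixes p :: "(nat \<times> nat) pexp" and z :: "nat \<Rightarrow> real"
  assumes inj: "inj_on z (fst ` pvars p)" and z01: "\<And>b. b \<in> fst ` pvars p \<Longrightarrow> 0 < z b \<and> z b < 1"
    and rel: "\<And>x. x \<noteq> 0 \<Longrightarrow> peval (\<lambda>(b, l). jet logistic_field cO x (logistic_init (z b) 0) (cJ, l) +
       \<sigma> * exp x * jet logistic_field cO x (logistic_init (z b) 0) (cO, l)) p = 0"
  shows "peval e p = (0 :: real)"
proof -
  define r where "r y t = logistic_deriv (snd y) (exp (exp t - 1)) (complex_of_real (z (fst y)))" for y t
  have "\<forall>y\<in>pvars p. \<exists>\<epsilon>. 0 < \<epsilon> \<and> (\<exists>h. (\<forall>t\<in>ball 0 \<epsilon>. (h has_field_derivative r y t) (at t)) \<and>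
    r y holomorphic_on ball 0 \<epsilon> \<and>
    (\<forall>x. \<bar>x\<bar> < \<epsilon> \<longrightarrow> h (of_real x) = complex_of_real (jet logistic_field cO x (logistic_init (z (fst y)) 0) (cJ, snd y))))"
    using aux_jet_complex z01 unfolding r_def by blast
  from bchoice[OF this] obtain \<epsilon> where \<epsilon>: "\<forall>y\<in>pvars p. 0 < \<epsilon> y \<and> (\<exists>h. (\<forall>t\<in>ball 0 (\<epsilon> y). (h has_field_derivative r y t) (at t)) \<and>
    r y holomorphic_on ball 0 (\<epsilon> y) \<and>
    (\<forall>x. \<bar>x\<bar> < \<epsilon> y \<longrightarrow> h (of_real x) = complex_of_real (jet logistic_field cO x (logistic_init (z (fst y)) 0) (cJ, snd y))))" by blast
  then have "\<forall>y\<in>pvars p. \<exists>h. (\<forall>t\<in>ball 0 (\<epsilon> y). (h has_field_derivative r y t) (at t)) \<and>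
    r y holomorphic_on ball 0 (\<epsilon> y) \<and>
    (\<forall>x. \<bar>x\<bar> < \<epsilon> y \<longrightarrow> h (of_real x) = complex_of_real (jet logistic_field cO x (logistic_init (z (fst y)) 0) (cJ, snd y)))" by blast
  from bchoice[OF this] obtain h where h: "\<And>y. y \<in> pvars p \<Longrightarrow> (\<forall>t\<in>ball 0 (\<epsilon> y). (h y has_field_derivative r y t) (at t)) \<and>
    r y holomorphic_on ball 0 (\<epsilon> y) \<and>
    (\<forall>x. \<bar>x\<bar> < \<epsilon> y \<longrightarrow> h y (of_real x) = complex_of_real (jet logistic_field cO x (logistic_init (z (fst y)) 0) (cJ, snd y)))" by blast
  define \<rho> where "\<rho> = Min (insert 1 (\<epsilon> ` pvars p))"
  have \<rho>: "0 < \<rho>" unfolding \<rho>_def using \<epsilon> by (subst Min_gr_iff) auto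
  have \<rho>le: "\<rho> \<le> \<epsilon> y" if "y \<in> pvars p" for y unfolding \<rho>_def by (rule Min_le) (use that in auto)
  have hd: "(h y has_field_derivative r y t) (at t)" if "y \<in> pvars p" "t \<in> ball 0 \<rho>" for y t
    using h[OF that(1)] \<rho>le[OF that(1)] that(2) by auto
  have rh: "r y holomorphic_on ball 0 \<rho>" if "y \<in> pvars p" for y
    by (rule holomorphic_on_subset[of _ "ball 0 (\<epsilon> y)"]) (use h[OF that] \<rho>le[OF that] in auto)
  have hh: "h y holomorphic_on ball 0 \<rho>" if "y \<in> pvars p" for y
    unfolding holomorphic_on_open[OF open_ball] using hd[OF that] by blast
  define f where "f t = peval (\<lambda>y. h y t + of_real \<sigma> * exp t * r y t) p" for t
  have fh: "f holomorphic_on ball 0 \<rho>" unfolding f_def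
    by (rule holomorphic_on_peval) (intro holomorphic_intros hh rh)
  have f0: "f t = 0" if t: "t \<in> ball 0 \<rho>" for t
  proof (rule real_zeros_identity[OF fh _ \<rho> order_refl t])
    fix x :: real assume x: "0 < \<bar>x\<bar>" "\<bar>x\<bar> < \<rho>"
    have "f (of_real x) = peval (\<lambda>y. complex_of_real (case y of (b, l) \<Rightarrow> jet logistic_field cO x (logistic_init (z b) 0) (cJ, l) +
       \<sigma> * exp x * jet logistic_field cO x (logistic_init (z b) 0) (cO, l))) p"
      unfolding f_def
    proof (rule peval_cong)
      fix y assume y: "y \<in> pvars p"
      obtain b l where bl: "y = (b, l)" by (cases y)
      have zb: "0 < z b" "z b < 1" using z01[of b] y unfolding bl by force+
      have "h y (of_real x) = complex_of_real (jet logistic_field cO x (logistic_init (z b) 0) (cJ, l))"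
        using h[OF y] \<rho>le[OF y] x(2) unfolding bl by simp
      moreover have "r y (of_real x) = complex_of_real (jet logistic_field cO x (logistic_init (z b) 0) (cO, l))"
        unfolding aux_jet_O[OF zb] of_real_logistic_deriv of_real_exp_exp r_def bl by simp
      ultimately show "h y (of_real x) + of_real \<sigma> * exp (of_real x) * r y (of_real x) =
        complex_of_real (case y of (b, l) \<Rightarrow> jet logistic_field cO x (logistic_init (z b) 0) (cJ, l) +
       \<sigma> * exp x * jet logistic_field cO x (logistic_init (z b) 0) (cO, l))"
        unfolding bl prod.case by (simp add: exp_of_real)
    qed
    also have "\<dots> = 0" unfolding peval_of_real using rel[of x] x by simp
    finally show "f (of_real x) = 0" .
  qed
  have "isCont Ln 1" by (rule continuous_at_Ln) (simp add: complex_nonpos_Reals_iff)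
  then have "eventually (\<lambda>v. dist (Ln v) (Ln 1) < \<rho>) (nhds 1)"
    using \<rho> unfolding isCont_def tendsto_at_iff_tendsto_nhds by (rule tendstoD)
  then obtain \<delta>1 where \<delta>1: "0 < \<delta>1" "\<And>v. dist v 1 < \<delta>1 \<Longrightarrow> dist (Ln v) (Ln 1) < \<rho>"
    unfolding eventually_nhds_metric by blast
  define \<delta> where "\<delta> = min \<delta>1 1"
  have \<delta>: "0 < \<delta>" using \<delta>1(1) by (simp add: \<delta>_def)
  have Lnb: "Ln v \<in> ball 0 \<rho>" if "v \<in> ball 1 \<delta>" for v :: complex
    using \<delta>1(2)[of v] that by (simp add: \<delta>_def dist_commute)
  have pos: "v \<notin> \<real>\<^sub>\<le>\<^sub>0" if "v \<in> ball 1 \<delta>" for v :: complex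
  proof
    assume "v \<in> \<real>\<^sub>\<le>\<^sub>0"
    then have "Re v \<le> 0" by (simp add: complex_nonpos_Reals_iff)
    moreover have "\<bar>Re (1 - v)\<bar> \<le> norm (1 - v)" by (rule abs_Re_le_cmod)
    moreover have "norm (1 - v) < 1" using that by (simp add: \<delta>_def dist_norm)
    ultimately show False by simp
  qed
  show ?thesis
  proof (rule logistic_integrals_independent[OF inj z01 \<delta>, of "\<lambda>y v. h y (Ln v)" \<sigma>])
    fix y v assume y: "y \<in> pvars p" and v: "v \<in> ball (1 :: complex) \<delta>"
    have "v \<noteq> 0" using pos[OF v] by auto
    then have e: "exp (Ln v) = v" by simp
    have "((\<lambda>v. h y (Ln v)) has_field_derivative r y (Ln v) * inverse v) (at v)"
      by (rule DERIV_chain2[OF hd[OF y Lnb[OF v]] has_field_derivative_Ln[OF pos[OF v]]])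
    then show "((\<lambda>v. h y (Ln v)) has_field_derivative logistic_deriv (snd y) (exp (v - 1)) (complex_of_real (z (fst y))) / v) (at v)"
      unfolding r_def e divide_inverse .
  next
    have "eventually (\<lambda>v. v \<in> ball (1 :: complex) \<delta>) (at 1)"
      by (rule eventually_at_in_open') (use \<delta> in auto)
    then show "eventually (\<lambda>v. peval (\<lambda>y. h y (Ln v) + of_real \<sigma> * v * logistic_deriv (snd y) (exp (v - 1)) (complex_of_real (z (fst y)))) p = 0) (at 1)"
    proof eventually_elim
      case (elim v)
      have "v \<noteq> 0" using pos[OF elim] by auto
      then have e: "exp (Ln v) = v" by simp
      show ?case using f0[OF Lnb[OF elim]] unfolding f_def r_def e .
    qed
  qed
qed

lemma aux_perturb:
  assumes z: "0 < z" "z < 1"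
  shows "((\<lambda>\<gamma>. jet logistic_field cO x (logistic_init z \<gamma>) q) \<longlongrightarrow> jet logistic_field cO x (logistic_init z 0) q) (at 0)"
    and "eventually (\<lambda>\<gamma>. x \<in> flow_dom logistic_field (logistic_init z \<gamma>)) (at 0)"
proof -
  have lim: "((\<lambda>\<gamma>. (x, logistic_init z \<gamma>)) \<longlongrightarrow> (x, logistic_init z 0)) (at 0)"
  proof (rule tendsto_Pair[OF tendsto_const], rule vec_tendstoI)
    fix k show "((\<lambda>\<gamma>. logistic_init z \<gamma> $ k) \<longlongrightarrow> logistic_init z 0 $ k) (at 0)"
      by (cases "k = cG") (auto simp: logistic_init_def)
  qed
  have jt: "((\<lambda>(x, r'). jet logistic_field cO x r' q) \<longlongrightarrow> (\<lambda>(x, r'). jet logistic_field cO x r' q) (x, logistic_init z 0))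
    (at (x, logistic_init z 0) within {(x, r'). r' $ cO = logistic_init z 0 $ cO})"
    using jet_tendsto[OF aux_explicit(1)[OF z, of x], of cO q] by (simp only: prod.case)
  have mem: "(x, logistic_init z \<gamma>) \<in> {(x, r'). r' $ cO = logistic_init z 0 $ cO}" for \<gamma> by (simp add: logistic_init_cO)
  show "((\<lambda>\<gamma>. jet logistic_field cO x (logistic_init z \<gamma>) q) \<longlongrightarrow> jet logistic_field cO x (logistic_init z 0) q) (at 0)"
    using tendsto_compose_at_within[OF jt lim mem] by (simp only: prod.case)
  have "(x, logistic_init z 0) \<in> {(x, r). x \<in> flow_dom logistic_field r}" using aux_explicit(1)[OF z] by simp
  from topological_tendstoD[OF lim open_flow_dom this]
  show "eventually (\<lambda>\<gamma>. x \<in> flow_dom logistic_field (logistic_init z \<gamma>)) (at 0)" by simp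
qed

section \<open>Quadratic systems containing the logistic one\<close>

text \<open>
  Functions that may occur as components of a vector field of degree \<open>d\<close>.
\<close>

definition poly_field :: "nat \<Rightarrow> (real ^ 'm::finite \<Rightarrow> real) \<Rightarrow> bool" where
  "poly_field d f \<longleftrightarrow> (\<exists>g. \<forall>y. f y = (\<Sum>\<alpha> | monomial_degree \<alpha> \<le> d. g \<alpha> * mon_val \<alpha> (\<lambda>v. y $ v)))"

lemma poly_field_add: "poly_field d f \<Longrightarrow> poly_field d g \<Longrightarrow> poly_field d (\<lambda>y. f y + g y)"
  unfolding poly_field_def
proof (elim exE)
  fix a b
  assume "\<forall>y. f y = (\<Sum>\<alpha> | monomial_degree \<alpha> \<le> d. a \<alpha> * mon_val \<alpha> (\<lambda>v. y $ v))"
    "\<forall>y. g y = (\<Sum>\<alpha> | monomial_degree \<alpha> \<le> d. b \<alpha> * mon_val \<alpha> (\<lambda>v. y $ v))"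
  then show "\<exists>c. \<forall>y. f y + g y = (\<Sum>\<alpha> | monomial_degree \<alpha> \<le> d. c \<alpha> * mon_val \<alpha> (\<lambda>v. y $ v))"
    by (intro exI[of _ "\<lambda>\<alpha>. a \<alpha> + b \<alpha>"]) (simp add: sum.distrib distrib_right)
qed

lemma poly_field_scale: "poly_field d f \<Longrightarrow> poly_field d (\<lambda>y. t * f y)"
  unfolding poly_field_def
proof (elim exE)
  fix a
  assume "\<forall>y. f y = (\<Sum>\<alpha> | monomial_degree \<alpha> \<le> d. a \<alpha> * mon_val \<alpha> (\<lambda>v. y $ v))"
  then show "\<exists>c. \<forall>y. t * f y = (\<Sum>\<alpha> | monomial_degree \<alpha> \<le> d. c \<alpha> * mon_val \<alpha> (\<lambda>v. y $ v))"
    by (intro exI[of _ "\<lambda>\<alpha>. t * a \<alpha>"]) (simp add: sum_distrib_left mult.assoc)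
qed

lemma poly_field_power_power:
  fixes a b :: "'m::finite"
  assumes "m + n \<le> d" shows "poly_field d (\<lambda>y. y $ a ^ m * y $ b ^ n)"
proof -
  define \<alpha>0 where "\<alpha>0 = Poly_Mapping.single a m + Poly_Mapping.single b n"
  have lk: "Poly_Mapping.lookup \<alpha>0 v = (if v = a then m else 0) + (if v = b then n else 0)" for v
    by (simp add: \<alpha>0_def lookup_add lookup_single when_def)
  have "mon_val \<alpha>0 (\<lambda>v. y $ v) = (\<Prod>v\<in>UNIV. (if v = a then y $ v ^ m else 1) * (if v = b then y $ v ^ n else 1))" for y :: "real ^ 'm"
    by (subst mon_val_superset[of UNIV]) (auto simp: lk power_add intro!: prod.cong)
  then have mv: "mon_val \<alpha>0 (\<lambda>v. y $ v) = y $ a ^ m * y $ b ^ n" for y :: "real ^ 'm"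
    unfolding prod.distrib by simp
  have "monomial_degree \<alpha>0 = (\<Sum>v\<in>UNIV. Poly_Mapping.lookup \<alpha>0 v)"
    unfolding monomial_degree_def by (rule sum.mono_neutral_left) (auto simp: Poly_Mapping.in_keys_iff)
  then have deg: "monomial_degree \<alpha>0 \<le> d" unfolding lk sum.distrib using assms by simp
  show ?thesis unfolding poly_field_def
  proof (intro exI[of _ "\<lambda>\<alpha>. if \<alpha> = \<alpha>0 then 1 else 0"] allI)
    fix y :: "real ^ 'm"
    have "(\<Sum>\<alpha> | monomial_degree \<alpha> \<le> d. (if \<alpha> = \<alpha>0 then 1 else 0) * mon_val \<alpha> (\<lambda>v. y $ v)) =
      (\<Sum>\<alpha> | monomial_degree \<alpha> \<le> d. if \<alpha> = \<alpha>0 then mon_val \<alpha> (\<lambda>v. y $ v) else 0)"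
      by (rule sum.cong) auto
    also have "\<dots> = mon_val \<alpha>0 (\<lambda>v. y $ v)" using deg by (simp add: finite_monomials)
    finally show "y $ a ^ m * y $ b ^ n = (\<Sum>\<alpha> | monomial_degree \<alpha> \<le> d. (if \<alpha> = \<alpha>0 then 1 else 0) * mon_val \<alpha> (\<lambda>v. y $ v))"
      unfolding mv ..
  qed
qed

lemma poly_field_quadratic:
  fixes a b :: "'m::finite"
  assumes "d \<ge> 2"
  shows "poly_field d (\<lambda>y :: real ^ 'm. t)" "poly_field d (\<lambda>y. y $ a)" "poly_field d (\<lambda>y. y $ a * y $ b)"
proof -
  show "poly_field d (\<lambda>y :: real ^ 'm. t)" using poly_field_scale[OF poly_field_power_power[of 0 0 d], of t] by simp
  show "poly_field d (\<lambda>y. y $ a)" using poly_field_power_power[of 1 0 d a] assms by simp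
  show "poly_field d (\<lambda>y. y $ a * y $ b)" using poly_field_power_power[of 1 1 d a b] assms by simp
qed

lemma field_of_exists:
  fixes f :: "'m::finite \<Rightarrow> real ^ 'm \<Rightarrow> real"
  assumes "\<And>k. poly_field d (f k)"
  obtains c where "\<And>y k. peval (\<lambda>k. y $ k) (field_of d c k) = f k y"
proof -
  have "\<forall>k. \<exists>g. \<forall>y. f k y = (\<Sum>\<alpha> | monomial_degree \<alpha> \<le> d. g \<alpha> * mon_val \<alpha> (\<lambda>v. y $ v))"
    using assms unfolding poly_field_def by blast
  from choice[OF this] obtain g where g: "\<And>k y. f k y = (\<Sum>\<alpha> | monomial_degree \<alpha> \<le> d. g k \<alpha> * mon_val \<alpha> (\<lambda>v. y $ v))" by blast
  have "peval (\<lambda>k. y $ k) (field_of d (\<lambda>(k, \<alpha>). g k \<alpha>) k) = f k y" for y k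
    unfolding field_of_def peval_general_field g by (rule sum.cong) (auto simp: coeff_index_def)
  then show ?thesis by (rule that)
qed

lemma aux_time:
  assumes t: "t \<in> flow_dom logistic_field (logistic_init z \<gamma>)"
  shows "flow logistic_field (logistic_init z \<gamma>) t $ cG = \<gamma>" "flow logistic_field (logistic_init z \<gamma>) t $ cV = exp t"
proof -
  let ?S = "flow_dom logistic_field (logistic_init z \<gamma>)" and ?y = "flow logistic_field (logistic_init z \<gamma>)"
  have sol: "((\<lambda>t. ?y t $ k) has_real_derivative peval (\<lambda>k. ?y t $ k) (logistic_field k)) (at t within ?S)" if "t \<in> ?S" for t k
    using solves_on_flow_dom[of logistic_field "logistic_init z \<gamma>"] that unfolding solves_on_def by blast
  have cv: "convex ?S" using is_interval_flow_dom is_interval_convex by blast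
  have "\<exists>c. \<forall>t\<in>?S. ?y t $ cG = c"
    by (rule has_field_derivative_zero_constant[OF cv]) (use sol[of _ cG] in \<open>simp add: logistic_field_def\<close>)
  then obtain c where c: "\<And>t. t \<in> ?S \<Longrightarrow> ?y t $ cG = c" by blast
  have "c = \<gamma>" using c[OF zero_in_flow_dom] by (simp add: logistic_init_def)
  then show "?y t $ cG = \<gamma>" using c[OF t] by simp
  have "\<exists>c. \<forall>t\<in>?S. ?y t $ cV * exp (- t) = c"
  proof (rule has_field_derivative_zero_constant[OF cv])
    fix t assume "t \<in> ?S"
    then have d: "((\<lambda>t. ?y t $ cV) has_real_derivative ?y t $ cV) (at t within ?S)" using sol[of t cV] by (simp add: logistic_field_def)
    show "((\<lambda>t. ?y t $ cV * exp (- t)) has_real_derivative 0) (at t within ?S)"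
      by (rule derivative_eq_intros d refl | simp)+
  qed
  then obtain c where c: "\<And>t. t \<in> ?S \<Longrightarrow> ?y t $ cV * exp (- t) = c" by blast
  have "c = 1" using c[OF zero_in_flow_dom] by (simp add: logistic_init_def)
  then show "?y t $ cV = exp t" using c[OF t] by (simp add: exp_minus field_simps)
qed

lemma aux_derivs:
  assumes t: "t \<in> flow_dom logistic_field (logistic_init z \<gamma>)"
  defines "y \<equiv> flow logistic_field (logistic_init z \<gamma>)"
  shows "((\<lambda>t. y t $ cO) has_real_derivative exp t * (y t $ cO * (1 + \<gamma> * y t $ cJ - y t $ cO))) (at t within flow_dom logistic_field (logistic_init z \<gamma>))"
    and "((\<lambda>t. y t $ cJ) has_real_derivative y t $ cO) (at t within flow_dom logistic_field (logistic_init z \<gamma>))"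
proof -
  have sol: "((\<lambda>t. y t $ k) has_real_derivative peval (\<lambda>k. y t $ k) (logistic_field k)) (at t within flow_dom logistic_field (logistic_init z \<gamma>))" for k
    using solves_on_flow_dom[of logistic_field "logistic_init z \<gamma>"] t unfolding solves_on_def y_def by blast
  have "peval (\<lambda>k. y t $ k) (logistic_field cO) = exp t * (y t $ cO * (1 + \<gamma> * y t $ cJ - y t $ cO))"
    unfolding logistic_field_def using aux_time[OF t] by (simp add: y_def)
  then show "((\<lambda>t. y t $ cO) has_real_derivative exp t * (y t $ cO * (1 + \<gamma> * y t $ cJ - y t $ cO))) (at t within flow_dom logistic_field (logistic_init z \<gamma>))"
    using sol[of cO] by simp
  show "((\<lambda>t. y t $ cJ) has_real_derivative y t $ cO) (at t within flow_dom logistic_field (logistic_init z \<gamma>))"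
    using sol[of cJ] by (simp add: logistic_field_def)
qed

text \<open>
  A system whose solutions are expressed by \<open>U\<close> through \<open>O\<close>, \<open>J\<close> and \<open>exp t\<close> has, by uniqueness, the
  flow that \<open>U\<close> describes. The time \<open>X\<close> is fixed, and only coordinate \<open>i\<close> at that time enters.
\<close>

lemma transfer_jets:
  fixes V :: "'m::finite \<Rightarrow> 'm pexp" and U :: "'m \<Rightarrow> real \<Rightarrow> real \<Rightarrow> real \<Rightarrow> real"
  assumes sol: "\<And>O' J k t S. (O' has_real_derivative exp t * (O' t * (1 + \<gamma> * J t - O' t))) (at t within S) \<Longrightarrow>
      (J has_real_derivative O' t) (at t within S) \<Longrightarrow>
      ((\<lambda>t. U k (O' t) (J t) (exp t)) has_real_derivative f k (\<chi> k. U k (O' t) (J t) (exp t))) (at t within S)"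
    and f: "\<And>y k. peval (\<lambda>k. y $ k) (V k) = f k y"
    and init: "\<And>z k. U k z 0 1 = initial_value j v z $ k"
    and out: "\<And>o' J. U i o' J (exp X) = J + B * o' + T"
    and X: "X \<in> flow_dom logistic_field (logistic_init z0 \<gamma>)"
  shows "X \<in> flow_dom V (initial_value j v z0)"
    and "jet V j X (initial_value j v z0) (i, l) =
      jet logistic_field cO X (logistic_init z0 \<gamma>) (cJ, l) + B * jet logistic_field cO X (logistic_init z0 \<gamma>) (cO, l) + (if l = 0 then T else 0)"
proof -
  have main: "X \<in> flow_dom V (initial_value j v z) \<and>
    flow V (initial_value j v z) X $ i = flow logistic_field (logistic_init z \<gamma>) X $ cJ + B * flow logistic_field (logistic_init z \<gamma>) X $ cO + T"
    if z: "X \<in> flow_dom logistic_field (logistic_init z \<gamma>)" for z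
  proof -
    let ?S = "flow_dom logistic_field (logistic_init z \<gamma>)" and ?a = "flow logistic_field (logistic_init z \<gamma>)"
    define y where "y t = (\<chi> k. U k (?a t $ cO) (?a t $ cJ) (exp t))" for t
    have yk: "y t $ k = U k (?a t $ cO) (?a t $ cJ) (exp t)" for t k by (simp add: y_def)
    have "solves_on V ?S y" unfolding solves_on_def
    proof (intro ballI allI)
      fix t k assume t: "t \<in> ?S"
      have e: "peval (\<lambda>k. y t $ k) (V k) = f k (\<chi> k. U k (?a t $ cO) (?a t $ cJ) (exp t))"
        unfolding f y_def ..
      show "((\<lambda>s. y s $ k) has_real_derivative peval (\<lambda>k. y t $ k) (V k)) (at t within ?S)"
        unfolding e unfolding yk
        by (rule sol[of "\<lambda>t. ?a t $ cO" t "\<lambda>t. ?a t $ cJ", OF aux_derivs[OF t]])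
    qed
    moreover have "y 0 = initial_value j v z"
      unfolding vec_eq_iff yk flow_0 by (simp add: logistic_init_def init)
    ultimately have *: "X \<in> flow_dom V (initial_value j v z)" "flow V (initial_value j v z) X = y X"
      using fdomI[OF is_interval_flow_dom zero_in_flow_dom z] flow_eq[OF is_interval_flow_dom zero_in_flow_dom z] by blast+
    then show ?thesis by (simp add: yk out)
  qed
  show "X \<in> flow_dom V (initial_value j v z0)" using main[OF X] by blast
  have op: "open {z. X \<in> flow_dom logistic_field (logistic_init z \<gamma>)}"
  proof -
    have "continuous_on UNIV (\<lambda>z. logistic_init z \<gamma>)"
      unfolding logistic_init_def
    proof (rule continuous_on_vec_lambda)
      fix k show "continuous_on UNIV (\<lambda>z. if k = cO then z else if k = cJ then 0 else if k = cG then \<gamma> else 1)"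
        by (cases "k = cO") auto
    qed
    then have "continuous_on UNIV (\<lambda>z. (X, logistic_init z \<gamma>))" by (rule continuous_on_Pair[OF continuous_on_const])
    from open_vimage[OF open_flow_dom this] show ?thesis by (simp add: vimage_def)
  qed
  have "jet V j X (initial_value j v z0) (i, l) = (deriv ^^ l) (\<lambda>z. flow V (initial_value j v z) X $ i) z0"
    unfolding jet_def prod.case set_coord_initial_value by (simp add: initial_value_def)
  also have "\<dots> = (deriv ^^ l) (\<lambda>z. 1 * flow logistic_field (set_coord (logistic_init z0 \<gamma>) cO z) X $ cJ + B * flow logistic_field (set_coord (logistic_init z0 \<gamma>) cO z) X $ cO + T) z0"
    by (rule higher_deriv_cong_open[OF op]) (use X main in \<open>auto simp: set_coord_logistic_init\<close>)
  also have "\<dots> = 1 * jet logistic_field cO X (logistic_init z0 \<gamma>) (cJ, l) + B * jet logistic_field cO X (logistic_init z0 \<gamma>) (cO, l) + (if l = 0 then T else 0)"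
    using jet_linear[OF X, of l 1 cO cJ B cO T] unfolding logistic_init_cO .
  finally show "jet V j X (initial_value j v z0) (i, l) =
      jet logistic_field cO X (logistic_init z0 \<gamma>) (cJ, l) + B * jet logistic_field cO X (logistic_init z0 \<gamma>) (cO, l) + (if l = 0 then T else 0)" by simp
qed

lemma exp_mult_deriv:
  fixes g :: "real \<Rightarrow> real"
  assumes "(g has_real_derivative D) (at t within S)"
  shows "((\<lambda>t. exp t * g t) has_real_derivative exp t * g t + exp t * D) (at t within S)"
  using DERIV_mult'[OF has_field_derivative_at_within[OF DERIV_exp] assms] by (simp only: add.commute)

lemma affine_deriv:
  fixes g :: "real \<Rightarrow> real"
  assumes "(g has_real_derivative D) (at t within S)"
  shows "((\<lambda>t. a + b * g t) has_real_derivative b * D) (at t within S)"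
  using DERIV_add[OF DERIV_const DERIV_cmult[OF assms]] by (simp only: add_0_left)

text \<open>
  With \<open>w = v O\<close> and \<open>Y = v (1 + \<gamma> J)\<close> one has \<open>w' = w + Y w - w\<^sup>2\<close> and \<open>Y' = Y + \<gamma> w\<close>. The system has
  \<open>y\<^sub>j = w\<close> and \<open>y\<^sub>i = (Y - \<kappa>) / (\<gamma> \<kappa>)\<close> with \<open>\<kappa> = exp X\<close>, so that \<open>y\<^sub>i\<close> equals \<open>J\<close> at time \<open>X\<close> while its
  initial value does not depend on \<open>z\<close>.
\<close>

lemma embed_distinct:
  fixes i j :: "'m::finite"
  assumes d: "d \<ge> 2" and ij: "i \<noteq> j" and \<gamma>: "\<gamma> \<noteq> 0"
  shows "\<exists>c v. \<forall>z l. X \<in> flow_dom logistic_field (logistic_init z \<gamma>) \<longrightarrow> X \<in> flow_dom (field_of d c) (initial_value j v z) \<and>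
    jet (field_of d c) j X (initial_value j v z) (i, l) = jet logistic_field cO X (logistic_init z \<gamma>) (cJ, l)"
proof -
  define \<kappa> where "\<kappa> = exp X"
  have \<kappa>: "\<kappa> \<noteq> 0" by (simp add: \<kappa>_def)
  define f where "f k y = (if k = j then y $ j + \<kappa> * y $ j + (\<kappa> * \<gamma>) * (y $ i * y $ j) + (-1) * (y $ j * y $ j)
     else if k = i then 1 / \<gamma> + y $ i + (1 / \<kappa>) * y $ j else 0)" for k and y :: "real ^ 'm"
  have "poly_field d (f k)" for k
    unfolding f_def using d by (cases "k = j"; cases "k = i"; simp only: if_True if_False refl) (intro poly_field_add poly_field_scale poly_field_quadratic; assumption)+
  then obtain c where c: "\<And>y k. peval (\<lambda>k. y $ k) (field_of d c k) = f k y" using field_of_exists by blast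
  define U where "U k o' J e = (if k = j then e * o' else if k = i then (e * (1 + \<gamma> * J) - \<kappa>) / (\<gamma> * \<kappa>) else 0)" for k and o' J e :: real
  define v where "v a = (if a = Some i then (1 - \<kappa>) / (\<gamma> * \<kappa>) else 0)" for a
  have sol: "((\<lambda>t. U k (O' t) (J t) (exp t)) has_real_derivative f k (\<chi> k. U k (O' t) (J t) (exp t))) (at t within S)"
    if O': "(O' has_real_derivative exp t * (O' t * (1 + \<gamma> * J t - O' t))) (at t within S)"
      and J: "(J has_real_derivative O' t) (at t within S)" for O' J k t S
  proof (cases "k = j")
    case True
    have "((\<lambda>t. exp t * O' t) has_real_derivative exp t * O' t + exp t * (exp t * (O' t * (1 + \<gamma> * J t - O' t)))) (at t within S)"
      by (rule exp_mult_deriv[OF O'])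
    also have "exp t * O' t + exp t * (exp t * (O' t * (1 + \<gamma> * J t - O' t))) = f j (\<chi> k. U k (O' t) (J t) (exp t))"
      unfolding f_def U_def using ij \<gamma> \<kappa> by (simp add: field_simps)
    finally show ?thesis by (simp add: True U_def)
  next
    case False
    show ?thesis
    proof (cases "k = i")
      case True
      have "((\<lambda>t. (exp t * (1 + \<gamma> * J t) - \<kappa>) / (\<gamma> * \<kappa>)) has_real_derivative
        (exp t * (1 + \<gamma> * J t) + exp t * (\<gamma> * O' t)) / (\<gamma> * \<kappa>)) (at t within S)"
        using DERIV_cdivide[OF DERIV_diff[OF exp_mult_deriv[OF affine_deriv[OF J]] DERIV_const]] by (simp only: diff_0_right)
      also have "(exp t * (1 + \<gamma> * J t) + exp t * (\<gamma> * O' t)) / (\<gamma> * \<kappa>) = f i (\<chi> k. U k (O' t) (J t) (exp t))"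
        unfolding f_def U_def using ij \<gamma> \<kappa> by (simp add: field_simps)
      finally show ?thesis using ij by (simp add: True U_def)
    qed (use False in \<open>simp add: U_def f_def\<close>)
  qed
  have init: "U k z 0 1 = initial_value j v z $ k" for z k by (simp add: U_def v_def initial_value_def)
  have out: "U i o' J (exp X) = J + 0 * o' + 0" for o' J
    using ij \<gamma> \<kappa> by (simp add: U_def \<kappa>_def[symmetric] field_simps)
  show ?thesis
    using transfer_jets[where V = "field_of d c" and U = U and f = f and \<gamma> = \<gamma> and j = j and v = v and i = i and X = X and B = 0 and T = 0,
        OF sol c init out] by (intro exI[of _ c] exI[of _ v]) auto
qed

text \<open>
  The same variables \<open>w\<close> and \<open>Y\<close>, now with \<open>y\<^sub>k = Y\<close> and \<open>y\<^sub>j = w + A (Y - 1)\<close>. The factor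
  \<open>A = 1 / (\<gamma> exp X)\<close> is chosen so that \<open>J\<close> appears with coefficient \<open>1\<close> at time \<open>X\<close>, and the term
  \<open>- A\<close> makes the initial value of \<open>y\<^sub>j\<close> equal to \<open>z\<close>; the price is a constant of size \<open>1 / \<gamma>\<close>.
\<close>

lemma embed_same:
  fixes j k :: "'m::finite"
  assumes d: "d \<ge> 2" and jk: "k \<noteq> j" and \<gamma>: "\<gamma> \<noteq> 0"
  shows "\<exists>c v. \<forall>z l. X \<in> flow_dom logistic_field (logistic_init z \<gamma>) \<longrightarrow> X \<in> flow_dom (field_of d c) (initial_value j v z) \<and>
    jet (field_of d c) j X (initial_value j v z) (j, l) = jet logistic_field cO X (logistic_init z \<gamma>) (cJ, l) + exp X * jet logistic_field cO X (logistic_init z \<gamma>) (cO, l)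
      + (if l = 0 then (exp X - 1) / (\<gamma> * exp X) else 0)"
proof -
  define \<kappa> where "\<kappa> = exp X"
  have \<kappa>: "\<kappa> \<noteq> 0" by (simp add: \<kappa>_def)
  define A where "A = 1 / (\<gamma> * \<kappa>)"
  define f where "f n y = (if n = j then ((y $ j + (- A) * y $ k + A)
      + (y $ k * y $ j + (- A) * (y $ k * y $ k) + A * y $ k)
      + (-1) * (y $ j * y $ j + (A * A) * (y $ k * y $ k) + A * A + (- 2 * A) * (y $ j * y $ k) + (2 * A) * y $ j + (- 2 * A * A) * y $ k)
      + A * (y $ k + \<gamma> * (y $ j + (- A) * y $ k + A)))
     else if n = k then y $ k + \<gamma> * (y $ j + (- A) * y $ k + A) else 0)" for n and y :: "real ^ 'm"
  have "poly_field d (f n)" for n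
    unfolding f_def using d by (cases "n = j"; cases "n = k"; simp only: if_True if_False refl) (intro poly_field_add poly_field_scale poly_field_quadratic; assumption)+
  then obtain c where c: "\<And>y k. peval (\<lambda>k. y $ k) (field_of d c k) = f k y" using field_of_exists by blast
  define U where "U n o' J e = (if n = j then e * o' + A * (e * (1 + \<gamma> * J) - 1) else if n = k then e * (1 + \<gamma> * J) else 0)" for n and o' J e :: real
  define v where "v a = (if a = Some k then 1 else 0 :: real)" for a
  have sol: "((\<lambda>t. U n (O' t) (J t) (exp t)) has_real_derivative f n (\<chi> k. U k (O' t) (J t) (exp t))) (at t within S)"
    if O': "(O' has_real_derivative exp t * (O' t * (1 + \<gamma> * J t - O' t))) (at t within S)"
      and J: "(J has_real_derivative O' t) (at t within S)" for O' J n t S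
  proof (cases "n = j")
    case True
    have "((\<lambda>t. exp t * O' t + A * (exp t * (1 + \<gamma> * J t) - 1)) has_real_derivative
       exp t * O' t + exp t * (exp t * (O' t * (1 + \<gamma> * J t - O' t))) + A * (exp t * (1 + \<gamma> * J t) + exp t * (\<gamma> * O' t))) (at t within S)"
      using DERIV_add[OF exp_mult_deriv[OF O'] DERIV_cmult[OF DERIV_diff[OF exp_mult_deriv[OF affine_deriv[OF J]] DERIV_const]]]
      by (simp only: diff_0_right)
    also have "exp t * O' t + exp t * (exp t * (O' t * (1 + \<gamma> * J t - O' t))) + A * (exp t * (1 + \<gamma> * J t) + exp t * (\<gamma> * O' t))
       = f j (\<chi> k. U k (O' t) (J t) (exp t))"
      unfolding f_def U_def using jk by (simp add: algebra_simps power2_eq_square)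
    finally show ?thesis by (simp add: True U_def)
  next
    case False
    show ?thesis
    proof (cases "n = k")
      case True
      have "((\<lambda>t. exp t * (1 + \<gamma> * J t)) has_real_derivative exp t * (1 + \<gamma> * J t) + exp t * (\<gamma> * O' t)) (at t within S)"
        by (rule exp_mult_deriv[OF affine_deriv[OF J]])
      also have "exp t * (1 + \<gamma> * J t) + exp t * (\<gamma> * O' t) = f k (\<chi> k. U k (O' t) (J t) (exp t))"
        unfolding f_def U_def using jk by (simp add: algebra_simps)
      finally show ?thesis using jk by (simp add: True U_def)
    qed (use False in \<open>simp add: U_def f_def\<close>)
  qed
  have init: "U n z 0 1 = initial_value j v z $ n" for z n by (simp add: U_def v_def initial_value_def)
  have out: "U j o' J (exp X) = J + exp X * o' + (exp X - 1) / (\<gamma> * exp X)" for o' J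
    using jk \<gamma> \<kappa> by (simp add: U_def A_def \<kappa>_def[symmetric] field_simps)
  show ?thesis
    using transfer_jets[where V = "field_of d c" and U = U and f = f and \<gamma> = \<gamma> and j = j and v = v and i = j and X = X
        and B = "exp X" and T = "(exp X - 1) / (\<gamma> * exp X)", OF sol c init out] by (intro exI[of _ c] exI[of _ v]) auto
qed

section \<open>Leading coefficient under a large shift\<close>

text \<open>
  Coefficients of the expansion in powers of \<open>T\<close> when \<open>T\<close> is added to all variables in \<open>S\<close>.
\<close>

primrec shift_coeff :: "'x set \<Rightarrow> 'x pexp \<Rightarrow> nat \<Rightarrow> 'x pexp" where
  "shift_coeff S (Const a) h = (if h = 0 then Const a else Const 0)"
| "shift_coeff S (Var x) h = (if h = 0 then Var x else if h = 1 \<and> x \<in> S then Const 1 else Const 0)"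
| "shift_coeff S (Add p q) h = Add (shift_coeff S p h) (shift_coeff S q h)"
| "shift_coeff S (Mul p q) h = psum (map (\<lambda>a. Mul (shift_coeff S p a) (shift_coeff S q (h - a))) [0..<Suc h])"

primrec shift_bound :: "'x pexp \<Rightarrow> nat" where
  "shift_bound (Const a) = 0" | "shift_bound (Var x) = 1" | "shift_bound (Add p q) = shift_bound p + shift_bound q" | "shift_bound (Mul p q) = shift_bound p + shift_bound q"

definition shift_poly :: "'x set \<Rightarrow> 'x pexp \<Rightarrow> ('x \<Rightarrow> real) \<Rightarrow> real poly" where
  "shift_poly S p e = peval_in (\<lambda>a. [:a:]) (\<lambda>x. [:e x, if x \<in> S then 1 else 0:]) p"

lemma poly_shift_poly: "poly (shift_poly S p e) T = peval (\<lambda>x. e x + (if x \<in> S then T else 0)) p"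
  unfolding shift_poly_def by (induction p) auto

lemma coeff_shift_poly: "coeff (shift_poly S p e) h = peval e (shift_coeff S p h)"
proof (induction p arbitrary: h)
  case (Const a)
  then show ?case by (cases h) (auto simp: shift_poly_def)
next
  case (Var x)
  show ?case by (cases h; cases "h - 1") (auto simp: shift_poly_def)
next
  case (Mul p q)
  have "coeff (shift_poly S (Mul p q) e) h = (\<Sum>i\<le>h. coeff (shift_poly S p e) i * coeff (shift_poly S q e) (h - i))"
    by (simp add: shift_poly_def coeff_mult)
  also have "\<dots> = peval e (shift_coeff S (Mul p q) h)"
    unfolding Mul by (simp add: peval_psum o_def sum_list_distinct_conv_sum_set atLeast0LessThan lessThan_Suc_atMost del: upt_Suc)
  finally show ?case .
qed (simp add: shift_poly_def)

lemma degree_shift_poly: "degree (shift_poly S p e) \<le> shift_bound p"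
proof (induction p)
  case (Add p q)
  have "degree (shift_poly S p e + shift_poly S q e) \<le> shift_bound p + shift_bound q"
    by (rule degree_add_le) (use Add in auto)
  then show ?case by (simp add: shift_poly_def)
next
  case (Mul p q)
  have "degree (shift_poly S p e * shift_poly S q e) \<le> shift_bound p + shift_bound q"
    by (rule order_trans[OF degree_mult_le]) (use Mul in auto)
  then show ?case by (simp add: shift_poly_def)
qed (auto simp: shift_poly_def)

lemma pvars_shift_coeff: "pvars (shift_coeff S p h) \<subseteq> pvars p"
proof (induction p arbitrary: h)
  case (Mul p q)
  then show ?case by (auto simp: pvars_psum simp del: upt_Suc)
qed auto

text \<open>
  The highest power of \<open>T\<close> whose coefficient is not the zero polynomial. It does not depend on the
  argument \<open>e\<close>, so it survives a limit in \<open>e\<close>.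
\<close>

lemma leading_coefficient:
  assumes "peval e1 p \<noteq> (0 :: real)"
  obtains H e2 where "peval e2 (shift_coeff S p H) \<noteq> (0 :: real)" "\<And>e. degree (shift_poly S p e) \<le> H"
proof -
  define P where "P h \<longleftrightarrow> (\<exists>e. peval e (shift_coeff S p h) \<noteq> (0 :: real))" for h
  have "poly (shift_poly S p e1) 0 \<noteq> 0" unfolding poly_shift_poly using assms by simp
  then have "shift_poly S p e1 \<noteq> 0" by auto
  then obtain h0 where h0: "coeff (shift_poly S p e1) h0 \<noteq> 0" using leading_coeff_0_iff by blast
  then have Ph0: "P h0" unfolding P_def coeff_shift_poly by blast
  have bound: "h \<le> shift_bound p" if "P h" for h
  proof -
    obtain e where "coeff (shift_poly S p e) h \<noteq> 0" using \<open>P h\<close> unfolding P_def coeff_shift_poly by blast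
    then show ?thesis using le_degree degree_shift_poly order_trans by blast
  qed
  define H where "H = (GREATEST h. P h)"
  have "P H" unfolding H_def by (rule GreatestI_nat[of P, OF Ph0]) (use bound in blast)
  then obtain e2 where e2: "peval e2 (shift_coeff S p H) \<noteq> (0 :: real)" unfolding P_def by blast
  have "degree (shift_poly S p e) \<le> H" for e
  proof (rule degree_le, intro allI impI)
    fix h assume h: "H < h"
    have "\<not> P h"
    proof
      assume "P h"
      then have "h \<le> H" unfolding H_def by (rule Greatest_le_nat) (use bound in blast)
      with h show False by simp
    qed
    then show "coeff (shift_poly S p e) h = 0" unfolding coeff_shift_poly P_def by blast
  qed
  with e2 show ?thesis by (rule that)
qed

section \<open>Certificates do not vanish identically\<close>

text \<open>
  The points are placed in disjoint subintervals of \<open>(0, 1)\<close>, without making the certificate vanish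
  identically in the remaining variables.
\<close>

lemma distinct_points:
  obtains z :: "nat \<Rightarrow> real" where "\<And>b. b < npts s \<Longrightarrow> 0 < z b \<and> z b < 1" "inj_on z {..<npts s}"
    "\<exists>e. peval e (psubst (\<lambda>(b, u). case u of 0 \<Rightarrow> Const (z b) | Suc l \<Rightarrow> Var (b, l)) (dae_cert s)) \<noteq> (0 :: real)"
proof -
  obtain e0 :: "nat \<times> nat \<Rightarrow> real" where e0: "peval e0 (dae_cert s) \<noteq> 0" using dae_cert_nonzero by blast
  \<comment> \<open>Only the points, that is, the variables with second index \<open>0\<close>, are moved.\<close>
  define S where "S = (\<lambda>(b :: nat, u :: nat). {1 / real (b + 2)<..<1 / real (b + 1)})"
  let ?B = "(\<lambda>b. (b, 0 :: nat)) ` {..<npts s}"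
  have "\<forall>b\<in>?B. infinite (S b)" by (auto simp: S_def infinite_Ioo_iff frac_less2)
  from peval_nonzero_move[OF _ this e0] obtain e1 where e1: "\<forall>b\<in>?B. e1 b \<in> S b" "peval e1 (dae_cert s) \<noteq> 0" by blast
  define z where "z b = e1 (b, 0)" for b
  have zS: "1 / real (b + 2) < z b \<and> z b < 1 / real (b + 1)" if "b < npts s" for b
    using e1(1) that by (auto simp: S_def z_def)
  have mono: "z b' < z b" if "b < b'" "b' < npts s" for b b'
  proof -
    have "z b' < 1 / real (b' + 1)" using zS[OF that(2)] by blast
    also have "\<dots> \<le> 1 / real (b + 2)" using that(1) by (intro divide_left_mono) auto
    also have "\<dots> < z b" using zS[of b] that by simp
    finally show ?thesis .
  qed
  show ?thesis
  proof (rule that)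
    fix b assume "b < npts s"
    from zS[OF this] have "0 < z b" "z b < 1 / real (b + 1)" by (auto intro: less_trans[of 0 "1 / real (b + 2)"])
    moreover have "1 / real (b + 1) \<le> 1" by simp
    ultimately show "0 < z b \<and> z b < 1" by linarith
  next
    show "inj_on z {..<npts s}"
    proof (rule inj_onI)
      fix b b' assume "b \<in> {..<npts s}" "b' \<in> {..<npts s}" "z b = z b'"
      then show "b = b'" using mono[of b b'] mono[of b' b] by (cases b b' rule: linorder_cases) auto
    qed
  next
    have "peval (\<lambda>(b, l). e1 (b, Suc l)) (psubst (\<lambda>(b, u). case u of 0 \<Rightarrow> Const (z b) | Suc l \<Rightarrow> Var (b, l)) (dae_cert s)) = peval e1 (dae_cert s)"
      unfolding peval_psubst by (rule peval_cong) (auto simp: z_def split: nat.split)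
    then show "\<exists>e. peval e (psubst (\<lambda>(b, u). case u of 0 \<Rightarrow> Const (z b) | Suc l \<Rightarrow> Var (b, l)) (dae_cert s)) \<noteq> (0 :: real)"
      using e1(2) by metis
  qed
qed

text \<open>
  If all coefficients vanished, the certificate would vanish along every flow, in particular for the
  embedded logistic systems. The limit \<open>\<gamma> \<rightarrow> 0\<close> then yields a nontrivial polynomial relation between
  jets that are algebraically independent.
\<close>

theorem certificate_coefficient_nonzero:
  fixes i j :: "'m::finite"
  assumes m: "CARD('m) \<ge> 2" and d: "d \<ge> 2"
  shows "\<exists>c v z q. peval (param_env c v z) (cert_coeff d i j s q) \<noteq> 0"
proof (rule ccontr)
  assume "\<not> ?thesis"
  then have W0: "peval (param_env c v z) (cert_coeff d i j s q) = 0" for c v z q by blast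
  obtain z :: "nat \<Rightarrow> real" where z: "\<And>b. b < npts s \<Longrightarrow> 0 < z b \<and> z b < 1" "inj_on z {..<npts s}"
    "\<exists>e. peval e (psubst (\<lambda>(b, u). case u of 0 \<Rightarrow> Const (z b) | Suc l \<Rightarrow> Var (b, l)) (dae_cert s)) \<noteq> (0 :: real)"
    by (rule distinct_points[of s]) blast
  define G where "G = psubst (\<lambda>(b, u). case u of 0 \<Rightarrow> Const (z b) | Suc l \<Rightarrow> Var (b, l)) (dae_cert s)"
  obtain e1 where e1: "peval e1 G \<noteq> (0 :: real)" using z(3) unfolding G_def by blast
  have Gv: "b < npts s" if "(b, l) \<in> pvars G" for b l
  proof -
    obtain y where y: "y \<in> pvars (dae_cert s)" "(b, l) \<in> pvars (case y of (b, u) \<Rightarrow> case u of 0 \<Rightarrow> Const (z b) | Suc l \<Rightarrow> Var (b, l))"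
      using \<open>(b, l) \<in> pvars G\<close> unfolding G_def pvars_psubst by blast
    then have "b = fst y" by (auto split: prod.splits nat.splits)
    then show ?thesis using pvars_dae_cert[OF y(1)] by simp
  qed
  have flow: "peval (\<lambda>(b, l). jet (field_of d c) j X (initial_value j v (z b)) (i, l)) G = 0"
    if "\<And>b. b < npts s \<Longrightarrow> X \<in> flow_dom (field_of d c) (initial_value j v (z b))" for c v X
  proof -
    have "peval (flow_env d c j v z X) (cert_flow i s) = 0"
      by (rule certificate_zero[OF W0]) (use that in \<open>auto simp: flow_dom_all_def\<close>)
    moreover have "peval (flow_env d c j v z X) (cert_flow i s) = peval (\<lambda>(b, l). jet (field_of d c) j X (initial_value j v (z b)) (i, l)) G"
      unfolding cert_flow_def G_def peval_psubst by (rule peval_cong) (auto simp: flow_env_def split: nat.split)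
    ultimately show ?thesis by simp
  qed
  have indep: "peval e p = (0 :: real)"
    if "pvars p \<subseteq> pvars G" and "\<And>x. x \<noteq> 0 \<Longrightarrow> peval (\<lambda>(b, l). jet logistic_field cO x (logistic_init (z b) 0) (cJ, l) +
       \<sigma> * exp x * jet logistic_field cO x (logistic_init (z b) 0) (cO, l)) p = 0" for p e \<sigma>
  proof (rule aux_jets_independent[OF _ _ that(2)])
    have sub: "fst ` pvars p \<subseteq> {..<npts s}" using Gv that(1) by fastforce
    show "inj_on z (fst ` pvars p)" by (rule inj_on_subset[OF z(2) sub])
    show "0 < z b \<and> z b < 1" if "b \<in> fst ` pvars p" for b using z(1) that sub by blast
  qed
  have dom: "eventually (\<lambda>\<gamma>. \<gamma> \<noteq> 0 \<and> (\<forall>b<npts s. X \<in> flow_dom logistic_field (logistic_init (z b) \<gamma>))) (at 0)" for X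
  proof (rule eventually_conj)
    show "eventually (\<lambda>\<gamma> :: real. \<gamma> \<noteq> 0) (at 0)" by (simp add: eventually_at_filter)
    have "eventually (\<lambda>\<gamma>. \<forall>b\<in>{..<npts s}. X \<in> flow_dom logistic_field (logistic_init (z b) \<gamma>)) (at 0)"
      by (rule eventually_ball_finite) (use z(1) aux_perturb(2) in auto)
    then show "eventually (\<lambda>\<gamma>. \<forall>b<npts s. X \<in> flow_dom logistic_field (logistic_init (z b) \<gamma>)) (at 0)" by (simp add: Ball_def)
  qed
  have lim: "((\<lambda>\<gamma>. jet logistic_field cO X (logistic_init (z b) \<gamma>) q) \<longlongrightarrow> jet logistic_field cO X (logistic_init (z b) 0) q) (at 0)" if "b < npts s" for b q X
    using aux_perturb(1) z(1)[OF that] by blast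
  show False
  proof (cases "i = j")
    case False
    have van: "peval (\<lambda>(b, l). jet logistic_field cO X (logistic_init (z b) 0) (cJ, l)) G = 0" for X
    proof -
      have "eventually (\<lambda>\<gamma>. peval (\<lambda>(b, l). jet logistic_field cO X (logistic_init (z b) \<gamma>) (cJ, l)) G = 0) (at 0)"
        using dom[of X]
      proof eventually_elim
        case (elim \<gamma>)
        obtain c v where cv: "\<And>z l. X \<in> flow_dom logistic_field (logistic_init z \<gamma>) \<Longrightarrow> X \<in> flow_dom (field_of d c) (initial_value j v z) \<and>
          jet (field_of d c) j X (initial_value j v z) (i, l) = jet logistic_field cO X (logistic_init z \<gamma>) (cJ, l)"
          using embed_distinct[OF d False, of \<gamma> X] elim by blast
        have "peval (\<lambda>(b, l). jet (field_of d c) j X (initial_value j v (z b)) (i, l)) G = 0"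
          by (rule flow) (use cv elim in blast)
        moreover have "peval (\<lambda>(b, l). jet (field_of d c) j X (initial_value j v (z b)) (i, l)) G =
          peval (\<lambda>(b, l). jet logistic_field cO X (logistic_init (z b) \<gamma>) (cJ, l)) G"
        proof (rule peval_cong)
          fix y assume y: "y \<in> pvars G"
          obtain b l where bl: "y = (b, l)" by (cases y)
          have "b < npts s" using Gv y unfolding bl by blast
          then show "(case y of (b, l) \<Rightarrow> jet (field_of d c) j X (initial_value j v (z b)) (i, l)) =
            (case y of (b, l) \<Rightarrow> jet logistic_field cO X (logistic_init (z b) \<gamma>) (cJ, l))"
            using cv elim unfolding bl prod.case by blast
        qed
        ultimately show ?case by simp
      qed
      moreover have "((\<lambda>\<gamma>. peval (\<lambda>(b, l). jet logistic_field cO X (logistic_init (z b) \<gamma>) (cJ, l)) G) \<longlongrightarrow>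
        peval (\<lambda>(b, l). jet logistic_field cO X (logistic_init (z b) 0) (cJ, l)) G) (at 0)"
      proof (rule tendsto_peval)
        fix y assume y: "y \<in> pvars G"
        obtain b l where bl: "y = (b, l)" by (cases y)
        have "b < npts s" using Gv y unfolding bl by blast
        then show "((\<lambda>\<gamma>. case y of (b, l) \<Rightarrow> jet logistic_field cO X (logistic_init (z b) \<gamma>) (cJ, l)) \<longlongrightarrow>
          (case y of (b, l) \<Rightarrow> jet logistic_field cO X (logistic_init (z b) 0) (cJ, l))) (at 0)"
          unfolding bl prod.case by (rule lim)
      qed
      ultimately have "((\<lambda>\<gamma> :: real. 0) \<longlongrightarrow> peval (\<lambda>(b, l). jet logistic_field cO X (logistic_init (z b) 0) (cJ, l)) G) (at 0)"
        using tendsto_cong by fast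
      then show ?thesis using tendsto_unique[OF _ tendsto_const] by (metis at_neq_bot)
    qed
    have "peval e1 G = 0"
      by (rule indep[of G 0 e1, OF order_refl]) (simp only: mult_zero_left add_0_right van)
    then show False using e1 by simp
  next
    case True
    obtain k where k: "k \<noteq> j"
    proof -
      have "(UNIV :: 'm set) \<noteq> {j}"
      proof
        assume "(UNIV :: 'm set) = {j}"
        then have "CARD('m) = card {j}" by (rule arg_cong)
        then show False using m by simp
      qed
      then show ?thesis using that by blast
    qed
    \<comment> \<open>The constant in the embedding changes the values of the function but not its derivatives.\<close>
    define S where "S = {(b :: nat, l :: nat). l = 0}"
    obtain H e2 where H: "peval e2 (shift_coeff S G H) \<noteq> (0 :: real)" "\<And>e. degree (shift_poly S G e) \<le> H"
      using leading_coefficient[OF e1, of S] by blast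
    define u where "u X \<gamma> = (\<lambda>(b, l). jet logistic_field cO X (logistic_init (z b) \<gamma>) (cJ, l) + exp X * jet logistic_field cO X (logistic_init (z b) \<gamma>) (cO, l))" for X \<gamma>
    have van: "peval (u X 0) (shift_coeff S G H) = 0" if X: "X \<noteq> 0" for X
    proof -
      have eX: "exp X - 1 \<noteq> 0" using X by simp
      \<comment> \<open>The inverse of the shift \<open>T\<close>; dividing by \<open>T ^ H\<close> leaves a polynomial in it.\<close>
      define \<tau> where "\<tau> \<gamma> = \<gamma> * exp X / (exp X - 1)" for \<gamma>
      define Q where "Q \<gamma> = (\<Sum>h\<le>H. peval (u X \<gamma>) (shift_coeff S G h) * \<tau> \<gamma> ^ (H - h))" for \<gamma>
      have "eventually (\<lambda>\<gamma>. Q \<gamma> = 0) (at 0)"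
        using dom[of X]
      proof eventually_elim
        case (elim \<gamma>)
        define T where "T = (exp X - 1) / (\<gamma> * exp X)"
        have T: "T \<noteq> 0" "\<tau> \<gamma> = inverse T" using elim eX by (auto simp: T_def \<tau>_def)
        obtain c v where cv: "\<And>z l. X \<in> flow_dom logistic_field (logistic_init z \<gamma>) \<Longrightarrow> X \<in> flow_dom (field_of d c) (initial_value j v z) \<and>
          jet (field_of d c) j X (initial_value j v z) (j, l) = jet logistic_field cO X (logistic_init z \<gamma>) (cJ, l) + exp X * jet logistic_field cO X (logistic_init z \<gamma>) (cO, l)
            + (if l = 0 then T else 0)"
          using embed_same[OF d k, of \<gamma> X] elim unfolding T_def by blast
        have "0 = peval (\<lambda>(b, l). jet (field_of d c) j X (initial_value j v (z b)) (i, l)) G"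
          by (rule flow[symmetric]) (use cv elim in blast)
        also have "\<dots> = peval (\<lambda>y. u X \<gamma> y + (if y \<in> S then T else 0)) G"
        proof (rule peval_cong)
          fix y assume y: "y \<in> pvars G"
          obtain b l where bl: "y = (b, l)" by (cases y)
          have "b < npts s" using Gv y unfolding bl by blast
          then have "jet (field_of d c) j X (initial_value j v (z b)) (j, l) = jet logistic_field cO X (logistic_init (z b) \<gamma>) (cJ, l) + exp X * jet logistic_field cO X (logistic_init (z b) \<gamma>) (cO, l)
            + (if l = 0 then T else 0)" using cv elim by blast
          then show "(case y of (b, l) \<Rightarrow> jet (field_of d c) j X (initial_value j v (z b)) (i, l)) =
            u X \<gamma> y + (if y \<in> S then T else 0)"
            unfolding bl prod.case u_def True S_def by simp
        qed
        also have "\<dots> = poly (shift_poly S G (u X \<gamma>)) T" by (rule poly_shift_poly[symmetric])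
        also have "\<dots> = (\<Sum>h\<le>H. peval (u X \<gamma>) (shift_coeff S G h) * T ^ h)"
        proof -
          have "poly (shift_poly S G (u X \<gamma>)) T = (\<Sum>h\<le>H. coeff (shift_poly S G (u X \<gamma>)) h * T ^ h)"
            unfolding poly_altdef
            by (rule sum.mono_neutral_left) (use H(2)[of "u X \<gamma>"] in \<open>auto simp: coeff_eq_0\<close>)
          then show ?thesis unfolding coeff_shift_poly .
        qed
        finally have "(\<Sum>h\<le>H. peval (u X \<gamma>) (shift_coeff S G h) * T ^ h) * inverse T ^ H = 0" by simp
        also have "(\<Sum>h\<le>H. peval (u X \<gamma>) (shift_coeff S G h) * T ^ h) * inverse T ^ H = Q \<gamma>"
          unfolding Q_def sum_distrib_right
        proof (rule sum.cong)
          fix h assume "h \<in> {..H}"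
          then have "inverse T ^ H = inverse T ^ h * inverse T ^ (H - h)" unfolding power_add[symmetric] by simp
          moreover have "T ^ h * inverse T ^ h = 1" unfolding power_mult_distrib[symmetric] using T(1) by simp
          ultimately show "peval (u X \<gamma>) (shift_coeff S G h) * T ^ h * inverse T ^ H = peval (u X \<gamma>) (shift_coeff S G h) * \<tau> \<gamma> ^ (H - h)"
            unfolding T(2) by (simp add: mult.assoc)
        qed simp
        finally show ?case .
      qed
      moreover have "(Q \<longlongrightarrow> (\<Sum>h\<le>H. peval (u X 0) (shift_coeff S G h) * 0 ^ (H - h))) (at 0)"
        unfolding Q_def
      proof (intro tendsto_sum tendsto_mult tendsto_power)
        show "(\<tau> \<longlongrightarrow> 0) (at 0)" unfolding \<tau>_def using eX by (auto intro!: tendsto_eq_intros)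
        fix h
        show "((\<lambda>\<gamma>. peval (u X \<gamma>) (shift_coeff S G h)) \<longlongrightarrow> peval (u X 0) (shift_coeff S G h)) (at 0)"
        proof (rule tendsto_peval)
          fix y assume y: "y \<in> pvars (shift_coeff S G h)"
          obtain b l where bl: "y = (b, l)" by (cases y)
          have "b < npts s" using Gv y pvars_shift_coeff[of S G h] unfolding bl by blast
          then show "((\<lambda>\<gamma>. u X \<gamma> y) \<longlongrightarrow> u X 0 y) (at 0)"
            unfolding bl u_def prod.case by (intro tendsto_add tendsto_mult tendsto_const lim)
        qed
      qed
      ultimately have "((\<lambda>\<gamma> :: real. 0) \<longlongrightarrow> (\<Sum>h\<le>H. peval (u X 0) (shift_coeff S G h) * 0 ^ (H - h))) (at 0)"
        using tendsto_cong by fast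
      then have "(\<Sum>h\<le>H. peval (u X 0) (shift_coeff S G h) * 0 ^ (H - h)) = 0"
        using tendsto_unique[OF _ tendsto_const] by (metis at_neq_bot)
      moreover have "(\<Sum>h\<le>H. peval (u X 0) (shift_coeff S G h) * 0 ^ (H - h)) = (\<Sum>h\<le>H. if h = H then peval (u X 0) (shift_coeff S G h) else 0)"
        by (rule sum.cong) (auto simp: power_0_left)
      ultimately show ?thesis by simp
    qed
    have "peval e2 (shift_coeff S G H) = 0"
      by (rule indep[of "shift_coeff S G H" 1 e2, OF pvars_shift_coeff]) (use van in \<open>simp only: u_def mult_1\<close>)
    then show False using H(1) by simp
  qed
qed

section \<open>Generic systems\<close>

theorem theorem1:
  fixes d :: nat
  assumes "CARD('m::finite) \<ge> 2" and "d \<ge> 2"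
  shows "generic_in (coeff_index d) (system_coeffs d ` (systems d :: 'm system set))
           (system_coeffs d ` {P \<in> systems d. \<forall>i j.
              generic_in (param_index j) (Lambda_proj j P)
                {v \<in> Lambda_proj j P.
                   \<not> differentially_algebraic_on (f_domain P j v) (f_fun P i j v)}})"
  by (rule generic_if_certificates_nonzero) (rule certificate_coefficient_nonzero[OF assms])

end
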